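(* Let $1<r\le 2$, $s>\frac{2}{r}+1$, $\frac{1}{r}<b<1$, and let $f_{+},f_-\in \widehat{H}^r_s(\mathbb R^3)$. Consider the system $$(i\partial_t \mp J_x)u_{\pm}=\mp \tfrac14 J_x^{-1}B_2(w,w)\mp\tfrac12 J_x^{-1}w,\qquad w:=u_++u_-,$$ with initial data $u_\pm(0)=f_\pm$, where $B_2(u,v)=\partial u\,\partial v$. Then there exist $\delta=\delta(\|f_+\|_{\widehat{H}^r_s},\|f_-\|_{\widehat{H}^r_s})>0$ and a unique solution $(u_+,u_-)\in Z^{r,+}_{s,b}(\delta)\times Z^{r,-}_{s,b}(\delta)$ of this system (in the sense of the Duhamel integral formulation) satisfying the initial condition. The solution is persistent, i.e. $u_\pm\in C([-\delta,\delta],\widehat{H}^r_s(\mathbb R^3))$, and the flow map $(f_+,f_-)\mapsto(u_+,u_-)$, $\widehat{H}^r_s\times\widehat{H}^r_s\to Z^{r,+}_{s,b}(\delta)\times Z^{r,-}_{s,b}(\delta)$, is locally Lipschitz continuous.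
   Context: All functions live on $\mathbb R^3$ (space) or $\mathbb R\times\mathbb R^3$ (time-space). For $1<r\le2$, $r'$ is the dual exponent, $\frac1r+\frac1{r'}=1$, and $\langle\xi\rangle=(1+|\xi|^2)^{1/2}$. The space $\widehat{H}^r_s(\mathbb R^3)$ is defined by the norm $\|f\|_{\widehat{H}^r_s}=\|\langle\xi\rangle^s\widehat f\|_{L^{r'}_\xi}$. $J_x=(1-\Delta_x)^{1/2}$ (Fourier multiplier $\langle\xi\rangle$). In $B_2(u,v)=\partial u\,\partial v$ each $\partial$ denotes any fixed derivative from $\{\partial_t,\partial_{x_1},\partial_{x_2},\partial_{x_3}\}$ (possibly different on the two factors); no null structure is assumed. This system is the first-order reformulation of $\Box u=(\partial_t^2-\Delta)u=B_2(u,u)$, $u(0)=u_0$, $u_t(0)=u_1$, via $u_\pm=u\pm iJ_x^{-1}\partial_t u$, $f_\pm=u_0\pm iJ_x^{-1}u_1$. For signs $\pm$, the space $X^{r,\pm}_{s,b}$ has norm $\|u\|_{X^{r,\pm}_{s,b}}=\big(\int\langle\xi\rangle^{sr'}\langle\tau\pm|\xi|\rangle^{br'}|\mathcal F u(\xi,\tau)|^{r'}d\xi d\tau\big)^{1/r'}$, where $\mathcal F$ is the space-time Fourier transform. $Z^{r,\pm}_{s,b}$ has norm $\|u\|_{Z^{r,\pm}_{s,b}}=\|u\|_{X^{r,\pm}_{s,b}}+\|\partial_t u\|_{X^{r,\pm}_{s-1,b}}$. The restriction space $Z^{r,\pm}_{s,b}(\delta)=\{u=\tilde u|_{[-\delta,\delta]\times\mathbb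 R^3}:\tilde u\in Z^{r,\pm}_{s,b}\}$ has norm $\inf\{\|\tilde u\|_{Z^{r,\pm}_{s,b}}:\tilde u|_{[-\delta,\delta]\times\mathbb R^3}=u\}$. *)

theory Defs
  imports "HOL-Analysis.Analysis" "HOL-Library.Numeral_Type"
begin

text \<open>Conventions. Space is real^3, frequencies xi :: real^3, time frequency tau :: real.
  Fourier transform: F u(xi,tau) = integral of exp(-i(x.xi + t tau)) u(t,x).
  All objects are represented on the (spatial) Fourier side, since all spaces
  involved are defined through the Fourier transform.\<close>

definition jap :: "real^3 \<Rightarrow> real" where
  "jap \<xi> = sqrt (1 + (norm \<xi>)\<^sup>2)"

definition japr :: "real \<Rightarrow> real" where
  "japr x = sqrt (1 + x\<^sup>2)"

definition dual_exp :: "real \<Rightarrow> real" where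
  "dual_exp r = r / (r - 1)"

text \<open>Elements f of hat-H^r_s are represented by their spatial Fourier transform F = hat f.\<close>

definition Hhat_int :: "real \<Rightarrow> real \<Rightarrow> (real^3 \<Rightarrow> complex) \<Rightarrow> ennreal" where
  "Hhat_int r s F = (\<integral>\<^sup>+ \<xi>. ennreal (jap \<xi> powr (s * dual_exp r) * cmod (F \<xi>) powr dual_exp r) \<partial>lebesgue)"

definition Hhat_in :: "real \<Rightarrow> real \<Rightarrow> (real^3 \<Rightarrow> complex) \<Rightarrow> bool" where
  "Hhat_in r s F \<longleftrightarrow> F \<in> borel_measurable lebesgue \<and> Hhat_int r s F < \<infinity>"

definition Hhat_norm :: "real \<Rightarrow> real \<Rightarrow> (real^3 \<Rightarrow> complex) \<Rightarrow> real" where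
  "Hhat_norm r s F = enn2real (Hhat_int r s F) powr (1 / dual_exp r)"

text \<open>X^{r,sigma}_{s,b} on the space-time Fourier side; sigma = 1 for +, sigma = -1 for -.
  U is the space-time Fourier transform, a function of (xi, tau).\<close>

definition X_int :: "real \<Rightarrow> real \<Rightarrow> real \<Rightarrow> real \<Rightarrow> ((real^3) \<times> real \<Rightarrow> complex) \<Rightarrow> ennreal" where
  "X_int r \<sigma> s b U = (\<integral>\<^sup>+ p. ennreal (jap (fst p) powr (s * dual_exp r)
        * japr (snd p + \<sigma> * norm (fst p)) powr (b * dual_exp r)
        * cmod (U p) powr dual_exp r) \<partial>lborel)"

definition X_norm :: "real \<Rightarrow> real \<Rightarrow> real \<Rightarrow> real \<Rightarrow> ((real^3) \<times> real \<Rightarrow> complex) \<Rightarrow> real" where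
  "X_norm r \<sigma> s b U = enn2real (X_int r \<sigma> s b U) powr (1 / dual_exp r)"

definition dt_hat :: "((real^3) \<times> real \<Rightarrow> complex) \<Rightarrow> (real^3) \<times> real \<Rightarrow> complex" where
  "dt_hat U p = \<i> * complex_of_real (snd p) * U p"

definition Z_in :: "real \<Rightarrow> real \<Rightarrow> real \<Rightarrow> real \<Rightarrow> ((real^3) \<times> real \<Rightarrow> complex) \<Rightarrow> bool" where
  "Z_in r \<sigma> s b U \<longleftrightarrow> U \<in> borel_measurable lborel
      \<and> X_int r \<sigma> s b U < \<infinity> \<and> X_int r \<sigma> (s - 1) b (dt_hat U) < \<infinity>"

definition Z_norm :: "real \<Rightarrow> real \<Rightarrow> real \<Rightarrow> real \<Rightarrow> ((real^3) \<times> real \<Rightarrow> complex) \<Rightarrow> real" where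
  "Z_norm r \<sigma> s b U = X_norm r \<sigma> s b U + X_norm r \<sigma> (s - 1) b (dt_hat U)"

definition time_inv :: "((real^3) \<times> real \<Rightarrow> complex) \<Rightarrow> real \<Rightarrow> real^3 \<Rightarrow> complex" where
  "time_inv U t \<xi> = complex_of_real (1 / (2 * pi)) * (\<integral> \<tau>. cis (t * \<tau>) * U (\<xi>, \<tau>) \<partial>lborel)"

text \<open>U (in Z) is an extension of u (given by its spatial Fourier transform u t xi) from
  [-delta, delta]: the restriction of the inverse transform agrees with u.\<close>
definition is_ext :: "real \<Rightarrow> real \<Rightarrow> real \<Rightarrow> real \<Rightarrow> real \<Rightarrow>
     ((real^3) \<times> real \<Rightarrow> complex) \<Rightarrow> (real \<Rightarrow> real^3 \<Rightarrow> complex) \<Rightarrow> bool" where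
  "is_ext r \<sigma> s b \<delta> U u \<longleftrightarrow> Z_in r \<sigma> s b U \<and>
      (\<forall>t\<in>{-\<delta>..\<delta>}. AE \<xi> in lebesgue. u t \<xi> = time_inv U t \<xi>)"

definition Zd_in :: "real \<Rightarrow> real \<Rightarrow> real \<Rightarrow> real \<Rightarrow> real \<Rightarrow> (real \<Rightarrow> real^3 \<Rightarrow> complex) \<Rightarrow> bool" where
  "Zd_in r \<sigma> s b \<delta> u \<longleftrightarrow> (\<exists>U. is_ext r \<sigma> s b \<delta> U u)"

definition Zd_norm :: "real \<Rightarrow> real \<Rightarrow> real \<Rightarrow> real \<Rightarrow> real \<Rightarrow> (real \<Rightarrow> real^3 \<Rightarrow> complex) \<Rightarrow> real" where
  "Zd_norm r \<sigma> s b \<delta> u = Inf {Z_norm r \<sigma> s b U | U. is_ext r \<sigma> s b \<delta> U u}"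

text \<open>The derivative in B_2: either d/dt or d/dx_j (j ranges over the three components).\<close>
datatype der = Dt | Dx 3

definition der_hat :: "der \<Rightarrow> ((real^3) \<times> real \<Rightarrow> complex) \<Rightarrow> real \<Rightarrow> real^3 \<Rightarrow> complex" where
  "der_hat d U t \<xi> = (case d of
      Dt \<Rightarrow> time_inv (dt_hat U) t \<xi>
    | Dx j \<Rightarrow> \<i> * complex_of_real (\<xi> $ j) * time_inv U t \<xi>)"

text \<open>Spatial Fourier transform of a product: (2 pi)^(-3) times the convolution.\<close>
definition conv3 :: "(real^3 \<Rightarrow> complex) \<Rightarrow> (real^3 \<Rightarrow> complex) \<Rightarrow> real^3 \<Rightarrow> complex" where
  "conv3 P Q \<xi> = complex_of_real (1 / (2 * pi) ^ 3) * (\<integral> \<eta>. P \<eta> * Q (\<xi> - \<eta>) \<partial>lborel)"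

text \<open>Duhamel formulation of
   (i d_t -+ J) u_pm = -+ (1/4) J^{-1} B_2(w,w) -+ (1/2) J^{-1} w,  w = u_+ + u_-,  u_pm(0) = f_pm,
  i.e. hat u_sig(t) = exp(-i sig t <xi>) hat f_sig - i int_0^t exp(-i sig (t-t') <xi>) G_sig(t') dt'
  with G_sig = - sig <xi>^{-1} ((1/4) hat B_2(w,w) + (1/2) hat w); here sig = 1 for +, -1 for -.
  Up, Um are extensions (in Z^{r,+}, Z^{r,-}) of up, um; the right-hand side is evaluated
  through them (it does not depend on the choice of extension).\<close>
definition duhamel_rhs :: "der \<Rightarrow> der \<Rightarrow> real \<Rightarrow> (real^3 \<Rightarrow> complex) \<Rightarrow>
    ((real^3) \<times> real \<Rightarrow> complex) \<Rightarrow> ((real^3) \<times> real \<Rightarrow> complex) \<Rightarrow> real \<Rightarrow> real^3 \<Rightarrow> complex" where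
  "duhamel_rhs d1 d2 \<sigma> F Up Um t \<xi> =
     (let W = (\<lambda>p. Up p + Um p);
          N = (\<lambda>t'. conv3 (der_hat d1 W t') (der_hat d2 W t') \<xi>);
          G = (\<lambda>t'. - complex_of_real (\<sigma> / jap \<xi>) * (N t' / 4 + time_inv W t' \<xi> / 2))
      in cis (- \<sigma> * t * jap \<xi>) * F \<xi>
         - \<i> * (LBINT t'=0..t. cis (- \<sigma> * (t - t') * jap \<xi>) * G t'))"

definition is_solution :: "real \<Rightarrow> real \<Rightarrow> real \<Rightarrow> real \<Rightarrow> der \<Rightarrow> der \<Rightarrow>
    (real^3 \<Rightarrow> complex) \<Rightarrow> (real^3 \<Rightarrow> complex) \<Rightarrow>
    (real \<Rightarrow> real^3 \<Rightarrow> complex) \<Rightarrow> (real \<Rightarrow> real^3 \<Rightarrow> complex) \<Rightarrow> bool" where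
  "is_solution r s b \<delta> d1 d2 Fp Fm up um \<longleftrightarrow>
     (\<exists>Up Um. is_ext r 1 s b \<delta> Up up \<and> is_ext r (-1) s b \<delta> Um um \<and>
        (\<forall>t\<in>{-\<delta>..\<delta>}. AE \<xi> in lebesgue.
            up t \<xi> = duhamel_rhs d1 d2 1 Fp Up Um t \<xi> \<and>
            um t \<xi> = duhamel_rhs d1 d2 (-1) Fm Up Um t \<xi>))"

definition persistent :: "real \<Rightarrow> real \<Rightarrow> real \<Rightarrow> (real \<Rightarrow> real^3 \<Rightarrow> complex) \<Rightarrow> bool" where
  "persistent r s \<delta> u \<longleftrightarrow> (\<forall>t\<in>{-\<delta>..\<delta>}. Hhat_in r s (u t)) \<and>
     (\<forall>t0\<in>{-\<delta>..\<delta>}. ((\<lambda>t. Hhat_norm r s (\<lambda>\<xi>. u t \<xi> - u t0 \<xi>)) \<longlongrightarrow> 0) (at t0 within {-\<delta>..\<delta>}))"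

end

theory Submission
  imports Defs "HOL-Probability.Probability"
begin

text \<open>On the Fourier side \<open>B\<^sub>2\<close> is a convolution. By Hoelder's inequality its bound in the
 \<open>X\<close>-spaces reduces to a bound, uniform in the output frequency, for the \<open>L\<^sup>r\<close>-norm of the product
 of the two inverse weights. Integration in time frequency leaves the brackets
 \<open>\<langle>\<tau> \<plusminus> |\<eta>| \<plusminus> |\<xi> - \<eta>|\<rangle>\<close>, and integration over the pairs of radii \<open>(|\<eta>|, |\<xi> - \<eta>|)\<close> converges because
 \<open>s > 2/r + 1\<close> and \<open>b > 1/r\<close>. The Duhamel operator, localized to a time interval of length \<open>T\<close>, gains
 the factor \<open>T\<^sup>1\<^sup>-\<^sup>b\<close>.

 The derivative \<open>\<partial>\<^sub>t w\<close> in \<open>B\<^sub>2(w, w)\<close> is not controlled by the \<open>X\<^sub>s\<^sub>,\<^sub>b\<close>-norm. But the forcing terms of the two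
 equations are opposite to each other, so \<open>\<partial>\<^sub>t w = - \<i> J (u\<^sub>+ - u\<^sub>-)\<close> for a solution. With this
 expression in place of \<open>\<partial>\<^sub>t w\<close> the Duhamel map is a contraction in \<open>X\<^sub>s\<^sub>,\<^sub>b\<close>; the fixed point is then
 seen to lie in \<open>Z\<^sub>s\<^sub>,\<^sub>b\<close> and to solve the original system on the time interval.

 For uniqueness, let \<open>D\<close> extend the difference of two solutions and let the difference vanish at \<open>t\<^sub>0\<close>. The linearized
 Duhamel map, localized to a short interval around \<open>t\<^sub>0\<close>, turns \<open>D\<close> into another extension of
 the same difference there, with half the norm. Hence the difference vanishes on an interval around
 \<open>t\<^sub>0\<close> whose length does not depend on \<open>t\<^sub>0\<close>.\<close>

text \<open>The estimates are made for the p-th powers of the norms, p the dual exponent of r, with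
  values in [0, \<infinity>]. Integrability then needs no separate proof, but the triangle
  inequality costs a factor 2^p; this is why the contraction constant is 1 / (2 * 2^p) and not 1/2.

  The bilinear estimate has its output in X with modulation exponent 0, not in a space of negative
  exponent.

  For the time derivative there is nothing left to spend: |\<tau>| is bounded by
  \<langle>\<xi>\<rangle> plus the modulation, so X_{s-1,1+b} is needed and the whole gain is used.
  Hence two cutoffs occur. The contraction runs with a short one; its fixed point is then inserted
  once more into the map with unit cutoff, where no smallness is asked for and the bound in
  X_{s-1,1+b} is available. On the short interval both maps give the same function of time.

  Equality of functions of time is therefore kept apart from equality of their extensions
  throughout, and exceptional null sets of frequencies must be made independent of the time.\<close>

abbreviation nn_integral_lborel :: "('a::euclidean_space \<Rightarrow> ennreal) \<Rightarrow> ennreal" (binder "\<L>" 10)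
 where "nn_integral_lborel f \<equiv> nn_integral lborel f"

abbreviation BM :: "('a::topological_space \<Rightarrow> 'b::topological_space) set"
 where "BM \<equiv> borel_measurable borel"

section \<open>Hoelder inequalities\<close>

text \<open>The inner integrals of an iterated estimate may be infinite for some outer variables.
  The power has to keep the value \<open>\<top>\<close> there, so that finiteness of the outer
  integral yields finiteness of the inner one almost everywhere.\<close>

definition epow :: "ennreal \<Rightarrow> real \<Rightarrow> ennreal" where
 "epow x p = (if x = \<top> then \<top> else ennreal (enn2real x powr p))"

lemma epow_ennreal [simp]: "0 \<le> x \<Longrightarrow> epow (ennreal x) p = ennreal (x powr p)"
 by (simp add: epow_def)

lemma epow_top [simp]: "epow \<top> p = \<top>"
 by (simp add: epow_def)

lemma epow_0 [simp]: "epow 0 p = 0"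
 by (simp add: epow_def)

lemma measurable_epow [measurable]:
 "f \<in> borel_measurable M \<Longrightarrow> (\<lambda>x. epow (f x) p) \<in> borel_measurable M"
proof -
 assume [measurable]: "f \<in> borel_measurable M"
 have [measurable]: "Measurable.pred M (\<lambda>x. f x = \<top>)"
  by (rule pred_eq_const1[where N=borel]) auto
 show ?thesis
  unfolding epow_def by measurable
qed

lemma epow_mono: "x \<le> y \<Longrightarrow> 0 < p \<Longrightarrow> epow x p \<le> epow y p"
 by (cases x; cases y) (auto simp: powr_mono2 top_unique)

lemma powr_add_le:
 fixes x y :: real
 assumes "0 \<le> x" "0 \<le> y" "0 \<le> p"
 shows "(x + y) powr p \<le> 2 powr p * (x powr p + y powr p)"
proof -
 have "(x + y) powr p \<le> (2 * max x y) powr p"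
  using assms by (intro powr_mono2) auto
 also have "... = 2 powr p * max x y powr p"
  using assms by (simp add: powr_mult)
 also have "... \<le> 2 powr p * (x powr p + y powr p)"
  by (intro mult_left_mono) (auto simp: max_def)
 finally show ?thesis .
qed

lemma epow_add_le:
 assumes "0 < p"
 shows "epow (x + y) p \<le> ennreal (2 powr p) * (epow x p + epow y p)"
proof (cases x; cases y)
 fix a b :: real
 assume "x = ennreal a" "0 \<le> a" "y = ennreal b" "0 \<le> b"
 then show ?thesis
  using powr_add_le[of a b p] assms
  by (simp flip: ennreal_plus ennreal_mult)
qed (use assms in \<open>auto simp: ennreal_mult_eq_top_iff\<close>)

lemma epow_cmult: "0 \<le> c \<Longrightarrow> epow (ennreal c * x) p = ennreal (c powr p) * epow x p"
proof (cases x)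
 case top
 assume "0 \<le> c"
 then show ?thesis
  by (cases "c = 0") (auto simp: top ennreal_mult_top)
next
 case (real a)
 assume "0 \<le> c"
 with real show ?thesis
  by (simp add: powr_mult flip: ennreal_mult)
qed

lemma epow_eq_top_iff [simp]: "epow x p = \<top> \<longleftrightarrow> x = \<top>"
 by (simp add: epow_def)

text \<open>The factor g is real-valued, but the integral of its p-th power may be infinite.\<close>
lemma Holder_epow:
 fixes f g :: "'a \<Rightarrow> real"
 assumes rp: "1 < r" "1 < p" "1 / r + 1 / p = 1"
  and [measurable]: "f \<in> borel_measurable M" "g \<in> borel_measurable M"
  and nonneg: "\<And>x. 0 \<le> f x" "\<And>x. 0 \<le> g x"
  and A: "0 \<le> A" "(\<integral>\<^sup>+ x. ennreal (f x powr r) \<partial>M) \<le> ennreal A"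
 shows "epow (\<integral>\<^sup>+ x. ennreal (f x * g x) \<partial>M) p \<le> ennreal (A powr (p / r)) * (\<integral>\<^sup>+ x. ennreal (g x powr p) \<partial>M)"
proof -
 define B where "B = (\<integral>\<^sup>+ x. ennreal (g x powr p) \<partial>M)"
 consider "A = 0" | "B = 0" | "A > 0" "B = \<top>" | b where "A > 0" "B = ennreal b" "b > 0"
  using A(1) by (cases B) (auto simp: less_le)
 then show ?thesis
 proof cases
  case 1
  with A have "(\<integral>\<^sup>+ x. ennreal (f x powr r) \<partial>M) = 0" by simp
  then have "AE x in M. ennreal (f x powr r) = 0"
   by (subst (asm) nn_integral_0_iff_AE) auto
  then have "AE x in M. ennreal (f x * g x) = 0"
   by eventually_elim (use nonneg in \<open>auto simp: ennreal_eq_0_iff\<close>)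
  then have "(\<integral>\<^sup>+ x. ennreal (f x * g x) \<partial>M) = 0"
   by (subst nn_integral_0_iff_AE) auto
  then show ?thesis by simp
 next
  case 2
  then have "AE x in M. ennreal (g x powr p) = 0"
   unfolding B_def by (subst (asm) nn_integral_0_iff_AE) auto
  then have "AE x in M. ennreal (f x * g x) = 0"
   by eventually_elim (use nonneg in \<open>auto simp: ennreal_eq_0_iff\<close>)
  then have "(\<integral>\<^sup>+ x. ennreal (f x * g x) \<partial>M) = 0"
   by (subst nn_integral_0_iff_AE) auto
  then show ?thesis by simp
 next
  case 3
  then show ?thesis
   using rp by (simp add: B_def[symmetric] ennreal_mult_top)
 next
  case 4
  \<comment> \<open>Both factors are divided by their norms, after which the inequality is Young's
    inequality integrated. The three preceding cases are those in which a norm is 0 or infinite and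
    cannot be divided out.\<close>
  define a \<beta> where "a = A powr (1 / r)" and "\<beta> = b powr (1 / p)"
  have pos: "a > 0" "\<beta> > 0" using 4 by (auto simp: a_def \<beta>_def)
  have ar: "a powr r = A" "\<beta> powr p = b"
   using 4 rp by (auto simp: a_def \<beta>_def powr_powr)
  have pt: "f x * g x \<le> a * \<beta> / (r * A) * f x powr r + a * \<beta> / (p * b) * g x powr p" for x
  proof -
   have "(f x / a) * (g x / \<beta>) \<le> (f x / a) powr r / r + (g x / \<beta>) powr p / p"
    using rp pos nonneg by (intro Youngs_inequality) auto
   also have "... = f x powr r / (r * A) + g x powr p / (p * b)"
    using pos nonneg by (simp add: powr_divide ar mult.commute)
   finally have "(a * \<beta>) * ((f x / a) * (g x / \<beta>)) \<le> (a * \<beta>) * (f x powr r / (r * A) + g x powr p / (p * b))"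
    using pos by (intro mult_left_mono) auto
   then show ?thesis using pos by (simp add: field_simps)
  qed
  have "(\<integral>\<^sup>+ x. ennreal (f x * g x) \<partial>M) \<le>
    (\<integral>\<^sup>+ x. ennreal (a * \<beta> / (r * A)) * ennreal (f x powr r) + ennreal (a * \<beta> / (p * b)) * ennreal (g x powr p) \<partial>M)"
   using pt pos 4 rp by (intro nn_integral_mono) (simp add: nonneg flip: ennreal_mult ennreal_plus)
  also have "... = ennreal (a * \<beta> / (r * A)) * (\<integral>\<^sup>+ x. ennreal (f x powr r) \<partial>M) + ennreal (a * \<beta> / (p * b)) * B"
   by (simp add: nn_integral_add nn_integral_cmult B_def)
  also have "... \<le> ennreal (a * \<beta> / (r * A)) * ennreal A + ennreal (a * \<beta> / (p * b)) * ennreal b"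
   using A 4 by (intro add_mono mult_left_mono) auto
  also have "... = ennreal (a * \<beta> * (1 / r + 1 / p))"
   using pos 4 rp by (simp add: field_simps flip: ennreal_mult ennreal_plus)
  finally have "(\<integral>\<^sup>+ x. ennreal (f x * g x) \<partial>M) \<le> ennreal (a * \<beta>)"
   using rp by simp
  then have "epow (\<integral>\<^sup>+ x. ennreal (f x * g x) \<partial>M) p \<le> epow (ennreal (a * \<beta>)) p"
   using rp by (intro epow_mono) auto
  also have "... = ennreal (A powr (p / r) * b)"
   using pos 4 rp by (simp add: powr_mult ar) (simp add: a_def powr_powr)
  finally show ?thesis
   using 4 by (simp add: B_def ennreal_mult)
 qed
qed

section \<open>Invariance of Lebesgue measure under translation and reflection\<close>

lemma nn_integral_lborel_translation:
 fixes f :: "'a::euclidean_space \<Rightarrow> ennreal"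
 assumes [measurable]: "f \<in> BM"
 shows "(\<L> x. f (c + x)) = (\<L> x. f x)"
proof -
 have "(\<L> x. f x) = (\<integral>\<^sup>+ x. f x \<partial>distr lborel borel ((+) c))"
  by (simp add: lborel_distr_plus)
 also have "... = (\<L> x. f (c + x))"
  by (subst nn_integral_distr) auto
 finally show ?thesis by simp
qed

lemma nn_integral_lborel_minus:
 fixes f :: "'a::euclidean_space \<Rightarrow> ennreal"
 assumes [measurable]: "f \<in> BM"
 shows "(\<L> x. f (x - c)) = (\<L> x. f x)"
 using nn_integral_lborel_translation[of f "-c"] by simp

lemma lborel_distr_reflect:
 fixes c :: "'a::euclidean_space"
 shows "distr lborel borel (\<lambda>x. c - x) = lborel"
proof -
 have "lborel = density (distr lborel borel (\<lambda>x. c + (- 1) *\<^sub>R x)) (\<lambda>_. \<bar>- 1 :: real\<bar> ^ DIM('a))"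
  by (rule lborel_affine) auto
 then show ?thesis by (simp add: density_1)
qed

lemma nn_integral_lborel_reflect:
 fixes f :: "'a::euclidean_space \<Rightarrow> ennreal"
 assumes [measurable]: "f \<in> BM"
 shows "(\<L> x. f (c - x)) = (\<L> x. f x)"
proof -
 have "(\<L> x. f x) = (\<integral>\<^sup>+ x. f x \<partial>distr lborel borel (\<lambda>x. c - x))"
  by (simp add: lborel_distr_reflect)
 also have "... = (\<L> x. f (c - x))"
  by (subst nn_integral_distr) auto
 finally show ?thesis by simp
qed

text \<open>Hoelder in \<open>y\<close> separates the inverse weights from the weighted functions.
  The kernel bound produces \<open>\<omega> x powr (- p)\<close>, which cancels the outer weight;
  what remains is the convolution of two integrable functions, whose integral factorizes by Tonelli
  and translation invariance.\<close>

lemma bilinear_Holder: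
 fixes f g A B \<omega> :: "'a::euclidean_space \<Rightarrow> real"
 assumes rp: "1 < r" "1 < p" "1 / r + 1 / p = 1"
  and [measurable]: "f \<in> BM" "g \<in> BM"
   "A \<in> BM" "B \<in> BM" "\<omega> \<in> BM"
  and nonneg: "\<And>x. 0 \<le> f x" "\<And>x. 0 \<le> g x"
  and pos: "\<And>x. 0 < A x" "\<And>x. 0 < B x" "\<And>x. 0 < \<omega> x"
  and C: "0 \<le> C"
   "\<And>x. (\<L> y. ennreal ((A y * B (x - y)) powr (- r))) \<le> ennreal (C * \<omega> x powr (- r))"
 shows "(\<L> x. ennreal (\<omega> x powr p) * epow (\<L> y. ennreal (f y * g (x - y))) p)
  \<le> ennreal (C powr (p / r)) * ((\<L> x. ennreal ((A x * f x) powr p)) * (\<L> x. ennreal ((B x * g x) powr p)))"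
proof -
 have *: "ennreal (\<omega> x powr p) * epow (\<L> y. ennreal (f y * g (x - y))) p
   \<le> ennreal (C powr (p / r)) * (\<L> y. ennreal ((A y * f y) powr p) * ennreal ((B (x - y) * g (x - y)) powr p))" for x
 proof -
  have eq: "f y * g (x - y) = (1 / (A y * B (x - y))) * ((A y * f y) * (B (x - y) * g (x - y)))" for y
   using pos[of y] pos[of "x - y"] by simp
  have "epow (\<L> y. ennreal (f y * g (x - y))) p
   \<le> ennreal ((C * \<omega> x powr (- r)) powr (p / r)) * (\<L> y. ennreal (((A y * f y) * (B (x - y) * g (x - y))) powr p))"
   unfolding eq
  proof (rule Holder_epow[OF rp])
   show "0 \<le> 1 / (A y * B (x - y))" for y using pos(1)[of y] pos(2)[of "x - y"] by simp
   show "0 \<le> A y * f y * (B (x - y) * g (x - y))" for y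
    using pos nonneg by (simp add: less_imp_le)
   show "0 \<le> C * \<omega> x powr (- r)" using C by simp
   have "(1 / (A y * B (x - y))) powr r = (A y * B (x - y)) powr (- r)" for y
    using pos(1)[of y] pos(2)[of "x - y"]
     powr_divide[of 1 "A y * B (x - y)" r] powr_minus_divide[of "A y * B (x - y)" r] by simp
   then show "(\<L> y. ennreal ((1 / (A y * B (x - y))) powr r)) \<le> ennreal (C * \<omega> x powr (- r))"
    using C(2)[of x] by simp
  qed measurable
  also have "(C * \<omega> x powr (- r)) powr (p / r) = C powr (p / r) * \<omega> x powr (- p)"
   using rp C by (simp add: powr_mult powr_powr)
  finally have "ennreal (\<omega> x powr p) * epow (\<L> y. ennreal (f y * g (x - y))) p
   \<le> ennreal (\<omega> x powr p) * (ennreal (C powr (p / r) * \<omega> x powr (- p)) * (\<L> y. ennreal (((A y * f y) * (B (x - y) * g (x - y))) powr p)))"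
   by (rule mult_left_mono) auto
  also have "... = ennreal (C powr (p / r)) * (\<L> y. ennreal (((A y * f y) * (B (x - y) * g (x - y))) powr p))"
  proof -
   have 1: "\<omega> x powr p * (C powr (p / r) * \<omega> x powr (- p)) = C powr (p / r)"
    using pos(3)[of x] by (simp add: powr_minus)
   have 2: "ennreal a * (ennreal b * X) = ennreal (a * b) * X" if "0 \<le> a" "0 \<le> b" for a b X
    using that by (simp add: ennreal_mult mult.assoc)
   show ?thesis
    by (subst 2) (simp_all only: 1 powr_ge_zero mult_nonneg_nonneg)
  qed
  also have "... = ennreal (C powr (p / r)) * (\<L> y. ennreal ((A y * f y) powr p) * ennreal ((B (x - y) * g (x - y)) powr p))"
   using pos nonneg by (intro arg_cong2[where f="(*)"] nn_integral_cong refl)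
    (simp add: powr_mult less_imp_le flip: ennreal_mult)
  finally show ?thesis .
 qed
 have "(\<L> x. ennreal (\<omega> x powr p) * epow (\<L> y. ennreal (f y * g (x - y))) p)
  \<le> (\<L> x. ennreal (C powr (p / r)) * (\<L> y. ennreal ((A y * f y) powr p) * ennreal ((B (x - y) * g (x - y)) powr p)))"
  by (intro nn_integral_mono *)
 also have "... = ennreal (C powr (p / r)) * (\<L> x. (\<L> y. ennreal ((A y * f y) powr p) * ennreal ((B (x - y) * g (x - y)) powr p)))"
  by (intro nn_integral_cmult) measurable
 also have "(\<L> x. (\<L> y. ennreal ((A y * f y) powr p) * ennreal ((B (x - y) * g (x - y)) powr p)))
  = (\<L> y. (\<L> x. ennreal ((A y * f y) powr p) * ennreal ((B (x - y) * g (x - y)) powr p)))"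
  by (rule lborel_pair.Fubini') measurable
 also have "... = (\<L> y. ennreal ((A y * f y) powr p) * (\<L> x. ennreal ((B x * g x) powr p)))"
  by (subst nn_integral_cmult, measurable)
   (simp add: nn_integral_lborel_minus[of "\<lambda>x. ennreal ((B x * g x) powr p)"])
 also have "... = (\<L> x. ennreal ((A x * f x) powr p)) * (\<L> x. ennreal ((B x * g x) powr p))"
  by (rule nn_integral_multc) measurable
 finally show ?thesis .
qed

section \<open>Japanese brackets and intersecting shells\<close>

lemma japr_pos [simp]: "0 < japr x"
 unfolding japr_def by (smt (verit) real_sqrt_gt_0_iff zero_le_power2)

lemma japr_ge_1 [simp]: "1 \<le> japr x"
 unfolding japr_def by simp

lemma japr_nonneg [simp]: "0 \<le> japr x"
 by (rule less_imp_le) simp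

lemma japr_neq_0 [simp]: "japr x \<noteq> 0"
 using japr_pos[of x] by linarith

lemma abs_le_japr: "\<bar>x\<bar> \<le> japr x"
 unfolding japr_def by (simp add: real_le_rsqrt)

lemma japr_le: "japr x \<le> 1 + \<bar>x\<bar>"
 unfolding japr_def by (rule real_le_lsqrt) (auto simp: power2_eq_square algebra_simps)

lemma japr_minus [simp]: "japr (- x) = japr x"
 unfolding japr_def by simp

lemma japr_mono: "\<bar>x\<bar> \<le> \<bar>y\<bar> \<Longrightarrow> japr x \<le> japr y"
 unfolding japr_def by (simp add: abs_le_square_iff)

text \<open>A form of Peetre's inequality.\<close>

lemma japr_add_mult: "japr (x + y) \<le> 2 * japr x * japr y"
proof -
 have "1 + (x + y)\<^sup>2 \<le> 2 * (1 + x\<^sup>2) * (2 * (1 + y\<^sup>2))"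
 proof -
  have "(x + y)\<^sup>2 \<le> 2 * x\<^sup>2 + 2 * y\<^sup>2"
   by (smt (verit) power2_diff power2_sum zero_le_power2)
  moreover have "0 \<le> x\<^sup>2 * y\<^sup>2" "0 \<le> x\<^sup>2" "0 \<le> y\<^sup>2" by simp_all
  moreover have "2 * (1 + x\<^sup>2) * (2 * (1 + y\<^sup>2)) = 4 + 4 * x\<^sup>2 + 4 * y\<^sup>2 + 4 * (x\<^sup>2 * y\<^sup>2)"
   by (simp add: algebra_simps)
  ultimately show ?thesis by linarith
 qed
 then have "japr (x + y) \<le> sqrt (2 * (1 + x\<^sup>2) * (2 * (1 + y\<^sup>2)))"
  unfolding japr_def by simp
 also have "2 * (1 + x\<^sup>2) * (2 * (1 + y\<^sup>2)) = 4 * ((1 + x\<^sup>2) * (1 + y\<^sup>2))"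
  by (simp add: algebra_simps)
 also have "sqrt \<dots> = 2 * japr x * japr y"
  unfolding japr_def by (simp only: real_sqrt_mult real_sqrt_four mult.assoc)
 finally show ?thesis .
qed

lemma japr_add_max: "japr (x + y) \<le> 2 * max (japr x) (japr y)"
proof -
 have *: "japr (2 * z) \<le> 2 * japr z" for z
 proof -
  have "sqrt (1 + (2 * z)\<^sup>2) \<le> sqrt (4 * (1 + z\<^sup>2))" by simp
  also have "... = 2 * sqrt (1 + z\<^sup>2)" by (simp only: real_sqrt_mult real_sqrt_four)
  finally show ?thesis unfolding japr_def .
 qed
 have "japr (x + y) \<le> japr (2 * x) \<or> japr (x + y) \<le> japr (2 * y)"
  by (cases "\<bar>x\<bar> \<le> \<bar>y\<bar>") (auto intro!: japr_mono)
 with *[of x] *[of y] show ?thesis by linarith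
qed

lemma japr_powr_add:
 assumes "0 \<le> a"
 shows "japr (x + y) powr a \<le> 2 powr a * (japr x powr a + japr y powr a)"
proof -
 have "japr (x + y) powr a \<le> (2 * max (japr x) (japr y)) powr a"
  using japr_add_max[of x y] assms by (intro powr_mono2) (auto intro: less_imp_le)
 also have "... = 2 powr a * max (japr x) (japr y) powr a"
  by (simp add: powr_mult less_imp_le)
 also have "... \<le> 2 powr a * (japr x powr a + japr y powr a)"
  by (intro mult_left_mono) (auto simp: max_def)
 finally show ?thesis .
qed

text \<open>Brackets are constant up to a factor on intervals of bounded length. A shift by 2 lets
  two radii move by 1 at the same time; 8 is a convenient bound for 2 * 3.\<close>

lemma japr_shift:
 assumes "\<bar>h\<bar> \<le> 2"
 shows "japr (x + h) \<le> 8 * japr x"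
proof -
 have "japr h \<le> 3" using japr_le[of h] assms by linarith
 then have "2 * japr x * japr h \<le> 2 * japr x * 3"
  by (intro mult_left_mono) (auto intro: less_imp_le)
 moreover have "0 < japr x" by simp
 ultimately show ?thesis using japr_add_mult[of x h] by linarith
qed

lemma japr_shift_powr:
 assumes "\<bar>h\<bar> \<le> 2" "0 \<le> a"
 shows "japr x powr (- a) \<le> 8 powr a * japr (x + h) powr (- a)"
proof -
 have "japr (x + h) powr a \<le> (8 * japr x) powr a"
  using japr_shift[OF assms(1)] assms by (intro powr_mono2) (auto intro: less_imp_le)
 then have "japr (x + h) powr a \<le> 8 powr a * japr x powr a"
  by (simp add: powr_mult less_imp_le)
 then show ?thesis
  by (simp add: powr_minus divide_simps)
qed

lemma jap_japr: "jap \<xi> = japr (norm \<xi>)"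
 by (simp add: jap_def japr_def)

lemma jap_pos [simp]: "0 < jap \<xi>" and jap_ge_1 [simp]: "1 \<le> jap \<xi>"
 by (simp_all add: jap_japr)

lemma jap_nonneg [simp]: "0 \<le> jap \<xi>"
 by (rule less_imp_le) simp

lemma jap_neq_0 [simp]: "jap \<xi> \<noteq> 0"
 using jap_pos[of \<xi>] by linarith

lemma norm_le_jap: "norm \<xi> \<le> jap \<xi>"
 using abs_le_japr[of "norm \<xi>"] by (simp add: jap_japr)

lemma jap_le: "jap \<xi> \<le> 1 + norm \<xi>"
 using japr_le[of "norm \<xi>"] by (simp add: jap_japr)

lemma jap_diff_max: "jap \<xi> \<le> 2 * max (jap \<eta>) (jap (\<xi> - \<eta>))"
proof -
 have "norm \<xi> \<le> norm \<eta> + norm (\<xi> - \<eta>)" by (metis add.commute diff_add_cancel norm_triangle_ineq)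
 then have "japr (norm \<xi>) \<le> japr (norm \<eta> + norm (\<xi> - \<eta>))" by (intro japr_mono) auto
 then show ?thesis using japr_add_max[of "norm \<eta>" "norm (\<xi> - \<eta>)"] by (simp add: jap_japr)
qed

lemma measurable_japr [measurable]: "f \<in> borel_measurable M \<Longrightarrow> (\<lambda>x. japr (f x)) \<in> borel_measurable M"
 unfolding japr_def by measurable

lemma measurable_jap [measurable]: "f \<in> borel_measurable M \<Longrightarrow> (\<lambda>x. jap (f x)) \<in> borel_measurable M"
 unfolding jap_def by measurable

section \<open>One-dimensional integrals of brackets\<close>

definition Jint :: "real \<Rightarrow> ennreal" where
 "Jint a = (\<L> x. ennreal (japr x powr (- a)))"

lemma Jint_finite:
 assumes "1 < a"
 shows "Jint a < \<infinity>"
proof -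
 define F where "F = (\<lambda>x::real. - ((1 + x) powr (1 - a)) / (a - 1))"
 have "(\<L> x. ennreal ((1 + x) powr (- a)) * indicator {0..} x) = ennreal (0 - F 0)"
 proof (rule nn_integral_FTC_atLeast)
  fix x :: real assume "0 \<le> x"
  then show "DERIV F x :> (1 + x) powr (- a)"
   unfolding F_def using assms
   by (auto intro!: derivative_eq_intros simp: divide_simps) (simp add: algebra_simps)
  show "0 \<le> (1 + x) powr - a" by simp
 next
  have "filterlim (\<lambda>x::real. 1 + x) at_top at_top"
   by (rule filterlim_tendsto_add_at_top[OF tendsto_const filterlim_ident])
  then have "((\<lambda>x::real. (1 + x) powr (1 - a)) \<longlongrightarrow> 0) at_top"
   using assms by (intro tendsto_neg_powr) auto
  from tendsto_mult_right[OF this, of "- 1 / (a - 1)"]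
  show "(F \<longlongrightarrow> 0) at_top" unfolding F_def by simp
 qed measurable
 then have fin: "(\<L> x. ennreal ((1 + x) powr (- a)) * indicator {0..} x) < \<infinity>"
  by simp
 have le: "japr x powr (- a) \<le> 2 powr a * (1 + \<bar>x\<bar>) powr (- a)" for x
 proof -
  have "(1 + \<bar>x\<bar>) powr a \<le> (2 * japr x) powr a"
   using assms abs_le_japr[of x] japr_ge_1[of x] by (intro powr_mono2) (auto simp del: japr_ge_1)
  then have "(1 + \<bar>x\<bar>) powr a \<le> 2 powr a * japr x powr a"
   by (simp add: powr_mult less_imp_le)
  then show ?thesis
   by (simp add: powr_minus divide_simps)
 qed
 let ?g = "\<lambda>x. ennreal (2 powr a) * (ennreal ((1 + x) powr (- a)) * indicator {0..} x)"
 have "Jint a \<le> (\<L> x. ?g x + ?g (- x))"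
  unfolding Jint_def
 proof (intro nn_integral_mono)
  fix x :: real
  show "ennreal (japr x powr - a) \<le> ?g x + ?g (- x)"
   using le[of x] by (cases "0 \<le> x"; cases "x = 0") (auto simp: indicator_def ennreal_mult[symmetric] intro: add_increasing)
 qed
 also have "... = (\<L> x. ?g x) + (\<L> x. ?g (- x))"
  by (rule nn_integral_add) measurable
 also have "(\<L> x. ?g (- x)) = (\<L> x. ?g x)"
  using nn_integral_lborel_reflect[of ?g 0] by simp
 also have "(\<L> x. ?g x) = ennreal (2 powr a) * (\<L> x. ennreal ((1 + x) powr (- a)) * indicator {0..} x)"
  by (rule nn_integral_cmult) measurable
 finally show ?thesis
  using fin by (auto simp: ennreal_mult_less_top intro: le_less_trans)
qed

lemma Jint_affine:
 assumes "\<bar>c\<bar> = 1"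
 shows "(\<L> x. ennreal (japr (t + c * x) powr (- a))) = Jint a"
 unfolding Jint_def using assms
 by (subst (2) nn_integral_real_affine[where c=c and t=t]) auto

lemma Jint_affine2:
 assumes "\<bar>c\<bar> = 1"
 shows "(\<L> x. ennreal (japr (t + c * (2 * x)) powr (- a))) \<le> Jint a"
proof -
 have "Jint a = ennreal 2 * (\<L> x. ennreal (japr (t + c * (2 * x)) powr (- a)))"
  unfolding Jint_def using assms
  by (subst nn_integral_real_affine[where c="c*2" and t=t]) (auto simp: abs_mult mult.assoc)
 moreover have "(\<L> x. ennreal (japr (t + c * (2 * x)) powr (- a))) \<le> ennreal 2 * (\<L> x. ennreal (japr (t + c * (2 * x)) powr (- a)))"
  using mult_right_mono[of 1 "ennreal 2"] by simp
 ultimately show ?thesis by simp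
qed

text \<open>The arguments \<open>l + x\<close> and \<open>y - l\<close> add up to
  \<open>x + y\<close>, so the larger bracket is at least half of \<open>japr (x + y)\<close>; the
  other bracket is integrable in \<open>l\<close>.\<close>

lemma nn_integral_two_brackets:
 assumes "1 < a"
 shows "(\<L> l. ennreal (japr (l + x) powr (- a) * japr (y - l) powr (- a)))
  \<le> ennreal (2 powr (a + 1) * enn2real (Jint a) * japr (x + y) powr (- a))"
proof -
 have pt: "japr u powr (- a) * japr v powr (- a) \<le> 2 powr a * japr (u + v) powr (- a) * (japr u powr (- a) + japr v powr (- a))" for u v
 proof -
  have "japr (u + v) powr a \<le> 2 powr a * (japr u powr a + japr v powr a)"
   using assms by (intro japr_powr_add) auto
  moreover have "0 < japr u powr a" "0 < japr v powr a" "0 < japr (u + v) powr a" by simp_all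
  ultimately show ?thesis by (simp add: powr_minus field_simps)
 qed
 have J: "Jint a = ennreal (enn2real (Jint a))" using Jint_finite[OF assms] by simp
 have "(\<L> l. ennreal (japr (l + x) powr (- a) * japr (y - l) powr (- a)))
  \<le> (\<L> l. ennreal (2 powr a * japr (x + y) powr (- a)) * (ennreal (japr (x + 1 * l) powr (- a)) + ennreal (japr (y + (-1) * l) powr (- a))))"
  using pt[of "l + x" "y - l" for l]
  by (intro nn_integral_mono) (simp add: algebra_simps flip: ennreal_mult ennreal_plus)
 also have "... = ennreal (2 powr a * japr (x + y) powr (- a)) * (Jint a + Jint a)"
  by (subst nn_integral_cmult, measurable, subst nn_integral_add) (simp_all only: Jint_affine abs_one abs_minus, measurable)
 also have "... = ennreal (2 powr (a + 1) * enn2real (Jint a) * japr (x + y) powr (- a))"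
  by (subst (1 2) J) (simp add: powr_add algebra_simps flip: ennreal_mult ennreal_plus)
 finally show ?thesis .
qed

section \<open>Volume of the intersection of two spherical shells\<close>

lemma emeasure_annulus_le:
 assumes "a \<le> b"
 shows "emeasure lborel {q :: real \<times> real. a \<le> (norm q)\<^sup>2 \<and> (norm q)\<^sup>2 \<le> b} \<le> ennreal (pi * (b - a))"
proof (cases "b < 0")
 case True
 then have "{q :: real \<times> real. a \<le> (norm q)\<^sup>2 \<and> (norm q)\<^sup>2 \<le> b} = {}"
  using zero_le_power2 order_trans not_le by blast
 then show ?thesis by (simp only: emeasure_empty zero_le)
next
 case False
 define a' where "a' = max a 0"
 have a': "0 \<le> a'" "a' \<le> b" "b - a' \<le> b - a" using assms False by (auto simp: a'_def)
 have "{q :: real \<times> real. a \<le> (norm q)\<^sup>2 \<and> (norm q)\<^sup>2 \<le> b} \<subseteq> cball 0 (sqrt b) - ball 0 (sqrt a')"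
 proof
  fix q :: "real \<times> real"
  assume "q \<in> {q. a \<le> (norm q)\<^sup>2 \<and> (norm q)\<^sup>2 \<le> b}"
  then have "a' \<le> (norm q)\<^sup>2" "(norm q)\<^sup>2 \<le> b" by (auto simp: a'_def)
  then have "sqrt a' \<le> norm q" "norm q \<le> sqrt b"
   using real_le_lsqrt real_le_rsqrt by (auto intro: real_le_rsqrt real_le_lsqrt simp: real_le_rsqrt)
  then show "q \<in> cball 0 (sqrt b) - ball 0 (sqrt a')" by auto
 qed
 then have "emeasure lborel {q :: real \<times> real. a \<le> (norm q)\<^sup>2 \<and> (norm q)\<^sup>2 \<le> b}
  \<le> emeasure lborel (cball (0 :: real \<times> real) (sqrt b) - ball 0 (sqrt a'))"
  by (rule emeasure_mono) auto
 also have "... = emeasure lborel (cball (0 :: real \<times> real) (sqrt b)) - emeasure lborel (ball (0 :: real \<times> real) (sqrt a'))"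
 proof (rule emeasure_Diff)
  show "emeasure lborel (ball (0 :: real \<times> real) (sqrt a')) \<noteq> \<infinity>"
   using a' by (simp add: emeasure_ball)
  have "sqrt a' \<le> sqrt b" using a' by simp
  then show "ball (0 :: real \<times> real) (sqrt a') \<subseteq> cball 0 (sqrt b)"
   using ball_subset_cball subset_cball subset_trans by blast
 qed auto
 also have "... = ennreal (pi * b) - ennreal (pi * a')"
  using a' by (simp add: emeasure_cball emeasure_ball unit_ball_vol_2 flip: ennreal_mult)
 also have "... \<le> ennreal (pi * (b - a))"
  using a' by (simp add: ennreal_minus right_diff_distrib[symmetric] mult_left_mono)
 finally show ?thesis .
qed

lemma measurable_vector3 [measurable]:
 "(\<lambda>(x, y, z). vector [x, y, z] :: real^3) \<in> BM"
proof -
 have eq: "(\<lambda>(x, y, z). vector [x, y, z] :: real^3) = (\<lambda>q. \<chi> i. if i = 1 then fst q else if i = 2 then fst (snd q) else snd (snd q))"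
  by (auto simp: fun_eq_iff vec_eq_iff vector_3 forall_3)
 have "continuous_on UNIV (\<lambda>q :: real \<times> real \<times> real. if i = 1 then fst q else if i = 2 then fst (snd q) else snd (snd q))" for i :: 3
  by (cases "i = 1"; cases "i = 2") (auto intro!: continuous_intros)
 then show ?thesis
  unfolding eq by (intro borel_measurable_continuous_onI continuous_on_vec_lambda)
qed

text \<open>Makes slicing by parallel planes, that is Fubini on a product of lines, available in
  \<open>real^3\<close>.\<close>

lemma lborel_vector3:
 "distr (lborel :: (real \<times> real \<times> real) measure) borel (\<lambda>(x, y, z). vector [x, y, z] :: real^3) = lborel"
proof (rule lborel_eqI[symmetric])
 fix l u :: "real^3"
 assume le: "\<And>b. b \<in> Basis \<Longrightarrow> l \<bullet> b \<le> u \<bullet> b"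
 then have le': "l $ i \<le> u $ i" for i
  by (metis axis_in_Basis_iff cart_eq_inner_axis real_inner_1_left inner_real_def Basis_real_def insertI1)
 have pre: "(\<lambda>(x, y, z). vector [x, y, z] :: real^3) -` box l u = box (l $ 1, l $ 2, l $ 3) (u $ 1, u $ 2, u $ 3)"
  by (auto simp: mem_box_cart forall_3 vector_3 mem_box Basis_prod_def ball_Un inner_Pair)
 have "emeasure (distr lborel borel (\<lambda>(x, y, z). vector [x, y, z] :: real^3)) (box l u)
  = emeasure lborel (box (l $ 1, l $ 2, l $ 3) (u $ 1, u $ 2, u $ 3))"
  by (subst emeasure_distr) (auto simp: pre)
 also have "... = ennreal ((u $ 1 - l $ 1) * (u $ 2 - l $ 2) * (u $ 3 - l $ 3))"
  using le' by (subst emeasure_lborel_box) (auto simp: Basis_prod_def prod.union_disjoint prod.reindex inj_on_def algebra_simps)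
 also have "(u $ 1 - l $ 1) * (u $ 2 - l $ 2) * (u $ 3 - l $ 3) = (\<Prod>b\<in>Basis. (u - l) \<bullet> b)"
 proof -
  have *: "Basis = {axis 1 1, axis 2 1, axis 3 1 :: real^3}"
   by (auto simp: Basis_vec_def UNIV_3)
  show ?thesis
   unfolding * by (simp add: axis_eq_axis inner_axis mult.assoc)
 qed
 finally show "emeasure (distr lborel borel (\<lambda>(x, y, z). vector [x, y, z] :: real^3)) (box l u) = (\<Prod>b\<in>Basis. (u - l) \<bullet> b)" .
qed simp

text \<open>The observation of Archimedes: a plane at height \<open>x\<close> cuts the shell in an
  annulus whose squared radii are \<open>a - x^2\<close> and \<open>b - x^2\<close>, so its area is
  at most \<pi> (b - a) at every height.\<close>

lemma emeasure_slab_shell_le: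
 assumes "\<alpha> \<le> \<beta>" "a \<le> b"
 shows "emeasure lborel {x :: real^3. \<alpha> \<le> x $ 1 \<and> x $ 1 \<le> \<beta> \<and> a \<le> (norm x)\<^sup>2 \<and> (norm x)\<^sup>2 \<le> b}
  \<le> ennreal ((\<beta> - \<alpha>) * (pi * (b - a)))"
proof -
 let ?S = "{x :: real^3. \<alpha> \<le> x $ 1 \<and> x $ 1 \<le> \<beta> \<and> a \<le> (norm x)\<^sup>2 \<and> (norm x)\<^sup>2 \<le> b}"
 let ?Q = "{(x, q). \<alpha> \<le> x \<and> x \<le> \<beta> \<and> a \<le> x\<^sup>2 + (norm q)\<^sup>2 \<and> x\<^sup>2 + (norm q)\<^sup>2 \<le> b} :: (real \<times> real \<times> real) set"
 have norm_vec: "(norm (vector [x, y, z] :: real^3))\<^sup>2 = x\<^sup>2 + (norm (y, z))\<^sup>2" for x y z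
  by (simp add: norm_Pair norm_vec_def L2_set_def sum_3 vector_3)
 have S: "?S \<in> sets borel" by measurable
 have "closed ?Q"
  unfolding case_prod_beta
  by (intro closed_Collect_conj closed_Collect_le continuous_intros)
 then have Q: "?Q \<in> sets borel" by (rule borel_closed)
 have "emeasure lborel ?S = emeasure (distr (lborel :: (real \<times> real \<times> real) measure) borel (\<lambda>(x, y, z). vector [x, y, z] :: real^3)) ?S"
  by (simp only: lborel_vector3)
 also have "... = emeasure lborel ?Q"
  by (subst emeasure_distr) (use S in \<open>auto simp: norm_vec vector_3 intro!: arg_cong2[where f=emeasure]\<close>)
 also have "... = emeasure (lborel \<Otimes>\<^sub>M lborel) ?Q" by (simp only: lborel_prod)
 also have "... = (\<L> x. emeasure lborel (Pair x -` ?Q))"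
  by (rule lborel.emeasure_pair_measure_alt) (use Q in \<open>simp only: lborel_prod sets_lborel\<close>)
 also have "... \<le> (\<L> x. ennreal (pi * (b - a)) * indicator {\<alpha>..\<beta>} x)"
 proof (rule nn_integral_mono)
  fix x :: real
  have "Pair x -` ?Q \<subseteq> {q. a - x\<^sup>2 \<le> (norm q)\<^sup>2 \<and> (norm q)\<^sup>2 \<le> b - x\<^sup>2}" by auto
  then have "emeasure lborel (Pair x -` ?Q) \<le> emeasure lborel {q :: real \<times> real. a - x\<^sup>2 \<le> (norm q)\<^sup>2 \<and> (norm q)\<^sup>2 \<le> b - x\<^sup>2}"
   by (rule emeasure_mono) measurable
  also have "... \<le> ennreal (pi * (b - a))"
   using emeasure_annulus_le[of "a - x\<^sup>2" "b - x\<^sup>2"] assms by simp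
  finally show "emeasure lborel (Pair x -` ?Q) \<le> ennreal (pi * (b - a)) * indicator {\<alpha>..\<beta>} x"
   by (auto simp: indicator_def)
 qed
 also have "... = ennreal ((\<beta> - \<alpha>) * (pi * (b - a)))"
  using assms by (subst nn_integral_cmult_indicator) (simp_all add: mult.commute flip: ennreal_mult)
 finally show ?thesis .
qed

text \<open>The components of \<open>q\<close> are the outer radii. With thickness 1, a fixed
  \<open>\<eta>\<close> lies in \<open>shells \<xi> q\<close> exactly when \<open>q\<close> lies in
  a unit square with corner at the two distances of \<open>\<eta>\<close>.\<close>

definition shells :: "real^3 \<Rightarrow> real \<times> real \<Rightarrow> (real^3) set" where
 "shells \<xi> q = {\<eta>. fst q - 1 \<le> norm \<eta> \<and> norm \<eta> \<le> fst q \<and> snd q - 1 \<le> norm (\<xi> - \<eta>) \<and> norm (\<xi> - \<eta>) \<le> snd q}"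

lemma shells_nonempty:
 assumes "shells \<xi> (\<rho>, y) \<noteq> {}"
 shows "0 \<le> \<rho>" "0 \<le> y" "norm \<xi> \<le> \<rho> + y" "\<bar>\<rho> - y\<bar> \<le> norm \<xi> + 1"
proof -
 from assms obtain \<eta> where \<eta>: "\<rho> - 1 \<le> norm \<eta>" "norm \<eta> \<le> \<rho>" "y - 1 \<le> norm (\<xi> - \<eta>)" "norm (\<xi> - \<eta>) \<le> y"
  by (auto simp: shells_def)
 have "norm \<xi> \<le> norm \<eta> + norm (\<xi> - \<eta>)" "norm (\<xi> - \<eta>) \<le> norm \<xi> + norm \<eta>" "norm \<eta> \<le> norm \<xi> + norm (\<xi> - \<eta>)"
  by norm+
 with \<eta> norm_ge_zero[of \<eta>] norm_ge_zero[of "\<xi> - \<eta>"]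
 show "0 \<le> \<rho>" "0 \<le> y" "norm \<xi> \<le> \<rho> + y" "\<bar>\<rho> - y\<bar> \<le> norm \<xi> + 1"
  by linarith+
qed

lemma measurable_shells [measurable]: "shells \<xi> q \<in> sets borel"
 unfolding shells_def by measurable

lemma emeasure_shells_reflect: "emeasure lborel (shells \<xi> (\<rho>, y)) = emeasure lborel (shells \<xi> (y, \<rho>))"
proof -
 have "emeasure lborel (shells \<xi> (\<rho>, y)) = emeasure (distr lborel borel (\<lambda>x. \<xi> - x)) (shells \<xi> (\<rho>, y))"
  by (simp add: lborel_distr_reflect)
 also have "... = emeasure lborel (shells \<xi> (y, \<rho>))"
  by (subst emeasure_distr) (auto simp: shells_def intro!: arg_cong2[where f=emeasure])
 finally show ?thesis .
qed

text \<open>Allows \<open>\<xi>\<close> to be placed on the first coordinate axis, where the second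
  shell becomes a condition on one coordinate.\<close>

lemma emeasure_shells_rotate:
 assumes "norm \<xi> = norm \<xi>'"
 shows "emeasure lborel (shells \<xi> q) = emeasure lborel (shells \<xi>' q)"
proof -
 obtain f where f: "orthogonal_transformation f" "f \<xi> = \<xi>'"
  using orthogonal_transformation_exists[OF assms] by blast
 have bdd: "bounded (shells z q)" for z
  by (rule bounded_subset[of "cball 0 (fst q)"]) (auto simp: shells_def)
 have meas: "shells z q \<in> lmeasurable" for z
 proof (rule lmeasurable_compact)
  note bdd[of z]
  moreover have "closed (shells z q)"
   unfolding shells_def
   by (intro closed_Collect_conj closed_Collect_le continuous_intros)
  ultimately show "compact (shells z q)" by (simp add: compact_eq_bounded_closed)
 qed
 have nf: "norm (f x) = norm x" for x using f by (simp add: orthogonal_transformation_norm)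
 have lin: "f (x - y) = f x - f y" for x y
  using f by (simp add: orthogonal_transformation_linear linear_diff)
 have sub: "\<xi>' - f x = f (\<xi> - x)" for x using f lin by simp
 have "f ` shells \<xi> q = shells \<xi>' q"
 proof safe
  fix x assume "x \<in> shells \<xi> q"
  then show "f x \<in> shells \<xi>' q" by (simp add: shells_def sub nf)
 next
  fix z assume z: "z \<in> shells \<xi>' q"
  obtain x where "z = f x" using orthogonal_transformation_surj[OF f(1)] by (auto simp: surj_def)
  with z show "z \<in> f ` shells \<xi> q" by (auto simp: shells_def sub nf)
 qed
 then have "measure lebesgue (shells \<xi>' q) = measure lebesgue (shells \<xi> q)"
  using measure_orthogonal_image[OF f(1) meas] by metis
 moreover have "emeasure lborel (shells z q) = ennreal (measure lebesgue (shells z q))" for z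
  using emeasure_bounded_finite[OF bdd[of z]]
  by (simp add: emeasure_eq_ennreal_measure less_top)
 ultimately show ?thesis by simp
qed

text \<open>For \<open>\<xi>\<close> on the first axis, |\<eta>|^2 - |\<xi> - \<eta>|^2 is affine in
  the first coordinate of \<eta> with slope 2 |\<xi>|. Prescribing both radii up to 1 thus confines
  \<eta> to a slab of thickness of order (1 + \<rho> + y) / |\<xi>|, and in a slab the first shell
  has volume of order thickness times 1 + \<rho>.\<close>

lemma emeasure_shells_le:
 assumes "0 \<le> \<rho>" "0 \<le> y"
 shows "emeasure lborel (shells \<xi> (\<rho>, y)) \<le> ennreal (24 * pi * (1 + \<rho>) * (1 + y) / jap \<xi>)"
proof -
 \<comment> \<open>The reflection exchanges the two radii, so it is enough to treat the case in
   which the first is not much larger than the second; then 1 + \<rho> + y is of order 1 +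
   y.\<close>
 have main: "emeasure lborel (shells \<xi> (\<rho>, y)) \<le> ennreal (24 * pi * (1 + \<rho>) * (1 + y) / jap \<xi>)"
  if \<rho>y: "\<rho> \<le> y + 2" "0 \<le> \<rho>" "0 \<le> y" for \<rho> y
 proof (cases "shells \<xi> (\<rho>, y) = {}")
  case True
  then show ?thesis by simp
 next
  case False
  \<comment> \<open>The inner radius may be negative; it is cut at 0 before squaring.\<close>
  define a where "a = (max 0 (\<rho> - 1))\<^sup>2"
  define c where "c = (max 0 (y - 1))\<^sup>2"
  have sq: "\<rho>\<^sup>2 - a \<le> 2 * \<rho> + 1" "a \<le> \<rho>\<^sup>2" "y\<^sup>2 - c \<le> 2 * y + 1" "c \<le> y\<^sup>2"
  proof -
   have "t\<^sup>2 - (max 0 (t - 1))\<^sup>2 \<le> 2 * t + 1 \<and> (max 0 (t - 1))\<^sup>2 \<le> t\<^sup>2" if "0 \<le> t" for t :: real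
   proof (cases "t \<le> 1")
    case True
    then have "t * t \<le> t" using that by (simp add: mult_left_le)
    then show ?thesis using True that by (simp add: max_def power2_eq_square)
   next
    case False
    then show ?thesis by (simp add: max_def power2_eq_square algebra_simps)
   qed
   then show "\<rho>\<^sup>2 - a \<le> 2 * \<rho> + 1" "a \<le> \<rho>\<^sup>2" "y\<^sup>2 - c \<le> 2 * y + 1" "c \<le> y\<^sup>2"
    using \<rho>y by (auto simp: a_def c_def)
  qed
  have sh: "a \<le> (norm x)\<^sup>2 \<and> (norm x)\<^sup>2 \<le> \<rho>\<^sup>2 \<and> c \<le> (norm (z - x))\<^sup>2 \<and> (norm (z - x))\<^sup>2 \<le> y\<^sup>2"
   if "x \<in> shells z (\<rho>, y)" for x z
   using that by (auto simp: shells_def a_def c_def intro!: power_mono)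
  show ?thesis
  proof (cases "norm \<xi> < 1")
   case True
   \<comment> \<open>For small \<open>\<xi>\<close> the second shell gives no thin slab. The first
     shell alone is small enough, as \<open>\<rho> \<le> y + 2\<close> and
     \<open>jap \<xi> \<le> 2\<close>.\<close>
   have "shells \<xi> (\<rho>, y) \<subseteq> {x. - \<rho> \<le> x $ 1 \<and> x $ 1 \<le> \<rho> \<and> a \<le> (norm x)\<^sup>2 \<and> (norm x)\<^sup>2 \<le> \<rho>\<^sup>2}"
   proof
    fix x assume x: "x \<in> shells \<xi> (\<rho>, y)"
    then have "\<bar>x $ 1\<bar> \<le> \<rho>" using component_le_norm_cart[of x 1] by (auto simp: shells_def)
    with sh[OF x] show "x \<in> {x. - \<rho> \<le> x $ 1 \<and> x $ 1 \<le> \<rho> \<and> a \<le> (norm x)\<^sup>2 \<and> (norm x)\<^sup>2 \<le> \<rho>\<^sup>2}" by auto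
   qed
   then have "emeasure lborel (shells \<xi> (\<rho>, y)) \<le> emeasure lborel {x :: real^3. - \<rho> \<le> x $ 1 \<and> x $ 1 \<le> \<rho> \<and> a \<le> (norm x)\<^sup>2 \<and> (norm x)\<^sup>2 \<le> \<rho>\<^sup>2}"
    by (rule emeasure_mono) measurable
   also have "... \<le> ennreal ((\<rho> - (- \<rho>)) * (pi * (\<rho>\<^sup>2 - a)))"
    using \<rho>y sq by (intro emeasure_slab_shell_le) auto
   also have "... \<le> ennreal (24 * pi * (1 + \<rho>) * (1 + y) / jap \<xi>)"
   proof (rule ennreal_leI)
    have "(\<rho> - (- \<rho>)) * (pi * (\<rho>\<^sup>2 - a)) \<le> (2 * (1 + \<rho>)) * (pi * (2 * (3 * (1 + y))))"
     using sq \<rho>y by (intro mult_mono) auto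
    also have "... = 24 * pi * (1 + \<rho>) * (1 + y) / 2" by (simp add: algebra_simps)
    also have "... \<le> 24 * pi * (1 + \<rho>) * (1 + y) / jap \<xi>"
     using jap_le[of \<xi>] True \<rho>y by (intro divide_left_mono) auto
    finally show "(\<rho> - (- \<rho>)) * (pi * (\<rho>\<^sup>2 - a)) \<le> 24 * pi * (1 + \<rho>) * (1 + y) / jap \<xi>" .
   qed
   finally show ?thesis .
  next
   case False
   define R where "R = norm \<xi>"
   have R: "R \<ge> 1" using False by (simp add: R_def)
   define e where "e = (axis 1 R :: real^3)"
   have ne: "norm \<xi> = norm e" using R by (simp add: e_def R_def norm_eq_sqrt_inner inner_axis_axis)
   \<comment> \<open>These are the extreme values of the first coordinate in |e - x|^2 = R^2 - 2 R
     x_1 + |x|^2 when |x|^2 lies between \<open>a\<close> and the square of \<open>\<rho>\<close>,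
     and |e - x|^2 between \<open>c\<close> and the square of \<open>y\<close>.\<close>
   define \<alpha> \<beta> where "\<alpha> = (R\<^sup>2 + a - y\<^sup>2) / (2 * R)" and "\<beta> = (R\<^sup>2 + \<rho>\<^sup>2 - c) / (2 * R)"
   have "shells e (\<rho>, y) \<subseteq> {x. \<alpha> \<le> x $ 1 \<and> x $ 1 \<le> \<beta> \<and> a \<le> (norm x)\<^sup>2 \<and> (norm x)\<^sup>2 \<le> \<rho>\<^sup>2}"
   proof
    fix x assume x: "x \<in> shells e (\<rho>, y)"
    have "(norm (e - x))\<^sup>2 = R\<^sup>2 - 2 * R * x $ 1 + (norm x)\<^sup>2"
     unfolding power2_norm_eq_inner e_def
     by (simp add: inner_diff_left inner_diff_right inner_axis inner_axis' power2_eq_square algebra_simps)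
    with sh[OF x] have "R\<^sup>2 + a - y\<^sup>2 \<le> 2 * R * x $ 1" "2 * R * x $ 1 \<le> R\<^sup>2 + \<rho>\<^sup>2 - c" by linarith+
    with sh[OF x] R show "x \<in> {x. \<alpha> \<le> x $ 1 \<and> x $ 1 \<le> \<beta> \<and> a \<le> (norm x)\<^sup>2 \<and> (norm x)\<^sup>2 \<le> \<rho>\<^sup>2}"
     by (auto simp: \<alpha>_def \<beta>_def field_simps)
   qed
   then have "emeasure lborel (shells e (\<rho>, y)) \<le> emeasure lborel {x :: real^3. \<alpha> \<le> x $ 1 \<and> x $ 1 \<le> \<beta> \<and> a \<le> (norm x)\<^sup>2 \<and> (norm x)\<^sup>2 \<le> \<rho>\<^sup>2}"
    by (rule emeasure_mono) measurable
   also have "... \<le> ennreal ((\<beta> - \<alpha>) * (pi * (\<rho>\<^sup>2 - a)))"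
    using sq R by (intro emeasure_slab_shell_le) (auto simp: \<alpha>_def \<beta>_def divide_right_mono)
   also have "... \<le> ennreal (24 * pi * (1 + \<rho>) * (1 + y) / jap \<xi>)"
   proof (rule ennreal_leI)
    have "\<beta> - \<alpha> = ((\<rho>\<^sup>2 - a) + (y\<^sup>2 - c)) / (2 * R)"
     by (simp add: \<alpha>_def \<beta>_def diff_divide_distrib[symmetric])
    also have "... \<le> (6 * (1 + y)) / (2 * R)"
     using sq R \<rho>y by (intro divide_right_mono) auto
    also have "... = 3 * (1 + y) / R" using R by (simp add: field_simps)
    finally have "\<beta> - \<alpha> \<le> 3 * (1 + y) / R" .
    then have "(\<beta> - \<alpha>) * (pi * (\<rho>\<^sup>2 - a)) \<le> (3 * (1 + y) / R) * (pi * (2 * (1 + \<rho>)))"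
     using sq \<rho>y R by (intro mult_mono) auto
    also have "... = (1 / R) * (6 * pi * (1 + \<rho>) * (1 + y))" by (simp add: algebra_simps add_divide_distrib)
    also have "... \<le> (4 / jap \<xi>) * (6 * pi * (1 + \<rho>) * (1 + y))"
    proof (rule mult_right_mono)
     have "jap \<xi> \<le> 4 * R" using jap_le[of \<xi>] R by (simp add: R_def)
     then show "1 / R \<le> 4 / jap \<xi>" using R by (simp add: field_simps)
    qed (use \<rho>y in auto)
    also have "... = 24 * pi * (1 + \<rho>) * (1 + y) / jap \<xi>" by simp
    finally show "(\<beta> - \<alpha>) * (pi * (\<rho>\<^sup>2 - a)) \<le> 24 * pi * (1 + \<rho>) * (1 + y) / jap \<xi>" .
   qed
   finally show ?thesis using emeasure_shells_rotate[OF ne] by simp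
  qed
 qed
 show ?thesis
 proof (cases "\<rho> \<le> y + 2")
  case True
  then show ?thesis using main assms by blast
 next
  case False
  then have "emeasure lborel (shells \<xi> (y, \<rho>)) \<le> ennreal (24 * pi * (1 + y) * (1 + \<rho>) / jap \<xi>)"
   using main[of y \<rho>] assms by simp
  moreover have "24 * pi * (1 + y) * (1 + \<rho>) = 24 * pi * (1 + \<rho>) * (1 + y)" by simp
  ultimately show ?thesis by (simp only: emeasure_shells_reflect[of \<xi> \<rho> y])
 qed
qed

lemma borel_measurable_fst [measurable (raw)]:
 fixes f :: "'c \<Rightarrow> 'a::second_countable_topology \<times> 'b::second_countable_topology"
 assumes "f \<in> borel_measurable M"
 shows "(\<lambda>x. fst (f x)) \<in> borel_measurable M"
 using measurable_compose[OF assms borel_measurable_continuous_onI[of fst]]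
 by (simp add: continuous_on_fst)

lemma borel_measurable_snd [measurable (raw)]:
 fixes f :: "'c \<Rightarrow> 'a::second_countable_topology \<times> 'b::second_countable_topology"
 assumes "f \<in> borel_measurable M"
 shows "(\<lambda>x. snd (f x)) \<in> borel_measurable M"
 using measurable_compose[OF assms borel_measurable_continuous_onI[of snd]]
 by (simp add: continuous_on_snd)

lemma abs_japr [simp]: "\<bar>japr x\<bar> = japr x" and abs_jap [simp]: "\<bar>jap \<xi>\<bar> = jap \<xi>"
 by (simp_all add: abs_of_pos)

section \<open>Integrals over the pair of radii\<close>

lemma powr_split_max:
 fixes a c z e :: real
 assumes "0 < a" "0 < c" "0 < z" "z \<le> 2 * max a c" "0 \<le> e"
 shows "a powr (- e) * c powr (- e) \<le> 2 powr e * z powr (- e) * (a powr (- e) + c powr (- e))"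
proof -
 have "z powr e \<le> (2 * max a c) powr e"
  using assms by (intro powr_mono2) auto
 also have "... = 2 powr e * max a c powr e"
  using assms by (simp add: powr_mult)
 also have "... \<le> 2 powr e * (a powr e + c powr e)"
  by (intro mult_left_mono) (auto simp: max_def)
 finally have "z powr e \<le> 2 powr e * (a powr e + c powr e)" .
 moreover have "0 < a powr e" "0 < c powr e" "0 < z powr e" using assms by auto
 ultimately show ?thesis by (simp add: powr_minus field_simps)
qed

text \<open>Replaces the change of variables from \<eta> to (|\<eta>|, |\<xi> - \<eta>|). The
  integrand is averaged over the unit square of outer radii attached to \<open>\<eta>\<close>, on
  which \<open>slow\<close> bounds its variation by \<open>K\<close>; exchanging the integrals turns
  the indicator of that square into the volume of the shell intersection.\<close>

lemma nn_integral_two_radii_le: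
 fixes f :: "real \<times> real \<Rightarrow> real"
 assumes [measurable]: "f \<in> BM"
  and nonneg: "\<And>q. 0 \<le> f q" and K: "0 \<le> K"
  and slow: "\<And>\<rho> y u v. 0 \<le> u \<Longrightarrow> u \<le> 1 \<Longrightarrow> 0 \<le> v \<Longrightarrow> v \<le> 1 \<Longrightarrow> f (\<rho>, y) \<le> K * f (\<rho> + u, y + v)"
 shows "(\<L> \<eta>. ennreal (f (norm \<eta>, norm (\<xi> - \<eta>))))
  \<le> ennreal K * (\<L> q. ennreal (f q) * emeasure lborel (shells \<xi> q))"
proof -
 let ?I = "\<lambda>\<eta> q. (if fst q - 1 \<le> norm \<eta> \<and> norm \<eta> \<le> fst q \<and> snd q - 1 \<le> norm (\<xi> - \<eta>) \<and> norm (\<xi> - \<eta>) \<le> snd q then 1 else 0 :: ennreal)"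
 have I: "?I \<eta> q = indicator (shells \<xi> q) \<eta>" for \<eta> q
  by (simp add: shells_def indicator_def)
 have "ennreal (f (norm \<eta>, norm (\<xi> - \<eta>))) \<le> (\<L> q. ennreal K * (ennreal (f q) * ?I \<eta> q))" for \<eta>
 proof -
  let ?c = "(norm \<eta>, norm (\<xi> - \<eta>))"
  have "ennreal (f ?c) = ennreal (f ?c) * emeasure lborel (cbox ?c (norm \<eta> + 1, norm (\<xi> - \<eta>) + 1))"
   by (subst emeasure_lborel_cbox) (auto simp: Basis_prod_def prod.union_disjoint prod.reindex inj_on_def)
  also have "... = (\<L> q. ennreal (f ?c) * indicator (cbox ?c (norm \<eta> + 1, norm (\<xi> - \<eta>) + 1)) q)"
   by (simp add: nn_integral_cmult_indicator)
  also have "... \<le> (\<L> q. ennreal K * (ennreal (f q) * ?I \<eta> q))"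
  proof (rule nn_integral_mono)
   fix q :: "real \<times> real"
   obtain \<rho> y where q: "q = (\<rho>, y)" by (cases q)
   show "ennreal (f ?c) * indicator (cbox ?c (norm \<eta> + 1, norm (\<xi> - \<eta>) + 1)) q \<le> ennreal K * (ennreal (f q) * ?I \<eta> q)"
   proof (cases "q \<in> cbox ?c (norm \<eta> + 1, norm (\<xi> - \<eta>) + 1)")
    case True
    then have *: "norm \<eta> \<le> \<rho>" "\<rho> \<le> norm \<eta> + 1" "norm (\<xi> - \<eta>) \<le> y" "y \<le> norm (\<xi> - \<eta>) + 1"
     by (auto simp: q cbox_Pair_eq)
    then have "f ?c \<le> K * f q"
     using slow[of "\<rho> - norm \<eta>" "y - norm (\<xi> - \<eta>)" "norm \<eta>" "norm (\<xi> - \<eta>)"] by (simp add: q)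
    with * True K nonneg show ?thesis by (simp add: q flip: ennreal_mult)
   qed simp
  qed
  finally show ?thesis .
 qed
 then have "(\<L> \<eta>. ennreal (f (norm \<eta>, norm (\<xi> - \<eta>)))) \<le> (\<L> \<eta>. (\<L> q. ennreal K * (ennreal (f q) * ?I \<eta> q)))"
  by (intro nn_integral_mono)
 also have "... = (\<L> q. (\<L> \<eta>. ennreal K * (ennreal (f q) * ?I \<eta> q)))"
  by (rule lborel_pair.Fubini') measurable
 also have "... = (\<L> q. ennreal K * (ennreal (f q) * emeasure lborel (shells \<xi> q)))"
  unfolding I by (simp add: nn_integral_cmult)
 also have "... = ennreal K * (\<L> q. ennreal (f q) * emeasure lborel (shells \<xi> q))"
 proof (rule nn_integral_cmult)
  have "(\<lambda>q. ennreal (f q) * (\<L> \<eta>. ?I \<eta> q)) \<in> borel_measurable lborel" by measurable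
  then show "(\<lambda>q. ennreal (f q) * emeasure lborel (shells \<xi> q)) \<in> borel_measurable lborel"
   unfolding I by simp
 qed
 finally show ?thesis .
qed

lemma nn_integral_lborel_prod:
 fixes f :: "'a::euclidean_space \<times> 'b::euclidean_space \<Rightarrow> ennreal"
 assumes "f \<in> BM"
 shows "(\<L> q. f q) = (\<L> x. (\<L> y. f (x, y)))"
  and "(\<L> q. f q) = (\<L> y. (\<L> x. f (x, y)))"
proof -
 have f: "f \<in> borel_measurable (lborel \<Otimes>\<^sub>M lborel)" using assms by (simp add: lborel_prod)
 show "(\<L> q. f q) = (\<L> x. (\<L> y. f (x, y)))"
  using lborel.nn_integral_fst[OF f] by (simp add: lborel_prod)
 show "(\<L> q. f q) = (\<L> y. (\<L> x. f (x, y)))"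
  using lborel_pair.nn_integral_snd[OF f] by (simp add: lborel_prod)
qed

lemma japr_ge_half: "0 \<le> x \<Longrightarrow> 1 + x \<le> 2 * japr x"
 using abs_le_japr[of x] japr_ge_1[of x] by (simp del: japr_ge_1)

text \<open>The two-radii bound with \<xi> = 0: the shells meet only if the radii differ by at most
  1, and then their intersection has volume of order \<rho>^2. The condition 3 < k becomes 1 < k - 2
  in the remaining radius.\<close>

lemma radial_powr_integrable:
 assumes "3 < k"
 shows "(\<L> \<eta>. ennreal (jap \<eta> powr (- k))) < \<infinity>"
proof -
 let ?f = "\<lambda>q :: real \<times> real. japr (fst q) powr (- k)"
 have "(\<L> \<eta>. ennreal (jap \<eta> powr (- k))) = (\<L> \<eta>. ennreal (?f (norm \<eta>, norm ((0 :: real^3) - \<eta>))))"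
  by (simp add: jap_japr)
 also have "... \<le> ennreal (8 powr k) * (\<L> q. ennreal (?f q) * emeasure lborel (shells 0 q))"
 proof (rule nn_integral_two_radii_le)
  show "?f (\<rho>, y) \<le> 8 powr k * ?f (\<rho> + u, y + v)" if "0 \<le> u" "u \<le> 1" for \<rho> y u v
   using japr_shift_powr[of u k \<rho>] that assms by simp
 qed auto
 also have "(\<L> q. ennreal (?f q) * emeasure lborel (shells 0 q))
   \<le> (\<L> q. ennreal (192 * pi * japr (fst q) powr (- (k - 2))) * indicator {-1..1} (snd q - fst q))"
 proof (rule nn_integral_mono)
  fix q :: "real \<times> real"
  obtain \<rho> y where q: "q = (\<rho>, y)" by (cases q)
  show "ennreal (?f q) * emeasure lborel (shells 0 q) \<le> ennreal (192 * pi * japr (fst q) powr (- (k - 2))) * indicator {-1..1} (snd q - fst q)"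
  proof (cases "shells 0 q = {}")
   case False
   note ne = shells_nonempty[OF False[unfolded q]]
   have "emeasure lborel (shells 0 q) \<le> ennreal (24 * pi * (1 + \<rho>) * (1 + y))"
    using emeasure_shells_le[of \<rho> y 0] ne by (simp add: q jap_def)
   also have "... \<le> ennreal (192 * pi * (japr \<rho> * japr \<rho>))"
   proof (rule ennreal_leI)
    have "(24 * pi * (1 + \<rho>)) * (1 + y) \<le> (24 * pi * (2 * japr \<rho>)) * (4 * japr \<rho>)"
     using ne japr_ge_half[of \<rho>] by (intro mult_mono) auto
    then show "24 * pi * (1 + \<rho>) * (1 + y) \<le> 192 * pi * (japr \<rho> * japr \<rho>)" by simp
   qed
   finally have "ennreal (?f q) * emeasure lborel (shells 0 q) \<le> ennreal (?f q) * ennreal (192 * pi * (japr \<rho> * japr \<rho>))"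
    by (rule mult_left_mono) simp
   also have "... = ennreal (192 * pi * japr \<rho> powr (- (k - 2)))"
    by (subst ennreal_mult[symmetric]) (simp_all add: q powr_diff powr_minus power2_eq_square field_simps less_imp_le)
   moreover have "y - \<rho> \<in> {-1..1}" using ne by auto
   ultimately show ?thesis by (simp add: q)
  qed simp
 qed
 also have "... = (\<L> \<rho>. (\<L> y. ennreal (192 * pi * japr \<rho> powr (- (k - 2))) * indicator {\<rho> - 1..\<rho> + 1} y))"
  by (subst nn_integral_lborel_prod(1)) (auto intro!: nn_integral_cong simp: indicator_def algebra_simps)
 also have "... = (\<L> \<rho>. ennreal (384 * pi) * ennreal (japr \<rho> powr (- (k - 2))))"
  by (intro nn_integral_cong, subst nn_integral_cmult_indicator) (simp_all add: mult_ac flip: ennreal_mult ennreal_numeral)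
 also have "... = ennreal (384 * pi) * Jint (k - 2)"
  unfolding Jint_def by (rule nn_integral_cmult) measurable
 also have "ennreal (8 powr k) * (ennreal (384 * pi) * Jint (k - 2)) < \<infinity>"
  using Jint_finite[of "k - 2"] assms by (auto simp: ennreal_mult_less_top)
 finally show ?thesis by (simp add: mult_left_mono)
qed

text \<open>In each of the two summands one radius is missing from the power. That radius is
  integrated first, against the bracket, and the sign in front of it does not change the
  value.\<close>

lemma nn_integral_radii_bracket:
 assumes "\<bar>sg1\<bar> = 1" "\<bar>sg2\<bar> = 1"
 shows "(\<L> q. ennreal ((japr (fst q) powr (- e) + japr (snd q) powr (- e)) * japr (\<tau> + sg1 * fst q + sg2 * snd q) powr (- \<beta>)))
  = 2 * Jint e * Jint \<beta>"
proof -
 let ?h = "\<lambda>q :: real \<times> real. ennreal (japr (\<tau> + sg1 * fst q + sg2 * snd q) powr (- \<beta>))"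
 have "(\<L> q. ennreal ((japr (fst q) powr (- e) + japr (snd q) powr (- e)) * japr (\<tau> + sg1 * fst q + sg2 * snd q) powr (- \<beta>)))
  = (\<L> q. ennreal (japr (fst q) powr (- e)) * ?h q + ennreal (japr (snd q) powr (- e)) * ?h q)"
  by (intro nn_integral_cong) (simp add: ring_distribs flip: ennreal_mult ennreal_plus)
 also have "... = (\<L> q. ennreal (japr (fst q) powr (- e)) * ?h q) + (\<L> q. ennreal (japr (snd q) powr (- e)) * ?h q)"
  by (rule nn_integral_add) measurable
 also have "(\<L> q. ennreal (japr (fst q) powr (- e)) * ?h q) = Jint e * Jint \<beta>"
  using assms
  by (subst nn_integral_lborel_prod(1)) (simp_all add: nn_integral_cmult Jint_affine nn_integral_multc Jint_def[of e, symmetric])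
 also have "(\<L> q. ennreal (japr (snd q) powr (- e)) * ?h q) = Jint e * Jint \<beta>"
 proof -
  have *: "\<tau> + sg1 * x + sg2 * y = (\<tau> + sg2 * y) + sg1 * x" for x y by simp
  show ?thesis
   using assms
   by (subst nn_integral_lborel_prod(2)) (simp_all add: * nn_integral_cmult Jint_affine nn_integral_multc Jint_def[of e, symmetric] del: add.assoc)
 qed
 finally show ?thesis by (simp add: mult_2 ring_distribs)
qed

text \<open>The larger of the two brackets dominates \<open>jap \<xi>\<close> up to a factor 2 and
  gives away the power \<open>\<alpha> - k\<close>. The powers \<open>\<alpha>\<close> and
  \<open>k\<close> that remain are collected by \<open>mix\<close> on a single bracket, whose
  exponent exceeds the dimension 3.\<close>

lemma radial_conv_le:
 assumes "0 \<le> k" "k \<le> \<alpha>" "3 < \<alpha> + k"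
 shows "\<exists>C\<ge>0. \<forall>\<xi>. (\<L> \<eta>. ennreal (jap \<eta> powr (- \<alpha>) * jap (\<xi> - \<eta>) powr (- \<alpha>))) \<le> ennreal (C * jap \<xi> powr (- (\<alpha> - k)))"
proof -
 define I where "I = (\<L> \<eta>. ennreal (jap \<eta> powr (- (\<alpha> + k))))"
 have I: "I = ennreal (enn2real I)" using radial_powr_integrable[OF assms(3)] by (simp add: I_def)
 define C where "C = 2 * 2 powr (\<alpha> - k) * (2 * enn2real I)"
 have mix: "a powr (- x) * c powr (- y) \<le> a powr (- (x + y)) + c powr (- (x + y))"
  if "1 \<le> a" "1 \<le> c" "0 \<le> x" "0 \<le> y" for a c x y :: real
 proof (cases "a \<le> c")
  case True
  have "c powr (- y) \<le> a powr (- y)" using True that by (intro powr_mono2') auto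
  then have "a powr (- x) * c powr (- y) \<le> a powr (- x) * a powr (- y)" by (intro mult_left_mono) auto
  also have "... = a powr (- (x + y))" by (simp add: powr_add[symmetric])
  finally show ?thesis using powr_ge_zero[of c "- (x + y)"] by linarith
 next
  case False
  have "a powr (- x) \<le> c powr (- x)" using False that by (intro powr_mono2') auto
  then have "a powr (- x) * c powr (- y) \<le> c powr (- x) * c powr (- y)" by (intro mult_right_mono) auto
  also have "... = c powr (- (x + y))" by (simp add: powr_add[symmetric])
  finally show ?thesis using powr_ge_zero[of a "- (x + y)"] by linarith
 qed
 have pt: "jap \<eta> powr (- \<alpha>) * jap (\<xi> - \<eta>) powr (- \<alpha>) \<le> 2 * 2 powr (\<alpha> - k) * jap \<xi> powr (- (\<alpha> - k)) * (jap \<eta> powr (- (\<alpha> + k)) + jap (\<xi> - \<eta>) powr (- (\<alpha> + k)))" for \<xi> \<eta>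
 proof -
  let ?a = "jap \<eta>" and ?c = "jap (\<xi> - \<eta>)" and ?e = "\<alpha> - k"
  have "?a powr (- \<alpha>) * ?c powr (- \<alpha>) = (?a powr (- ?e) * ?c powr (- ?e)) * (?a powr (- k) * ?c powr (- k))"
   by (simp add: powr_add[symmetric] mult_ac)
  also have "... \<le> (2 powr ?e * jap \<xi> powr (- ?e) * (?a powr (- ?e) + ?c powr (- ?e))) * (?a powr (- k) * ?c powr (- k))"
   using assms jap_diff_max[of \<xi> \<eta>] by (intro mult_right_mono powr_split_max) auto
  also have "... = 2 powr ?e * jap \<xi> powr (- ?e) * ((?a powr (- ?e) * ?a powr (- k)) * ?c powr (- k) + ?a powr (- k) * (?c powr (- ?e) * ?c powr (- k)))"
   by (simp add: algebra_simps)
  also have "... = 2 powr ?e * jap \<xi> powr (- ?e) * (?a powr (- \<alpha>) * ?c powr (- k) + ?a powr (- k) * ?c powr (- \<alpha>))"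
   by (simp add: powr_add[symmetric])
  also have "... \<le> 2 powr ?e * jap \<xi> powr (- ?e) * (2 * (?a powr (- (\<alpha> + k)) + ?c powr (- (\<alpha> + k))))"
   using mix[of ?a ?c \<alpha> k] mix[of ?a ?c k \<alpha>] assms by (intro mult_left_mono) (auto simp: add.commute)
  finally show ?thesis by (simp add: algebra_simps)
 qed
 have "(\<L> \<eta>. ennreal (jap \<eta> powr (- \<alpha>) * jap (\<xi> - \<eta>) powr (- \<alpha>))) \<le> ennreal (C * jap \<xi> powr (- (\<alpha> - k)))" for \<xi>
 proof -
  let ?K = "2 * 2 powr (\<alpha> - k) * jap \<xi> powr (- (\<alpha> - k))"
  let ?g = "\<lambda>\<eta>. ennreal (jap \<eta> powr (- (\<alpha> + k)))"
  have "(\<L> \<eta>. ennreal (jap \<eta> powr (- \<alpha>) * jap (\<xi> - \<eta>) powr (- \<alpha>)))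
   \<le> (\<L> \<eta>. ennreal ?K * (?g \<eta> + ?g (\<xi> - \<eta>)))"
   using pt by (intro nn_integral_mono) (simp flip: ennreal_mult ennreal_plus)
  also have "... = ennreal ?K * (\<L> \<eta>. ?g \<eta> + ?g (\<xi> - \<eta>))"
   by (rule nn_integral_cmult) measurable
  also have "(\<L> \<eta>. ?g \<eta> + ?g (\<xi> - \<eta>)) = I + I"
   using nn_integral_lborel_reflect[of ?g \<xi>]
   by (subst nn_integral_add) (simp_all add: I_def)
  also have "ennreal ?K * (I + I) = ennreal (C * jap \<xi> powr (- (\<alpha> - k)))"
   by (subst (1 2) I) (simp add: C_def mult_ac flip: ennreal_mult ennreal_plus)
  finally show ?thesis .
 qed
 then show ?thesis by (intro exI[of _ C]) (auto simp: C_def)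
qed

text \<open>The volume of the shells costs one power of each radius and returns one power of
  \<open>jap \<xi>\<close>. Extracting \<open>\<alpha> - 1\<close> powers of
  \<open>jap \<xi>\<close> from the larger radius therefore restores the full decay
  \<open>\<alpha>\<close> in the output, with one radius left to decay of order
  \<open>\<alpha> - 1\<close>.\<close>

lemma wave_weight_pointwise:
 assumes "1 \<le> \<alpha>" "0 \<le> \<rho>" "0 \<le> y" "norm \<xi> \<le> \<rho> + y"
 shows "japr \<rho> powr (- \<alpha>) * japr y powr (- \<alpha>) * ((1 + \<rho>) * (1 + y) / jap \<xi>)
  \<le> 4 * 2 powr (\<alpha> - 1) * jap \<xi> powr (- \<alpha>) * (japr \<rho> powr (- (\<alpha> - 1)) + japr y powr (- (\<alpha> - 1)))"
proof -
 let ?a = "japr \<rho>" and ?c = "japr y" and ?e = "\<alpha> - 1"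
 have *: "x powr (- \<alpha>) * x = x powr (- ?e)" if "0 < x" for x :: real
  using that by (simp add: powr_diff powr_minus field_simps)
 have z: "jap \<xi> \<le> 2 * max ?a ?c"
 proof -
  have "jap \<xi> \<le> japr (\<rho> + y)" unfolding jap_japr using assms by (intro japr_mono) auto
  then show ?thesis using japr_add_max[of \<rho> y] by linarith
 qed
 have "?a powr (- \<alpha>) * ?c powr (- \<alpha>) * ((1 + \<rho>) * (1 + y) / jap \<xi>)
  \<le> ?a powr (- \<alpha>) * ?c powr (- \<alpha>) * ((2 * ?a) * (2 * ?c) / jap \<xi>)"
  using assms japr_ge_half by (intro mult_left_mono divide_right_mono mult_mono) (auto intro: less_imp_le)
 also have "... = 4 * ((?a powr (- \<alpha>) * ?a) * (?c powr (- \<alpha>) * ?c)) / jap \<xi>" by simp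
 also have "... = 4 * (?a powr (- ?e) * ?c powr (- ?e)) / jap \<xi>" by (simp only: * japr_pos)
 also have "... \<le> 4 * (2 powr ?e * jap \<xi> powr (- ?e) * (?a powr (- ?e) + ?c powr (- ?e))) / jap \<xi>"
  using assms z by (intro divide_right_mono mult_left_mono powr_split_max) (auto intro: less_imp_le)
 also have "... = 4 * 2 powr ?e * (jap \<xi> powr (- ?e) / jap \<xi>) * (?a powr (- ?e) + ?c powr (- ?e))" by simp
 also have "jap \<xi> powr (- ?e) / jap \<xi> = jap \<xi> powr (- \<alpha>)"
  by (simp add: powr_diff powr_minus field_simps)
 finally show ?thesis .
qed

lemma wave_bracket_slow:
 assumes "0 \<le> u" "u \<le> 1" "0 \<le> v" "v \<le> 1" "0 \<le> \<beta>" "\<bar>sg1\<bar> = 1" "\<bar>sg2\<bar> = 1"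
 shows "japr (\<tau> + sg1 * \<rho> + sg2 * y) powr (- \<beta>) \<le> 8 powr \<beta> * japr (\<tau> + sg1 * (\<rho> + u) + sg2 * (y + v)) powr (- \<beta>)"
proof -
 have "\<bar>sg1 * u + sg2 * v\<bar> \<le> \<bar>sg1 * u\<bar> + \<bar>sg2 * v\<bar>" by linarith
 also have "... \<le> 2" using assms by (simp add: abs_mult)
 finally have "\<bar>sg1 * u + sg2 * v\<bar> \<le> 2" .
 from japr_shift_powr[OF this assms(5), of "\<tau> + sg1 * \<rho> + sg2 * y"]
 show ?thesis by (simp add: algebra_simps)
qed

text \<open>Here \<alpha> > 2 enters as integrability of the power \<alpha> - 1 in one radius, while
  \<beta> > 1 makes the bracket integrable in the other. The argument does not distinguish the
  signs, which is why no null structure is asked of the product.\<close>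

lemma wave_interaction_le:
 assumes "2 < \<alpha>" "1 < \<beta>" "\<bar>sg1\<bar> = 1" "\<bar>sg2\<bar> = 1"
 shows "\<exists>C\<ge>0. \<forall>\<xi> \<tau>. (\<L> \<eta>. ennreal (jap \<eta> powr (- \<alpha>) * jap (\<xi> - \<eta>) powr (- \<alpha>) *
  japr (\<tau> + sg1 * norm \<eta> + sg2 * norm (\<xi> - \<eta>)) powr (- \<beta>))) \<le> ennreal (C * jap \<xi> powr (- \<alpha>))"
proof -
 define J where "J = enn2real (Jint (\<alpha> - 1)) * enn2real (Jint \<beta>)"
 have J: "Jint (\<alpha> - 1) * Jint \<beta> = ennreal J"
  using Jint_finite[of "\<alpha> - 1"] Jint_finite[of \<beta>] assms by (simp add: J_def ennreal_mult)
 define K where "K = 8 powr \<alpha> * 8 powr \<alpha> * 8 powr \<beta>"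
 define D where "D = 24 * pi * (4 * 2 powr (\<alpha> - 1))"
 have pos: "0 \<le> J" "0 \<le> K" "0 \<le> D" by (auto simp: J_def K_def D_def)
 have "(\<L> \<eta>. ennreal (jap \<eta> powr (- \<alpha>) * jap (\<xi> - \<eta>) powr (- \<alpha>) *
  japr (\<tau> + sg1 * norm \<eta> + sg2 * norm (\<xi> - \<eta>)) powr (- \<beta>))) \<le> ennreal (K * (D * (2 * J)) * jap \<xi> powr (- \<alpha>))" for \<xi> \<tau>
 proof -
  let ?b = "\<lambda>q. japr (\<tau> + sg1 * fst q + sg2 * snd q) powr (- \<beta>)"
  let ?f = "\<lambda>q. japr (fst q) powr (- \<alpha>) * japr (snd q) powr (- \<alpha>) * ?b q"
  let ?g = "\<lambda>q. (japr (fst q) powr (- (\<alpha> - 1)) + japr (snd q) powr (- (\<alpha> - 1))) * ?b q"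
  have "(\<L> \<eta>. ennreal (jap \<eta> powr (- \<alpha>) * jap (\<xi> - \<eta>) powr (- \<alpha>) *
   japr (\<tau> + sg1 * norm \<eta> + sg2 * norm (\<xi> - \<eta>)) powr (- \<beta>)))
   = (\<L> \<eta>. ennreal (?f (norm \<eta>, norm (\<xi> - \<eta>))))"
   by (simp add: jap_japr)
  also have "... \<le> ennreal K * (\<L> q. ennreal (?f q) * emeasure lborel (shells \<xi> q))"
  proof (rule nn_integral_two_radii_le)
   fix \<rho> y u v :: real
   assume uv: "0 \<le> u" "u \<le> 1" "0 \<le> v" "v \<le> 1"
   have "?f (\<rho>, y) \<le> (8 powr \<alpha> * japr (\<rho> + u) powr (- \<alpha>)) * (8 powr \<alpha> * japr (y + v) powr (- \<alpha>))
     * (8 powr \<beta> * japr (\<tau> + sg1 * (\<rho> + u) + sg2 * (y + v)) powr (- \<beta>))"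
    using uv assms wave_bracket_slow[of u v \<beta> sg1 sg2 \<tau> \<rho> y] japr_shift_powr[of u \<alpha> \<rho>] japr_shift_powr[of v \<alpha> y]
    by (simp only: fst_conv snd_conv) (intro mult_mono; simp)
   then show "?f (\<rho>, y) \<le> K * ?f (\<rho> + u, y + v)" by (simp add: K_def mult_ac)
  qed (use pos in auto)
  also have "... \<le> ennreal K * (\<L> q. ennreal (D * jap \<xi> powr (- \<alpha>)) * ennreal (?g q))"
  proof (intro mult_left_mono nn_integral_mono)
   fix q :: "real \<times> real"
   obtain \<rho> y where q: "q = (\<rho>, y)" by (cases q)
   show "ennreal (?f q) * emeasure lborel (shells \<xi> q) \<le> ennreal (D * jap \<xi> powr (- \<alpha>)) * ennreal (?g q)"
   proof (cases "shells \<xi> q = {}")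
    case False
    note ne = shells_nonempty[OF False[unfolded q]]
    have "ennreal (?f q) * emeasure lborel (shells \<xi> q) \<le> ennreal (?f q) * ennreal (24 * pi * (1 + \<rho>) * (1 + y) / jap \<xi>)"
     using emeasure_shells_le[of \<rho> y \<xi>] ne by (intro mult_left_mono) (auto simp: q)
    also have "... = ennreal (24 * pi * ?b q * (japr \<rho> powr (- \<alpha>) * japr y powr (- \<alpha>) * ((1 + \<rho>) * (1 + y) / jap \<xi>)))"
     using ne by (subst ennreal_mult[symmetric]) (auto simp: q mult_ac less_imp_le)
    also have "... \<le> ennreal (24 * pi * ?b q * (4 * 2 powr (\<alpha> - 1) * jap \<xi> powr (- \<alpha>) * (japr \<rho> powr (- (\<alpha> - 1)) + japr y powr (- (\<alpha> - 1)))))"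
     using wave_weight_pointwise[of \<alpha> \<rho> y \<xi>] assms ne by (intro ennreal_leI mult_left_mono) auto
    also have "... = ennreal (D * jap \<xi> powr (- \<alpha>)) * ennreal (?g q)"
     using pos by (subst ennreal_mult[symmetric]) (auto simp: q D_def mult_ac)
    finally show ?thesis .
   qed simp
  qed auto
  also have "... = ennreal K * (ennreal (D * jap \<xi> powr (- \<alpha>)) * (2 * ennreal J))"
   using nn_integral_radii_bracket[of sg1 sg2 "\<alpha> - 1" \<tau> \<beta>] assms
   by (subst nn_integral_cmult) (simp_all add: J mult.assoc)
  also have "... = ennreal (K * (D * (2 * J)) * jap \<xi> powr (- \<alpha>))"
   using pos by (simp add: mult_ac flip: ennreal_mult ennreal_numeral)
  finally show ?thesis .
 qed
 then show ?thesis using pos by (intro exI[of _ "K * (D * (2 * J))"]) auto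
qed

section \<open>Interaction of two waves\<close>

text \<open>In the coordinates \<open>\<rho>\<close> and \<open>v = y - \<rho>\<close> the argument
  of the bracket moves with \<open>2 * \<rho>\<close>, because the signs are equal; with opposite
  signs it would depend on \<open>v\<close> alone. The integral over \<open>\<rho>\<close> is
  bounded by \<open>Jint \<beta>\<close> and the strip contributes its width.\<close>

lemma nn_integral_diagonal_strip:
 assumes "\<bar>sg\<bar> = 1" "0 \<le> z"
 shows "(\<L> q. indicator {- (2 * z)..2 * z} (snd q - fst q) * ennreal (japr (\<tau> + sg * fst q + sg * snd q) powr (- \<beta>)))
  \<le> ennreal (4 * z) * Jint \<beta>"
proof -
 let ?i = "indicator {- (2 * z)..2 * z} :: real \<Rightarrow> ennreal"
 have "(\<L> q. ?i (snd q - fst q) * ennreal (japr (\<tau> + sg * fst q + sg * snd q) powr (- \<beta>)))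
  = (\<L> \<rho>. (\<L> y. ?i (y - \<rho>) * ennreal (japr (\<tau> + sg * \<rho> + sg * y) powr (- \<beta>))))"
  by (subst nn_integral_lborel_prod(1)) simp_all
 also have "... = (\<L> \<rho>. (\<L> v. ?i v * ennreal (japr (\<tau> + sg * v + sg * (2 * \<rho>)) powr (- \<beta>))))"
 proof (rule nn_integral_cong)
  fix \<rho> :: real
  show "(\<L> y. ?i (y - \<rho>) * ennreal (japr (\<tau> + sg * \<rho> + sg * y) powr (- \<beta>)))
   = (\<L> v. ?i v * ennreal (japr (\<tau> + sg * v + sg * (2 * \<rho>)) powr (- \<beta>)))"
   by (subst nn_integral_lborel_translation[symmetric, where c=\<rho>]) (auto simp: algebra_simps intro!: nn_integral_cong)
 qed
 also have "... = (\<L> v. (\<L> \<rho>. ?i v * ennreal (japr (\<tau> + sg * v + sg * (2 * \<rho>)) powr (- \<beta>))))"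
  by (rule lborel_pair.Fubini') measurable
 also have "... \<le> (\<L> v. Jint \<beta> * ?i v)"
 proof (rule nn_integral_mono)
  fix v :: real
  have "(\<L> \<rho>. ?i v * ennreal (japr (\<tau> + sg * v + sg * (2 * \<rho>)) powr (- \<beta>)))
   = ?i v * (\<L> \<rho>. ennreal (japr (\<tau> + sg * v + sg * (2 * \<rho>)) powr (- \<beta>)))"
   by (rule nn_integral_cmult) measurable
  also have "... \<le> ?i v * Jint \<beta>"
   by (intro mult_left_mono Jint_affine2 assms(1)) simp
  finally show "(\<L> \<rho>. ?i v * ennreal (japr (\<tau> + sg * v + sg * (2 * \<rho>)) powr (- \<beta>))) \<le> Jint \<beta> * ?i v"
   by (simp only: mult.commute)
 qed
 also have "... = ennreal (4 * z) * Jint \<beta>"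
  using assms by (subst nn_integral_cmult_indicator) (simp_all add: mult.commute)
 finally show ?thesis .
qed

text \<open>For equal signs the resonance function can be as large as the sum of the radii, which
  the output frequency does not control. Where the sum is at most of order \<open>jap \<xi>\<close>,
  the extra weight becomes a power of \<open>jap \<xi>\<close>. Elsewhere both radii are large and
  comparable, so both weights contribute their decay; the integral then runs over a diagonal strip
  of width \<open>4 * jap \<xi>\<close>, which pays for the division by \<open>jap \<xi>\<close> in
  the volume of the shells.\<close>

lemma wave_interaction_same_sign_le:
 assumes "2 < \<alpha>" "1 < \<beta>" "\<beta> \<le> k" "k \<le> \<alpha>" "\<bar>sg\<bar> = 1"
 shows "\<exists>C\<ge>0. \<forall>\<xi> \<tau>. (\<L> \<eta>. ennreal (jap \<eta> powr (- \<alpha>) * jap (\<xi> - \<eta>) powr (- \<alpha>) *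
  (japr (norm \<eta> + norm (\<xi> - \<eta>)) powr \<beta> * japr (\<tau> + sg * norm \<eta> + sg * norm (\<xi> - \<eta>)) powr (- \<beta>))))
  \<le> ennreal (C * jap \<xi> powr (- (\<alpha> - k)))"
proof -
 define J where "J = enn2real (Jint (\<alpha> - 1)) * enn2real (Jint \<beta>)"
 define Jb where "Jb = enn2real (Jint \<beta>)"
 have J: "Jint (\<alpha> - 1) * Jint \<beta> = ennreal J" and Jb: "Jint \<beta> = ennreal Jb"
  using Jint_finite[of "\<alpha> - 1"] Jint_finite[of \<beta>] assms by (simp_all add: J_def Jb_def ennreal_mult)
 define K where "K = 8 powr \<alpha> * 8 powr \<alpha> * (8 powr \<beta> * 8 powr \<beta>)"
 define D where "D = 24 * pi * 16 powr \<beta> * (4 * 2 powr (\<alpha> - 1))"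
 define E where "E = 24 * pi * (4 * 16 powr (\<alpha> - 1))"
 have pos: "0 \<le> J" "0 \<le> Jb" "0 \<le> K" "0 \<le> D" "0 \<le> E" by (auto simp: J_def Jb_def K_def D_def E_def)
 have "(\<L> \<eta>. ennreal (jap \<eta> powr (- \<alpha>) * jap (\<xi> - \<eta>) powr (- \<alpha>) *
  (japr (norm \<eta> + norm (\<xi> - \<eta>)) powr \<beta> * japr (\<tau> + sg * norm \<eta> + sg * norm (\<xi> - \<eta>)) powr (- \<beta>))))
  \<le> ennreal (K * (D * (2 * J) + E * (4 * Jb)) * jap \<xi> powr (- (\<alpha> - k)))" for \<xi> \<tau>
 proof -
  let ?z = "jap \<xi>"
  let ?b = "\<lambda>q. japr (\<tau> + sg * fst q + sg * snd q) powr (- \<beta>)"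
  let ?n = "\<lambda>q. japr (fst q + snd q)"
  let ?w = "\<lambda>q. japr (fst q) powr (- \<alpha>) * japr (snd q) powr (- \<alpha>)"
  let ?f = "\<lambda>q. ?w q * (?n q powr \<beta> * ?b q)"
  let ?g = "\<lambda>q. (japr (fst q) powr (- (\<alpha> - 1)) + japr (snd q) powr (- (\<alpha> - 1))) * ?b q"
  let ?i = "\<lambda>q. indicator {- (2 * ?z)..2 * ?z} (snd q - fst q) :: ennreal"
  let ?Z = "?z powr (- (\<alpha> - k))"
  have "(\<L> \<eta>. ennreal (jap \<eta> powr (- \<alpha>) * jap (\<xi> - \<eta>) powr (- \<alpha>) *
  (japr (norm \<eta> + norm (\<xi> - \<eta>)) powr \<beta> * japr (\<tau> + sg * norm \<eta> + sg * norm (\<xi> - \<eta>)) powr (- \<beta>))))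
   = (\<L> \<eta>. ennreal (?f (norm \<eta>, norm (\<xi> - \<eta>))))"
   by (simp add: jap_japr)
  also have "... \<le> ennreal K * (\<L> q. ennreal (?f q) * emeasure lborel (shells \<xi> q))"
  proof (rule nn_integral_two_radii_le)
   fix \<rho> y u v :: real
   assume uv: "0 \<le> u" "u \<le> 1" "0 \<le> v" "v \<le> 1"
   have "japr (\<rho> + y) powr \<beta> \<le> (8 * japr ((\<rho> + u) + (y + v))) powr \<beta>"
    using japr_shift[of "- (u + v)" "(\<rho> + u) + (y + v)"] uv assms
    by (intro powr_mono2) (auto simp: algebra_simps intro: less_imp_le)
   then have n: "japr (\<rho> + y) powr \<beta> \<le> 8 powr \<beta> * japr ((\<rho> + u) + (y + v)) powr \<beta>"
    by (simp add: powr_mult less_imp_le)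
   have "?f (\<rho>, y) \<le> ((8 powr \<alpha> * japr (\<rho> + u) powr (- \<alpha>)) * (8 powr \<alpha> * japr (y + v) powr (- \<alpha>)))
     * ((8 powr \<beta> * japr ((\<rho> + u) + (y + v)) powr \<beta>) * (8 powr \<beta> * japr (\<tau> + sg * (\<rho> + u) + sg * (y + v)) powr (- \<beta>)))"
    using uv assms n wave_bracket_slow[of u v \<beta> sg sg \<tau> \<rho> y] japr_shift_powr[of u \<alpha> \<rho>] japr_shift_powr[of v \<alpha> y]
    by (simp only: fst_conv snd_conv) (intro mult_mono; simp)
   then show "?f (\<rho>, y) \<le> K * ?f (\<rho> + u, y + v)" by (simp add: K_def mult_ac)
  qed (use pos in auto)
  also have "... \<le> ennreal K * (\<L> q. ennreal (D * ?Z) * ennreal (?g q) + ennreal (E * ?Z / ?z) * (?i q * ennreal (?b q)))"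
  proof (intro mult_left_mono nn_integral_mono)
   fix q :: "real \<times> real"
   obtain \<rho> y where q: "q = (\<rho>, y)" by (cases q)
   show "ennreal (?f q) * emeasure lborel (shells \<xi> q) \<le> ennreal (D * ?Z) * ennreal (?g q) + ennreal (E * ?Z / ?z) * (?i q * ennreal (?b q))"
   proof (cases "shells \<xi> q = {}")
    case False
    note ne = shells_nonempty[OF False[unfolded q]]
    let ?m = "(1 + \<rho>) * (1 + y) / ?z"
    have le: "ennreal (?f q) * emeasure lborel (shells \<xi> q) \<le> ennreal (24 * pi * (?w q * ?m) * (?n q powr \<beta> * ?b q))"
    proof -
     have "ennreal (?f q) * emeasure lborel (shells \<xi> q) \<le> ennreal (?f q) * ennreal (24 * pi * (1 + \<rho>) * (1 + y) / ?z)"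
      using emeasure_shells_le[of \<rho> y \<xi>] ne by (intro mult_left_mono) (auto simp: q)
     also have "... = ennreal (24 * pi * (?w q * ?m) * (?n q powr \<beta> * ?b q))"
      using ne by (subst ennreal_mult[symmetric]) (auto simp: q mult_ac less_imp_le)
     finally show ?thesis .
    qed
    show ?thesis
    proof (cases "?n q \<le> 16 * ?z")
     case True
     have "?n q powr \<beta> \<le> (16 * ?z) powr \<beta>" using True assms by (intro powr_mono2) (auto intro: less_imp_le)
     also have "... = 16 powr \<beta> * ?z powr \<beta>" by (simp add: powr_mult less_imp_le)
     also have "... \<le> 16 powr \<beta> * ?z powr k" using assms by (intro mult_left_mono powr_mono) auto
     finally have n: "?n q powr \<beta> \<le> 16 powr \<beta> * ?z powr k" .
     have "24 * pi * (?w q * ?m) * (?n q powr \<beta> * ?b q)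
      \<le> 24 * pi * (4 * 2 powr (\<alpha> - 1) * ?z powr (- \<alpha>) * (japr \<rho> powr (- (\<alpha> - 1)) + japr y powr (- (\<alpha> - 1)))) * ((16 powr \<beta> * ?z powr k) * ?b q)"
     proof (rule mult_mono)
      have "?w q * ?m \<le> 4 * 2 powr (\<alpha> - 1) * ?z powr (- \<alpha>) * (japr \<rho> powr (- (\<alpha> - 1)) + japr y powr (- (\<alpha> - 1)))"
       using wave_weight_pointwise[of \<alpha> \<rho> y \<xi>] assms ne by (simp add: q)
      then show "24 * pi * (?w q * ?m) \<le> 24 * pi * (4 * 2 powr (\<alpha> - 1) * ?z powr (- \<alpha>) * (japr \<rho> powr (- (\<alpha> - 1)) + japr y powr (- (\<alpha> - 1))))"
       by (rule mult_left_mono) simp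
      show "?n q powr \<beta> * ?b q \<le> (16 powr \<beta> * ?z powr k) * ?b q"
       using n by (rule mult_right_mono) simp
     qed auto
     also have "... = D * (?z powr (- \<alpha>) * ?z powr k) * ?g q" by (simp add: D_def q mult_ac)
     also have "?z powr (- \<alpha>) * ?z powr k = ?Z" by (simp add: powr_add[symmetric])
     finally have "ennreal (?f q) * emeasure lborel (shells \<xi> q) \<le> ennreal (D * ?Z * ?g q)"
      using le by (meson ennreal_leI order_trans)
     also have "... = ennreal (D * ?Z) * ennreal (?g q)" using pos by (intro ennreal_mult) auto
     finally show ?thesis by (rule order_trans) simp
    next
     case False
     let ?N = "?n q"
     have N: "16 * ?z < ?N" "?N \<le> 1 + \<rho> + y" using False japr_le[of "\<rho> + y"] ne by (auto simp: q)
     have z1: "1 \<le> ?z" "norm \<xi> \<le> ?z" by (simp_all add: norm_le_jap)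
     have strip: "\<bar>\<rho> - y\<bar> \<le> 2 * ?z" using ne z1 by linarith
     \<comment> \<open>The difference of the radii is at most \<open>norm \<xi> + 1\<close>, far
       less than their sum, so each radius is comparable to the sum.\<close>
     have big: "?N / 4 \<le> \<rho>" "?N / 4 \<le> y" using N z1 ne by linarith+
     have zN: "?z \<le> ?N" using N z1 by linarith
     have half: "japr t powr (- \<alpha>) * (1 + t) \<le> 2 * (?N / 4) powr (- (\<alpha> - 1))" if "?N / 4 \<le> t" for t
     proof -
      have t: "0 \<le> t" using that N z1 by linarith
      have "japr t powr (- \<alpha>) * (1 + t) \<le> japr t powr (- \<alpha>) * (2 * japr t)"
       using t by (intro mult_left_mono japr_ge_half) auto
      also have "... = 2 * japr t powr (- (\<alpha> - 1))"
       by (simp add: powr_diff powr_minus field_simps)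
      also have "... \<le> 2 * (?N / 4) powr (- (\<alpha> - 1))"
       using assms that abs_le_japr[of t] N z1 by (intro mult_left_mono powr_mono2') auto
      finally show ?thesis .
     qed
     have "?w q * ?m = (japr \<rho> powr (- \<alpha>) * (1 + \<rho>)) * (japr y powr (- \<alpha>) * (1 + y)) / ?z"
      by (simp add: q)
     also have "... \<le> (2 * (?N / 4) powr (- (\<alpha> - 1))) * (2 * (?N / 4) powr (- (\<alpha> - 1))) / ?z"
      using ne by (intro divide_right_mono mult_mono[OF half half] big) (auto intro: less_imp_le)
     also have "... = 4 * 16 powr (\<alpha> - 1) * ?N powr (- (2 * (\<alpha> - 1))) / ?z"
     proof -
      have "(16 :: real) powr (\<alpha> - 1) = 4 powr (\<alpha> - 1) * 4 powr (\<alpha> - 1)"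
       by (subst powr_mult[symmetric]) auto
      moreover have "?N powr (- (2 * (\<alpha> - 1))) = ?N powr (- (\<alpha> - 1)) * ?N powr (- (\<alpha> - 1))"
       by (simp add: powr_add[symmetric])
      moreover have "(?N / 4) powr (- (\<alpha> - 1)) = 4 powr (\<alpha> - 1) * ?N powr (- (\<alpha> - 1))"
       using powr_divide[of ?N 4 "- (\<alpha> - 1)"] powr_minus_divide[of 4 "\<alpha> - 1"] by simp
      ultimately show ?thesis by simp
     qed
     finally have "24 * pi * (?w q * ?m) * (?N powr \<beta> * ?b q)
      \<le> 24 * pi * (4 * 16 powr (\<alpha> - 1) * ?N powr (- (2 * (\<alpha> - 1))) / ?z) * (?N powr \<beta> * ?b q)"
      by (intro mult_right_mono mult_left_mono) auto
     also have "... = E * (?N powr (- (2 * (\<alpha> - 1))) * ?N powr \<beta>) / ?z * ?b q"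
      by (simp add: E_def)
     also have "?N powr (- (2 * (\<alpha> - 1))) * ?N powr \<beta> = ?N powr (\<beta> - 2 * (\<alpha> - 1))"
      by (simp add: powr_add[symmetric] algebra_simps)
     also have "E * ?N powr (\<beta> - 2 * (\<alpha> - 1)) / ?z * ?b q \<le> E * ?Z / ?z * ?b q"
     proof -
      \<comment> \<open>The exponents compare because \<open>2 < \<alpha>\<close> and
        \<open>\<beta> \<le> k\<close>.\<close>
      have "?N powr (\<beta> - 2 * (\<alpha> - 1)) \<le> ?N powr (- (\<alpha> - k))"
       using assms by (intro powr_mono) auto
      also have "... \<le> ?Z" using assms zN by (intro powr_mono2') auto
      finally show ?thesis using pos by (intro mult_right_mono divide_right_mono mult_left_mono) (auto intro: less_imp_le)
     qed
     finally have "ennreal (?f q) * emeasure lborel (shells \<xi> q) \<le> ennreal (E * ?Z / ?z * ?b q)"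
      using le by (meson ennreal_leI order_trans)
     also have "... = ennreal (E * ?Z / ?z) * (?i q * ennreal (?b q))"
     proof -
      have "y - \<rho> \<in> {- (2 * ?z)..2 * ?z}" using strip by auto
      then have "?i q = 1" by (simp add: q)
      moreover have "ennreal (E * ?Z / ?z * ?b q) = ennreal (E * ?Z / ?z) * ennreal (?b q)"
       using pos by (intro ennreal_mult) (auto intro: less_imp_le)
      ultimately show ?thesis by (simp only: mult_1)
     qed
     finally show ?thesis by (rule order_trans) simp
    qed
   qed simp
  qed auto
  also have "... = ennreal K * (ennreal (D * ?Z) * (2 * ennreal J) + ennreal (E * ?Z / ?z) * (\<L> q. ?i q * ennreal (?b q)))"
   using nn_integral_radii_bracket[of sg sg "\<alpha> - 1" \<tau> \<beta>] assms
   by (subst nn_integral_add) (simp_all add: nn_integral_cmult J mult.assoc)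
  also have "... \<le> ennreal K * (ennreal (D * ?Z) * (2 * ennreal J) + ennreal (E * ?Z / ?z) * (ennreal (4 * ?z) * ennreal Jb))"
   using nn_integral_diagonal_strip[of sg ?z \<tau> \<beta>] assms
   by (intro mult_left_mono add_mono) (auto simp: Jb less_imp_le)
  also have "... = ennreal (K * (D * ?Z * (2 * J) + E * ?Z / ?z * (4 * ?z * Jb)))"
   using pos by (simp add: less_imp_le flip: ennreal_mult ennreal_numeral ennreal_plus)
  also have "K * (D * ?Z * (2 * J) + E * ?Z / ?z * (4 * ?z * Jb)) = K * (D * (2 * J) + E * (4 * Jb)) * ?Z"
   by (simp add: algebra_simps)
  finally show ?thesis .
 qed
 then show ?thesis using pos by (intro exI[of _ "K * (D * (2 * J) + E * (4 * Jb))"]) auto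
qed

section \<open>Space-time weights and their kernel integrals\<close>

definition Xw :: "real \<Rightarrow> real \<Rightarrow> real \<Rightarrow> (real^3) \<times> real \<Rightarrow> real" where
 "Xw sg s b q = jap (fst q) powr s * japr (snd q + sg * norm (fst q)) powr b"

lemma Xw_pos [simp]: "0 < Xw sg s b q"
 by (simp add: Xw_def)

lemma measurable_Xw [measurable]: "Xw sg s b \<in> BM"
 unfolding Xw_def[abs_def] by measurable

lemma Xw_powr: "Xw sg s b q powr a = jap (fst q) powr (s * a) * japr (snd q + sg * norm (fst q)) powr (b * a)"
 by (simp add: Xw_def powr_mult powr_powr)

lemma wave_kernel_integral_le:
 assumes "2 < s * r" "1 < b * r" "\<bar>sg1\<bar> = 1" "\<bar>sg2\<bar> = 1"
 shows "\<exists>C\<ge>0. \<forall>x. (\<L> y. ennreal ((Xw sg1 s b y * Xw sg2 s b (x - y)) powr (- r)))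
  \<le> ennreal (C * Xw sg0 s 0 x powr (- r))"
proof -
 let ?\<alpha> = "s * r" and ?\<beta> = "b * r"
 obtain C where C: "0 \<le> C" and "\<forall>\<xi> \<tau>. (\<L> \<eta>. ennreal (jap \<eta> powr (- ?\<alpha>) * jap (\<xi> - \<eta>) powr (- ?\<alpha>) *
  japr (\<tau> + sg1 * norm \<eta> + sg2 * norm (\<xi> - \<eta>)) powr (- ?\<beta>))) \<le> ennreal (C * jap \<xi> powr (- ?\<alpha>))"
  using wave_interaction_le[OF assms] by blast
 then have C': "(\<L> \<eta>. ennreal (jap \<eta> powr (- ?\<alpha>) * jap (\<xi> - \<eta>) powr (- ?\<alpha>) *
  japr (\<tau> + sg1 * norm \<eta> + sg2 * norm (\<xi> - \<eta>)) powr (- ?\<beta>))) \<le> ennreal (C * jap \<xi> powr (- ?\<alpha>))" for \<xi> \<tau>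
  by blast
 define K where "K = 2 powr (?\<beta> + 1) * enn2real (Jint ?\<beta>)"
 have K: "0 \<le> K" by (simp add: K_def)
 have "(\<L> y. ennreal ((Xw sg1 s b y * Xw sg2 s b (x - y)) powr (- r))) \<le> ennreal (K * C * Xw sg0 s 0 x powr (- r))" for x
 proof -
  obtain \<xi> \<tau> where x: "x = (\<xi>, \<tau>)" by (cases x)
  let ?w = "\<lambda>\<eta>. jap \<eta> powr (- ?\<alpha>) * jap (\<xi> - \<eta>) powr (- ?\<alpha>)"
  have "(\<L> y. ennreal ((Xw sg1 s b y * Xw sg2 s b (x - y)) powr (- r)))
   = (\<L> \<eta>. (\<L> l. ennreal ((Xw sg1 s b (\<eta>, l) * Xw sg2 s b (x - (\<eta>, l))) powr (- r))))"
   by (rule nn_integral_lborel_prod) measurable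
  also have "... = (\<L> \<eta>. (\<L> l. ennreal (?w \<eta>) * ennreal (japr (l + sg1 * norm \<eta>) powr (- ?\<beta>) * japr ((\<tau> + sg2 * norm (\<xi> - \<eta>)) - l) powr (- ?\<beta>))))"
   by (intro nn_integral_cong) (simp add: powr_mult Xw_powr x less_imp_le algebra_simps flip: ennreal_mult)
  also have "... \<le> (\<L> \<eta>. ennreal (?w \<eta>) * ennreal (K * japr (\<tau> + sg1 * norm \<eta> + sg2 * norm (\<xi> - \<eta>)) powr (- ?\<beta>)))"
  proof (rule nn_integral_mono)
   fix \<eta> :: "real^3"
   show "(\<L> l. ennreal (?w \<eta>) * ennreal (japr (l + sg1 * norm \<eta>) powr (- ?\<beta>) * japr ((\<tau> + sg2 * norm (\<xi> - \<eta>)) - l) powr (- ?\<beta>)))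
    \<le> ennreal (?w \<eta>) * ennreal (K * japr (\<tau> + sg1 * norm \<eta> + sg2 * norm (\<xi> - \<eta>)) powr (- ?\<beta>))"
    using nn_integral_two_brackets[OF assms(2), of "sg1 * norm \<eta>" "\<tau> + sg2 * norm (\<xi> - \<eta>)"]
    by (subst nn_integral_cmult) (simp_all add: mult_left_mono K_def add_ac)
  qed
  also have "... = (\<L> \<eta>. ennreal K * ennreal (?w \<eta> * japr (\<tau> + sg1 * norm \<eta> + sg2 * norm (\<xi> - \<eta>)) powr (- ?\<beta>)))"
   using K by (intro nn_integral_cong) (simp add: mult_ac flip: ennreal_mult)
  also have "... = ennreal K * (\<L> \<eta>. ennreal (?w \<eta> * japr (\<tau> + sg1 * norm \<eta> + sg2 * norm (\<xi> - \<eta>)) powr (- ?\<beta>)))"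
   by (rule nn_integral_cmult) measurable
  also have "... \<le> ennreal K * ennreal (C * jap \<xi> powr (- ?\<alpha>))"
   by (intro mult_left_mono C') simp
  also have "... = ennreal (K * C * Xw sg0 s 0 x powr (- r))"
   using K C by (simp add: x Xw_powr mult_ac flip: ennreal_mult)
  finally show ?thesis .
 qed
 then show ?thesis using K C by (intro exI[of _ "K * C"]) auto
qed

text \<open>The modulation weight of the output is distributed to the two factors, up to the resonance
 function: the latter is controlled by the output frequency when the signs differ, and by the
 sum of the input frequencies otherwise.\<close>
lemma japr_modulation_le:
 assumes "0 \<le> \<beta>" "sg0 \<in> {1, -1}" "sg1 \<in> {1, -1}" "sg2 \<in> {1, -1}"
 shows "japr (\<tau> + sg0 * norm \<xi>) powr \<beta> \<le> 2 * 8 powr \<beta> * (japr (l + sg1 * norm \<eta>) powr \<beta> + japr (\<tau> - l + sg2 * norm (\<xi> - \<eta>)) powr \<beta>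
  + (if sg1 = sg2 then japr (norm \<eta> + norm (\<xi> - \<eta>)) else jap \<xi>) powr \<beta>)"
proof -
 let ?P = "l + sg1 * norm \<eta>" and ?Q = "\<tau> - l + sg2 * norm (\<xi> - \<eta>)"
 let ?m = "if sg1 = sg2 then norm \<eta> + norm (\<xi> - \<eta>) else norm \<xi>"
 let ?R = "sg0 * norm \<xi> - sg1 * norm \<eta> - sg2 * norm (\<xi> - \<eta>)"
 have tri: "norm \<xi> \<le> norm \<eta> + norm (\<xi> - \<eta>)" "norm (\<xi> - \<eta>) \<le> norm \<xi> + norm \<eta>" "norm \<eta> \<le> norm \<xi> + norm (\<xi> - \<eta>)"
  by norm+
 have R: "\<bar>?R\<bar> \<le> \<bar>?m + ?m\<bar>"
  using assms(2-4) tri norm_ge_zero[of \<xi>] norm_ge_zero[of \<eta>] norm_ge_zero[of "\<xi> - \<eta>"] by (auto simp: abs_if)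
 have "japr ?R powr \<beta> \<le> japr (?m + ?m) powr \<beta>"
  using japr_mono[OF R] assms by (intro powr_mono2) (auto intro: less_imp_le)
 also have "... \<le> 2 powr \<beta> * (japr ?m powr \<beta> + japr ?m powr \<beta>)"
  by (rule japr_powr_add[OF assms(1)])
 finally have R': "japr ?R powr \<beta> \<le> 2 powr \<beta> * 2 * japr ?m powr \<beta>" by simp
 have "japr (\<tau> + sg0 * norm \<xi>) powr \<beta> = japr (?P + (?Q + ?R)) powr \<beta>" by (simp add: algebra_simps)
 also have "... \<le> 2 powr \<beta> * (japr ?P powr \<beta> + japr (?Q + ?R) powr \<beta>)" by (rule japr_powr_add[OF assms(1)])
 also have "... \<le> 2 powr \<beta> * (japr ?P powr \<beta> + 2 powr \<beta> * (japr ?Q powr \<beta> + 2 powr \<beta> * 2 * japr ?m powr \<beta>))"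
  using japr_powr_add[OF assms(1), of ?Q ?R] R'
  by (intro mult_left_mono add_left_mono) (auto intro: order_trans mult_left_mono)
 also have "... \<le> 2 * 8 powr \<beta> * (japr ?P powr \<beta> + japr ?Q powr \<beta> + japr ?m powr \<beta>)"
 proof -
  define t where "t = (2::real) powr \<beta>"
  have t: "1 \<le> t" using assms(1) by (simp add: t_def ge_one_powr_ge_zero)
  have t3: "8 powr \<beta> = t * (t * t)"
   unfolding t_def by (simp add: powr_mult[symmetric])
  have t1: "t * 1 \<le> t * (t * t)" "t * (t * 1) \<le> t * (t * t)"
   using t mult_mono[of 1 t 1 t] by (intro mult_left_mono; simp)+
  have "t * p \<le> 2 * (t * (t * t)) * p" if "0 \<le> p" for p
   using t1 t that by (intro mult_right_mono) auto
  moreover have "t * (t * p) \<le> 2 * (t * (t * t)) * p" if "0 \<le> p" for p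
  proof -
   have "t * t * p \<le> 2 * (t * (t * t)) * p" using t1 t that by (intro mult_right_mono) auto
   then show ?thesis by (simp add: mult.assoc)
  qed
  ultimately have "t * japr ?P powr \<beta> \<le> 2 * (t * (t * t)) * japr ?P powr \<beta>"
   "t * (t * japr ?Q powr \<beta>) \<le> 2 * (t * (t * t)) * japr ?Q powr \<beta>" by simp_all
  then show ?thesis unfolding t3 t_def[symmetric] by (simp add: algebra_simps)
 qed
 finally show ?thesis by (cases "sg1 = sg2") (simp_all add: jap_japr)
qed

text \<open>Distributing the output modulation gives three terms. In the first two a single bracket
  in the time frequency remains, which integrates to a constant and leaves a purely spatial
  convolution. In the third both brackets remain, together with a power of the resonance function.
  The output exponent \<open>s - 1\<close> instead of \<open>s\<close> pays for that power, since b
  \<le> 1.\<close>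

lemma wave_kernel_integral_modulated_le:
 assumes r: "1 < r" and s: "2 < s * r" "1 \<le> s" and b: "1 < b * r" "b \<le> 1"
  and sg: "sg0 \<in> {1, -1}" "sg1 \<in> {1, -1}" "sg2 \<in> {1, -1}"
 shows "\<exists>C\<ge>0. \<forall>x. (\<L> y. ennreal ((Xw sg1 s b y * Xw sg2 s b (x - y)) powr (- r)))
  \<le> ennreal (C * Xw sg0 (s - 1) b x powr (- r))"
proof -
 let ?\<alpha> = "s * r" and ?\<beta> = "b * r"
 have sg': "\<bar>sg1\<bar> = 1" "\<bar>sg2\<bar> = 1" using sg by auto
 have \<beta>r: "?\<beta> \<le> r" "r \<le> ?\<alpha>" using r s b by simp_all
 let ?w = "\<lambda>\<xi> \<eta>. jap \<eta> powr (- ?\<alpha>) * jap (\<xi> - \<eta>) powr (- ?\<alpha>)"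
 let ?M = "\<lambda>\<xi> \<eta>. (if sg1 = sg2 then japr (norm \<eta> + norm (\<xi> - \<eta>)) else jap \<xi>) powr ?\<beta>"
 let ?B = "\<lambda>\<xi> \<tau> \<eta>. japr (\<tau> + sg1 * norm \<eta> + sg2 * norm (\<xi> - \<eta>)) powr (- ?\<beta>)"
 obtain C1 where C1: "0 \<le> C1" "\<And>\<xi>. (\<L> \<eta>. ennreal (?w \<xi> \<eta>)) \<le> ennreal (C1 * jap \<xi> powr (- (?\<alpha> - r)))"
 proof -
  have "0 \<le> r" "3 < ?\<alpha> + r" using r s by linarith+
  from radial_conv_le[OF this(1) \<beta>r(2) this(2)] show ?thesis using that by blast
 qed
 have "\<exists>C2\<ge>0. \<forall>\<xi> \<tau>. (\<L> \<eta>. ennreal (?w \<xi> \<eta> * (?M \<xi> \<eta> * ?B \<xi> \<tau> \<eta>))) \<le> ennreal (C2 * jap \<xi> powr (- (?\<alpha> - r)))"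
 proof (cases "sg1 = sg2")
  case True
  then show ?thesis
   using wave_interaction_same_sign_le[OF s(1) b(1) \<beta>r sg'(1)] by simp
 next
  case False
  obtain C where C: "0 \<le> C" "\<And>\<xi> \<tau>. (\<L> \<eta>. ennreal (?w \<xi> \<eta> * ?B \<xi> \<tau> \<eta>)) \<le> ennreal (C * jap \<xi> powr (- ?\<alpha>))"
   using wave_interaction_le[OF s(1) b(1) sg'] by blast
  have "(\<L> \<eta>. ennreal (?w \<xi> \<eta> * (?M \<xi> \<eta> * ?B \<xi> \<tau> \<eta>))) \<le> ennreal (C * jap \<xi> powr (- (?\<alpha> - r)))" for \<xi> \<tau>
  proof -
   have "(\<L> \<eta>. ennreal (?w \<xi> \<eta> * (?M \<xi> \<eta> * ?B \<xi> \<tau> \<eta>)))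
    = (\<L> \<eta>. ennreal (jap \<xi> powr ?\<beta>) * ennreal (?w \<xi> \<eta> * ?B \<xi> \<tau> \<eta>))"
    using False by (intro nn_integral_cong) (simp add: mult_ac flip: ennreal_mult)
   also have "... = ennreal (jap \<xi> powr ?\<beta>) * (\<L> \<eta>. ennreal (?w \<xi> \<eta> * ?B \<xi> \<tau> \<eta>))"
    by (rule nn_integral_cmult) measurable
   also have "... \<le> ennreal (jap \<xi> powr r) * ennreal (C * jap \<xi> powr (- ?\<alpha>))"
    using \<beta>r by (intro mult_mono C ennreal_leI powr_mono) auto
   also have "... = ennreal (C * jap \<xi> powr (- (?\<alpha> - r)))"
    using C by (simp add: powr_diff powr_minus field_simps flip: ennreal_mult)
   finally show ?thesis .
  qed
  then show ?thesis using C by blast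
 qed
 then obtain C2 where C2: "0 \<le> C2" "\<And>\<xi> \<tau>. (\<L> \<eta>. ennreal (?w \<xi> \<eta> * (?M \<xi> \<eta> * ?B \<xi> \<tau> \<eta>))) \<le> ennreal (C2 * jap \<xi> powr (- (?\<alpha> - r)))"
  by blast
 define J where "J = enn2real (Jint ?\<beta>)"
 have J: "Jint ?\<beta> = ennreal J" using Jint_finite[of ?\<beta>] b by (simp add: J_def)
 define K where "K = 2 powr (?\<beta> + 1) * J"
 define D where "D = 2 * 8 powr ?\<beta>"
 have pos: "0 \<le> J" "0 \<le> K" "0 \<le> D" by (auto simp: J_def K_def D_def)
 have "(\<L> y. ennreal ((Xw sg1 s b y * Xw sg2 s b (x - y)) powr (- r)))
  \<le> ennreal (D * (2 * J * C1 + K * C2) * Xw sg0 (s - 1) b x powr (- r))" for x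
 proof -
  obtain \<xi> \<tau> where x: "x = (\<xi>, \<tau>)" by (cases x)
  let ?T = "japr (\<tau> + sg0 * norm \<xi>)"
  let ?P = "\<lambda>\<eta> l. japr (l + sg1 * norm \<eta>)" and ?Q = "\<lambda>\<eta> l. japr (\<tau> - l + sg2 * norm (\<xi> - \<eta>))"
  \<comment> \<open>This is the modulation inequality divided by all three brackets.\<close>
  have T: "?P \<eta> l powr (- ?\<beta>) * ?Q \<eta> l powr (- ?\<beta>) \<le> D * ?T powr (- ?\<beta>) *
    (?P \<eta> l powr (- ?\<beta>) + ?Q \<eta> l powr (- ?\<beta>) + ?M \<xi> \<eta> * (?P \<eta> l powr (- ?\<beta>) * ?Q \<eta> l powr (- ?\<beta>)))" for \<eta> l
  proof -
   define p where "p = ?P \<eta> l powr ?\<beta>"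
   define q where "q = ?Q \<eta> l powr ?\<beta>"
   define t where "t = ?T powr ?\<beta>"
   define m where "m = ?M \<xi> \<eta>"
   have p: "0 < p" "0 < q" "0 < t" by (simp_all add: p_def q_def t_def)
   have "t \<le> D * (p + q + m)"
    unfolding m_def using japr_modulation_le[of ?\<beta> sg0 sg1 sg2 \<tau> \<xi> l \<eta>] sg b by (simp add: p_def q_def t_def D_def)
   then have "t / (t * (p * q)) \<le> D * (p + q + m) / (t * (p * q))"
    using p by (intro divide_right_mono) auto
   then have "inverse p * inverse q \<le> D * inverse t * (inverse p + inverse q + m * (inverse p * inverse q))"
    using p by (simp add: field_simps)
   then show ?thesis unfolding m_def p_def q_def t_def by (simp add: powr_minus)
  qed
  have "(\<L> y. ennreal ((Xw sg1 s b y * Xw sg2 s b (x - y)) powr (- r)))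
   = (\<L> \<eta>. (\<L> l. ennreal ((Xw sg1 s b (\<eta>, l) * Xw sg2 s b (x - (\<eta>, l))) powr (- r))))"
   by (rule nn_integral_lborel_prod) measurable
  also have "... = (\<L> \<eta>. (\<L> l. ennreal (?w \<xi> \<eta>) * ennreal (?P \<eta> l powr (- ?\<beta>) * ?Q \<eta> l powr (- ?\<beta>))))"
   by (intro nn_integral_cong) (simp add: powr_mult Xw_powr x less_imp_le algebra_simps flip: ennreal_mult)
  also have "... \<le> (\<L> \<eta>. ennreal (D * ?T powr (- ?\<beta>) * (2 * J)) * ennreal (?w \<xi> \<eta>) + ennreal (D * ?T powr (- ?\<beta>) * K) * ennreal (?w \<xi> \<eta> * (?M \<xi> \<eta> * ?B \<xi> \<tau> \<eta>)))"
  proof (rule nn_integral_mono)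
   fix \<eta> :: "real^3"
   let ?DT = "D * ?T powr (- ?\<beta>)"
   let ?p = "\<lambda>l. ?P \<eta> l powr (- ?\<beta>)" and ?q = "\<lambda>l. ?Q \<eta> l powr (- ?\<beta>)"
   have "(\<L> l. ennreal (?p l * ?q l))
    \<le> (\<L> l. ennreal ?DT * (ennreal (?p l) + ennreal (?q l) + ennreal (?M \<xi> \<eta>) * ennreal (?p l * ?q l)))"
    using T pos by (intro nn_integral_mono) (simp flip: ennreal_mult ennreal_plus)
   also have "... = ennreal ?DT * ((\<L> l. ennreal (?p l)) + (\<L> l. ennreal (?q l)) + ennreal (?M \<xi> \<eta>) * (\<L> l. ennreal (?p l * ?q l)))"
    by (simp add: nn_integral_cmult nn_integral_add)
   also have "(\<L> l. ennreal (?p l)) = ennreal J"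
    using Jint_affine[of 1 "sg1 * norm \<eta>" ?\<beta>] by (simp add: J add.commute)
   also have "(\<L> l. ennreal (?q l)) = ennreal J"
    using Jint_affine[of "-1" "\<tau> + sg2 * norm (\<xi> - \<eta>)" ?\<beta>] by (simp add: J algebra_simps)
   also have "(\<L> l. ennreal (?p l * ?q l)) \<le> ennreal (K * ?B \<xi> \<tau> \<eta>)"
    using nn_integral_two_brackets[OF b(1), of "sg1 * norm \<eta>" "\<tau> + sg2 * norm (\<xi> - \<eta>)"]
    by (simp add: K_def J_def algebra_simps)
   also have "ennreal ?DT * (ennreal J + ennreal J + ennreal (?M \<xi> \<eta>) * ennreal (K * ?B \<xi> \<tau> \<eta>))
    = ennreal (?DT * (2 * J) + ?DT * K * (?M \<xi> \<eta> * ?B \<xi> \<tau> \<eta>))"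
    using pos by (simp add: algebra_simps flip: ennreal_mult ennreal_plus)
   finally have le: "(\<L> l. ennreal (?p l * ?q l)) \<le> ennreal (?DT * (2 * J) + ?DT * K * (?M \<xi> \<eta> * ?B \<xi> \<tau> \<eta>))"
    by (simp add: mult_left_mono)
   have "(\<L> l. ennreal (?w \<xi> \<eta>) * ennreal (?p l * ?q l)) = ennreal (?w \<xi> \<eta>) * (\<L> l. ennreal (?p l * ?q l))"
    by (rule nn_integral_cmult) measurable
   also have "... \<le> ennreal (?w \<xi> \<eta>) * ennreal (?DT * (2 * J) + ?DT * K * (?M \<xi> \<eta> * ?B \<xi> \<tau> \<eta>))"
    by (intro mult_left_mono le) simp
   also have "... = ennreal (?DT * (2 * J)) * ennreal (?w \<xi> \<eta>) + ennreal (?DT * K) * ennreal (?w \<xi> \<eta> * (?M \<xi> \<eta> * ?B \<xi> \<tau> \<eta>))"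
    using pos by (simp add: algebra_simps flip: ennreal_mult ennreal_plus)
   finally show "(\<L> l. ennreal (?w \<xi> \<eta>) * ennreal (?p l * ?q l))
    \<le> ennreal (?DT * (2 * J)) * ennreal (?w \<xi> \<eta>) + ennreal (?DT * K) * ennreal (?w \<xi> \<eta> * (?M \<xi> \<eta> * ?B \<xi> \<tau> \<eta>))" .
  qed
  also have "... = ennreal (D * ?T powr (- ?\<beta>) * (2 * J)) * (\<L> \<eta>. ennreal (?w \<xi> \<eta>)) + ennreal (D * ?T powr (- ?\<beta>) * K) * (\<L> \<eta>. ennreal (?w \<xi> \<eta> * (?M \<xi> \<eta> * ?B \<xi> \<tau> \<eta>)))"
   by (subst nn_integral_add) (simp_all add: nn_integral_cmult)
  also have "... \<le> ennreal (D * ?T powr (- ?\<beta>) * (2 * J)) * ennreal (C1 * jap \<xi> powr (- (?\<alpha> - r))) + ennreal (D * ?T powr (- ?\<beta>) * K) * ennreal (C2 * jap \<xi> powr (- (?\<alpha> - r)))"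
   by (intro add_mono mult_left_mono C1 C2) auto
  also have "... = ennreal (D * (2 * J * C1 + K * C2) * (jap \<xi> powr (- (?\<alpha> - r)) * ?T powr (- ?\<beta>)))"
   using pos C1(1) C2(1) by (simp add: algebra_simps flip: ennreal_mult ennreal_plus)
  also have "jap \<xi> powr (- (?\<alpha> - r)) * ?T powr (- ?\<beta>) = Xw sg0 (s - 1) b x powr (- r)"
   by (simp add: x Xw_powr algebra_simps)
  finally show ?thesis .
 qed
 then show ?thesis using pos C1(1) C2(1) by (intro exI[of _ "D * (2 * J * C1 + K * C2)"]) auto
qed

section \<open>A band-limited cutoff\<close>

text \<open>Decay of order \<open>n\<close> of the function and, in Lipschitz form, of its
  derivative. In this form the property passes to products and needs no differentiation.\<close>

definition decays :: "real \<Rightarrow> (real \<Rightarrow> real) \<Rightarrow> bool" where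
 "decays n f \<longleftrightarrow> (\<exists>K\<ge>0. (\<forall>x. \<bar>f x\<bar> \<le> K * japr x powr (- n)) \<and>
  (\<forall>x h. \<bar>h\<bar> \<le> 1 \<longrightarrow> \<bar>f (x + h) - f x\<bar> \<le> K * \<bar>h\<bar> * japr x powr (- n)))"

lemma decays_mult:
 assumes "decays n f" "decays m g" "0 \<le> m"
 shows "decays (n + m) (\<lambda>x. f x * g x)"
proof -
 obtain K where K: "0 \<le> K" "\<And>x. \<bar>f x\<bar> \<le> K * japr x powr (- n)"
   "\<And>x h. \<bar>h\<bar> \<le> 1 \<Longrightarrow> \<bar>f (x + h) - f x\<bar> \<le> K * \<bar>h\<bar> * japr x powr (- n)"
  using assms(1) unfolding decays_def by blast
 obtain L where L: "0 \<le> L" "\<And>x. \<bar>g x\<bar> \<le> L * japr x powr (- m)"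
   "\<And>x h. \<bar>h\<bar> \<le> 1 \<Longrightarrow> \<bar>g (x + h) - g x\<bar> \<le> L * \<bar>h\<bar> * japr x powr (- m)"
  using assms(2) unfolding decays_def by blast
 have j: "japr x powr (- (n + m)) = japr x powr (- n) * japr x powr (- m)" for x
  by (simp add: powr_add[symmetric])
 define C where "C = K * L * (1 + 8 powr m)"
 have KL: "K * L \<le> C" "0 \<le> C" using K L by (auto simp: C_def algebra_simps)
 have 1: "\<bar>f x * g x\<bar> \<le> C * japr x powr (- (n + m))" for x
 proof -
  have "\<bar>f x * g x\<bar> \<le> (K * japr x powr (- n)) * (L * japr x powr (- m))"
   unfolding abs_mult using K L by (intro mult_mono) auto
  also have "... = (K * L) * japr x powr (- (n + m))" by (simp only: j mult_ac)
  also have "... \<le> C * japr x powr (- (n + m))" using KL by (intro mult_right_mono) auto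
  finally show ?thesis .
 qed
 have 2: "\<bar>f (x + h) * g (x + h) - f x * g x\<bar> \<le> C * \<bar>h\<bar> * japr x powr (- (n + m))" if h: "\<bar>h\<bar> \<le> 1" for x h
 proof -
  have g: "\<bar>g (x + h)\<bar> \<le> L * (8 powr m * japr x powr (- m))"
  proof -
   have "japr (x + h) powr (- m) \<le> 8 powr m * japr (x + h + (- h)) powr (- m)"
    using h assms(3) by (intro japr_shift_powr) auto
   then have "L * japr (x + h) powr (- m) \<le> L * (8 powr m * japr x powr (- m))"
    using L(1) by (intro mult_left_mono) auto
   with L(2)[of "x + h"] show ?thesis by linarith
  qed
  have "f (x + h) * g (x + h) - f x * g x = (f (x + h) - f x) * g (x + h) + f x * (g (x + h) - g x)"
   by (simp add: algebra_simps)
  then have "\<bar>f (x + h) * g (x + h) - f x * g x\<bar> \<le> \<bar>f (x + h) - f x\<bar> * \<bar>g (x + h)\<bar> + \<bar>f x\<bar> * \<bar>g (x + h) - g x\<bar>"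
   by (metis abs_mult abs_triangle_ineq)
  also have "... \<le> (K * \<bar>h\<bar> * japr x powr (- n)) * (L * (8 powr m * japr x powr (- m))) + (K * japr x powr (- n)) * (L * \<bar>h\<bar> * japr x powr (- m))"
   using K L g h by (intro add_mono mult_mono) auto
  also have "... = C * \<bar>h\<bar> * japr x powr (- (n + m))"
   unfolding j C_def by (simp only: ring_distribs mult_ac mult_1 mult_1_right)
  finally show ?thesis .
 qed
 show ?thesis unfolding decays_def using 1 2 KL by (intro exI[of _ C]) auto
qed

lemma decays_cmult:
 assumes "decays n f"
 shows "decays n (\<lambda>x. c * f x)"
proof -
 obtain K where K: "0 \<le> K" "\<And>x. \<bar>f x\<bar> \<le> K * japr x powr (- n)"
   "\<And>x h. \<bar>h\<bar> \<le> 1 \<Longrightarrow> \<bar>f (x + h) - f x\<bar> \<le> K * \<bar>h\<bar> * japr x powr (- n)"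
  using assms(1) unfolding decays_def by blast
 have "\<bar>c * f x\<bar> \<le> (\<bar>c\<bar> * K) * japr x powr (- n)" for x
  using mult_left_mono[OF K(2)[of x], of "\<bar>c\<bar>"] by (simp add: abs_mult mult.assoc)
 moreover have "\<bar>c * f (x + h) - c * f x\<bar> \<le> (\<bar>c\<bar> * K) * \<bar>h\<bar> * japr x powr (- n)" if "\<bar>h\<bar> \<le> 1" for x h
  using mult_left_mono[OF K(3)[OF that, of x], of "\<bar>c\<bar>"] by (simp add: abs_mult mult.assoc right_diff_distrib[symmetric])
 ultimately show ?thesis unfolding decays_def using K(1) by (intro exI[of _ "\<bar>c\<bar> * K"]) auto
qed

text \<open>\<open>sinc\<close> is half the transform of the indicator function of [-1, 1]; the
  phase \<open>t\<close> makes the identity usable under a further cosine transform.\<close>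

lemma sinc_average:
 "(\<integral>y. indicator {-1..1::real} y * cos ((t + y) * x) \<partial>lborel) = 2 * (cos (t * x) * sinc x)"
proof (cases "x = 0")
 case True
 then show ?thesis by simp
next
 case False
 have "(\<integral>y. cos ((t + y) * x) * indicator {-1..1::real} y \<partial>lborel) = sin ((t + 1) * x) / x - sin ((t + (-1)) * x) / x"
  using False
  by (intro integral_FTC_Icc_real) (auto intro!: derivative_eq_intros continuous_intros)
 also have "... = 2 * (cos (t * x) * sinc x)"
  using False by (simp add: ring_distribs sin_add sin_diff field_simps)
 finally show ?thesis by (simp add: mult.commute)
qed

lemma abs_cos_diff_le: "\<bar>cos x - cos y\<bar> \<le> \<bar>x - y\<bar>" for x y :: real
proof -
 have "\<bar>cos x - cos y\<bar> = 2 * (\<bar>sin ((x + y) / 2)\<bar> * \<bar>sin ((y - x) / 2)\<bar>)"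
  by (simp add: cos_diff_cos abs_mult)
 also have "... \<le> 2 * (1 * \<bar>(y - x) / 2\<bar>)"
  by (intro mult_left_mono mult_mono abs_sin_x_le_abs_x) auto
 finally show ?thesis by simp
qed

lemma abs_sin_diff_le: "\<bar>sin x - sin y\<bar> \<le> \<bar>x - y\<bar>" for x y :: real
proof -
 have "\<bar>sin x - sin y\<bar> = 2 * (\<bar>sin ((x - y) / 2)\<bar> * \<bar>cos ((x + y) / 2)\<bar>)"
  by (simp add: sin_diff_sin abs_mult)
 also have "... \<le> 2 * (\<bar>(x - y) / 2\<bar> * 1)"
  by (intro mult_left_mono mult_mono abs_sin_x_le_abs_x) auto
 finally show ?thesis by simp
qed

lemma abs_sinc_le: "\<bar>sinc x\<bar> \<le> 1"
 using abs_sin_x_le_abs_x[of x] by (cases "x = 0") (auto simp: divide_le_eq)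

lemma integrable_indicator_bounded:
 fixes f :: "real \<Rightarrow> 'a::{banach, second_countable_topology}"
 assumes [measurable]: "f \<in> BM" and "\<And>x. norm (f x) \<le> B"
 shows "integrable lborel (\<lambda>x. indicator {a..b} x *\<^sub>R f x)"
proof (rule Bochner_Integration.integrable_bound)
 show "integrable lborel (\<lambda>x. indicator {a..b} x * B :: real)"
  by (intro integrable_mult_left integrable_real_indicator) (auto simp: emeasure_lborel_Icc_eq)
 show "AE x in lborel. norm (indicator {a..b} x *\<^sub>R f x) \<le> norm (indicator {a..b} x * B :: real)"
  using assms(2) by (auto simp: indicator_def intro!: order_trans[OF assms(2)])
qed measurable

lemma sinc_Lipschitz: "\<bar>sinc x - sinc y\<bar> \<le> \<bar>x - y\<bar>"
proof -
 have int: "integrable lborel (\<lambda>v. indicator {-1..1::real} v * cos (v * z) :: real)" for z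
  using integrable_indicator_bounded[of "\<lambda>v. cos (v * z)" 1 "-1" 1] by simp
 have "2 * (sinc x - sinc y) = (\<integral>v. indicator {-1..1::real} v * cos (v * x) - indicator {-1..1::real} v * cos (v * y) \<partial>lborel)"
  using sinc_average[of 0 x] sinc_average[of 0 y] int by (subst Bochner_Integration.integral_diff) auto
 also have "\<bar>\<dots>\<bar> \<le> (\<integral>v. \<bar>x - y\<bar> * indicator {-1..1::real} v \<partial>lborel)"
 proof (rule order_trans[OF integral_abs_bound Bochner_Integration.integral_mono])
  show "\<bar>indicator {-1..1::real} v * cos (v * x) - indicator {-1..1::real} v * cos (v * y)\<bar> \<le> \<bar>x - y\<bar> * indicator {-1..1::real} v" for v :: real
  proof (cases "v \<in> {-1..1}")
   case True
   have "\<bar>cos (v * x) - cos (v * y)\<bar> \<le> \<bar>v * x - v * y\<bar>" by (rule abs_cos_diff_le)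
   also have "... = \<bar>v\<bar> * \<bar>x - y\<bar>" by (simp add: abs_mult right_diff_distrib[symmetric])
   also have "... \<le> 1 * \<bar>x - y\<bar>" using True by (intro mult_right_mono) auto
   finally show ?thesis using True by simp
  qed simp
 qed (use int in auto)
 also have "... = 2 * \<bar>x - y\<bar>" by simp
 finally have *: "\<bar>2 * (sinc x - sinc y)\<bar> \<le> 2 * \<bar>x - y\<bar>" .
 have "\<bar>2 * d\<bar> \<le> 2 * e \<Longrightarrow> \<bar>d\<bar> \<le> e" for d e :: real by simp
 from this[OF *] show ?thesis .
qed

lemma decays_sinc_scaled:
 assumes "1 \<le> A"
 shows "decays 1 (\<lambda>x. sinc (A * x))"
proof -
 have inv: "c / japr (A * x) \<le> c / japr x" if "0 \<le> c" for c x
 proof -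
  have "\<bar>x\<bar> \<le> \<bar>A * x\<bar>" using assms mult_right_mono[of 1 A "\<bar>x\<bar>"] by (simp add: abs_mult)
  then show ?thesis using that japr_mono[of x "A * x"] by (intro divide_left_mono) auto
 qed
 have 1: "\<bar>sinc x\<bar> \<le> 2 / japr x" for x
 proof -
  have "\<bar>x\<bar> * \<bar>sinc x\<bar> \<le> 1" by (cases "x = 0") auto
  with abs_sinc_le[of x] have "(1 + \<bar>x\<bar>) * \<bar>sinc x\<bar> \<le> 2" by (simp add: algebra_simps)
  moreover have "japr x * \<bar>sinc x\<bar> \<le> (1 + \<bar>x\<bar>) * \<bar>sinc x\<bar>" using japr_le[of x] by (intro mult_right_mono) auto
  ultimately have "japr x * \<bar>sinc x\<bar> \<le> 2" by linarith
  then show ?thesis by (simp add: field_simps)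
 qed
 have 2: "\<bar>sinc (x + h) - sinc x\<bar> \<le> 3 * \<bar>h\<bar> / japr x" for x h
 proof -
  have "\<bar>x\<bar> * \<bar>sinc (x + h) - sinc x\<bar> \<le> 2 * \<bar>h\<bar>"
  proof -
   have id: "y * sinc y = sin y" for y by simp
   \<comment> \<open>The identity \<open>y * sinc y = sin y\<close> converts the factor
     \<open>x\<close> into a difference of sines, up to an error \<open>h\<close>.\<close>
   have "x * (sinc (x + h) - sinc x) = (sin (x + h) - sin x) - h * sinc (x + h)"
    using id[of x] id[of "x + h"] by (simp add: algebra_simps)
   also have "\<bar>\<dots>\<bar> \<le> \<bar>sin (x + h) - sin x\<bar> + \<bar>h\<bar> * \<bar>sinc (x + h)\<bar>"
    by (metis abs_mult abs_triangle_ineq4)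
   also have "... \<le> \<bar>h\<bar> + \<bar>h\<bar> * 1"
    using abs_sin_diff_le[of "x + h" x] by (intro add_mono mult_left_mono abs_sinc_le) auto
   finally show ?thesis by (simp add: abs_mult)
  qed
  with sinc_Lipschitz[of "x + h" x] have "(1 + \<bar>x\<bar>) * \<bar>sinc (x + h) - sinc x\<bar> \<le> 3 * \<bar>h\<bar>" by (simp add: algebra_simps)
  moreover have "japr x * \<bar>sinc (x + h) - sinc x\<bar> \<le> (1 + \<bar>x\<bar>) * \<bar>sinc (x + h) - sinc x\<bar>"
   using japr_le[of x] by (intro mult_right_mono) auto
  ultimately have "japr x * \<bar>sinc (x + h) - sinc x\<bar> \<le> 3 * \<bar>h\<bar>" by linarith
  then show ?thesis by (simp add: field_simps)
 qed
 have "\<bar>sinc (A * x)\<bar> \<le> (3 * A) * japr x powr (- 1)" for x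
 proof -
  have "\<bar>sinc (A * x)\<bar> \<le> 2 / japr x" using 1[of "A * x"] inv[of 2 x] by simp
  also have "... \<le> 3 * A / japr x" using assms by (intro divide_right_mono) (auto intro: less_imp_le)
  finally show ?thesis by (simp add: powr_minus divide_inverse)
 qed
 moreover have "\<bar>sinc (A * (x + h)) - sinc (A * x)\<bar> \<le> (3 * A) * \<bar>h\<bar> * japr x powr (- 1)" for x h
 proof -
  have "A * (x + h) = A * x + A * h" by (simp add: algebra_simps)
  then have "\<bar>sinc (A * (x + h)) - sinc (A * x)\<bar> \<le> 3 * \<bar>A * h\<bar> / japr (A * x)"
   by (simp only: 2)
  also have "... \<le> 3 * \<bar>A * h\<bar> / japr x" by (rule inv) simp
  also have "... = (3 * A) * \<bar>h\<bar> * japr x powr (- 1)"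
   using assms by (simp add: powr_minus divide_inverse abs_mult)
  finally show ?thesis .
 qed
 ultimately show ?thesis
  unfolding decays_def using assms by (intro exI[of _ "3 * A"]) auto
qed

lemma decays_sinc: "decays 1 sinc"
 using decays_sinc_scaled[of 1] by (simp only: mult_1_left order_refl)

text \<open>On the transform side, multiplication by \<open>sinc\<close> is averaging over an
  interval of length 2.\<close>

lemma integral_cos_times_sinc:
 assumes [measurable, simp]: "integrable lborel f"
 shows "(\<integral>x. cos (t * x) * (f x * sinc x) \<partial>lborel) = 1/2 * (\<integral>y. indicator {-1..1::real} y * (\<integral>x. cos ((t + y) * x) * f x \<partial>lborel) \<partial>lborel)"
proof -
 have int: "integrable (lborel \<Otimes>\<^sub>M lborel) (\<lambda>(x, y). indicator {-1..1::real} y * (cos ((t + y) * x) * f x) :: real)"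
 proof (rule lborel_pair.Fubini_integrable)
  show "(\<lambda>(x, y). indicator {-1..1::real} y * (cos ((t + y) * x) * f x)) \<in> borel_measurable (lborel \<Otimes>\<^sub>M lborel)"
   by measurable
  have fin: "integrable lborel (\<lambda>y. indicator {-1..1::real} y * (cos ((t + y) * x) * f x))" for x
  proof -
   have "norm (cos ((t + y) * x) * f x) \<le> \<bar>f x\<bar>" for y
    by (simp add: abs_mult mult_left_le_one_le)
   from integrable_indicator_bounded[where a="-1" and b=1, OF _ this] show ?thesis by simp
  qed
  then show "AE x in lborel. integrable lborel (\<lambda>y. case (x, y) of (x, y) \<Rightarrow> indicator {-1..1::real} y * (cos ((t + y) * x) * f x))"
   by simp
  show "integrable lborel (\<lambda>x. \<integral>y. norm (case (x, y) of (x, y) \<Rightarrow> indicator {-1..1::real} y * (cos ((t + y) * x) * f x)) \<partial>lborel)"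
  proof (rule Bochner_Integration.integrable_bound)
   show "integrable lborel (\<lambda>x. 2 * f x)" by simp
   have "(\<integral>y. \<bar>indicator {-1..1::real} y * (cos ((t + y) * x) * f x)\<bar> \<partial>lborel) \<le> (\<integral>y. \<bar>f x\<bar> * indicator {-1..1::real} y \<partial>lborel)" for x
   proof (rule Bochner_Integration.integral_mono)
    show "integrable lborel (\<lambda>y. \<bar>f x\<bar> * indicator {-1..1::real} y)"
     by (intro integrable_mult_right integrable_real_indicator) (auto simp: emeasure_lborel_Icc_eq)
    show "\<bar>indicator {-1..1::real} y * (cos ((t + y) * x) * f x)\<bar> \<le> \<bar>f x\<bar> * indicator {-1..1::real} y" for y
     by (simp add: indicator_def abs_mult mult_left_le_one_le)
   qed (use fin[of x] in auto)
   then show "AE x in lborel. norm (\<integral>y. norm (case (x, y) of (x, y) \<Rightarrow> indicator {-1..1::real} y * (cos ((t + y) * x) * f x)) \<partial>lborel) \<le> norm (2 * f x)"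
    by (intro AE_I2) (simp add: abs_mult mult.commute)
  qed measurable
 qed
 have "(\<integral>x. cos (t * x) * (f x * sinc x) \<partial>lborel) = (\<integral>x. 1/2 * (\<integral>y. indicator {-1..1::real} y * (cos ((t + y) * x) * f x) \<partial>lborel) \<partial>lborel)"
 proof (rule Bochner_Integration.integral_cong)
  fix x :: real
  have "(\<integral>y. indicator {-1..1::real} y * (cos ((t + y) * x) * f x) \<partial>lborel) = (\<integral>y. (indicator {-1..1::real} y * cos ((t + y) * x)) * f x \<partial>lborel)"
   by (simp add: mult.assoc)
  also have "... = 2 * (cos (t * x) * sinc x) * f x"
   by (subst integral_mult_left_zero) (simp add: sinc_average)
  finally show "cos (t * x) * (f x * sinc x) = 1/2 * (\<integral>y. indicator {-1..1::real} y * (cos ((t + y) * x) * f x) \<partial>lborel)"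
   by simp
 qed simp
 also have "... = 1/2 * (\<integral>x. (\<integral>y. indicator {-1..1::real} y * (cos ((t + y) * x) * f x) \<partial>lborel) \<partial>lborel)"
  by (rule integral_mult_right_zero)
 also have "(\<integral>x. (\<integral>y. indicator {-1..1::real} y * (cos ((t + y) * x) * f x) \<partial>lborel) \<partial>lborel)
  = (\<integral>y. (\<integral>x. indicator {-1..1::real} y * (cos ((t + y) * x) * f x) \<partial>lborel) \<partial>lborel)"
  by (rule lborel_pair.Fubini_integral[symmetric]) (rule int)
 finally show ?thesis by (simp add: integral_mult_right_zero)
qed

lemma integrable_japr_powr:
 assumes "1 < a"
 shows "integrable lborel (\<lambda>x. japr x powr (- a))"
 using Jint_finite[OF assms] by (intro integrableI_nonneg) (auto simp: Jint_def)

lemma decays_integrable: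
 assumes [measurable]: "f \<in> BM" and "decays n f" "1 < n"
 shows "integrable lborel f"
proof -
 obtain K where K: "0 \<le> K" "\<And>x. \<bar>f x\<bar> \<le> K * japr x powr (- n)"
  using assms(2) unfolding decays_def by blast
 show ?thesis
  by (rule Bochner_Integration.integrable_bound[OF integrable_mult_right[OF integrable_japr_powr[OF assms(3)], of K]])
   (use K in \<open>auto simp: abs_mult\<close>)
qed

text \<open>The function \<open>sinc (A * x)\<close> is not absolutely integrable, so its transform
  is reached only through truncations. Since |u| < A, both \<open>A + u\<close> and
  \<open>A - u\<close> are positive and the two sine integrals share their limit.\<close>

lemma integral_cos_sinc_truncated:
 assumes "0 < A" "\<bar>u\<bar> < A" "0 \<le> T"
 shows "(\<integral>x. cos (u * x) * (indicator {-T..T} x * sinc (A * x)) \<partial>lborel) = (Si ((A + u) * T) + Si ((A - u) * T)) / A"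
proof -
 define F where "F = (\<lambda>x. (Si ((A + u) * x) + Si ((A - u) * x)) / (2 * A))"
 have "(\<integral>x. (cos (u * x) * sinc (A * x)) * indicator {-T..T} x \<partial>lborel) = F T - F (- T)"
 proof (rule integral_FTC_Icc_real)
  show "- T \<le> T" using assms by simp
  fix x assume "- T \<le> x" "x \<le> T"
  have "(F has_real_derivative ((A + u) * sinc ((A + u) * x) + (A - u) * sinc ((A - u) * x)) / (2 * A)) (at x)"
  proof -
   have "((\<lambda>x. Si (c * x)) has_real_derivative sinc (c * x) * c) (at x)" for c
    by (rule DERIV_chain2[OF DERIV_Si]) (auto intro!: derivative_eq_intros)
   then have "((\<lambda>x. Si ((A + u) * x) + Si ((A - u) * x)) has_real_derivative
     sinc ((A + u) * x) * (A + u) + sinc ((A - u) * x) * (A - u)) (at x)"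
    by (intro DERIV_add)
   from DERIV_cdivide[OF this, of "2 * A"] show ?thesis
    unfolding F_def by (simp only: mult.commute)
  qed
  also have "((A + u) * sinc ((A + u) * x) + (A - u) * sinc ((A - u) * x)) / (2 * A) = cos (u * x) * sinc (A * x)"
  proof (cases "x = 0")
   case True
   then show ?thesis using assms by simp
  next
   case False
   have "c * sinc (c * x) = sin (c * x) / x" if "0 < c" for c using that False by simp
   from this[of "A + u"] this[of "A - u"] this[of A] assms
   have e: "(A + u) * sinc ((A + u) * x) = sin ((A + u) * x) / x" "(A - u) * sinc ((A - u) * x) = sin ((A - u) * x) / x"
    "A * sinc (A * x) = sin (A * x) / x" by linarith+
   have "cos (u * x) * sinc (A * x) = cos (u * x) * (A * sinc (A * x)) / A" using assms by simp
   then show ?thesis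
    unfolding e using False assms by (simp only:) (simp add: ring_distribs sin_add sin_diff field_simps)
  qed
  finally show "(F has_real_derivative cos (u * x) * sinc (A * x)) (at x)" .
  show "isCont (\<lambda>x. cos (u * x) * sinc (A * x)) x"
   by (intro continuous_intros isCont_o2[OF _ isCont_sinc])
 qed
 moreover have "F (- T) = - F T"
 proof -
  have "Si (c * - T) = - Si (c * T)" if "0 < c" for c
   using Si_neg[of "c * T"] that assms by simp
  from this[of "A + u"] this[of "A - u"] assms show ?thesis
   unfolding F_def by (simp only:) (simp add: field_simps)
 qed
 ultimately show ?thesis
  using assms by (simp add: F_def mult_ac add_divide_distrib)
qed

text \<open>After averaging, the truncated transforms are evaluated at \<open>t + y\<close> with |y|
  \<le> 1, still inside (-A, A); there they converge to \<pi> / A, dominated by the bound for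
  \<open>Si\<close>. The second factor \<open>sinc\<close> makes the left-hand side absolutely
  convergent, so the truncation can be removed there as well.\<close>

lemma integral_cos_sinc_sinc:
 assumes "1 \<le> A" "\<bar>t\<bar> < A - 1"
 shows "(\<integral>x. cos (t * x) * (sinc (A * x) * sinc x) \<partial>lborel) = pi / A"
proof -
 have [measurable]: "(\<lambda>x. sinc (A * x)) \<in> BM"
  by (rule measurable_compose[OF _ borel_measurable_sinc]) simp
 obtain B where B: "\<And>T. \<bar>Si T\<bar> \<le> B" using bounded_Si by blast
 have int: "integrable lborel (\<lambda>x. sinc (A * x) * sinc x)"
 proof (rule decays_integrable)
  show "decays (1 + 1) (\<lambda>x. sinc (A * x) * sinc x)"
   by (intro decays_mult decays_sinc_scaled[OF assms(1)] decays_sinc) simp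
 qed auto
 let ?D = "\<lambda>T u. (Si ((A + u) * T) + Si ((A - u) * T)) / A"
 let ?L = "\<lambda>n::nat. \<integral>x. cos (t * x) * ((indicator {- real n..real n} x * sinc (A * x)) * sinc x) \<partial>lborel"
 have "?L \<longlonglongrightarrow> (\<integral>x. cos (t * x) * (sinc (A * x) * sinc x) \<partial>lborel)"
 proof (rule integral_dominated_convergence[where w="\<lambda>x. \<bar>sinc (A * x) * sinc x\<bar>"])
  show "AE x in lborel. (\<lambda>n. cos (t * x) * ((indicator {- real n..real n} x * sinc (A * x)) * sinc x)) \<longlonglongrightarrow> cos (t * x) * (sinc (A * x) * sinc x)"
  proof (rule AE_I2, rule tendsto_eventually)
   fix x :: real
   show "\<forall>\<^sub>F n in sequentially. cos (t * x) * ((indicator {- real n..real n} x * sinc (A * x)) * sinc x) = cos (t * x) * (sinc (A * x) * sinc x)"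
    using eventually_ge_at_top[of "nat \<lceil>\<bar>x\<bar>\<rceil>"]
   proof eventually_elim
    case (elim n)
    then have "\<bar>x\<bar> \<le> real n" by linarith
    then show ?case by (auto simp: abs_le_iff)
   qed
  qed
  show "AE x in lborel. norm (cos (t * x) * ((indicator {- real n..real n} x * sinc (A * x)) * sinc x)) \<le> \<bar>sinc (A * x) * sinc x\<bar>" for n :: nat
  proof (rule AE_I2)
   fix x :: real
   have "\<bar>c * ((indicator {- real n..real n} x * a) * b)\<bar> \<le> \<bar>a * b\<bar>" if "\<bar>c\<bar> \<le> 1" for a b c :: real
    using that by (auto simp: abs_mult indicator_def mult_left_le_one_le)
   from this[OF abs_cos_le_one]
   show "norm (cos (t * x) * ((indicator {- real n..real n} x * sinc (A * x)) * sinc x)) \<le> \<bar>sinc (A * x) * sinc x\<bar>"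
    by (simp only: real_norm_def)
  qed
 qed (use int in auto)
 moreover have "?L \<longlonglongrightarrow> pi / A"
 proof -
  have eq: "?L = (\<lambda>n. 1/2 * (\<integral>y. indicator {-1..1::real} y * ?D (real n) (t + y) \<partial>lborel))"
  proof
   fix n
   have "?L n = 1/2 * (\<integral>y. indicator {-1..1::real} y * (\<integral>x. cos ((t + y) * x) * (indicator {- real n..real n} x * sinc (A * x)) \<partial>lborel) \<partial>lborel)"
   proof (rule integral_cos_times_sinc)
    have "norm (sinc (A * x)) \<le> 1" for x by (simp only: real_norm_def abs_sinc_le)
    from integrable_indicator_bounded[OF _ this, where a="- real n" and b="real n"]
    show "integrable lborel (\<lambda>x. indicator {- real n..real n} x * sinc (A * x))"
     by (simp only: real_scaleR_def) measurable
   qed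
   also have "(\<integral>y. indicator {-1..1::real} y * (\<integral>x. cos ((t + y) * x) * (indicator {- real n..real n} x * sinc (A * x)) \<partial>lborel) \<partial>lborel)
    = (\<integral>y. indicator {-1..1::real} y * ?D (real n) (t + y) \<partial>lborel)"
   proof (rule Bochner_Integration.integral_cong)
    fix y :: real
    show "indicator {-1..1::real} y * (\<integral>x. cos ((t + y) * x) * (indicator {- real n..real n} x * sinc (A * x)) \<partial>lborel) = indicator {-1..1::real} y * ?D (real n) (t + y)"
    proof (cases "y \<in> {-1..1}")
     case True
     then have "\<bar>t + y\<bar> < A" "0 < A" using assms by auto
     then show ?thesis by (simp only: integral_cos_sinc_truncated of_nat_0_le_iff)
    qed simp
   qed simp
   finally show "?L n = 1/2 * (\<integral>y. indicator {-1..1::real} y * ?D (real n) (t + y) \<partial>lborel)" .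
  qed
  have lim: "(\<lambda>n. \<integral>y. indicator {-1..1::real} y * ?D (real n) (t + y) \<partial>lborel) \<longlonglongrightarrow> (\<integral>y. indicator {-1..1::real} y * (pi / A) \<partial>lborel)"
  proof (rule integral_dominated_convergence[where w="\<lambda>y. indicator {-1..1::real} y * (2 * B / A)"])
   show "integrable lborel (\<lambda>y. indicator {-1..1::real} y * (2 * B / A) :: real)"
    by (intro integrable_mult_left integrable_real_indicator) (auto simp: emeasure_lborel_Icc_eq)
   have si: "(\<lambda>n. Si (c * real n)) \<longlonglongrightarrow> pi / 2" if "0 < c" for c
   proof -
    have "filterlim (\<lambda>n. c * real n) at_top sequentially"
     by (rule filterlim_tendsto_pos_mult_at_top[OF tendsto_const that filterlim_real_sequentially])
    from filterlim_compose[OF Si_at_top this] show ?thesis .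
   qed
   show "AE y in lborel. (\<lambda>n. indicator {-1..1::real} y * ?D (real n) (t + y)) \<longlonglongrightarrow> indicator {-1..1::real} y * (pi / A)"
   proof (rule AE_I2)
    fix y :: real
    show "(\<lambda>n. indicator {-1..1::real} y * ?D (real n) (t + y)) \<longlonglongrightarrow> indicator {-1..1::real} y * (pi / A)"
    proof (cases "y \<in> {-1..1}")
     case True
     then have "0 < A + (t + y)" "0 < A - (t + y)" using assms by auto
     from tendsto_add[OF si[OF this(1)] si[OF this(2)]]
     have "(\<lambda>n. ?D (real n) (t + y)) \<longlonglongrightarrow> (pi / 2 + pi / 2) / A"
      using assms by (intro tendsto_divide tendsto_const) auto
     then show ?thesis using True by simp
    qed simp
   qed
   show "AE y in lborel. norm (indicator {-1..1::real} y * ?D (real n) (t + y)) \<le> indicator {-1..1::real} y * (2 * B / A)" for n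
   proof (rule AE_I2)
    fix y :: real
    have "\<bar>Si ((A + (t + y)) * real n) + Si ((A - (t + y)) * real n)\<bar> \<le> 2 * B"
     using B[of "(A + (t + y)) * real n"] B[of "(A - (t + y)) * real n"] by linarith
    then show "norm (indicator {-1..1::real} y * ?D (real n) (t + y)) \<le> indicator {-1..1::real} y * (2 * B / A)"
     using assms by (cases "y \<in> {-1..1}") (auto intro!: divide_right_mono)
   qed
  qed measurable
  have "1/2 * (\<integral>y. indicator {-1..1::real} y * (pi / A) \<partial>lborel) = pi / A" by simp
  with tendsto_mult_left[OF lim, of "1/2"] show ?thesis unfolding eq by (simp only:)
 qed
 ultimately show ?thesis by (rule LIMSEQ_unique)
qed

text \<open>A function constant for |t| < R keeps its value under averaging over [t - 1, t + 1] as
  long as |t| < R - 1.\<close>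

lemma integral_cos_times_sinc_const:
 assumes "integrable lborel f" "\<And>t. \<bar>t\<bar> < R \<Longrightarrow> (\<integral>x. cos (t * x) * f x \<partial>lborel) = c" "\<bar>t\<bar> < R - 1"
 shows "(\<integral>x. cos (t * x) * (f x * sinc x) \<partial>lborel) = c"
proof -
 have "(\<integral>y. indicator {-1..1::real} y * (\<integral>x. cos ((t + y) * x) * f x \<partial>lborel) \<partial>lborel) = (\<integral>y. indicator {-1..1::real} y * c \<partial>lborel)"
 proof (rule Bochner_Integration.integral_cong)
  fix y :: real
  show "indicator {-1..1::real} y * (\<integral>x. cos ((t + y) * x) * f x \<partial>lborel) = indicator {-1..1::real} y * c"
   using assms(2)[of "t + y"] assms(3) by (cases "y \<in> {-1..1}") auto
 qed simp
 then show ?thesis using integral_cos_times_sinc[OF assms(1), of t] by simp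
qed

text \<open>A multiple of \<open>sin (5 x) sin\<^sup>3 x / x\<^sup>4\<close> works: its transform is the convolution of the indicator
 function of [-5, 5] with three copies of that of [-1, 1], which is constant on [-2, 2].\<close>
lemma cutoff_exists:
 "\<exists>\<psi> :: real \<Rightarrow> real. \<psi> \<in> BM \<and> decays 4 \<psi> \<and>
  (\<forall>t. \<bar>t\<bar> \<le> 1 \<longrightarrow> (\<integral>x. cis (t * x) * complex_of_real (\<psi> x) \<partial>lborel) = 1)"
proof -
 define f1 f2 f3 :: "real \<Rightarrow> real" where "f1 = (\<lambda>x. sinc (5 * x) * sinc x)" and "f2 = (\<lambda>x. f1 x * sinc x)" and "f3 = (\<lambda>x. f2 x * sinc x)"
 have d1: "decays 2 f1" and d2: "decays 3 f2" and d3: "decays 4 f3"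
 proof -
  show d1: "decays 2 f1"
   using decays_mult[OF decays_sinc_scaled[of 5] decays_sinc] by (simp only: f1_def) simp
  show d2: "decays 3 f2"
   using decays_mult[OF d1 decays_sinc] by (simp only: f2_def) simp
  show "decays 4 f3"
   using decays_mult[OF d2 decays_sinc] by (simp only: f3_def) simp
 qed
 have [measurable]: "(\<lambda>x. sinc (5 * x)) \<in> BM"
  by (rule measurable_compose[OF _ borel_measurable_sinc]) simp
 have [measurable]: "f1 \<in> BM" "f2 \<in> BM" "f3 \<in> BM"
  unfolding f3_def f2_def f1_def by measurable
 have i: "integrable lborel f1" "integrable lborel f2" "integrable lborel f3"
  using d1 d2 d3 by (auto intro: decays_integrable)
 \<comment> \<open>The radius on which the transform is constant drops by 1 with each factor
   \<open>sinc\<close>: 4, 3, 2. The starting value 5 in the first factor leaves room for the three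
   of them.\<close>
 have c1: "(\<integral>x. cos (t * x) * f1 x \<partial>lborel) = pi / 5" if "\<bar>t\<bar> < 4" for t
  using integral_cos_sinc_sinc[of 5 t] that by (simp add: f1_def)
 have c2: "(\<integral>x. cos (t * x) * f2 x \<partial>lborel) = pi / 5" if "\<bar>t\<bar> < 3" for t
  unfolding f2_def using that by (intro integral_cos_times_sinc_const[where R=4] i c1) auto
 have c3: "(\<integral>x. cos (t * x) * f3 x \<partial>lborel) = pi / 5" if "\<bar>t\<bar> < 2" for t
  unfolding f3_def using that by (intro integral_cos_times_sinc_const[where R=3] i c2) auto
 define \<psi> where "\<psi> = (\<lambda>x. 5 / pi * f3 x)"
 have [measurable]: "\<psi> \<in> BM" unfolding \<psi>_def by measurable
 have d: "decays 4 \<psi>" unfolding \<psi>_def by (rule decays_cmult[OF d3])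
 then have i: "integrable lborel \<psi>" by (auto intro: decays_integrable)
 have "(\<integral>x. cis (t * x) * complex_of_real (\<psi> x) \<partial>lborel) = 1" if "\<bar>t\<bar> \<le> 1" for t
 proof -
  have ic: "integrable lborel (\<lambda>x. cos (t * x) * \<psi> x)" and isn: "integrable lborel (\<lambda>x. sin (t * x) * \<psi> x)"
   by (rule Bochner_Integration.integrable_bound[OF i]; simp add: abs_mult mult_left_le_one_le)+
  have even: "\<psi> (- x) = \<psi> x" for x
   unfolding \<psi>_def f3_def f2_def f1_def using sinc_neg[of "5 * x"] by simp
  have "(\<integral>x. sin (t * x) * \<psi> x \<partial>lborel) = (\<integral>x. sin (t * - x) * \<psi> (- x) \<partial>lborel)"
   using lborel_integral_real_affine[of "-1" "\<lambda>x. sin (t * x) * \<psi> x" 0] by simp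
  also have "... = - (\<integral>x. sin (t * x) * \<psi> x \<partial>lborel)" by (simp add: even)
  finally have s0: "(\<integral>x. sin (t * x) * \<psi> x \<partial>lborel) = 0" by simp
  have "(\<integral>x. cos (t * x) * \<psi> x \<partial>lborel) = (\<integral>x. 5 / pi * (cos (t * x) * f3 x) \<partial>lborel)"
   by (simp add: \<psi>_def mult_ac)
  also have "... = 1" using c3[of t] that by (subst integral_mult_right_zero) simp
  finally have c0: "(\<integral>x. cos (t * x) * \<psi> x \<partial>lborel) = 1" .
  have "(\<integral>x. cis (t * x) * complex_of_real (\<psi> x) \<partial>lborel)
   = (\<integral>x. complex_of_real (cos (t * x) * \<psi> x) + \<i> * complex_of_real (sin (t * x) * \<psi> x) \<partial>lborel)"
   by (intro Bochner_Integration.integral_cong refl) (simp add: complex_eq_iff)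
  also have "... = complex_of_real (\<integral>x. cos (t * x) * \<psi> x \<partial>lborel) + \<i> * complex_of_real (\<integral>x. sin (t * x) * \<psi> x \<partial>lborel)"
   using ic isn by (subst Bochner_Integration.integral_add) (auto simp: integral_of_real integral_mult_right_zero simp del: of_real_mult)
  finally show ?thesis by (simp add: c0 s0)
 qed
 with d show ?thesis by (intro exI[of _ \<psi>]) auto
qed

section \<open>The Duhamel kernel\<close>

definition bump :: "real \<Rightarrow> real" where
 "bump = (SOME \<psi>. \<psi> \<in> BM \<and> decays 4 \<psi> \<and>
  (\<forall>t. \<bar>t\<bar> \<le> 1 \<longrightarrow> (\<integral>x. cis (t * x) * complex_of_real (\<psi> x) \<partial>lborel) = 1))"

lemma measurable_bump [measurable]: "bump \<in> BM"
 and decays_bump: "decays 4 bump"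
 and bump_transform: "\<bar>t\<bar> \<le> 1 \<Longrightarrow> (\<integral>x. cis (t * x) * complex_of_real (bump x) \<partial>lborel) = 1"
 using someI_ex[OF cutoff_exists] unfolding bump_def by blast+

lemma measurable_cis [measurable]: "f \<in> borel_measurable M \<Longrightarrow> (\<lambda>x. cis (f x)) \<in> borel_measurable M"
 by (rule measurable_compose[OF _ borel_measurable_continuous_onI]) (auto intro!: continuous_intros)

lemma bump_bound:
 obtains K where "0 \<le> K" "\<And>x. \<bar>bump x\<bar> \<le> K * japr x powr (- 4)"
 using decays_bump unfolding decays_def by blast

text \<open>Frequency profile of the time cutoff dilated by \<open>dt\<close>; its transform equals
  1 for |t| \<le> dt.\<close>

definition bump_scaled :: "real \<Rightarrow> real \<Rightarrow> real" where
 "bump_scaled dt x = dt * bump (dt * x)"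

lemma measurable_bump_scaled [measurable]: "bump_scaled dt \<in> BM"
 unfolding bump_scaled_def[abs_def] by measurable

lemma integrable_bump_scaled:
 assumes "0 < dt"
 shows "integrable lborel (bump_scaled dt)"
proof -
 have "integrable lborel bump" using decays_bump by (rule decays_integrable[rotated]) auto
 then show ?thesis
  unfolding bump_scaled_def[abs_def]
  using lborel_integrable_real_affine[of bump dt 0] assms by simp
qed

lemma bump_scaled_transform:
 assumes "0 < dt" "\<bar>t\<bar> \<le> dt"
 shows "(\<integral>x. cis (t * x) * complex_of_real (bump_scaled dt (x - \<mu>)) \<partial>lborel) = cis (t * \<mu>)"
proof -
 have "(\<integral>x. cis (t * x) * complex_of_real (bump_scaled dt (x - \<mu>)) \<partial>lborel)
  = (\<integral>x. cis (t * (\<mu> + x)) * complex_of_real (bump_scaled dt x) \<partial>lborel)"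
  using lborel_integral_real_affine[of 1 "\<lambda>x. cis (t * x) * complex_of_real (bump_scaled dt (x - \<mu>))" \<mu>] by simp
 also have "... = (\<integral>x. cis (t * \<mu>) * (cis (t * x) * complex_of_real (bump_scaled dt x)) \<partial>lborel)"
  by (simp add: ring_distribs mult_ac flip: cis_mult)
 also have "... = cis (t * \<mu>) * (\<integral>x. cis (t * x) * complex_of_real (bump_scaled dt x) \<partial>lborel)"
  by (rule integral_mult_right_zero)
 also have "(\<integral>x. cis (t * x) * complex_of_real (bump_scaled dt x) \<partial>lborel)
   = (\<integral>x. dt *\<^sub>R (cis (t / dt * (0 + dt * x)) * complex_of_real (bump (0 + dt * x))) \<partial>lborel)"
  using assms by (intro Bochner_Integration.integral_cong) (simp_all add: bump_scaled_def scaleR_conv_of_real mult_ac)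
 also have "... = (\<integral>x. cis (t / dt * x) * complex_of_real (bump x) \<partial>lborel)"
  using assms lborel_integral_real_affine[of dt "\<lambda>x. cis (t / dt * x) * complex_of_real (bump x)" 0] by simp
 also have "... = 1" using assms by (intro bump_transform) (simp add: abs_divide)
 finally show ?thesis by simp
qed

text \<open>For |t| \<le> dt its transform in \<open>l\<close> is (exp(i t m) - 1) / (i m), the
  integral of exp(i t' m) over [0, t]. It is thus the frequency form of integration in time,
  followed by a cutoff. At \<open>m = 0\<close> the quotient is 0 by convention, which affects a
  null set only.\<close>

definition kern :: "real \<Rightarrow> real \<Rightarrow> real \<Rightarrow> complex" where
 "kern dt l m = complex_of_real (bump_scaled dt (l - m) - bump_scaled dt l) / (\<i> * complex_of_real m)"

lemma measurable_kern [measurable]: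
 assumes [measurable]: "f \<in> borel_measurable M" "g \<in> borel_measurable M"
 shows "(\<lambda>x. kern dt (f x) (g x)) \<in> borel_measurable M"
 unfolding kern_def by measurable

lemma kern_transform:
 assumes "0 < dt" "\<bar>t\<bar> \<le> dt"
 shows "(\<integral>l. cis (t * l) * kern dt l m \<partial>lborel) = (cis (t * m) - 1) / (\<i> * complex_of_real m)"
proof -
 have i: "integrable lborel (\<lambda>l. cis (t * l) * complex_of_real (bump_scaled dt (l - m)))" for m
 proof -
  have "integrable lborel (\<lambda>l. bump_scaled dt (l - m))"
   using lborel_integrable_real_affine[OF integrable_bump_scaled[OF assms(1)], of 1 "- m"] by simp
  then show ?thesis
   by (rule Bochner_Integration.integrable_bound) (auto simp: norm_mult)
 qed
 have "(\<integral>l. cis (t * l) * kern dt l m \<partial>lborel)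
  = (\<integral>l. (cis (t * l) * complex_of_real (bump_scaled dt (l - m)) - cis (t * l) * complex_of_real (bump_scaled dt (l - 0))) / (\<i> * complex_of_real m) \<partial>lborel)"
  by (intro Bochner_Integration.integral_cong) (simp_all add: kern_def right_diff_distrib diff_divide_distrib)
 also have "... = (cis (t * m) - cis (t * 0)) / (\<i> * complex_of_real m)"
  by (subst integral_divide_zero, subst Bochner_Integration.integral_diff[OF i i])
   (simp_all only: bump_scaled_transform[OF assms])
 finally show ?thesis by simp
qed

text \<open>If |dt * m| \<le> 1, the division by \<open>m\<close> is compensated by the Lipschitz
  bound of \<open>bump\<close>; otherwise both terms decay separately and the division supplies the
  factor \<open>japr (dt * m) powr (- 1)\<close>. One factor \<open>dt\<close> comes from the
  scaling of \<open>bump\<close>, the other from writing 1 / m as dt / (dt * m).\<close>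

lemma kern_le:
 "\<exists>C\<ge>0. \<forall>dt l m. 0 < dt \<longrightarrow> cmod (kern dt l m) \<le> C * dt\<^sup>2 * (japr (dt * m) powr (- 1) *
  (japr (dt * (l - m)) powr (- 4) + japr (dt * l) powr (- 4)))"
proof -
 obtain K where K: "0 \<le> K" "\<And>x. \<bar>bump x\<bar> \<le> K * japr x powr (- 4)"
   "\<And>x h. \<bar>h\<bar> \<le> 1 \<Longrightarrow> \<bar>bump (x + h) - bump x\<bar> \<le> K * \<bar>h\<bar> * japr x powr (- 4)"
  using decays_bump unfolding decays_def by blast
 have 1: "\<bar>bump (x - m) - bump x\<bar> \<le> 2 * K * \<bar>m\<bar> * (japr m powr (- 1) * (japr (x - m) powr (- 4) + japr x powr (- 4)))" for x m
 proof (cases "\<bar>m\<bar> \<le> 1")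
  case True
  have "\<bar>bump (x + (- m)) - bump x\<bar> \<le> K * \<bar>- m\<bar> * japr x powr (- 4)" using True by (intro K) auto
  also have "... \<le> K * \<bar>m\<bar> * (2 * (japr m powr (- 1) * (japr (x - m) powr (- 4) + japr x powr (- 4))))"
  proof -
   have "japr m \<le> 2" using japr_le[of m] True by linarith
   then have "1 \<le> 2 * japr m powr (- 1)" by (simp add: powr_minus field_simps)
   then have "1 * japr x powr (- 4) \<le> (2 * japr m powr (- 1)) * (japr (x - m) powr (- 4) + japr x powr (- 4))"
    by (intro mult_mono) auto
   then show ?thesis using K(1) by (intro mult_mono) (auto simp: mult.assoc)
  qed
  finally show ?thesis by (simp add: mult_ac)
 next
  case False
  have "\<bar>bump (x - m) - bump x\<bar> \<le> K * japr (x - m) powr (- 4) + K * japr x powr (- 4)"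
   using K(2)[of x] K(2)[of "x - m"] by linarith
  also have "... = K * (1 * (japr (x - m) powr (- 4) + japr x powr (- 4)))" by (simp add: algebra_simps)
  also have "... \<le> K * ((2 * \<bar>m\<bar> * japr m powr (- 1)) * (japr (x - m) powr (- 4) + japr x powr (- 4)))"
  proof -
   have "japr m \<le> 2 * \<bar>m\<bar>" using japr_le[of m] False by linarith
   then have "1 \<le> 2 * \<bar>m\<bar> * japr m powr (- 1)" by (simp add: powr_minus field_simps)
   then show ?thesis using K(1) by (intro mult_left_mono mult_right_mono) auto
  qed
  finally show ?thesis by (simp add: mult_ac)
 qed
 have "cmod (kern dt l m) \<le> 2 * K * dt\<^sup>2 * (japr (dt * m) powr (- 1) * (japr (dt * (l - m)) powr (- 4) + japr (dt * l) powr (- 4)))"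
  if "0 < dt" for dt l m
 proof (cases "m = 0")
  case True
  then show ?thesis using K(1) by (simp add: kern_def)
 next
  case False
  let ?R = "japr (dt * m) powr (- 1) * (japr (dt * (l - m)) powr (- 4) + japr (dt * l) powr (- 4))"
  have "cmod (kern dt l m) = dt * \<bar>bump (dt * l - dt * m) - bump (dt * l)\<bar> / \<bar>m\<bar>"
   using that by (simp only: kern_def norm_divide norm_mult norm_of_real norm_ii bump_scaled_def right_diff_distrib[symmetric] abs_mult)
  also have "... \<le> dt * (2 * K * \<bar>dt * m\<bar> * ?R) / \<bar>m\<bar>"
   using that 1[of "dt * l" "dt * m"] by (intro divide_right_mono mult_left_mono) (auto simp: right_diff_distrib)
  also have "... = 2 * K * dt\<^sup>2 * ?R"
   using that False by (simp add: abs_mult power2_eq_square)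
  finally show ?thesis .
 qed
 then show ?thesis using K(1) by (intro exI[of _ "2 * K"]) auto
qed

text \<open>Sum of a convolution kernel and a kernel of rank one. Each carries the single factor
  \<open>dt\<close> that makes its norm on L^p independent of \<open>dt\<close>.\<close>

definition schur :: "real \<Rightarrow> real \<Rightarrow> real \<Rightarrow> real" where
 "schur dt l m = dt * japr (dt * (l - m)) powr (- 2) + dt * (japr (dt * m) powr (- 1) * japr (dt * l) powr (- 2))"

text \<open>The weight \<open>japr l powr b\<close> costs \<open>dt powr (- b)\<close> by rescaling,
  and the kernel has one factor \<open>dt\<close> more than \<open>schur\<close>; together they give
  \<open>dt powr (1 - b)\<close>. In the second estimate the factor \<open>japr m powr (- 1)\<close>
  is fully used: of the 1 + b powers that \<open>japr m\<close> contributes, only b are left as a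
  weight on the input. Decay of order 4 of \<open>bump\<close> is what leaves the exponent -2 after
  spending 1 + b \<le> 2 powers.\<close>

lemma kern_schur:
 "\<exists>C\<ge>0. (\<forall>dt b l m. 0 < dt \<and> dt \<le> 1 \<and> 0 \<le> b \<and> b \<le> 1 \<longrightarrow> japr l powr b * cmod (kern dt l m) \<le> C * dt powr (1 - b) * schur dt l m)
  \<and> (\<forall>b l m. 0 \<le> b \<and> b \<le> 1 \<longrightarrow> japr l powr (1 + b) * cmod (kern 1 l m) \<le> C * (schur 1 l m * japr m powr b))"
proof -
 obtain C where C: "0 \<le> C" and Ck: "\<And>dt l m. 0 < dt \<Longrightarrow> cmod (kern dt l m) \<le> C * dt\<^sup>2 * (japr (dt * m) powr (- 1) *
  (japr (dt * (l - m)) powr (- 4) + japr (dt * l) powr (- 4)))"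
  using kern_le by blast
 have split: "japr x \<le> 2 * japr y * japr (x - y)" for x y
  using japr_add_mult[of y "x - y"] by simp
 have a: "japr l powr b * cmod (kern dt l m) \<le> (4 * C) * dt powr (1 - b) * schur dt l m"
  if dt: "0 < dt" "dt \<le> 1" and b: "0 \<le> b" "b \<le> 1" for dt b l m
 proof -
  let ?l = "japr (dt * l)" and ?m = "japr (dt * m)" and ?d = "japr (dt * (l - m))"
  have l: "japr l powr b \<le> dt powr (- b) * ?l powr b"
  proof -
   have "dt * japr l \<le> ?l"
   proof -
    have "(dt * japr l)\<^sup>2 \<le> ?l\<^sup>2"
     using dt by (simp add: japr_def power_mult_distrib algebra_simps power_le_one)
    then show ?thesis by (rule power2_le_imp_le) simp
   qed
   then have "(dt * japr l) powr b \<le> ?l powr b" using dt b by (intro powr_mono2) auto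
   then show ?thesis using dt by (simp add: powr_mult powr_minus field_simps)
  qed
  have x: "?l powr b * (?m powr (- 1) * (?d powr (- 4) + ?l powr (- 4))) \<le> 2 * (?d powr (- 2) + ?m powr (- 1) * ?l powr (- 2))"
  proof -
   have lb: "?l powr b \<le> ?l" using powr_mono[OF b(2), of ?l] by simp
   have "?l \<le> 2 * ?m * ?d" using split[of "dt * l" "dt * m"] by (simp add: right_diff_distrib)
   then have "?l powr b * (?m powr (- 1) * ?d powr (- 4)) \<le> (2 * ?m * ?d) * (?m powr (- 1) * ?d powr (- 4))"
    using lb by (intro mult_right_mono) auto
   also have "... = 2 * (?d * ?d powr (- 4))" by (simp add: powr_minus field_simps)
   also have "?d * ?d powr (- 4) = ?d powr (- 3)"
    using powr_mult_base[of ?d "- 4"] by simp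
   also have "... \<le> ?d powr (- 2)" by (intro powr_mono) auto
   finally have 1: "?l powr b * (?m powr (- 1) * ?d powr (- 4)) \<le> 2 * ?d powr (- 2)" by simp
   have "?l powr b * ?l powr (- 4) = ?l powr (b - 4)" by (simp add: powr_add[symmetric])
   also have "... \<le> ?l powr (- 2)" using b by (intro powr_mono) auto
   finally have "?m powr (- 1) * (?l powr b * ?l powr (- 4)) \<le> ?m powr (- 1) * ?l powr (- 2)" by (intro mult_left_mono) auto
   moreover have "?l powr b * (?m powr (- 1) * (?d powr (- 4) + ?l powr (- 4)))
     = ?l powr b * (?m powr (- 1) * ?d powr (- 4)) + ?m powr (- 1) * (?l powr b * ?l powr (- 4))"
    by (simp only: ring_distribs mult_ac)
   moreover have "0 \<le> ?m powr (- 1) * ?l powr (- 2)" by simp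
   moreover have "s \<le> 2 * (d + y)" if "a \<le> y" "s = e + a" "0 \<le> y" "e \<le> 2 * d" for a d e s y :: real
    using that by simp
   ultimately show ?thesis using 1 by blast
  qed
  have "japr l powr b * cmod (kern dt l m) \<le> (dt powr (- b) * ?l powr b) * (C * dt\<^sup>2 * (?m powr (- 1) * (?d powr (- 4) + ?l powr (- 4))))"
   using Ck[of dt l m] l dt by (intro mult_mono) auto
  also have "... = (C * dt powr (- b) * dt\<^sup>2) * (?l powr b * (?m powr (- 1) * (?d powr (- 4) + ?l powr (- 4))))"
   by (simp add: mult_ac)
  also have "... \<le> (C * dt powr (- b) * dt\<^sup>2) * (2 * (?d powr (- 2) + ?m powr (- 1) * ?l powr (- 2)))"
   using C dt x by (intro mult_left_mono) auto
  also have "... = 2 * C * (dt powr (- b) * dt) * schur dt l m"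
   by (simp add: schur_def power2_eq_square algebra_simps)
  also have "dt powr (- b) * dt = dt powr (1 - b)" using dt powr_mult_base[of dt "- b"] by (simp add: mult.commute)
  also have "2 * C * dt powr (1 - b) * schur dt l m \<le> (4 * C) * dt powr (1 - b) * schur dt l m"
   using C dt by (intro mult_right_mono) (auto simp: schur_def)
  finally show ?thesis .
 qed
 have b: "japr l powr (1 + b) * cmod (kern 1 l m) \<le> (4 * C) * (schur 1 l m * japr m powr b)"
  if b: "0 \<le> b" "b \<le> 1" for b l m
 proof -
  let ?l = "japr l" and ?m = "japr m" and ?d = "japr (l - m)"
  have "?l powr (1 + b) \<le> (2 * ?m * ?d) powr (1 + b)"
   using split[of l m] b by (intro powr_mono2) auto
  also have "... = 2 powr (1 + b) * ?m powr (1 + b) * ?d powr (1 + b)" by (simp add: powr_mult)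
  also have "... \<le> 4 * ?m powr (1 + b) * ?d powr 2"
  proof -
   have "(2::real) powr (1 + b) \<le> 2 powr 2" using b by (intro powr_mono) auto
   then show ?thesis using b by (intro mult_mono powr_mono) auto
  qed
  finally have "?l powr (1 + b) * (?m powr (- 1) * ?d powr (- 4)) \<le> (4 * ?m powr (1 + b) * ?d powr 2) * (?m powr (- 1) * ?d powr (- 4))"
   by (intro mult_right_mono) auto
  also have "... = 4 * (?m powr (1 + b) * ?m powr (- 1)) * (?d powr 2 * ?d powr (- 4))" by (simp add: mult_ac)
  also have "... = 4 * ?m powr b * ?d powr (- 2)" by (simp only: powr_add[symmetric]) simp
  finally have 1: "?l powr (1 + b) * (?m powr (- 1) * ?d powr (- 4)) \<le> 4 * (?d powr (- 2) * ?m powr b)" by (simp add: mult_ac)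
  have "?l powr (1 + b) * ?l powr (- 4) = ?l powr (b - 3)" by (simp add: powr_add[symmetric])
  also have "... \<le> ?l powr (- 2)" using b by (intro powr_mono) auto
  finally have "?l powr (1 + b) * ?l powr (- 4) \<le> ?l powr (- 2)" .
  from mult_left_mono[OF this, of "?m powr (- 1)"]
  have "?m powr (- 1) * (?l powr (1 + b) * ?l powr (- 4)) \<le> ?m powr (- 1) * ?l powr (- 2) * 1"
   by simp
  also have "... \<le> ?m powr (- 1) * ?l powr (- 2) * (4 * ?m powr b)"
  proof -
   have "1 \<le> ?m powr b" using b by (simp add: ge_one_powr_ge_zero)
   then show ?thesis by (intro mult_left_mono) auto
  qed
  finally have 2: "?l powr (1 + b) * (?m powr (- 1) * ?l powr (- 4)) \<le> 4 * ((?m powr (- 1) * ?l powr (- 2)) * ?m powr b)"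
   by (simp add: mult_ac)
  have "?l powr (1 + b) * cmod (kern 1 l m) \<le> ?l powr (1 + b) * (C * (?m powr (- 1) * (?d powr (- 4) + ?l powr (- 4))))"
   using Ck[of 1 l m] by (intro mult_left_mono) auto
  also have "... = C * (?l powr (1 + b) * (?m powr (- 1) * ?d powr (- 4)) + ?l powr (1 + b) * (?m powr (- 1) * ?l powr (- 4)))"
   by (simp add: algebra_simps)
  also have "... \<le> C * (4 * (?d powr (- 2) * ?m powr b) + 4 * ((?m powr (- 1) * ?l powr (- 2)) * ?m powr b))"
   using C 1 2 by (intro mult_left_mono add_mono) auto
  also have "... = (4 * C) * (schur 1 l m * ?m powr b)" by (simp add: schur_def algebra_simps)
  finally show ?thesis .
 qed
 show ?thesis using a b C by (intro exI[of _ "4 * C"]) auto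
qed

section \<open>Bounds in L^p for the Duhamel kernel\<close>

lemma Jint_scaled:
 assumes "c \<noteq> 0"
 shows "(\<L> x. ennreal (\<bar>c\<bar> * japr (t + c * x) powr (- a))) = Jint a"
 unfolding Jint_def using assms
 by (subst (2) nn_integral_real_affine[where c=c and t=t]) (simp_all add: nn_integral_cmult ennreal_mult)

text \<open>The convolution part is treated as in the Schur test, by Hoelder for k = k^(1/r) k^(1/p)
  and integration in the other variable. The rank-one part needs its \<open>m\<close>-profile, a
  bracket to the power -1, in L^r, which holds because r > 1.\<close>

lemma schur_bound:
 assumes rp: "1 < r" "1 < p" "1 / r + 1 / p = 1"
 shows "\<exists>C\<ge>0. \<forall>dt>0. \<forall>g. g \<in> BM \<longrightarrow> (\<forall>x. 0 \<le> g x) \<longrightarrow>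
  (\<L> l. epow (\<L> m. ennreal (schur dt l m * g m)) p) \<le> ennreal C * (\<L> m. ennreal (g m powr p))"
proof -
 define J2 Jr Jp where "J2 = enn2real (Jint 2)" and "Jr = enn2real (Jint r)" and "Jp = enn2real (Jint (2 * p))"
 have J: "Jint 2 = ennreal J2" "Jint r = ennreal Jr" "Jint (2 * p) = ennreal Jp"
  using Jint_finite[of 2] Jint_finite[of r] Jint_finite[of "2 * p"] rp by (simp_all add: J2_def Jr_def Jp_def)
 have pos: "0 \<le> J2" "0 \<le> Jr" "0 \<le> Jp" by (simp_all add: J2_def Jr_def Jp_def)
 have "(\<L> l. epow (\<L> m. ennreal (schur dt l m * g m)) p)
   \<le> ennreal (2 powr p * (J2 powr (p / r) * J2 + Jr powr (p / r) * Jp)) * (\<L> m. ennreal (g m powr p))"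
  if dt: "0 < dt" and [measurable]: "g \<in> BM" and g: "\<And>x. 0 \<le> g x" for dt g
 proof -
  define k where "k = (\<lambda>l m. dt * japr (dt * (l - m)) powr (- 2))"
  \<comment> \<open>The factor \<open>dt\<close> is split into the powers 1/r and 1/p, so that the
    two profiles of the rank-one part have norms in L^r and L^p independent of
    \<open>dt\<close>.\<close>
  define h where "h = (\<lambda>m. dt powr (1 / r) * japr (dt * m) powr (- 1))"
  define c where "c = (\<lambda>l. dt powr (1 / p) * japr (dt * l) powr (- 2))"
  have [measurable]: "case_prod k \<in> borel_measurable (borel \<Otimes>\<^sub>M borel)" "h \<in> BM" "c \<in> BM"
   unfolding k_def h_def c_def by measurable
  have k1 [measurable]: "k l \<in> BM" for l unfolding k_def by measurable
  have kpos: "0 < k l m" "0 \<le> h m" "0 \<le> c l" for l m using dt by (simp_all add: k_def h_def c_def)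
  have kn [simp]: "0 \<le> k l m" for l m by (rule less_imp_le[OF kpos(1)])
  define G where "G = (\<L> m. ennreal (g m powr p))"
  have sch: "schur dt l m * g m = k l m * g m + c l * (h m * g m)" for l m
  proof -
   have "dt powr (1 / r) * dt powr (1 / p) = dt" using dt rp by (simp add: powr_add[symmetric])
   moreover have "c l * h m = (dt powr (1 / r) * dt powr (1 / p)) * (japr (dt * m) powr (- 1) * japr (dt * l) powr (- 2))"
    unfolding c_def h_def by (simp only: mult_ac)
   ultimately have "c l * h m = dt * (japr (dt * m) powr (- 1) * japr (dt * l) powr (- 2))"
    by (simp only:)
   then show ?thesis by (simp add: schur_def k_def ring_distribs mult.assoc[symmetric])
  qed
  have kl: "(\<L> m. ennreal (k l m)) = Jint 2" for l
   using Jint_scaled[of "- dt" "dt * l" 2] dt by (simp add: k_def algebra_simps)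
  have km: "(\<L> l. ennreal (k l m)) = Jint 2" for m
   using Jint_scaled[of "dt" "- (dt * m)" 2] dt by (simp add: k_def algebra_simps)
  have 1: "epow (\<L> m. ennreal (k l m * g m)) p \<le> ennreal (J2 powr (p / r)) * (\<L> m. ennreal (k l m * g m powr p))" for l
  proof -
   have split: "k l m * g m = k l m powr (1 / r) * (k l m powr (1 / p) * g m)" for m
    using kpos(1)[of l m] rp by (simp add: mult.assoc[symmetric] powr_add[symmetric])
   have "epow (\<L> m. ennreal (k l m powr (1 / r) * (k l m powr (1 / p) * g m))) p
    \<le> ennreal (J2 powr (p / r)) * (\<L> m. ennreal ((k l m powr (1 / p) * g m) powr p))"
    using g rp kpos kl[of l] pos
    by (intro Holder_epow[OF rp]) (auto simp: powr_powr J less_imp_le[OF kpos(1)])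
   moreover have "(k l m powr (1 / p) * g m) powr p = k l m * g m powr p" for m
    using g kpos(1)[of l m] rp by (simp add: powr_mult powr_powr)
   ultimately show ?thesis by (simp only: split[symmetric])
  qed
  have 2: "epow (\<L> m. ennreal (c l * (h m * g m))) p \<le> ennreal (c l powr p) * (ennreal (Jr powr (p / r)) * G)" for l
  proof -
   have "(\<L> m. ennreal (c l * (h m * g m))) = ennreal (c l) * (\<L> m. ennreal (h m * g m))"
    using kpos g by (subst nn_integral_cmult[symmetric]) (auto simp: ennreal_mult)
   then have "epow (\<L> m. ennreal (c l * (h m * g m))) p = ennreal (c l powr p) * epow (\<L> m. ennreal (h m * g m)) p"
    using kpos by (simp add: epow_cmult)
   also have "epow (\<L> m. ennreal (h m * g m)) p \<le> ennreal (Jr powr (p / r)) * G"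
    unfolding G_def
   proof (rule Holder_epow[OF rp])
    have "h m powr r = dt powr (1 / r * r) * japr (dt * m) powr (- 1 * r)" for m
     by (simp only: h_def powr_mult powr_powr powr_ge_zero)
    then have "h m powr r = \<bar>dt\<bar> * japr (0 + dt * m) powr (- r)" for m
     using dt rp by simp
    then show "(\<L> m. ennreal (h m powr r)) \<le> ennreal Jr"
     using Jint_scaled[of dt 0 r] dt by (simp add: J[symmetric])
   qed (use g kpos pos in auto)
   finally show ?thesis by (simp add: mult_left_mono)
  qed
  have "(\<L> l. epow (\<L> m. ennreal (schur dt l m * g m)) p)
   \<le> (\<L> l. ennreal (2 powr p) * (ennreal (J2 powr (p / r)) * (\<L> m. ennreal (k l m * g m powr p)) + ennreal (c l powr p) * (ennreal (Jr powr (p / r)) * G)))"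
  proof (rule nn_integral_mono)
   fix l
   have "(\<L> m. ennreal (schur dt l m * g m)) = (\<L> m. ennreal (k l m * g m) + ennreal (c l * (h m * g m)))"
    unfolding sch using kpos g by (intro nn_integral_cong ennreal_plus) auto
   also have "... = (\<L> m. ennreal (k l m * g m)) + (\<L> m. ennreal (c l * (h m * g m)))"
    by (rule nn_integral_add) measurable
   also have "epow \<dots> p \<le> ennreal (2 powr p) * (epow (\<L> m. ennreal (k l m * g m)) p + epow (\<L> m. ennreal (c l * (h m * g m))) p)"
    using rp by (intro epow_add_le) simp
   also have "... \<le> ennreal (2 powr p) * (ennreal (J2 powr (p / r)) * (\<L> m. ennreal (k l m * g m powr p)) + ennreal (c l powr p) * (ennreal (Jr powr (p / r)) * G))"
    by (intro mult_left_mono add_mono 1 2) simp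
   finally show "epow (\<L> m. ennreal (schur dt l m * g m)) p \<le> ennreal (2 powr p) * (ennreal (J2 powr (p / r)) * (\<L> m. ennreal (k l m * g m powr p)) + ennreal (c l powr p) * (ennreal (Jr powr (p / r)) * G))" .
  qed
  also have "... = ennreal (2 powr p) * (ennreal (J2 powr (p / r)) * (\<L> l. (\<L> m. ennreal (k l m * g m powr p))) + (\<L> l. ennreal (c l powr p)) * (ennreal (Jr powr (p / r)) * G))"
   by (simp add: nn_integral_cmult nn_integral_add nn_integral_multc)
  also have "(\<L> l. (\<L> m. ennreal (k l m * g m powr p))) = (\<L> m. (\<L> l. ennreal (k l m * g m powr p)))"
   by (rule lborel_pair.Fubini') measurable
  also have "... = (\<L> m. Jint 2 * ennreal (g m powr p))"
  proof (rule nn_integral_cong)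
   fix m
   have [measurable]: "(\<lambda>l. k l m) \<in> BM" unfolding k_def by measurable
   have "(\<L> l. ennreal (k l m * g m powr p)) = (\<L> l. ennreal (k l m) * ennreal (g m powr p))"
    using kpos by (intro nn_integral_cong ennreal_mult) (auto intro: less_imp_le)
   also have "... = Jint 2 * ennreal (g m powr p)"
    by (subst nn_integral_multc) (simp_all add: km)
   finally show "(\<L> l. ennreal (k l m * g m powr p)) = Jint 2 * ennreal (g m powr p)" .
  qed
  also have "... = ennreal J2 * G" by (simp add: nn_integral_cmult G_def J)
  also have "(\<L> l. ennreal (c l powr p)) = ennreal Jp"
  proof -
   have "c l powr p = \<bar>dt\<bar> * japr (0 + dt * l) powr (- (2 * p))" for l
    using dt rp by (simp add: c_def powr_mult powr_powr)
   then show ?thesis using Jint_scaled[of dt 0 "2 * p"] dt by (simp add: J[symmetric])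
  qed
  also have "ennreal (2 powr p) * (ennreal (J2 powr (p / r)) * (ennreal J2 * G) + ennreal Jp * (ennreal (Jr powr (p / r)) * G))
   = ennreal (2 powr p * (J2 powr (p / r) * J2 + Jr powr (p / r) * Jp)) * G"
   using pos by (simp add: ennreal_mult ennreal_plus ring_distribs mult_ac)
  finally show ?thesis unfolding G_def .
 qed
 then show ?thesis
  using pos by (intro exI[of _ "2 powr p * (J2 powr (p / r) * J2 + Jr powr (p / r) * Jp)"]) auto
qed

lemma cmod_integral_le:
 "ennreal (cmod (\<integral>x. f x \<partial>M)) \<le> (\<integral>\<^sup>+ x. ennreal (cmod (f x)) \<partial>M)"
 by (cases "integrable M f") (simp_all add: integral_norm_bound_ennreal not_integrable_integral_eq)

lemma ennreal_powr_le_epow: "0 < p \<Longrightarrow> 0 \<le> x \<Longrightarrow> ennreal x \<le> y \<Longrightarrow> ennreal (x powr p) \<le> epow y p"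
 using epow_mono[of "ennreal x" y p] by simp

lemma dual_exp:
 assumes "1 < r"
 shows "1 < dual_exp r" "1 / r + 1 / dual_exp r = 1"
 using assms by (simp_all add: dual_exp_def field_simps)

lemma X_int_eq: "X_int r sg s b U = (\<L> q. ennreal ((Xw sg s b q * cmod (U q)) powr dual_exp r))"
 unfolding X_int_def by (simp add: powr_mult Xw_powr)

text \<open>The space-time transform of a function that for times within distance \<open>T\<close> (the first argument)
 of \<open>t\<^sub>0\<close> equals the Duhamel integral of G started at \<open>t\<^sub>0\<close>.\<close>
definition duh_ext :: "real \<Rightarrow> real \<Rightarrow> real \<Rightarrow> ((real^3) \<times> real \<Rightarrow> complex) \<Rightarrow> (real^3) \<times> real \<Rightarrow> complex" where
 "duh_ext dt t0 sg G q = cis (- t0 * (snd q + sg * jap (fst q))) *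
  (\<integral>m. kern dt (snd q + sg * jap (fst q)) m * (cis (t0 * m) * G (fst q, m - sg * jap (fst q))) \<partial>lborel)"

text \<open>The factor 2 \<pi> compensates the one in \<open>time_inv\<close>. For times up to 1
  this represents the free evolution of \<open>F\<close>.\<close>

definition free_ext :: "real \<Rightarrow> (real^3 \<Rightarrow> complex) \<Rightarrow> (real^3) \<times> real \<Rightarrow> complex" where
 "free_ext sg F q = complex_of_real (2 * pi * bump (snd q + sg * jap (fst q))) * F (fst q)"

lemma measurable_duh_ext [measurable]:
 assumes [measurable]: "G \<in> BM"
 shows "duh_ext dt t0 sg G \<in> BM"
 unfolding duh_ext_def[abs_def] by measurable

lemma measurable_free_ext [measurable]:
 assumes [measurable]: "F \<in> BM"
 shows "free_ext sg F \<in> BM"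
 unfolding free_ext_def[abs_def] by measurable

text \<open>For fixed \<xi> and in the shifted variables \<open>l = \<tau> + sg * jap \<xi>\<close>
  the operator is, up to factors of modulus 1, integration against \<open>kern\<close>. Any
  pointwise bound of the weighted kernel by \<open>schur\<close> therefore becomes a weighted
  estimate; the weights \<open>a\<close> and \<open>c\<close> are left open because two pairs of
  them are used.\<close>

lemma duh_ext_weighted:
 assumes r: "1 < r"
 obtains C where "0 \<le> C"
  and "\<And>dt t0 sg s G a c D. 0 < dt \<Longrightarrow> G \<in> BM \<Longrightarrow> a \<in> BM \<Longrightarrow> c \<in> BM \<Longrightarrow>
  (\<And>x. 0 \<le> a x) \<Longrightarrow> (\<And>x. 0 \<le> c x) \<Longrightarrow> 0 \<le> D \<Longrightarrow> (\<And>l m. a l * cmod (kern dt l m) \<le> D * (schur dt l m * c m)) \<Longrightarrow>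
  (\<L> q. ennreal ((jap (fst q) powr s * a (snd q + sg * jap (fst q)) * cmod (duh_ext dt t0 sg G q)) powr dual_exp r))
  \<le> ennreal (C * D powr dual_exp r) * (\<L> q. ennreal ((jap (fst q) powr s * c (snd q + sg * jap (fst q)) * cmod (G q)) powr dual_exp r))"
proof -
 let ?p = "dual_exp r"
 have p: "0 < ?p" using dual_exp[OF r] by simp
 obtain C where C: "0 \<le> C" "\<And>dt g. 0 < dt \<Longrightarrow> g \<in> BM \<Longrightarrow> (\<And>x. 0 \<le> g x) \<Longrightarrow>
  (\<L> l. epow (\<L> m. ennreal (schur dt l m * g m)) ?p) \<le> ennreal C * (\<L> m. ennreal (g m powr ?p))"
  using schur_bound[OF r dual_exp[OF r]] by blast
 have main: "(\<L> q. ennreal ((jap (fst q) powr s * a (snd q + sg * jap (fst q)) * cmod (duh_ext dt t0 sg G q)) powr ?p))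
  \<le> ennreal (C * D powr ?p) * (\<L> q. ennreal ((jap (fst q) powr s * c (snd q + sg * jap (fst q)) * cmod (G q)) powr ?p))"
  if dt: "0 < dt" and [measurable]: "G \<in> BM" "a \<in> BM" "c \<in> BM"
   and a: "\<And>x. 0 \<le> a x" and c: "\<And>x. 0 \<le> c x" and D: "0 \<le> D" and k: "\<And>l m. a l * cmod (kern dt l m) \<le> D * (schur dt l m * c m)"
  for dt t0 sg s G a c D
 proof -
  have schur_nonneg: "0 \<le> schur dt l m" for l m using dt by (simp add: schur_def)
  have *: "(\<L> \<tau>. ennreal ((jap \<xi> powr s * a (\<tau> + sg * jap \<xi>) * cmod (duh_ext dt t0 sg G (\<xi>, \<tau>))) powr ?p))
   \<le> ennreal (C * D powr ?p) * (\<L> \<tau>. ennreal ((jap \<xi> powr s * c (\<tau> + sg * jap \<xi>) * cmod (G (\<xi>, \<tau>))) powr ?p))" for \<xi>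
  proof -
   let ?z = "jap \<xi> powr s" and ?c = "sg * jap \<xi>"
   let ?g = "\<lambda>m. D * (?z * c m * cmod (G (\<xi>, m - ?c)))"
   have g: "0 \<le> ?g m" for m using D c by simp
   have "(\<L> \<tau>. ennreal ((?z * a (\<tau> + ?c) * cmod (duh_ext dt t0 sg G (\<xi>, \<tau>))) powr ?p))
    = (\<L> l. ennreal ((?z * a l * cmod (duh_ext dt t0 sg G (\<xi>, l - ?c))) powr ?p))"
    using nn_integral_lborel_translation[of "\<lambda>\<tau>. ennreal ((?z * a (\<tau> + ?c) * cmod (duh_ext dt t0 sg G (\<xi>, \<tau>))) powr ?p)" "- ?c"]
    by (simp add: algebra_simps)
   also have "... \<le> (\<L> l. epow (\<L> m. ennreal (schur dt l m * ?g m)) ?p)"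
   proof (intro nn_integral_mono ennreal_powr_le_epow p)
    fix l
    show "0 \<le> ?z * a l * cmod (duh_ext dt t0 sg G (\<xi>, l - ?c))" using a by simp
    have "ennreal (?z * a l * cmod (duh_ext dt t0 sg G (\<xi>, l - ?c))) = ennreal (?z * a l) * ennreal (cmod (\<integral>m. kern dt l m * (cis (t0 * m) * G (\<xi>, m - ?c)) \<partial>lborel))"
     using a by (simp add: duh_ext_def norm_mult ennreal_mult)
    also have "... \<le> ennreal (?z * a l) * (\<L> m. ennreal (cmod (kern dt l m * (cis (t0 * m) * G (\<xi>, m - ?c)))))"
     by (intro mult_left_mono cmod_integral_le) simp
    also have "... = (\<L> m. ennreal (?z * a l) * ennreal (cmod (kern dt l m * (cis (t0 * m) * G (\<xi>, m - ?c)))))"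
     by (rule nn_integral_cmult[symmetric]) measurable
    also have "... \<le> (\<L> m. ennreal (schur dt l m * ?g m))"
    proof (rule nn_integral_mono)
     fix m
     have "(?z * a l) * cmod (kern dt l m * (cis (t0 * m) * G (\<xi>, m - ?c))) = (a l * cmod (kern dt l m)) * (?z * cmod (G (\<xi>, m - ?c)))"
      by (simp add: norm_mult)
     also have "... \<le> (D * (schur dt l m * c m)) * (?z * cmod (G (\<xi>, m - ?c)))"
      by (intro mult_right_mono k) auto
     finally show "ennreal (?z * a l) * ennreal (cmod (kern dt l m * (cis (t0 * m) * G (\<xi>, m - ?c)))) \<le> ennreal (schur dt l m * ?g m)"
      using a by (subst ennreal_mult[symmetric]) (auto intro!: ennreal_leI simp: mult_ac)
    qed
    finally show "ennreal (?z * a l * cmod (duh_ext dt t0 sg G (\<xi>, l - ?c))) \<le> (\<L> m. ennreal (schur dt l m * ?g m))" .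
   qed
   also have "... \<le> ennreal C * (\<L> m. ennreal (?g m powr ?p))"
    by (rule C(2)[OF dt _ g]) measurable
   also have "(\<L> m. ennreal (?g m powr ?p)) = (\<L> m. ennreal (D powr ?p) * ennreal ((?z * c m * cmod (G (\<xi>, m - ?c))) powr ?p))"
    using c D by (intro nn_integral_cong) (simp add: powr_mult ennreal_mult)
   also have "... = ennreal (D powr ?p) * (\<L> m. ennreal ((?z * c m * cmod (G (\<xi>, m - ?c))) powr ?p))"
    by (rule nn_integral_cmult) measurable
   also have "(\<L> m. ennreal ((?z * c m * cmod (G (\<xi>, m - ?c))) powr ?p))
    = (\<L> \<tau>. ennreal ((?z * c (\<tau> + ?c) * cmod (G (\<xi>, \<tau>))) powr ?p))"
    using nn_integral_lborel_translation[of "\<lambda>m. ennreal ((?z * c m * cmod (G (\<xi>, m - ?c))) powr ?p)" "?c"]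
    by (simp add: algebra_simps)
   finally show ?thesis using C(1) D by (simp add: ennreal_mult mult.assoc)
  qed
  have "(\<L> q. ennreal ((jap (fst q) powr s * a (snd q + sg * jap (fst q)) * cmod (duh_ext dt t0 sg G q)) powr ?p))
   = (\<L> \<xi>. (\<L> \<tau>. ennreal ((jap \<xi> powr s * a (\<tau> + sg * jap \<xi>) * cmod (duh_ext dt t0 sg G (\<xi>, \<tau>))) powr ?p)))"
   by (subst nn_integral_lborel_prod(1)) simp_all
  also have "... \<le> (\<L> \<xi>. ennreal (C * D powr ?p) * (\<L> \<tau>. ennreal ((jap \<xi> powr s * c (\<tau> + sg * jap \<xi>) * cmod (G (\<xi>, \<tau>))) powr ?p)))"
   by (intro nn_integral_mono *)
  also have "... = ennreal (C * D powr ?p) * (\<L> \<xi>. (\<L> \<tau>. ennreal ((jap \<xi> powr s * c (\<tau> + sg * jap \<xi>) * cmod (G (\<xi>, \<tau>))) powr ?p)))"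
   by (rule nn_integral_cmult) measurable
  also have "(\<L> \<xi>. (\<L> \<tau>. ennreal ((jap \<xi> powr s * c (\<tau> + sg * jap \<xi>) * cmod (G (\<xi>, \<tau>))) powr ?p)))
   = (\<L> q. ennreal ((jap (fst q) powr s * c (snd q + sg * jap (fst q)) * cmod (G q)) powr ?p))"
   by (subst nn_integral_lborel_prod(1)) simp_all
  finally show ?thesis .
 qed
 show thesis by (rule that[OF C(1) main])
qed

text \<open>The propagator of the first-order system has phase \<langle>\<xi>\<rangle>, whereas the
  X-spaces are built on |\<xi>|. The two differ by at most 1.\<close>

lemma japr_norm_jap:
 assumes "\<bar>sg\<bar> = 1"
 shows "japr (\<tau> + sg * norm \<xi>) \<le> 8 * japr (\<tau> + sg * jap \<xi>)" "japr (\<tau> + sg * jap \<xi>) \<le> 8 * japr (\<tau> + sg * norm \<xi>)"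
proof -
 have "\<bar>sg * (jap \<xi> - norm \<xi>)\<bar> \<le> 2"
  using norm_le_jap[of \<xi>] jap_le[of \<xi>] assms by (simp add: abs_mult)
 then show "japr (\<tau> + sg * norm \<xi>) \<le> 8 * japr (\<tau> + sg * jap \<xi>)" "japr (\<tau> + sg * jap \<xi>) \<le> 8 * japr (\<tau> + sg * norm \<xi>)"
  using japr_shift[of "- (sg * (jap \<xi> - norm \<xi>))" "\<tau> + sg * jap \<xi>"] japr_shift[of "sg * (jap \<xi> - norm \<xi>)" "\<tau> + sg * norm \<xi>"]
  by (simp_all add: algebra_simps)
qed

lemma duh_ext_bound:
 assumes r: "1 < r"
 shows "\<exists>C\<ge>0. (\<forall>dt t0 sg s b G. 0 < dt \<and> dt \<le> 1 \<and> 0 \<le> b \<and> b \<le> 1 \<and> \<bar>sg\<bar> = 1 \<and> G \<in> BM \<longrightarrow>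
    X_int r sg s b (duh_ext dt t0 sg G) \<le> ennreal (C * dt powr ((1 - b) * dual_exp r)) * X_int r sg s 0 G)
  \<and> (\<forall>t0 sg s b G. 0 \<le> b \<and> b \<le> 1 \<and> \<bar>sg\<bar> = 1 \<and> G \<in> BM \<longrightarrow>
    X_int r sg s (1 + b) (duh_ext 1 t0 sg G) \<le> ennreal C * X_int r sg s b G)"
proof (rule duh_ext_weighted[OF r])
 let ?p = "dual_exp r"
 have p: "0 < ?p" using dual_exp[OF r] by simp
 fix C assume C: "0 \<le> C" and Cb: "\<And>dt t0 sg s G a c D. 0 < dt \<Longrightarrow> G \<in> BM \<Longrightarrow> a \<in> BM \<Longrightarrow> c \<in> BM \<Longrightarrow>
  (\<And>x. 0 \<le> a x) \<Longrightarrow> (\<And>x. 0 \<le> c x) \<Longrightarrow> 0 \<le> D \<Longrightarrow> (\<And>l m. a l * cmod (kern dt l m) \<le> D * (schur dt l m * c m)) \<Longrightarrow>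
  (\<L> q. ennreal ((jap (fst q) powr s * a (snd q + sg * jap (fst q)) * cmod (duh_ext dt t0 sg G q)) powr ?p))
  \<le> ennreal (C * D powr ?p) * (\<L> q. ennreal ((jap (fst q) powr s * c (snd q + sg * jap (fst q)) * cmod (G q)) powr ?p))"
 obtain K where K: "0 \<le> K" and K1: "\<And>dt b l m. 0 < dt \<Longrightarrow> dt \<le> 1 \<Longrightarrow> 0 \<le> b \<Longrightarrow> b \<le> 1 \<Longrightarrow> japr l powr b * cmod (kern dt l m) \<le> K * dt powr (1 - b) * schur dt l m"
   and K2: "\<And>b l m. 0 \<le> b \<Longrightarrow> b \<le> 1 \<Longrightarrow> japr l powr (1 + b) * cmod (kern 1 l m) \<le> K * (schur 1 l m * japr m powr b)"
  using kern_schur by blast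
 define L where "L = C * K powr ?p * 64 powr ?p * 64 powr ?p"
 \<comment> \<open>Comparing the two brackets costs a factor 8, raised to an exponent of at most 2;
   hence 64.\<close>
 have weight: "X_int r sg s b V \<le> ennreal (64 powr ?p) * (\<L> q. ennreal ((jap (fst q) powr s * japr (snd q + sg * jap (fst q)) powr b * cmod (V q)) powr ?p))"
   "(\<L> q. ennreal ((jap (fst q) powr s * japr (snd q + sg * jap (fst q)) powr b * cmod (V q)) powr ?p)) \<le> ennreal (64 powr ?p) * X_int r sg s b V"
  if b: "0 \<le> b" "b \<le> 2" and sg: "\<bar>sg\<bar> = 1" and [measurable]: "V \<in> BM" for s b sg V
 proof -
  have cmp: "japr y powr b \<le> 64 * japr x powr b" if "japr y \<le> 8 * japr x" for x y
  proof -
   have "japr y powr b \<le> (8 * japr x) powr b" using that b by (intro powr_mono2) auto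
   also have "... = 8 powr b * japr x powr b" by (simp add: powr_mult)
   also have "... \<le> 64 * japr x powr b"
   proof -
    have "(8::real) powr b \<le> 8 powr 2" using b by (intro powr_mono) auto
    then show ?thesis by (intro mult_right_mono) auto
   qed
   finally show ?thesis .
  qed
  have aux: "(\<L> q. ennreal ((u q * f q * v q) powr ?p)) \<le> ennreal (64 powr ?p) * (\<L> q. ennreal ((u q * g q * v q) powr ?p))"
   if "\<And>q. 0 \<le> f q" "\<And>q. 0 \<le> g q" "\<And>q. f q \<le> 64 * g q" "\<And>q. 0 \<le> u q" "\<And>q. 0 \<le> v q"
    and [measurable]: "f \<in> BM" "g \<in> BM" "u \<in> BM" "v \<in> BM"
   for f g u v :: "(real^3) \<times> real \<Rightarrow> real"
  proof -
   have "(\<L> q. ennreal ((u q * f q * v q) powr ?p)) \<le> (\<L> q. ennreal (64 powr ?p) * ennreal ((u q * g q * v q) powr ?p))"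
   proof (rule nn_integral_mono)
    fix q
    have "u q * f q * v q \<le> u q * (64 * g q) * v q" by (intro mult_right_mono mult_left_mono that)
    then have "(u q * f q * v q) powr ?p \<le> (64 * (u q * g q * v q)) powr ?p" using p that by (intro powr_mono2) (auto simp: mult_ac)
    also have "... = 64 powr ?p * (u q * g q * v q) powr ?p" using that by (simp add: powr_mult)
    finally show "ennreal ((u q * f q * v q) powr ?p) \<le> ennreal (64 powr ?p) * ennreal ((u q * g q * v q) powr ?p)"
     by (subst ennreal_mult[symmetric]) (auto intro: ennreal_leI)
   qed
   also have "... = ennreal (64 powr ?p) * (\<L> q. ennreal ((u q * g q * v q) powr ?p))"
    by (rule nn_integral_cmult) measurable
   finally show ?thesis .
  qed
  show "X_int r sg s b V \<le> ennreal (64 powr ?p) * (\<L> q. ennreal ((jap (fst q) powr s * japr (snd q + sg * jap (fst q)) powr b * cmod (V q)) powr ?p))"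
   "(\<L> q. ennreal ((jap (fst q) powr s * japr (snd q + sg * jap (fst q)) powr b * cmod (V q)) powr ?p)) \<le> ennreal (64 powr ?p) * X_int r sg s b V"
  proof -
   have c1: "japr (snd q + sg * norm (fst q)) powr b \<le> 64 * japr (snd q + sg * jap (fst q)) powr b"
    and c2: "japr (snd q + sg * jap (fst q)) powr b \<le> 64 * japr (snd q + sg * norm (fst q)) powr b" for q :: "(real^3) \<times> real"
    by (rule cmp[OF japr_norm_jap(1)[OF sg]] cmp[OF japr_norm_jap(2)[OF sg]])+
   show "X_int r sg s b V \<le> ennreal (64 powr ?p) * (\<L> q. ennreal ((jap (fst q) powr s * japr (snd q + sg * jap (fst q)) powr b * cmod (V q)) powr ?p))"
    unfolding X_int_eq Xw_def by (rule aux[OF _ _ c1]) simp_all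
   show "(\<L> q. ennreal ((jap (fst q) powr s * japr (snd q + sg * jap (fst q)) powr b * cmod (V q)) powr ?p)) \<le> ennreal (64 powr ?p) * X_int r sg s b V"
    unfolding X_int_eq Xw_def by (rule aux[OF _ _ c2]) simp_all
  qed
 qed
 have A: "X_int r sg s b (duh_ext dt t0 sg G) \<le> ennreal (L * dt powr ((1 - b) * ?p)) * X_int r sg s 0 G"
  if "0 < dt" "dt \<le> 1" "0 \<le> b" "b \<le> 1" "\<bar>sg\<bar> = 1" and [measurable]: "G \<in> BM" for dt t0 sg s b G
 proof -
  have "X_int r sg s b (duh_ext dt t0 sg G) \<le> ennreal (64 powr ?p) * (ennreal (C * (K * dt powr (1 - b)) powr ?p) * X_int r sg s 0 G)"
  proof (rule order_trans[OF weight(1) mult_left_mono])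
   show "(\<L> q. ennreal ((jap (fst q) powr s * japr (snd q + sg * jap (fst q)) powr b * cmod (duh_ext dt t0 sg G q)) powr ?p))
    \<le> ennreal (C * (K * dt powr (1 - b)) powr ?p) * X_int r sg s 0 G"
    using Cb[of dt G "\<lambda>x. japr x powr b" "\<lambda>x. 1" "K * dt powr (1 - b)" s sg t0] that K K1[of dt b]
    by (simp add: X_int_eq Xw_def)
  qed (use that in auto)
  also have "... = ennreal (64 powr ?p * (C * (K * dt powr (1 - b)) powr ?p)) * X_int r sg s 0 G"
   using C by (simp add: ennreal_mult mult.assoc)
  also have "... \<le> ennreal (L * dt powr ((1 - b) * ?p)) * X_int r sg s 0 G"
  proof (intro mult_right_mono ennreal_leI)
   have "64 powr ?p * (C * (K * dt powr (1 - b)) powr ?p) = (64 powr ?p * (C * K powr ?p) * dt powr ((1 - b) * ?p)) * 1"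
    using K by (simp add: powr_mult powr_powr)
   also have "... \<le> (64 powr ?p * (C * K powr ?p) * dt powr ((1 - b) * ?p)) * 64 powr ?p"
    using C p by (intro mult_left_mono) (auto simp: ge_one_powr_ge_zero)
   finally show "64 powr ?p * (C * (K * dt powr (1 - b)) powr ?p) \<le> L * dt powr ((1 - b) * ?p)"
    by (simp add: L_def mult_ac)
  qed simp
  finally show ?thesis .
 qed
 have B: "X_int r sg s (1 + b) (duh_ext 1 t0 sg G) \<le> ennreal L * X_int r sg s b G"
  if "0 \<le> b" "b \<le> 1" "\<bar>sg\<bar> = 1" and [measurable]: "G \<in> BM" for t0 sg s b G
 proof -
  have "X_int r sg s (1 + b) (duh_ext 1 t0 sg G) \<le> ennreal (64 powr ?p) * (ennreal (C * K powr ?p) * (ennreal (64 powr ?p) * X_int r sg s b G))"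
  proof (rule order_trans[OF weight(1) mult_left_mono[OF order_trans[OF _ mult_left_mono[OF weight(2)]]]])
   show "(\<L> q. ennreal ((jap (fst q) powr s * japr (snd q + sg * jap (fst q)) powr (1 + b) * cmod (duh_ext 1 t0 sg G q)) powr ?p))
    \<le> ennreal (C * K powr ?p) * (\<L> q. ennreal ((jap (fst q) powr s * japr (snd q + sg * jap (fst q)) powr b * cmod (G q)) powr ?p))"
    using that K K2 by (intro Cb) auto
  qed (use that in auto)
  also have "... = ennreal L * X_int r sg s b G"
   using C by (simp add: L_def ennreal_mult mult_ac)
  finally show ?thesis .
 qed
 have "0 \<le> L" using C by (simp add: L_def)
 with A B show ?thesis by (intro exI[of _ L]) auto
qed

lemma Hhat_int_borel: "Hhat_int r s F = (\<L> \<xi>. ennreal ((jap \<xi> powr s * cmod (F \<xi>)) powr dual_exp r))"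
 unfolding Hhat_int_def by (simp add: nn_integral_completion powr_mult powr_powr)

text \<open>A modulation weight of order at most 2 against decay of order 4 leaves the exponent -2,
  whose p-th power is integrable in \<tau>.\<close>

lemma free_ext_bound:
 assumes r: "1 < r"
 shows "\<exists>C\<ge>0. \<forall>sg s b F. 0 \<le> b \<and> b \<le> 2 \<and> \<bar>sg\<bar> = 1 \<and> F \<in> BM \<longrightarrow>
  X_int r sg s b (free_ext sg F) \<le> ennreal C * Hhat_int r s F"
proof -
 let ?p = "dual_exp r"
 have p: "1 < ?p" using dual_exp[OF r] by simp
 obtain K where K: "0 \<le> K" "\<And>x. \<bar>bump x\<bar> \<le> K * japr x powr (- 4)" using bump_bound by blast
 define J where "J = enn2real (Jint (2 * ?p))"
 have J: "Jint (2 * ?p) = ennreal J" using Jint_finite[of "2 * ?p"] p by (simp add: J_def)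
 define C where "C = (2 * pi * (64 * K)) powr ?p * J"
 have "X_int r sg s b (free_ext sg F) \<le> ennreal C * Hhat_int r s F"
  if b: "0 \<le> b" "b \<le> 2" and sg: "\<bar>sg\<bar> = 1" and [measurable]: "F \<in> BM" for sg s b F
 proof -
  have pt: "Xw sg s b (\<xi>, \<tau>) * cmod (free_ext sg F (\<xi>, \<tau>)) \<le> (2 * pi * (64 * K)) * (japr (\<tau> + sg * jap \<xi>) powr (- 2) * (jap \<xi> powr s * cmod (F \<xi>)))" for \<xi> \<tau>
  proof -
   let ?l = "japr (\<tau> + sg * jap \<xi>)"
   have "japr (\<tau> + sg * norm \<xi>) powr b \<le> japr (\<tau> + sg * norm \<xi>) powr 2" using b by (intro powr_mono) auto
   also have "... \<le> (8 * ?l) powr 2" using japr_norm_jap[OF sg] by (intro powr_mono2) auto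
   also have "... = 64 * ?l powr 2" by (simp add: powr_mult)
   finally have "japr (\<tau> + sg * norm \<xi>) powr b * \<bar>bump (\<tau> + sg * jap \<xi>)\<bar> \<le> (64 * ?l powr 2) * (K * ?l powr (- 4))"
    using K by (intro mult_mono) auto
   also have "... = 64 * K * (?l powr 2 * ?l powr (- 4))" by (simp only: mult_ac)
   also have "?l powr 2 * ?l powr (- 4) = ?l powr (- 2)" by (simp only: powr_add[symmetric]) simp
   finally have le: "(2 * pi * (jap \<xi> powr s * cmod (F \<xi>))) * (japr (\<tau> + sg * norm \<xi>) powr b * \<bar>bump (\<tau> + sg * jap \<xi>)\<bar>) \<le> (2 * pi * (jap \<xi> powr s * cmod (F \<xi>))) * (64 * K * ?l powr (- 2))"
    by (intro mult_left_mono) auto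
   have "Xw sg s b (\<xi>, \<tau>) * cmod (free_ext sg F (\<xi>, \<tau>)) = (2 * pi * (jap \<xi> powr s * cmod (F \<xi>))) * (japr (\<tau> + sg * norm \<xi>) powr b * \<bar>bump (\<tau> + sg * jap \<xi>)\<bar>)"
    by (simp add: Xw_def free_ext_def norm_mult abs_mult)
   moreover have "(2 * pi * (jap \<xi> powr s * cmod (F \<xi>))) * (64 * K * ?l powr (- 2)) = (2 * pi * (64 * K)) * (?l powr (- 2) * (jap \<xi> powr s * cmod (F \<xi>)))"
    by simp
   ultimately show ?thesis using le by (simp only:)
  qed
  have em: "ennreal (x * y * z) = ennreal x * ennreal y * ennreal z" if "0 \<le> x" "0 \<le> y" "0 \<le> z" for x y z
   using that by (simp add: ennreal_mult)
  have "X_int r sg s b (free_ext sg F) = (\<L> \<xi>. (\<L> \<tau>. ennreal ((Xw sg s b (\<xi>, \<tau>) * cmod (free_ext sg F (\<xi>, \<tau>))) powr ?p)))"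
   unfolding X_int_eq by (rule nn_integral_lborel_prod(1)) measurable
  also have "... \<le> (\<L> \<xi>. (\<L> \<tau>. (ennreal ((2 * pi * (64 * K)) powr ?p) * ennreal ((jap \<xi> powr s * cmod (F \<xi>)) powr ?p)) * ennreal (japr (sg * jap \<xi> + 1 * \<tau>) powr (- (2 * ?p)))))"
  proof (intro nn_integral_mono)
   fix \<xi> :: "real^3" and \<tau>
   have "(Xw sg s b (\<xi>, \<tau>) * cmod (free_ext sg F (\<xi>, \<tau>))) powr ?p \<le> ((2 * pi * (64 * K)) * (japr (\<tau> + sg * jap \<xi>) powr (- 2) * (jap \<xi> powr s * cmod (F \<xi>)))) powr ?p"
    using p pt by (intro powr_mono2) (auto simp: less_imp_le[OF Xw_pos])
   also have "... = (2 * pi * (64 * K)) powr ?p * (jap \<xi> powr s * cmod (F \<xi>)) powr ?p * japr (sg * jap \<xi> + 1 * \<tau>) powr (- (2 * ?p))"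
    using K(1) by (simp add: powr_mult powr_powr add.commute)
   finally show "ennreal ((Xw sg s b (\<xi>, \<tau>) * cmod (free_ext sg F (\<xi>, \<tau>))) powr ?p) \<le> (ennreal ((2 * pi * (64 * K)) powr ?p) * ennreal ((jap \<xi> powr s * cmod (F \<xi>)) powr ?p)) * ennreal (japr (sg * jap \<xi> + 1 * \<tau>) powr (- (2 * ?p)))"
    by (subst em[symmetric]) (auto intro: ennreal_leI)
  qed
  also have "... = (\<L> \<xi>. (ennreal ((2 * pi * (64 * K)) powr ?p) * ennreal J) * ennreal ((jap \<xi> powr s * cmod (F \<xi>)) powr ?p))"
  proof (rule nn_integral_cong)
   fix \<xi> :: "real^3"
   let ?c = "ennreal ((2 * pi * (64 * K)) powr ?p) * ennreal ((jap \<xi> powr s * cmod (F \<xi>)) powr ?p)"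
   have "(\<L> \<tau>. ?c * ennreal (japr (sg * jap \<xi> + 1 * \<tau>) powr (- (2 * ?p)))) = ?c * (\<L> \<tau>. ennreal (japr (sg * jap \<xi> + 1 * \<tau>) powr (- (2 * ?p))))"
    by (rule nn_integral_cmult) measurable
   also have "(\<L> \<tau>. ennreal (japr (sg * jap \<xi> + 1 * \<tau>) powr (- (2 * ?p)))) = ennreal J"
    by (simp only: Jint_affine abs_one J)
   finally show "(\<L> \<tau>. ?c * ennreal (japr (sg * jap \<xi> + 1 * \<tau>) powr (- (2 * ?p)))) = (ennreal ((2 * pi * (64 * K)) powr ?p) * ennreal J) * ennreal ((jap \<xi> powr s * cmod (F \<xi>)) powr ?p)"
    by (simp only: mult_ac)
  qed
  also have "... = ennreal C * Hhat_int r s F"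
   unfolding Hhat_int_borel by (subst nn_integral_cmult) (simp_all add: C_def ennreal_mult J_def)
  finally show ?thesis .
 qed
 moreover have "0 \<le> C" by (simp add: C_def J_def)
 ultimately show ?thesis by blast
qed

section \<open>The forcing term\<close>

type_synonym spacetime = "(real^3) \<times> real \<Rightarrow> complex"
type_synonym pair = "spacetime \<times> spacetime"
type_synonym data = "(real^3 \<Rightarrow> complex) \<times> (real^3 \<Rightarrow> complex)"

section \<open>Elementary estimates for the X-norms\<close>

lemma X_int_mono:
 assumes p: "1 < r" and "\<And>q. Xw sg s b q * cmod (U q) \<le> K * (Xw sg' s' b' q * cmod (V q))" "0 \<le> K"
  and [measurable]: "V \<in> BM"
 shows "X_int r sg s b U \<le> ennreal (K powr dual_exp r) * X_int r sg' s' b' V"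
proof -
 let ?p = "dual_exp r"
 have p: "0 < ?p" using dual_exp[OF p] by simp
 have "X_int r sg s b U \<le> (\<L> q. ennreal (K powr ?p) * ennreal ((Xw sg' s' b' q * cmod (V q)) powr ?p))"
  unfolding X_int_eq
 proof (rule nn_integral_mono)
  fix q
  have "(Xw sg s b q * cmod (U q)) powr ?p \<le> (K * (Xw sg' s' b' q * cmod (V q))) powr ?p"
   using assms p by (intro powr_mono2) (auto intro!: mult_nonneg_nonneg less_imp_le[OF Xw_pos])
  also have "... = K powr ?p * (Xw sg' s' b' q * cmod (V q)) powr ?p"
   by (rule powr_mult)
  finally have "ennreal ((Xw sg s b q * cmod (U q)) powr ?p) \<le> ennreal (K powr ?p * (Xw sg' s' b' q * cmod (V q)) powr ?p)"
   by (rule ennreal_leI)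
  then show "ennreal ((Xw sg s b q * cmod (U q)) powr ?p) \<le> ennreal (K powr ?p) * ennreal ((Xw sg' s' b' q * cmod (V q)) powr ?p)"
   by (simp add: ennreal_mult)
 qed
 also have "... = ennreal (K powr ?p) * X_int r sg' s' b' V"
  unfolding X_int_eq by (rule nn_integral_cmult) measurable
 finally show ?thesis .
qed

lemma X_int_add_le:
 assumes r: "1 < r" and "AE q in lborel. cmod (W q) \<le> cmod (U q) + cmod (V q)"
  and [measurable]: "U \<in> BM" "V \<in> BM"
 shows "X_int r sg s b W \<le> ennreal (2 powr dual_exp r) * (X_int r sg s b U + X_int r sg s b V)"
proof -
 let ?p = "dual_exp r"
 have p: "0 < ?p" using dual_exp[OF r] by simp
 have "X_int r sg s b W \<le> (\<L> q. ennreal (2 powr ?p) * (ennreal ((Xw sg s b q * cmod (U q)) powr ?p) + ennreal ((Xw sg s b q * cmod (V q)) powr ?p)))"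
  unfolding X_int_eq
 proof (rule nn_integral_mono_AE)
  show "AE q in lborel. ennreal ((Xw sg s b q * cmod (W q)) powr ?p) \<le> ennreal (2 powr ?p) * (ennreal ((Xw sg s b q * cmod (U q)) powr ?p) + ennreal ((Xw sg s b q * cmod (V q)) powr ?p))"
   using assms(2)
  proof eventually_elim
   case (elim q)
   have x: "0 \<le> Xw sg s b q" by (rule less_imp_le) simp
   have "(Xw sg s b q * cmod (W q)) powr ?p \<le> (Xw sg s b q * cmod (U q) + Xw sg s b q * cmod (V q)) powr ?p"
    using elim x p mult_left_mono[OF elim x] by (intro powr_mono2) (auto simp: ring_distribs)
   also have "... \<le> 2 powr ?p * ((Xw sg s b q * cmod (U q)) powr ?p + (Xw sg s b q * cmod (V q)) powr ?p)"
    using x p by (intro powr_add_le) auto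
   finally show ?case
    by (simp flip: ennreal_mult ennreal_plus add: ennreal_leI)
  qed
 qed
 also have "... = ennreal (2 powr ?p) * (X_int r sg s b U + X_int r sg s b V)"
  unfolding X_int_eq by (simp add: nn_integral_cmult nn_integral_add)
 finally show ?thesis .
qed

text \<open>Since |\<tau>| \<le> \<langle>\<xi>\<rangle> + \<langle>\<tau> \<plusminus>
  |\<xi>|\<rangle>, a time derivative costs either one space derivative or one power of the
  modulation.\<close>

lemma X_int_dt_hat_le:
 assumes r: "1 < r" and sg: "\<bar>sg\<bar> = 1" and [measurable]: "V \<in> BM"
 shows "X_int r sg (s - 1) b (dt_hat V) \<le> ennreal (2 powr dual_exp r) * (X_int r sg s b V + X_int r sg (s - 1) (1 + b) V)"
proof -
 let ?p = "dual_exp r"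
 have p: "0 < ?p" using dual_exp[OF r] by simp
 have "X_int r sg (s - 1) b (dt_hat V) \<le> (\<L> q. ennreal (2 powr ?p) * (ennreal ((Xw sg s b q * cmod (V q)) powr ?p) + ennreal ((Xw sg (s - 1) (1 + b) q * cmod (V q)) powr ?p)))"
  unfolding X_int_eq
 proof (rule nn_integral_mono)
  fix q :: "(real^3) \<times> real"
  obtain \<xi> \<tau> where q: "q = (\<xi>, \<tau>)" by (cases q)
  let ?l = "japr (\<tau> + sg * norm \<xi>)"
  have "\<bar>\<tau>\<bar> \<le> \<bar>\<tau> + sg * norm \<xi>\<bar> + \<bar>sg * norm \<xi>\<bar>" by linarith
  also have "... \<le> ?l + jap \<xi>"
   using sg abs_le_japr[of "\<tau> + sg * norm \<xi>"] norm_le_jap[of \<xi>] by (simp add: abs_mult)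
  finally have t: "\<bar>\<tau>\<bar> \<le> jap \<xi> + ?l" by simp
  have "Xw sg (s - 1) b q * cmod (dt_hat V q) = (jap \<xi> powr (s - 1) * ?l powr b * cmod (V q)) * \<bar>\<tau>\<bar>"
   by (simp add: q Xw_def dt_hat_def norm_mult mult_ac)
  also have "... \<le> (jap \<xi> powr (s - 1) * ?l powr b * cmod (V q)) * (jap \<xi> + ?l)"
   using t by (intro mult_left_mono) auto
  also have "... = (jap \<xi> * jap \<xi> powr (s - 1)) * ?l powr b * cmod (V q) + jap \<xi> powr (s - 1) * (?l * ?l powr b) * cmod (V q)"
   by (simp add: algebra_simps)
  also have "jap \<xi> * jap \<xi> powr (s - 1) = jap \<xi> powr s" using powr_mult_base[of "jap \<xi>" "s - 1"] by simp
  also have "?l * ?l powr b = ?l powr (1 + b)" using powr_mult_base[of ?l b] by simp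
  finally have le: "Xw sg (s - 1) b q * cmod (dt_hat V q) \<le> Xw sg s b q * cmod (V q) + Xw sg (s - 1) (1 + b) q * cmod (V q)"
   by (simp add: q Xw_def)
  have x: "0 \<le> Xw sg s b q" for sg s b by (rule less_imp_le) simp
  have "(Xw sg (s - 1) b q * cmod (dt_hat V q)) powr ?p \<le> (Xw sg s b q * cmod (V q) + Xw sg (s - 1) (1 + b) q * cmod (V q)) powr ?p"
   using le x p by (intro powr_mono2) auto
  also have "... \<le> 2 powr ?p * ((Xw sg s b q * cmod (V q)) powr ?p + (Xw sg (s - 1) (1 + b) q * cmod (V q)) powr ?p)"
   using x p by (intro powr_add_le) auto
  finally show "ennreal ((Xw sg (s - 1) b q * cmod (dt_hat V q)) powr ?p) \<le> ennreal (2 powr ?p) * (ennreal ((Xw sg s b q * cmod (V q)) powr ?p) + ennreal ((Xw sg (s - 1) (1 + b) q * cmod (V q)) powr ?p))"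
   by (simp flip: ennreal_mult ennreal_plus add: ennreal_leI)
 qed
 also have "... = ennreal (2 powr ?p) * (X_int r sg s b V + X_int r sg (s - 1) (1 + b) V)"
  unfolding X_int_eq by (simp add: nn_integral_cmult nn_integral_add)
 finally show ?thesis .
qed

section \<open>Bilinear estimate for the forcing term\<close>

definition conv4 :: "spacetime \<Rightarrow> spacetime \<Rightarrow> spacetime" where
 "conv4 P Q x = (\<integral>y. P y * Q (x - y) \<partial>lborel)"

lemma measurable_conv4 [measurable]:
 assumes [measurable]: "P \<in> BM" "Q \<in> BM"
 shows "conv4 P Q \<in> BM"
 unfolding conv4_def[abs_def] by measurable

text \<open>For the solution, the right-hand sides of the two equations cancel in the equation for
 \<open>\<partial>\<^sub>t (u\<^sub>+ + u\<^sub>-)\<close>, which therefore equals \<open>- \<i> J (u\<^sub>+ - u\<^sub>-)\<close>. Using this expression for the time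
 derivative, the bilinear form makes sense for states without control of \<open>\<partial>\<^sub>t u\<^sub>\<plusminus>\<close>.\<close>
definition symb :: "der \<Rightarrow> pair \<Rightarrow> spacetime" where
 "symb d U q = (case d of
   Dt \<Rightarrow> - \<i> * of_real (jap (fst q)) * (fst U q - snd U q)
  | Dx j \<Rightarrow> \<i> * of_real (fst q $ j) * (fst U q + snd U q))"

text \<open>The arguments of the product and of the linear term are kept separate, so that
  differences of forcing terms are again sums of such expressions. The constant belongs to the
  space-time transform of a product.\<close>

definition forcing :: "der \<Rightarrow> der \<Rightarrow> real \<Rightarrow> pair \<Rightarrow> pair \<Rightarrow> pair \<Rightarrow> spacetime" where
 "forcing d1 d2 sg U V L q = - of_real (sg / jap (fst q)) *
  (of_real (1 / (2 * pi) ^ 4) * conv4 (symb d1 U) (symb d2 V) q / 4 + (fst L q + snd L q) / 2)"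

text \<open>A common majorant of all symbols, whichever derivative is chosen; the constants of the
  bilinear estimate are therefore the same for all derivatives.\<close>

definition mag :: "pair \<Rightarrow> (real^3) \<times> real \<Rightarrow> real" where
 "mag U q = jap (fst q) * (cmod (fst U q) + cmod (snd U q))"

definition borel_pair :: "pair \<Rightarrow> bool" where
 "borel_pair U \<longleftrightarrow> fst U \<in> BM \<and> snd U \<in> BM"

lemma borel_pairD [measurable_dest]:
 "borel_pair U \<Longrightarrow> fst U \<in> BM" "borel_pair U \<Longrightarrow> snd U \<in> BM"
 by (simp_all add: borel_pair_def)

definition sgnpart :: "real \<Rightarrow> pair \<Rightarrow> spacetime" where
 "sgnpart sg U = (if sg = 1 then fst U else snd U)"

lemma sgnpart_simps [simp]: "sgnpart 1 U = fst U" "sgnpart (- 1) U = snd U"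
 by (simp_all add: sgnpart_def)

lemma measurable_sgnpart [measurable]: "borel_pair U \<Longrightarrow> sgnpart sg U \<in> BM"
 by (simp add: sgnpart_def borel_pair_def)

lemma borel_measurable_vec_nth [measurable (raw)]:
 fixes f :: "'c \<Rightarrow> real^'n"
 assumes "f \<in> borel_measurable M"
 shows "(\<lambda>x. f x $ i) \<in> borel_measurable M"
 by (rule measurable_compose[OF assms borel_measurable_continuous_onI]) (intro continuous_intros)

lemma measurable_symb [measurable]:
 assumes [measurable]: "borel_pair U"
 shows "symb d U \<in> BM"
 unfolding symb_def[abs_def] by (cases d) simp_all

lemma measurable_mag [measurable]:
 assumes [measurable]: "borel_pair U"
 shows "mag U \<in> BM"
 unfolding mag_def[abs_def] by measurable

lemma measurable_forcing [measurable]: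
 assumes [measurable]: "borel_pair U" "borel_pair V" "borel_pair L"
 shows "forcing d1 d2 sg U V L \<in> BM"
 unfolding forcing_def[abs_def] by measurable

lemma mag_nonneg [simp]: "0 \<le> mag U q"
 by (simp add: mag_def)

lemma cmod_symb_le: "cmod (symb d U q) \<le> mag U q"
proof (cases d)
 case Dt
 then show ?thesis
  by (simp add: symb_def mag_def norm_mult mult_left_mono norm_triangle_ineq4)
next
 case (Dx j)
 have "\<bar>fst q $ j\<bar> \<le> jap (fst q)"
  using component_le_norm_cart[of "fst q" j] norm_le_jap[of "fst q"] by linarith
 then have "\<bar>fst q $ j\<bar> * cmod (fst U q + snd U q) \<le> jap (fst q) * (cmod (fst U q) + cmod (snd U q))"
  by (intro mult_mono norm_triangle_ineq) auto
 then show ?thesis using Dx by (simp add: symb_def mag_def norm_mult)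
qed

definition pnorm :: "real \<Rightarrow> real \<Rightarrow> real \<Rightarrow> pair \<Rightarrow> ennreal" where
 "pnorm r s b U = X_int r 1 s b (fst U) + X_int r (- 1) s b (snd U)"

locale wave_params =
 fixes r s b :: real
 assumes r1: "1 < r" and r2: "r \<le> 2" and s: "2 / r + 1 < s" and b0: "1 / r < b" and b1: "b < 1"
begin

abbreviation p :: real where "p \<equiv> dual_exp r"

abbreviation pn :: "pair \<Rightarrow> ennreal" where "pn \<equiv> pnorm r s b"

lemma p: "1 < p" "1 / r + 1 / p = 1" "0 < p" "0 \<le> p"
 using dual_exp[OF r1] by simp_all

text \<open>The hypotheses in the form required by the integrals, with \<open>s - 1\<close> the
  regularity of a differentiated factor: the first concerns the radii, the third the modulations.
  The bound 1 \<le> s - 1 uses r \<le> 2.\<close>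

lemma sr: "2 < (s - 1) * r" "1 \<le> s - 1" "1 < b * r" "0 < b" "0 \<le> b"
proof -
 show "2 < (s - 1) * r" using s r1 by (simp add: field_simps)
 have "1 \<le> 2 / r" using r1 r2 by simp
 then show "1 \<le> s - 1" using s by linarith
 show "1 < b * r" using b0 r1 by (simp add: field_simps)
 show "0 < b" using b0 r1 by (meson less_trans zero_less_divide_1_iff zero_less_one)
 then show "0 \<le> b" by simp
qed

text \<open>The output with modulation exponent 0 feeds the contraction. The output with exponent
  \<open>b\<close> and one space derivative less feeds the estimate of the time derivative of the
  solution.\<close>

lemma majorant_conv_le:
 assumes sg0: "sg0 \<in> {1, -1}"
 shows "\<exists>C\<ge>0. \<forall>U V. borel_pair U \<longrightarrow> borel_pair V \<longrightarrow>
  (\<L> x. ennreal (Xw sg0 (s - 1) 0 x powr p) * epow (\<L> y. ennreal (mag U y * mag V (x - y))) p) \<le> ennreal C * (pn U * pn V)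
 \<and> (\<L> x. ennreal (Xw sg0 (s - 2) b x powr p) * epow (\<L> y. ennreal (mag U y * mag V (x - y))) p) \<le> ennreal C * (pn U * pn V)"
proof -
 have kernel: "\<exists>C\<ge>0. \<forall>x. (\<L> y. ennreal ((Xw sg1 (s - 1) b y * Xw sg2 (s - 1) b (x - y)) powr (- r))) \<le> ennreal (C * Xw sg0 (s - 1) 0 x powr (- r))
  \<and> (\<L> y. ennreal ((Xw sg1 (s - 1) b y * Xw sg2 (s - 1) b (x - y)) powr (- r))) \<le> ennreal (C * Xw sg0 (s - 2) b x powr (- r))"
  if sg: "sg1 \<in> {1, -1}" "sg2 \<in> {1, -1}" for sg1 sg2
 proof -
  have a: "\<bar>sg1\<bar> = 1" "\<bar>sg2\<bar> = 1" using sg by auto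
  obtain C1 where C1: "0 \<le> C1" "\<And>x. (\<L> y. ennreal ((Xw sg1 (s - 1) b y * Xw sg2 (s - 1) b (x - y)) powr (- r))) \<le> ennreal (C1 * Xw sg0 (s - 1) 0 x powr (- r))"
   using wave_kernel_integral_le[OF sr(1,3) a] by blast
  obtain C2 where C2: "0 \<le> C2" "\<And>x. (\<L> y. ennreal ((Xw sg1 (s - 1) b y * Xw sg2 (s - 1) b (x - y)) powr (- r))) \<le> ennreal (C2 * Xw sg0 (s - 1 - 1) b x powr (- r))"
   using wave_kernel_integral_modulated_le[OF r1 sr(1,2,3) less_imp_le[OF b1] sg0 sg] by blast
  have "C1 * Xw sg0 (s - 1) 0 x powr (- r) \<le> max C1 C2 * Xw sg0 (s - 1) 0 x powr (- r)"
   and "C2 * Xw sg0 (s - 1 - 1) b x powr (- r) \<le> max C1 C2 * Xw sg0 (s - 2) b x powr (- r)" for x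
   by (auto intro!: mult_right_mono)
  note m = order_trans[OF C1(2) ennreal_leI[OF this(1)]] order_trans[OF C2(2) ennreal_leI[OF this(2)]]
  show ?thesis using C1(1) m by (intro exI[of _ "max C1 C2"] conjI allI) (simp add: le_max_iff_disj, blast+)
 qed
 define K where "K = (\<lambda>sg1 sg2. SOME C. 0 \<le> C \<and> (\<forall>x. (\<L> y. ennreal ((Xw sg1 (s - 1) b y * Xw sg2 (s - 1) b (x - y)) powr (- r))) \<le> ennreal (C * Xw sg0 (s - 1) 0 x powr (- r)) \<and> (\<L> y. ennreal ((Xw sg1 (s - 1) b y * Xw sg2 (s - 1) b (x - y)) powr (- r))) \<le> ennreal (C * Xw sg0 (s - 2) b x powr (- r))))"
 have K': "0 \<le> K sg1 sg2 \<and> (\<forall>x. (\<L> y. ennreal ((Xw sg1 (s - 1) b y * Xw sg2 (s - 1) b (x - y)) powr (- r))) \<le> ennreal (K sg1 sg2 * Xw sg0 (s - 1) 0 x powr (- r)) \<and> (\<L> y. ennreal ((Xw sg1 (s - 1) b y * Xw sg2 (s - 1) b (x - y)) powr (- r))) \<le> ennreal (K sg1 sg2 * Xw sg0 (s - 2) b x powr (- r)))"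
  if "sg1 \<in> {1, -1}" "sg2 \<in> {1, -1}" for sg1 sg2
  unfolding K_def by (rule someI_ex[OF kernel[OF that]])
 note K = K'[THEN conjunct1] K'[THEN conjunct2, rule_format, THEN conjunct1] K'[THEN conjunct2, rule_format, THEN conjunct2]
 \<comment> \<open>The majorant is a sum over both signs in each factor, giving four products; the
   p-th power of a sum of four terms costs 4^p.\<close>
 define D where "D = 4 powr p * (K 1 1 powr (p / r) + K 1 (-1) powr (p / r) + K (-1) 1 powr (p / r) + K (-1) (-1) powr (p / r))"
 let ?m = "\<lambda>(sg :: real) U q. jap (fst q) * cmod (sgnpart sg U q)"
 let ?Y = "\<lambda>(sg :: real) U. X_int r sg s b (sgnpart sg U)"
 have part: "(\<L> x. ennreal (\<omega> x powr p) * epow (\<L> y. ennreal (?m sg1 U y * ?m sg2 V (x - y))) p)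
   \<le> ennreal (K sg1 sg2 powr (p / r)) * (?Y sg1 U * ?Y sg2 V)"
  if sg: "sg1 \<in> {1, -1}" "sg2 \<in> {1, -1}" and [measurable]: "borel_pair U" "borel_pair V"
   and \<omega>: "\<omega> = Xw sg0 (s - 1) 0 \<or> \<omega> = Xw sg0 (s - 2) b" for sg1 sg2 U V \<omega>
 proof -
  have [measurable]: "\<omega> \<in> BM" using \<omega> by auto
  have Y: "?Y sg W = (\<L> q. ennreal ((Xw sg (s - 1) b q * ?m sg W q) powr p))" for sg W
   unfolding X_int_eq
  proof (intro nn_integral_cong arg_cong[where f="\<lambda>x. ennreal (x powr p)"])
   fix q :: "(real^3) \<times> real"
   have "jap (fst q) * jap (fst q) powr (s - 1) = jap (fst q) powr s" using powr_mult_base[of "jap (fst q)" "s - 1"] by simp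
   then show "Xw sg s b q * cmod (sgnpart sg W q) = Xw sg (s - 1) b q * ?m sg W q"
    by (simp add: Xw_def mult_ac)
  qed
  show ?thesis
   unfolding Y
  proof (rule bilinear_Holder[OF r1 p(1,2)])
   show "0 \<le> K sg1 sg2" by (rule K(1)[OF sg])
   show "(\<L> y. ennreal ((Xw sg1 (s - 1) b y * Xw sg2 (s - 1) b (x - y)) powr (- r))) \<le> ennreal (K sg1 sg2 * \<omega> x powr (- r))" for x
    using \<omega> K(2,3)[OF sg, of x] by auto
   show "0 < \<omega> x" for x using \<omega> by auto
  qed (simp_all, measurable)
 qed
 have main: "(\<L> x. ennreal (\<omega> x powr p) * epow (\<L> y. ennreal (mag U y * mag V (x - y))) p) \<le> ennreal D * (pn U * pn V)"
  if [measurable]: "borel_pair U" "borel_pair V" and \<omega>: "\<omega> = Xw sg0 (s - 1) 0 \<or> \<omega> = Xw sg0 (s - 2) b" for U V \<omega>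
 proof -
  have [measurable]: "\<omega> \<in> BM" using \<omega> by auto
  let ?I = "\<lambda>sg1 sg2 x. (\<L> y. ennreal (?m sg1 U y * ?m sg2 V (x - y)))"
  let ?T = "\<lambda>sg1 sg2. (\<L> x. ennreal (\<omega> x powr p) * epow (?I sg1 sg2 x) p)"
  have "(\<L> x. ennreal (\<omega> x powr p) * epow (\<L> y. ennreal (mag U y * mag V (x - y))) p)
   \<le> (\<L> x. ennreal (4 powr p) * ((ennreal (\<omega> x powr p) * epow (?I 1 1 x) p + ennreal (\<omega> x powr p) * epow (?I 1 (-1) x) p)
     + (ennreal (\<omega> x powr p) * epow (?I (-1) 1 x) p + ennreal (\<omega> x powr p) * epow (?I (-1) (-1) x) p)))"
  proof (rule nn_integral_mono)
   fix x
   have "(\<L> y. ennreal (mag U y * mag V (x - y)))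
    = (\<L> y. (ennreal (?m 1 U y * ?m 1 V (x - y)) + ennreal (?m 1 U y * ?m (-1) V (x - y)))
      + (ennreal (?m (-1) U y * ?m 1 V (x - y)) + ennreal (?m (-1) U y * ?m (-1) V (x - y))))"
    by (intro nn_integral_cong) (simp add: mag_def ring_distribs flip: ennreal_plus)
   also have "... = (?I 1 1 x + ?I 1 (-1) x) + (?I (-1) 1 x + ?I (-1) (-1) x)"
    by (subst nn_integral_add, measurable, subst nn_integral_add, measurable, subst nn_integral_add, measurable)
   finally have eq: "(\<L> y. ennreal (mag U y * mag V (x - y))) = (?I 1 1 x + ?I 1 (-1) x) + (?I (-1) 1 x + ?I (-1) (-1) x)" .
   have q: "epow ((w + x) + (y + z)) p \<le> ennreal (4 powr p) * ((epow w p + epow x p) + (epow y p + epow z p))" for w x y z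
   proof -
    have "epow ((w + x) + (y + z)) p \<le> ennreal (2 powr p) * (epow (w + x) p + epow (y + z) p)"
     by (rule epow_add_le[OF p(3)])
    also have "... \<le> ennreal (2 powr p) * (ennreal (2 powr p) * (epow w p + epow x p) + ennreal (2 powr p) * (epow y p + epow z p))"
     by (intro mult_left_mono add_mono epow_add_le[OF p(3)]) auto
    also have "... = (ennreal (2 powr p) * ennreal (2 powr p)) * ((epow w p + epow x p) + (epow y p + epow z p))"
     by (simp only: distrib_left mult.assoc)
    also have "ennreal (2 powr p) * ennreal (2 powr p) = ennreal (4 powr p)"
     by (simp add: powr_mult[symmetric] flip: ennreal_mult)
    finally show ?thesis .
   qed
   show "ennreal (\<omega> x powr p) * epow (\<L> y. ennreal (mag U y * mag V (x - y))) p
    \<le> ennreal (4 powr p) * ((ennreal (\<omega> x powr p) * epow (?I 1 1 x) p + ennreal (\<omega> x powr p) * epow (?I 1 (-1) x) p)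
     + (ennreal (\<omega> x powr p) * epow (?I (-1) 1 x) p + ennreal (\<omega> x powr p) * epow (?I (-1) (-1) x) p))"
    unfolding eq
    using mult_left_mono[OF q, of "ennreal (\<omega> x powr p)" "?I 1 1 x" "?I 1 (-1) x" "?I (-1) 1 x" "?I (-1) (-1) x"]
    by (simp only: distrib_left mult.left_commute zero_le simp_thms)
  qed
  also have "... = ennreal (4 powr p) * ((?T 1 1 + ?T 1 (-1)) + (?T (-1) 1 + ?T (-1) (-1)))"
   by (subst nn_integral_cmult, measurable, subst nn_integral_add, measurable, subst nn_integral_add, measurable, subst nn_integral_add, measurable)
  also have "... \<le> ennreal (4 powr p) * ((ennreal (K 1 1 powr (p / r)) * (?Y 1 U * ?Y 1 V) + ennreal (K 1 (-1) powr (p / r)) * (?Y 1 U * ?Y (-1) V))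
    + (ennreal (K (-1) 1 powr (p / r)) * (?Y (-1) U * ?Y 1 V) + ennreal (K (-1) (-1) powr (p / r)) * (?Y (-1) U * ?Y (-1) V)))"
   using that by (intro mult_left_mono add_mono part) auto
  also have "... \<le> ennreal (4 powr p) * ((ennreal (K 1 1 powr (p / r)) * (pn U * pn V) + ennreal (K 1 (-1) powr (p / r)) * (pn U * pn V))
    + (ennreal (K (-1) 1 powr (p / r)) * (pn U * pn V) + ennreal (K (-1) (-1) powr (p / r)) * (pn U * pn V)))"
   by (intro mult_left_mono add_mono mult_mono) (auto simp: pnorm_def)
  also have "... = ennreal D * (pn U * pn V)"
   by (simp add: D_def ennreal_mult ennreal_plus distrib_right distrib_left mult_ac)
  finally show ?thesis .
 qed
 have "0 \<le> D" by (simp add: D_def)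
 with main show ?thesis by (intro exI[of _ D]) auto
qed

end

context wave_params
begin

text \<open>The factor \<open>1 / jap\<close> in the forcing term raises the space exponents
  \<open>s - 1\<close> and \<open>s - 2\<close> of the product to \<open>s\<close> and
  \<open>s - 1\<close>.\<close>

lemma forcing_bound:
 assumes sg: "sg \<in> {1, -1}"
 shows "\<exists>C\<ge>0. \<forall>U V L. borel_pair U \<longrightarrow> borel_pair V \<longrightarrow> borel_pair L \<longrightarrow>
  X_int r sg s 0 (forcing d1 d2 sg U V L) \<le> ennreal C * (pn U * pn V + pn L)
 \<and> X_int r sg (s - 1) b (forcing d1 d2 sg U V L) \<le> ennreal C * (pn U * pn V + pn L)"
proof -
 obtain C where C: "0 \<le> C" and C': "\<And>U V. borel_pair U \<Longrightarrow> borel_pair V \<Longrightarrow>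
  (\<L> x. ennreal (Xw sg (s - 1) 0 x powr p) * epow (\<L> y. ennreal (mag U y * mag V (x - y))) p) \<le> ennreal C * (pn U * pn V)"
  "\<And>U V. borel_pair U \<Longrightarrow> borel_pair V \<Longrightarrow>
  (\<L> x. ennreal (Xw sg (s - 2) b x powr p) * epow (\<L> y. ennreal (mag U y * mag V (x - y))) p) \<le> ennreal C * (pn U * pn V)"
  using majorant_conv_le[OF sg] by blast
 define E where "E = 2 powr p * (C + 2 powr p * 4 powr p)"
 have main: "X_int r sg s0 b0 (forcing d1 d2 sg U V L) \<le> ennreal E * (pn U * pn V + pn L)"
  if [measurable]: "borel_pair U" "borel_pair V" "borel_pair L"
   and cv: "(\<L> x. ennreal (Xw sg (s0 - 1) b0 x powr p) * epow (\<L> y. ennreal (mag U y * mag V (x - y))) p) \<le> ennreal C * (pn U * pn V)"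
   and w: "\<And>sg' q. sg' \<in> {1, -1} \<Longrightarrow> Xw sg s0 b0 q / jap (fst q) \<le> 4 * Xw sg' s b q" for U V L s0 b0
 proof -
  let ?A = "\<lambda>q. conv4 (symb d1 U) (symb d2 V) q / complex_of_real (jap (fst q))"
  let ?B1 = "\<lambda>q. fst L q / complex_of_real (jap (fst q))" and ?B2 = "\<lambda>q. snd L q / complex_of_real (jap (fst q))"
  let ?B = "\<lambda>q. (fst L q + snd L q) / complex_of_real (jap (fst q))"
  have shift: "Xw sg s0 b0 q / jap (fst q) = Xw sg (s0 - 1) b0 q" for q
   by (simp add: Xw_def powr_diff)
  have A: "X_int r sg s0 b0 ?A \<le> ennreal C * (pn U * pn V)"
  proof -
   have "X_int r sg s0 b0 ?A \<le> (\<L> x. ennreal (Xw sg (s0 - 1) b0 x powr p) * epow (\<L> y. ennreal (mag U y * mag V (x - y))) p)"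
    unfolding X_int_eq
   proof (rule nn_integral_mono)
    fix x
    have "ennreal (cmod (conv4 (symb d1 U) (symb d2 V) x)) \<le> (\<L> y. ennreal (cmod (symb d1 U y * symb d2 V (x - y))))"
     unfolding conv4_def by (rule cmod_integral_le)
    also have "... \<le> (\<L> y. ennreal (mag U y * mag V (x - y)))"
     by (intro nn_integral_mono ennreal_leI) (simp add: norm_mult mult_mono cmod_symb_le)
    finally have "ennreal (cmod (conv4 (symb d1 U) (symb d2 V) x) powr p) \<le> epow (\<L> y. ennreal (mag U y * mag V (x - y))) p"
     by (intro ennreal_powr_le_epow p) auto
    then have "ennreal (Xw sg (s0 - 1) b0 x powr p) * ennreal (cmod (conv4 (symb d1 U) (symb d2 V) x) powr p) \<le> ennreal (Xw sg (s0 - 1) b0 x powr p) * epow (\<L> y. ennreal (mag U y * mag V (x - y))) p"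
     by (rule mult_left_mono) simp
    moreover have "Xw sg s0 b0 x * cmod (?A x) = Xw sg (s0 - 1) b0 x * cmod (conv4 (symb d1 U) (symb d2 V) x)"
     unfolding shift[symmetric] by (simp add: norm_divide)
    ultimately show "ennreal ((Xw sg s0 b0 x * cmod (?A x)) powr p) \<le> ennreal (Xw sg (s0 - 1) b0 x powr p) * epow (\<L> y. ennreal (mag U y * mag V (x - y))) p"
     by (simp only: powr_mult ennreal_mult powr_ge_zero)
   qed
   with cv show ?thesis by (rule order_trans[rotated])
  qed
  have B: "X_int r sg s0 b0 ?B \<le> ennreal (2 powr p * 4 powr p) * pn L"
  proof -
   have Bi: "X_int r sg s0 b0 (\<lambda>q. M q / complex_of_real (jap (fst q))) \<le> ennreal (4 powr p) * X_int r sg' s b M"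
    if sg': "sg' \<in> {1, -1}" and [measurable]: "M \<in> BM" for sg' M
   proof (rule X_int_mono[OF r1])
    fix q
    show "Xw sg s0 b0 q * cmod (M q / complex_of_real (jap (fst q))) \<le> 4 * (Xw sg' s b q * cmod (M q))"
     using mult_right_mono[OF w[OF sg', of q], of "cmod (M q)"] by (simp add: norm_divide mult.assoc)
   qed auto
   have "X_int r sg s0 b0 ?B \<le> ennreal (2 powr p) * (X_int r sg s0 b0 ?B1 + X_int r sg s0 b0 ?B2)"
    by (rule X_int_add_le[OF r1]) (auto simp: add_divide_distrib intro!: AE_I2 norm_triangle_ineq)
   also have "... \<le> ennreal (2 powr p) * (ennreal (4 powr p) * X_int r 1 s b (fst L) + ennreal (4 powr p) * X_int r (-1) s b (snd L))"
    by (intro mult_left_mono add_mono Bi) auto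
   also have "... = ennreal (2 powr p * 4 powr p) * pn L"
    by (simp add: pnorm_def ennreal_mult distrib_left mult.assoc)
   finally show ?thesis .
  qed
  have "X_int r sg s0 b0 (forcing d1 d2 sg U V L) \<le> ennreal (2 powr p) * (X_int r sg s0 b0 ?A + X_int r sg s0 b0 ?B)"
  proof (rule X_int_add_le[OF r1])
   show "AE q in lborel. cmod (forcing d1 d2 sg U V L q) \<le> cmod (?A q) + cmod (?B q)"
   proof (rule AE_I2)
    fix q
    define c where "c = 1 / (2 * pi) ^ 4 / 4"
    have "1 \<le> (2 * pi) ^ 4" using pi_ge_two by (intro one_le_power) linarith
    then have c: "0 \<le> c" "c \<le> 1" by (auto simp: c_def field_simps)
    have "forcing d1 d2 sg U V L q = - complex_of_real sg * (complex_of_real c * ?A q + ?B q / 2)"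
     by (simp add: forcing_def c_def add_divide_distrib ring_distribs)
    then have "cmod (forcing d1 d2 sg U V L q) = cmod (complex_of_real c * ?A q + ?B q / 2)"
     using sg by (auto simp: norm_mult)
    also have "... \<le> cmod (complex_of_real c * ?A q) + cmod (?B q / 2)" by (rule norm_triangle_ineq)
    also have "cmod (complex_of_real c * ?A q) \<le> cmod (?A q)"
     unfolding norm_mult using c by (simp add: mult_left_le_one_le del: norm_divide)
    also have "cmod (?B q / 2) \<le> cmod (?B q)" by (simp add: norm_divide field_simps)
    finally show "cmod (forcing d1 d2 sg U V L q) \<le> cmod (?A q) + cmod (?B q)" by simp
   qed
  qed measurable
  also have "... \<le> ennreal (2 powr p) * (ennreal C * (pn U * pn V) + ennreal (2 powr p * 4 powr p) * pn L)"
   by (intro mult_left_mono add_mono A B) auto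
  also have "... \<le> ennreal (2 powr p) * (ennreal (C + 2 powr p * 4 powr p) * (pn U * pn V) + ennreal (C + 2 powr p * 4 powr p) * pn L)"
   using C by (intro mult_left_mono add_mono mult_right_mono ennreal_leI) auto
  also have "... = ennreal E * (pn U * pn V + pn L)"
  proof -
   have "ennreal E = ennreal (2 powr p) * ennreal (C + 2 powr p * 4 powr p)"
    using C by (simp add: E_def ennreal_mult del: ennreal_plus)
   then show ?thesis by (simp only: distrib_left mult.assoc)
  qed
  finally show ?thesis .
 qed
 have w1: "Xw sg s 0 q / jap (fst q) \<le> 4 * Xw sg' s b q" for sg' q
 proof -
  have "1 \<le> japr (snd q + sg' * norm (fst q)) powr b" using sr by (simp add: ge_one_powr_ge_zero)
  then have "jap (fst q) powr s * 1 \<le> jap (fst q) powr s * japr (snd q + sg' * norm (fst q)) powr b"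
   by (intro mult_left_mono) auto
  moreover have "jap (fst q) powr s / jap (fst q) \<le> jap (fst q) powr s" by (simp add: field_simps)
  ultimately have "jap (fst q) powr s / jap (fst q) \<le> jap (fst q) powr s * japr (snd q + sg' * norm (fst q)) powr b" by linarith
  moreover have "0 \<le> jap (fst q) powr s * japr (snd q + sg' * norm (fst q)) powr b" by simp
  ultimately have "jap (fst q) powr s / jap (fst q) \<le> 4 * (jap (fst q) powr s * japr (snd q + sg' * norm (fst q)) powr b)" by linarith
  then show ?thesis by (simp add: Xw_def)
 qed
 \<comment> \<open>The linear term contains the component of the opposite sign. Exchanging the sign
   in the modulation costs at most \<langle>2 |\<xi>|\<rangle>^b, which the division by
   \<open>jap\<close> absorbs since b < 1.\<close>
 have w2: "Xw sg (s - 1) b q / jap (fst q) \<le> 4 * Xw sg' s b q" if sg': "sg' \<in> {1, -1}" for sg' q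
 proof -
  let ?z = "jap (fst q)" and ?P = "japr (snd q + sg' * norm (fst q))"
  have d: "japr ((sg - sg') * norm (fst q)) \<le> 2 * ?z"
  proof -
   have "\<bar>(sg - sg') * norm (fst q)\<bar> \<le> \<bar>norm (fst q) + norm (fst q)\<bar>"
    using sg sg' by (auto simp: abs_mult)
   then have "japr ((sg - sg') * norm (fst q)) \<le> japr (norm (fst q) + norm (fst q))" by (rule japr_mono)
   also have "... \<le> 2 * ?z" using japr_add_max[of "norm (fst q)" "norm (fst q)"] by (simp add: jap_japr)
   finally show ?thesis .
  qed
  have "japr (snd q + sg * norm (fst q)) \<le> 2 * ?P * japr ((sg - sg') * norm (fst q))"
   using japr_add_mult[of "snd q + sg' * norm (fst q)" "(sg - sg') * norm (fst q)"] by (simp add: algebra_simps)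
  also have "... \<le> 2 * ?P * (2 * ?z)" using d by (intro mult_left_mono) auto
  finally have "japr (snd q + sg * norm (fst q)) powr b \<le> (4 * (?P * ?z)) powr b"
   using sr by (intro powr_mono2) auto
  also have "... = 4 powr b * (?P powr b * ?z powr b)" by (simp add: powr_mult)
  also have "... \<le> 4 powr 1 * (?P powr b * ?z powr 1)"
   using b1 by (intro mult_mono powr_mono) auto
  finally have le: "japr (snd q + sg * norm (fst q)) powr b \<le> 4 * (?P powr b * ?z)" by simp
  have "Xw sg (s - 1) b q / ?z = (?z powr (s - 1) / ?z) * japr (snd q + sg * norm (fst q)) powr b"
   by (simp add: Xw_def)
  also have "... \<le> (?z powr (s - 1) / ?z) * (4 * (?P powr b * ?z))"
   using le by (intro mult_left_mono) auto
  also have "... = 4 * (?z powr (s - 1) * ?P powr b)" by simp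
  also have "... \<le> 4 * (?z powr s * ?P powr b)"
   by (intro mult_left_mono mult_right_mono powr_mono) auto
  finally show ?thesis by (simp add: Xw_def)
 qed
 have "0 \<le> E" using C by (simp add: E_def)
 with main[where ?s0.0=s and ?b0.0=0] main[where ?s0.0="s - 1" and ?b0.0=b] C' w1 w2 show ?thesis
  by (intro exI[of _ E]) (simp add: diff_diff_eq)
qed

text \<open>Hoelder in \<tau>: the inverse modulation weight lies in L^r because b r > 1. This is
  the embedding of X_{s,b} into functions continuous in time with values in the data space, in the
  stronger form of absolute integrability in \<tau>.\<close>

lemma time_mass_bound:
 assumes sg: "\<bar>sg\<bar> = 1" and [measurable]: "U \<in> BM"
 shows "(\<L> \<xi>. ennreal (jap \<xi> powr (s' * p)) * epow (\<L> \<tau>. ennreal (cmod (U (\<xi>, \<tau>)))) p)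
  \<le> ennreal (enn2real (Jint (b * r)) powr (p / r)) * X_int r sg s' b U"
proof -
 let ?J = "enn2real (Jint (b * r))"
 have J: "Jint (b * r) = ennreal ?J" using Jint_finite[OF sr(3)] by simp
 have *: "ennreal (jap \<xi> powr (s' * p)) * epow (\<L> \<tau>. ennreal (cmod (U (\<xi>, \<tau>)))) p
  \<le> ennreal (?J powr (p / r)) * (\<L> \<tau>. ennreal ((Xw sg s' b (\<xi>, \<tau>) * cmod (U (\<xi>, \<tau>))) powr p))" for \<xi>
 proof -
  let ?l = "\<lambda>\<tau>. japr (\<tau> + sg * norm \<xi>)"
  have "epow (\<L> \<tau>. ennreal (?l \<tau> powr (- b) * (?l \<tau> powr b * cmod (U (\<xi>, \<tau>))))) p
   \<le> ennreal (?J powr (p / r)) * (\<L> \<tau>. ennreal ((?l \<tau> powr b * cmod (U (\<xi>, \<tau>))) powr p))"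
  proof (rule Holder_epow[OF r1 p(1,2)])
   have "(?l \<tau> powr (- b)) powr r = japr (sg * norm \<xi> + 1 * \<tau>) powr (- (b * r))" for \<tau>
    by (simp only: powr_powr) (simp add: add.commute)
   then show "(\<L> \<tau>. ennreal ((?l \<tau> powr (- b)) powr r)) \<le> ennreal ?J"
    by (simp only: Jint_affine abs_one J[symmetric] order_refl)
  qed auto
  moreover have "?l \<tau> powr (- b) * (?l \<tau> powr b * cmod (U (\<xi>, \<tau>))) = cmod (U (\<xi>, \<tau>))" for \<tau>
   by (simp add: powr_minus)
  ultimately have "epow (\<L> \<tau>. ennreal (cmod (U (\<xi>, \<tau>)))) p
   \<le> ennreal (?J powr (p / r)) * (\<L> \<tau>. ennreal ((?l \<tau> powr b * cmod (U (\<xi>, \<tau>))) powr p))"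
   by (simp only:)
  then have "ennreal (jap \<xi> powr (s' * p)) * epow (\<L> \<tau>. ennreal (cmod (U (\<xi>, \<tau>)))) p
   \<le> ennreal (jap \<xi> powr (s' * p)) * (ennreal (?J powr (p / r)) * (\<L> \<tau>. ennreal ((?l \<tau> powr b * cmod (U (\<xi>, \<tau>))) powr p)))"
   by (rule mult_left_mono) simp
  also have "... = ennreal (?J powr (p / r)) * (\<L> \<tau>. ennreal (jap \<xi> powr (s' * p)) * ennreal ((?l \<tau> powr b * cmod (U (\<xi>, \<tau>))) powr p))"
   by (subst nn_integral_cmult) (simp_all add: mult.left_commute)
  also have "(\<L> \<tau>. ennreal (jap \<xi> powr (s' * p)) * ennreal ((?l \<tau> powr b * cmod (U (\<xi>, \<tau>))) powr p))
    = (\<L> \<tau>. ennreal ((Xw sg s' b (\<xi>, \<tau>) * cmod (U (\<xi>, \<tau>))) powr p))"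
   by (intro nn_integral_cong) (simp add: Xw_def powr_mult powr_powr mult.assoc flip: ennreal_mult)
  finally show ?thesis .
 qed
 have "(\<L> \<xi>. ennreal (jap \<xi> powr (s' * p)) * epow (\<L> \<tau>. ennreal (cmod (U (\<xi>, \<tau>)))) p)
  \<le> (\<L> \<xi>. ennreal (?J powr (p / r)) * (\<L> \<tau>. ennreal ((Xw sg s' b (\<xi>, \<tau>) * cmod (U (\<xi>, \<tau>))) powr p)))"
  by (intro nn_integral_mono *)
 also have "... = ennreal (?J powr (p / r)) * X_int r sg s' b U"
  unfolding X_int_eq by (subst nn_integral_cmult) (simp_all add: nn_integral_lborel_prod(1))
 finally show ?thesis .
qed

text \<open>Absolute integrability in \<tau> with the space regularity \<open>s - 1\<close> of a
  differentiated solution. It is enough to form products at each fixed time and is shared by the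
  true time derivative of a Z-function and by its replacement \<open>symb\<close>.\<close>

definition tame :: "spacetime \<Rightarrow> bool" where
 "tame P \<longleftrightarrow> P \<in> BM \<and>
  (\<L> \<xi>. ennreal (jap \<xi> powr ((s - 1) * p)) * epow (\<L> \<tau>. ennreal (cmod (P (\<xi>, \<tau>)))) p) < \<infinity>"

lemma tame_measurable [measurable_dest]: "tame P \<Longrightarrow> P \<in> BM"
 by (simp add: tame_def)

lemma tame_of_X_int:
 assumes "\<bar>sg\<bar> = 1" "U \<in> BM" "X_int r sg (s - 1) b U < \<infinity>"
 shows "tame U"
proof -
 have "ennreal (enn2real (Jint (b * r)) powr (p / r)) * X_int r sg (s - 1) b U < \<infinity>"
  using assms(3) by (simp add: ennreal_mult_less_top)
 with time_mass_bound[OF assms(1,2), of "s - 1"] show ?thesis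
  using assms(2) by (auto simp: tame_def intro: le_less_trans)
qed

lemma tame_add_mono:
 assumes "tame P" "tame Q" and [measurable]: "R \<in> BM"
  and le: "\<And>q. cmod (R q) \<le> cmod (P q) + cmod (Q q)"
 shows "tame R"
proof -
 let ?m = "\<lambda>P \<xi>. \<integral>\<^sup>+ \<tau>. ennreal (cmod (P (\<xi>, \<tau>))) \<partial>lborel"
 have [measurable]: "P \<in> BM" "Q \<in> BM" using assms by (auto simp: tame_def)
 have "?m R \<xi> \<le> ?m P \<xi> + ?m Q \<xi>" for \<xi>
  using le by (subst nn_integral_add[symmetric]) (auto intro!: nn_integral_mono ennreal_leI simp flip: ennreal_plus)
 then have "epow (?m R \<xi>) p \<le> ennreal (2 powr p) * (epow (?m P \<xi>) p + epow (?m Q \<xi>) p)" for \<xi>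
  using epow_mono[OF _ p(3)] epow_add_le[OF p(3)] order_trans by blast
 then have "(\<L> \<xi>. ennreal (jap \<xi> powr ((s - 1) * p)) * epow (?m R \<xi>) p)
  \<le> (\<L> \<xi>. ennreal (jap \<xi> powr ((s - 1) * p)) * (ennreal (2 powr p) * (epow (?m P \<xi>) p + epow (?m Q \<xi>) p)))"
  by (intro nn_integral_mono mult_left_mono) auto
 also have "... = (\<L> \<xi>. ennreal (2 powr p) * (ennreal (jap \<xi> powr ((s - 1) * p)) * epow (?m P \<xi>) p + ennreal (jap \<xi> powr ((s - 1) * p)) * epow (?m Q \<xi>) p))"
  by (intro nn_integral_cong) (simp add: distrib_left mult_ac)
 also have "... = ennreal (2 powr p) * ((\<L> \<xi>. ennreal (jap \<xi> powr ((s - 1) * p)) * epow (?m P \<xi>) p) + (\<L> \<xi>. ennreal (jap \<xi> powr ((s - 1) * p)) * epow (?m Q \<xi>) p))"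
  by (simp add: nn_integral_cmult nn_integral_add)
 also have "... < \<infinity>"
  using assms(1,2) by (simp add: tame_def ennreal_mult_less_top)
 finally show ?thesis by (simp add: tame_def)
qed

lemma tame_jap_mult:
 assumes sg: "\<bar>sg\<bar> = 1" and [measurable]: "U \<in> BM" and "X_int r sg s b U < \<infinity>"
 shows "tame (\<lambda>q. of_real (jap (fst q)) * U q)"
proof (rule tame_of_X_int[OF sg])
 have "X_int r sg (s - 1) b (\<lambda>q. of_real (jap (fst q)) * U q) \<le> ennreal (1 powr p) * X_int r sg s b U"
 proof (rule X_int_mono[OF r1])
  fix q :: "(real^3) \<times> real"
  have "jap (fst q) * jap (fst q) powr (s - 1) = jap (fst q) powr s" using powr_mult_base[of "jap (fst q)" "s - 1"] by simp
  moreover have "Xw sg (s - 1) b q * cmod (of_real (jap (fst q)) * U q) = (jap (fst q) * jap (fst q) powr (s - 1)) * japr (snd q + sg * norm (fst q)) powr b * cmod (U q)"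
   by (simp add: Xw_def norm_mult)
  ultimately show "Xw sg (s - 1) b q * cmod (of_real (jap (fst q)) * U q) \<le> 1 * (Xw sg s b q * cmod (U q))"
   by (simp add: Xw_def)
 qed auto
 with assms(3) show "X_int r sg (s - 1) b (\<lambda>q. of_real (jap (fst q)) * U q) < \<infinity>"
  by (auto intro: le_less_trans)
qed measurable

lemma tame_weaken:
 assumes "tame P" and [measurable]: "R \<in> BM" and le: "\<And>q. cmod (R q) \<le> cmod (P q)"
 shows "tame R"
 by (rule tame_add_mono[OF assms(1) assms(1) assms(2)]) (use le in \<open>smt (verit) norm_ge_zero\<close>)

lemma tame_of_X_int_s:
 assumes sg: "\<bar>sg\<bar> = 1" and [measurable]: "U \<in> BM" and "X_int r sg s b U < \<infinity>"
 shows "tame U"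
proof (rule tame_weaken[OF tame_jap_mult[OF assms]])
 show "cmod (U q) \<le> cmod (of_real (jap (fst q)) * U q)" for q
  using mult_right_mono[of 1 "jap (fst q)" "cmod (U q)"] by (simp add: norm_mult)
qed auto

lemma tame_AE:
 assumes "tame P"
 shows "AE \<xi> in lborel. (\<L> \<tau>. ennreal (cmod (P (\<xi>, \<tau>)))) < \<infinity>"
proof -
 note [measurable] = tame_measurable[OF assms]
 have "AE \<xi> in lborel. ennreal (jap \<xi> powr ((s - 1) * p)) * epow (\<L> \<tau>. ennreal (cmod (P (\<xi>, \<tau>)))) p \<noteq> \<infinity>"
  using assms by (intro nn_integral_PInf_AE) (auto simp: tame_def)
 then show ?thesis
 proof eventually_elim
  case (elim \<xi>)
  have "ennreal (jap \<xi> powr ((s - 1) * p)) \<noteq> 0" by (simp add: ennreal_eq_0_iff not_le)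
  with elim have "epow (\<L> \<tau>. ennreal (cmod (P (\<xi>, \<tau>)))) p \<noteq> \<top>"
   by (auto simp: ennreal_mult_eq_top_iff)
  then show ?case by (simp add: less_top)
 qed
qed

lemma AE_lborel_reflect:
 fixes P :: "'a::euclidean_space \<Rightarrow> bool"
 assumes "AE y in lborel. P y"
 shows "AE y in lborel. P (x - y)"
proof -
 have "AE y in distr lborel borel (\<lambda>y. x - y). P y" using assms by (simp only: lborel_distr_reflect)
 then show ?thesis by (rule AE_distrD[rotated]) simp
qed

text \<open>The bilinear Hoelder inequality, now in space only, with output weight 1, applied to the
  masses in \<tau>. The kernel integral is bounded because (s - 1) r \<ge> r and (s - 1) r + r >
  3.\<close>

lemma tame_conv_finite:
 assumes "tame P" "tame Q"
 shows "AE \<xi> in lborel. (\<L> \<eta>. (\<L> \<tau>. ennreal (cmod (P (\<eta>, \<tau>)))) * (\<L> \<tau>. ennreal (cmod (Q (\<xi> - \<eta>, \<tau>))))) < \<infinity>"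
proof -
 note [measurable] = tame_measurable[OF assms(1)] tame_measurable[OF assms(2)]
 let ?m = "\<lambda>P \<xi>. \<integral>\<^sup>+ \<tau>. ennreal (cmod (P (\<xi>, \<tau>))) \<partial>lborel"
 define f where "f = (\<lambda>\<eta>. enn2real (?m P \<eta>))"
 define g where "g = (\<lambda>\<eta>. enn2real (?m Q \<eta>))"
 define A where "A = (\<lambda>\<xi>. jap \<xi> powr (s - 1))"
 have [measurable]: "f \<in> BM" "g \<in> BM" "A \<in> BM"
  unfolding f_def g_def A_def by measurable
 have f: "AE \<eta> in lborel. ?m P \<eta> = ennreal (f \<eta>)" and g: "AE \<eta> in lborel. ?m Q \<eta> = ennreal (g \<eta>)"
  using tame_AE[OF assms(1)] tame_AE[OF assms(2)] by (auto simp: f_def g_def)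
 have fin: "(\<L> x. ennreal ((A x * h x) powr p)) < \<infinity>"
  if "AE \<eta> in lborel. ?m R \<eta> = ennreal (h \<eta>)" "tame R" "\<And>x. 0 \<le> h x" for R h
 proof -
  have "(\<L> x. ennreal ((A x * h x) powr p)) = (\<L> \<xi>. ennreal (jap \<xi> powr ((s - 1) * p)) * epow (?m R \<xi>) p)"
   using that(1) by (intro nn_integral_cong_AE, eventually_elim) (use that(3) in \<open>simp add: A_def powr_mult powr_powr ennreal_mult\<close>)
  with that(2) show ?thesis by (simp add: tame_def)
 qed
 obtain C where C: "0 \<le> C" "\<And>\<xi>. (\<L> \<eta>. ennreal (jap \<eta> powr (- ((s - 1) * r)) * jap (\<xi> - \<eta>) powr (- ((s - 1) * r)))) \<le> ennreal (C * jap \<xi> powr (- ((s - 1) * r - r)))"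
 proof -
  have "r \<le> (s - 1) * r" using mult_right_mono[OF sr(2), of r] r1 by simp
  moreover have "3 < (s - 1) * r + r" using sr(1) r1 by linarith
  moreover have "0 \<le> r" using r1 by simp
  ultimately show ?thesis using radial_conv_le[of r "(s - 1) * r"] that by blast
 qed
 have ker: "(\<L> y. ennreal ((A y * A (x - y)) powr (- r))) \<le> ennreal (C * 1 powr (- r))" for x
 proof -
  have "(\<L> y. ennreal ((A y * A (x - y)) powr (- r))) \<le> ennreal (C * jap x powr (- ((s - 1) * r - r)))"
   using C(2)[of x] by (simp add: A_def powr_mult powr_powr)
  also have "... \<le> ennreal (C * 1)"
  proof (intro ennreal_leI mult_left_mono C)
   have "r \<le> (s - 1) * r" using mult_right_mono[OF sr(2), of r] r1 by simp
   then have "jap x powr (- ((s - 1) * r - r)) \<le> jap x powr 0" by (intro powr_mono) auto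
   then show "jap x powr (- ((s - 1) * r - r)) \<le> 1" by simp
  qed
  finally show ?thesis by simp
 qed
 have "(\<L> x. ennreal (1 powr p) * epow (\<L> y. ennreal (f y * g (x - y))) p)
  \<le> ennreal (C powr (p / r)) * ((\<L> x. ennreal ((A x * f x) powr p)) * (\<L> x. ennreal ((A x * g x) powr p)))"
  by (rule bilinear_Holder[OF r1 p(1,2)]) (use C(1) ker in \<open>auto simp: A_def f_def g_def\<close>)
 also have "... < \<infinity>"
  using fin[OF f assms(1)] fin[OF g assms(2)] by (simp add: ennreal_mult_less_top f_def g_def)
 finally have "AE x in lborel. ennreal (1 powr p) * epow (\<L> y. ennreal (f y * g (x - y))) p \<noteq> \<infinity>"
  by (intro nn_integral_PInf_AE) auto
 then show ?thesis
 proof eventually_elim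
  case (elim \<xi>)
  have "(\<L> \<eta>. ?m P \<eta> * ?m Q (\<xi> - \<eta>)) = (\<L> \<eta>. ennreal (f \<eta> * g (\<xi> - \<eta>)))"
   using f AE_lborel_reflect[OF g, of \<xi>]
   by (intro nn_integral_cong_AE, eventually_elim) (simp add: f_def g_def ennreal_mult)
  then show ?case using elim by (simp add: less_top)
 qed
qed

end

section \<open>Convolution theorem in the time variable\<close>

lemma measurable_Pair_borel [measurable (raw)]:
 fixes P :: spacetime
 assumes "P \<in> BM"
 shows "(\<lambda>\<tau>. P (\<xi>, \<tau>)) \<in> BM"
 using assms by measurable

lemma integrable_section:
 fixes P :: spacetime
 assumes [measurable]: "P \<in> BM" and "(\<L> \<tau>. ennreal (cmod (P (\<xi>, \<tau>)))) < \<infinity>"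
 shows "integrable lborel (\<lambda>\<tau>. P (\<xi>, \<tau>))"
 using assms by (intro integrableI_bounded) auto

text \<open>The premise \<open>fin\<close> is the absolute convergence of the integral over the
  outer time frequency and both variables of the convolution. Fubini and a shift of the time
  frequency then separate the factors, while the space convolution stays.\<close>

lemma conv4_section:
 assumes [measurable]: "P \<in> BM" "Q \<in> BM"
  and fin: "(\<L> \<eta>. (\<L> \<tau>. ennreal (cmod (P (\<eta>, \<tau>)))) * (\<L> \<tau>. ennreal (cmod (Q (\<xi> - \<eta>, \<tau>))))) < \<infinity>"
 shows "integrable lborel (\<lambda>\<tau>. conv4 P Q (\<xi>, \<tau>))"
  and "(\<integral>\<tau>. cis (t * \<tau>) * conv4 P Q (\<xi>, \<tau>) \<partial>lborel)
   = (\<integral>\<eta>. (\<integral>l. cis (t * l) * P (\<eta>, l) \<partial>lborel) * (\<integral>l. cis (t * l) * Q (\<xi> - \<eta>, l) \<partial>lborel) \<partial>lborel)"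
proof -
 define H where "H = (\<lambda>t \<tau> y. cis (t * \<tau>) * (P y * Q ((\<xi>, \<tau>) - y)))"
 have mH [measurable]: "case_prod (H t) \<in> borel_measurable (lborel \<Otimes>\<^sub>M lborel)" for t
  unfolding H_def by measurable
 have Qt: "(\<L> \<tau>. ennreal (cmod (Q ((\<xi>, \<tau>) - y)))) = (\<L> \<tau>. ennreal (cmod (Q (\<xi> - fst y, \<tau>))))" for y
 proof -
  have "(\<xi>, \<tau>) - y = (\<xi> - fst y, \<tau> - snd y)" for \<tau> by (cases y) simp
  then show ?thesis
   using nn_integral_lborel_minus[of "\<lambda>\<tau>. ennreal (cmod (Q (\<xi> - fst y, \<tau>)))" "snd y"] by simp
 qed
 have int: "integrable (lborel \<Otimes>\<^sub>M lborel) (case_prod (H t))" for t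
 proof (rule integrableI_bounded)
  have "(\<integral>\<^sup>+ x. ennreal (norm (case_prod (H t) x)) \<partial>(lborel \<Otimes>\<^sub>M lborel)) = (\<L> y. (\<L> \<tau>. ennreal (cmod (H t \<tau> y))))"
   by (subst lborel_pair.nn_integral_snd[symmetric]) auto
  also have "... = (\<L> y. ennreal (cmod (P y)) * (\<L> \<tau>. ennreal (cmod (Q (\<xi> - fst y, \<tau>)))))"
   unfolding H_def norm_mult norm_cis Qt[symmetric]
   by (intro nn_integral_cong) (simp add: ennreal_mult nn_integral_cmult)
  also have "... = (\<L> \<eta>. (\<L> l. ennreal (cmod (P (\<eta>, l))) * (\<L> \<tau>. ennreal (cmod (Q (\<xi> - \<eta>, \<tau>))))))"
   by (subst nn_integral_lborel_prod(1)) simp_all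
  also have "... = (\<L> \<eta>. (\<L> \<tau>. ennreal (cmod (P (\<eta>, \<tau>)))) * (\<L> \<tau>. ennreal (cmod (Q (\<xi> - \<eta>, \<tau>)))))"
   by (intro nn_integral_cong nn_integral_multc) measurable
  finally show "(\<integral>\<^sup>+ x. ennreal (norm (case_prod (H t) x)) \<partial>(lborel \<Otimes>\<^sub>M lborel)) < \<infinity>" using fin by simp
 qed measurable
 have conv: "(\<integral>y. H t \<tau> y \<partial>lborel) = cis (t * \<tau>) * conv4 P Q (\<xi>, \<tau>)" for t \<tau>
  unfolding H_def conv4_def by (rule integral_mult_right_zero)
 have "integrable lborel (\<lambda>\<tau>. \<integral>y. H 0 \<tau> y \<partial>lborel)"
  using lborel_pair.integrable_fst'[OF int[of 0]] by simp
 then show "integrable lborel (\<lambda>\<tau>. conv4 P Q (\<xi>, \<tau>))" unfolding conv by simp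
 have inner: "(\<integral>\<tau>. H t \<tau> y \<partial>lborel) = (cis (t * snd y) * P y) * (\<integral>l. cis (t * l) * Q (\<xi> - fst y, l) \<partial>lborel)" for y
 proof -
  have e: "(\<xi>, \<tau>) - y = (\<xi> - fst y, \<tau> - snd y)" for \<tau> by (cases y) simp
  have "(\<integral>\<tau>. H t \<tau> y \<partial>lborel) = (\<integral>\<tau>. H t (snd y + 1 * \<tau>) y \<partial>lborel)"
   using lborel_integral_real_affine[of 1 "\<lambda>\<tau>. H t \<tau> y" "snd y"] by simp
  also have "... = (\<integral>\<tau>. (cis (t * snd y) * P y) * (cis (t * \<tau>) * Q (\<xi> - fst y, \<tau>)) \<partial>lborel)"
   by (intro Bochner_Integration.integral_cong) (simp_all add: H_def e ring_distribs mult_ac flip: cis_mult)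
  also have "... = (cis (t * snd y) * P y) * (\<integral>l. cis (t * l) * Q (\<xi> - fst y, l) \<partial>lborel)"
   by (rule integral_mult_right_zero)
  finally show ?thesis .
 qed
 have int2: "integrable (lborel \<Otimes>\<^sub>M lborel) (\<lambda>y. \<integral>\<tau>. H t \<tau> y \<partial>lborel)"
  using lborel_pair.integrable_snd[OF int[of t]] by (simp add: lborel_prod)
 have "(\<integral>\<tau>. cis (t * \<tau>) * conv4 P Q (\<xi>, \<tau>) \<partial>lborel) = (\<integral>\<tau>. (\<integral>y. H t \<tau> y \<partial>lborel) \<partial>lborel)"
  by (simp add: conv)
 also have "... = (\<integral>y. (\<integral>\<tau>. H t \<tau> y \<partial>lborel) \<partial>lborel)"
  by (rule lborel_pair.Fubini_integral[OF int, symmetric])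
 also have "... = (\<integral>\<eta>. (\<integral>l. (\<integral>\<tau>. H t \<tau> (\<eta>, l) \<partial>lborel) \<partial>lborel) \<partial>lborel)"
  using lborel_pair.integral_fst'[OF int2] by (simp add: lborel_prod)
 also have "... = (\<integral>\<eta>. (\<integral>l. (cis (t * l) * P (\<eta>, l)) * (\<integral>l. cis (t * l) * Q (\<xi> - \<eta>, l) \<partial>lborel) \<partial>lborel) \<partial>lborel)"
  by (simp add: inner)
 also have "... = (\<integral>\<eta>. (\<integral>l. cis (t * l) * P (\<eta>, l) \<partial>lborel) * (\<integral>l. cis (t * l) * Q (\<xi> - \<eta>, l) \<partial>lborel) \<partial>lborel)"
  by (intro Bochner_Integration.integral_cong refl integral_mult_left_zero)
 finally show "(\<integral>\<tau>. cis (t * \<tau>) * conv4 P Q (\<xi>, \<tau>) \<partial>lborel)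
   = (\<integral>\<eta>. (\<integral>l. cis (t * l) * P (\<eta>, l) \<partial>lborel) * (\<integral>l. cis (t * l) * Q (\<xi> - \<eta>, l) \<partial>lborel) \<partial>lborel)" .
qed

text \<open>Of the five factors 1 / (2 \<pi>) on the left, two go into the inverse transforms of the
  factors and three into \<open>conv3\<close>.\<close>

lemma time_inv_conv4:
 assumes "P \<in> BM" "Q \<in> BM"
  and "(\<L> \<eta>. (\<L> \<tau>. ennreal (cmod (P (\<eta>, \<tau>)))) * (\<L> \<tau>. ennreal (cmod (Q (\<xi> - \<eta>, \<tau>))))) < \<infinity>"
 shows "time_inv (\<lambda>q. of_real (1 / (2 * pi) ^ 4) * conv4 P Q q) t \<xi> = conv3 (time_inv P t) (time_inv Q t) \<xi>"
proof -
 let ?c = "complex_of_real (1 / (2 * pi))"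
 let ?a = "\<lambda>\<eta>. \<integral>l. cis (t * l) * P (\<eta>, l) \<partial>lborel" and ?b = "\<lambda>\<eta>. \<integral>l. cis (t * l) * Q (\<xi> - \<eta>, l) \<partial>lborel"
 have "time_inv (\<lambda>q. of_real (1 / (2 * pi) ^ 4) * conv4 P Q q) t \<xi>
  = ?c * (\<integral>\<tau>. ?c ^ 4 * (cis (t * \<tau>) * conv4 P Q (\<xi>, \<tau>)) \<partial>lborel)"
  unfolding time_inv_def by (simp add: power_one_over mult_ac)
 also have "... = ?c * (?c ^ 4 * (\<integral>\<eta>. ?a \<eta> * ?b \<eta> \<partial>lborel))"
  by (simp only: integral_mult_right_zero conv4_section(2)[OF assms])
 also have "... = ?c ^ 3 * (?c ^ 2 * (\<integral>\<eta>. ?a \<eta> * ?b \<eta> \<partial>lborel))"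
  by (simp only: power4_eq_xxxx power3_eq_cube power2_eq_square mult_ac)
 also have "?c ^ 2 * (\<integral>\<eta>. ?a \<eta> * ?b \<eta> \<partial>lborel) = (\<integral>\<eta>. ?c ^ 2 * (?a \<eta> * ?b \<eta>) \<partial>lborel)"
  by (rule integral_mult_right_zero[symmetric])
 also have "... = (\<integral>\<eta>. time_inv P t \<eta> * time_inv Q t (\<xi> - \<eta>) \<partial>lborel)"
  unfolding time_inv_def by (simp only: power2_eq_square mult_ac)
 finally show ?thesis
  by (simp add: conv3_def power_one_over)
qed

section \<open>Inverse time transforms\<close>

lemma interval_integral_cis:
 assumes "m \<noteq> 0"
 shows "(LBINT x=ereal a..ereal b. cis (x * m)) = (cis (b * m) - cis (a * m)) / (\<i> * complex_of_real m)"
proof -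
 have "(LBINT x=ereal a..ereal b. cis (x * m)) = cis (b * m) / (\<i> * complex_of_real m) - cis (a * m) / (\<i> * complex_of_real m)"
 proof (rule interval_integral_FTC_finite)
  fix x
  have "((\<lambda>x. cis (x * m)) has_vector_derivative (m *\<^sub>R (\<i> * cis (x * m)))) (at x)"
   unfolding has_vector_derivative_def
   by (rule has_derivative_eq_rhs[OF has_derivative_cis[OF has_derivative_mult_left[OF has_derivative_ident]]])
    (auto simp: fun_eq_iff scaleR_conv_of_real mult_ac)
  then have "((\<lambda>x. cis (x * m) / (\<i> * complex_of_real m)) has_vector_derivative (m *\<^sub>R (\<i> * cis (x * m)) / (\<i> * complex_of_real m))) (at x)"
   by (rule has_vector_derivative_divide)
  then show "((\<lambda>x. cis (x * m) / (\<i> * complex_of_real m)) has_vector_derivative cis (x * m)) (at x within {min a b..max a b})"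
   using assms by (auto simp: scaleR_conv_of_real intro: has_vector_derivative_at_within)
 qed (intro continuous_intros)
 then show ?thesis by (simp add: diff_divide_distrib)
qed

lemma interval_integral_transform:
 fixes f :: "real \<Rightarrow> complex"
 assumes f: "integrable lborel f"
 shows "(LBINT t=ereal a..ereal b. (\<integral>m. cis (t * m) * f m \<partial>lborel)) = (\<integral>m. (LBINT t=ereal a..ereal b. cis (t * m)) * f m \<partial>lborel)"
proof -
 note [measurable] = borel_measurable_integrable[OF f]
 have main: "(LBINT t=ereal a..ereal b. (\<integral>m. cis (t * m) * f m \<partial>lborel)) = (\<integral>m. (LBINT t=ereal a..ereal b. cis (t * m)) * f m \<partial>lborel)"
  if "a \<le> b" for a b
 proof -
  define H where "H = (\<lambda>t m. indicator {a..b} t *\<^sub>R (cis (t * m) * f m))"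
  have [measurable]: "case_prod H \<in> borel_measurable (lborel \<Otimes>\<^sub>M lborel)" unfolding H_def by measurable
  have int: "integrable (lborel \<Otimes>\<^sub>M lborel) (case_prod H)"
  proof (rule integrableI_bounded)
   have "(\<integral>\<^sup>+ x. ennreal (norm (case_prod H x)) \<partial>(lborel \<Otimes>\<^sub>M lborel)) = (\<L> t. (\<L> m. ennreal (cmod (H t m))))"
    by (subst lborel.nn_integral_fst[symmetric]) auto
   also have "... = (\<L> t. indicator {a..b} t * (\<L> m. ennreal (cmod (f m))))"
    unfolding H_def by (intro nn_integral_cong) (auto simp: norm_mult indicator_def)
   also have "... = ennreal (b - a) * (\<L> m. ennreal (cmod (f m)))"
    using that by (subst nn_integral_multc) auto
   also have "... < \<infinity>" using f by (simp add: ennreal_mult_less_top integrable_iff_bounded)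
   finally show "(\<integral>\<^sup>+ x. ennreal (norm (case_prod H x)) \<partial>(lborel \<Otimes>\<^sub>M lborel)) < \<infinity>" .
  qed measurable
  have "(LBINT t=ereal a..ereal b. (\<integral>m. cis (t * m) * f m \<partial>lborel)) = (\<integral>t. (\<integral>m. H t m \<partial>lborel) \<partial>lborel)"
   unfolding interval_integral_Icc[OF that] set_lebesgue_integral_def H_def
   by (intro Bochner_Integration.integral_cong refl integral_scaleR_right[symmetric])
  also have "... = (\<integral>m. (\<integral>t. H t m \<partial>lborel) \<partial>lborel)"
   by (rule lborel_pair.Fubini_integral[OF int, symmetric])
  also have "... = (\<integral>m. (LBINT t=ereal a..ereal b. cis (t * m)) * f m \<partial>lborel)"
  proof (rule Bochner_Integration.integral_cong)
   fix m
   have "(\<integral>t. H t m \<partial>lborel) = (\<integral>t. (indicator {a..b} t *\<^sub>R cis (t * m)) * f m \<partial>lborel)"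
    unfolding H_def by simp
   also have "... = (\<integral>t. indicator {a..b} t *\<^sub>R cis (t * m) \<partial>lborel) * f m"
    by (rule integral_mult_left_zero)
   finally show "(\<integral>t. H t m \<partial>lborel) = (LBINT t=ereal a..ereal b. cis (t * m)) * f m"
    unfolding interval_integral_Icc[OF that] set_lebesgue_integral_def .
  qed simp
  finally show ?thesis .
 qed
 show ?thesis
 proof (cases "a \<le> b")
  case True
  then show ?thesis by (rule main)
 next
  case False
  then show ?thesis
   using main[of b a]
   by (simp add: interval_integral_endpoints_reverse[of "ereal a" "ereal b"])
 qed
qed

lemma integrable_cis_mult:
 fixes f :: "real \<Rightarrow> complex"
 assumes "integrable lborel f"
 shows "integrable lborel (\<lambda>m. cis (t * m) * f m)"
 by (rule Bochner_Integration.integrable_bound[OF assms]) (use borel_measurable_integrable[OF assms] in \<open>auto simp: norm_mult\<close>)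

lemma continuous_transform:
 fixes f :: "real \<Rightarrow> complex"
 assumes f: "integrable lborel f"
 shows "continuous_on UNIV (\<lambda>t. \<integral>m. cis (t * m) * f m \<partial>lborel)"
 unfolding continuous_on_def
proof
 fix t :: real
 note [measurable] = borel_measurable_integrable[OF f]
 show "((\<lambda>t. \<integral>m. cis (t * m) * f m \<partial>lborel) \<longlongrightarrow> (\<integral>m. cis (t * m) * f m \<partial>lborel)) (at t within UNIV)"
 proof (rule tendsto_at_iff_sequentially[THEN iffD2], intro allI impI, unfold comp_def)
  fix x :: "nat \<Rightarrow> real" assume x: "x \<longlonglongrightarrow> t"
  show "(\<lambda>n. \<integral>m. cis (x n * m) * f m \<partial>lborel) \<longlonglongrightarrow> (\<integral>m. cis (t * m) * f m \<partial>lborel)"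
  proof (rule integral_dominated_convergence[where w="\<lambda>m. cmod (f m)"])
   show "AE m in lborel. (\<lambda>n. cis (x n * m) * f m) \<longlonglongrightarrow> cis (t * m) * f m"
   proof (intro AE_I2 tendsto_mult tendsto_const)
    fix m
    have "continuous_on UNIV (\<lambda>u. cis (u * m))" by (intro continuous_intros)
    then have "isCont (\<lambda>u. cis (u * m)) t" by (simp add: continuous_on_eq_continuous_at)
    from isCont_tendsto_compose[OF this x] show "(\<lambda>n. cis (x n * m)) \<longlonglongrightarrow> cis (t * m)" .
   qed
  qed (use f in \<open>auto simp: norm_mult\<close>)
 qed
qed

text \<open>A bound in L^1 that is uniform in \<open>m\<close>; it justifies exchanging the
  integrals when the inverse transform of a Duhamel extension is computed.\<close>

lemma kern_mass:
 assumes "0 < dt"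
 shows "\<exists>K\<ge>0. \<forall>m. (\<L> l. ennreal (cmod (kern dt l m))) \<le> ennreal K"
proof -
 obtain C where C: "0 \<le> C" "\<And>l m. cmod (kern dt l m) \<le> C * dt\<^sup>2 * (japr (dt * m) powr (- 1) * (japr (dt * (l - m)) powr (- 4) + japr (dt * l) powr (- 4)))"
  using kern_le assms by meson
 define J where "J = enn2real (Jint 4)"
 have J: "Jint 4 = ennreal J" "0 \<le> J" using Jint_finite[of 4] by (simp_all add: J_def)
 have "(\<L> l. ennreal (cmod (kern dt l m))) \<le> ennreal (C * dt * (J + J))" for m
 proof -
  have "(\<L> l. ennreal (cmod (kern dt l m)))
   \<le> (\<L> l. ennreal (C * dt) * (ennreal (\<bar>dt\<bar> * japr (- (dt * m) + dt * l) powr (- 4)) + ennreal (\<bar>dt\<bar> * japr (0 + dt * l) powr (- 4))))"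
  proof (rule nn_integral_mono)
   fix l
   let ?S = "japr (dt * (l - m)) powr (- 4) + japr (dt * l) powr (- 4)"
   have "japr (dt * m) powr (- 1) \<le> japr (dt * m) powr 0" by (intro powr_mono) auto
   then have "japr (dt * m) powr (- 1) * ?S \<le> 1 * ?S" by (intro mult_right_mono) auto
   then have "C * dt\<^sup>2 * (japr (dt * m) powr (- 1) * ?S) \<le> C * dt\<^sup>2 * ?S"
    using C by (intro mult_left_mono) auto
   with C(2)[of l m] have "cmod (kern dt l m) \<le> C * dt\<^sup>2 * ?S" by linarith
   also have "... = (C * dt) * (\<bar>dt\<bar> * japr (- (dt * m) + dt * l) powr (- 4) + \<bar>dt\<bar> * japr (0 + dt * l) powr (- 4))"
    using assms by (simp add: power2_eq_square algebra_simps)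
   finally show "ennreal (cmod (kern dt l m)) \<le> ennreal (C * dt) * (ennreal (\<bar>dt\<bar> * japr (- (dt * m) + dt * l) powr (- 4)) + ennreal (\<bar>dt\<bar> * japr (0 + dt * l) powr (- 4)))"
    using C assms by (simp add: ennreal_leI flip: ennreal_mult ennreal_plus)
  qed
  also have "... = ennreal (C * dt) * ((\<L> l. ennreal (\<bar>dt\<bar> * japr (- (dt * m) + dt * l) powr (- 4))) + (\<L> l. ennreal (\<bar>dt\<bar> * japr (0 + dt * l) powr (- 4))))"
   by (subst nn_integral_cmult, measurable, subst nn_integral_add) auto
  also have "... = ennreal (C * dt) * (ennreal J + ennreal J)"
   using assms by (subst (1 2) Jint_scaled) (auto simp: J)
  also have "... = ennreal (C * dt * (J + J))"
   using C assms J by (simp flip: ennreal_mult ennreal_plus)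
  finally show ?thesis .
 qed
 then show ?thesis using C assms J by (intro exI[of _ "C * dt * (J + J)"]) auto
qed

text \<open>The transform of \<open>kern\<close> at \<open>t - t0\<close>, multiplied by the phase
  exp(i t0 m), is the integral of exp(i t' m) from \<open>t0\<close> to \<open>t\<close>. The
  formula holds exactly where the dilated cutoff equals 1, hence the condition on |t - t0|.\<close>

lemma duh_ext_section:
 assumes [measurable]: "G \<in> BM" and G: "integrable lborel (\<lambda>\<tau>. G (\<xi>, \<tau>))" and dt: "0 < dt"
 shows "integrable lborel (\<lambda>\<tau>. duh_ext dt t0 sg G (\<xi>, \<tau>))"
  and "\<bar>t - t0\<bar> \<le> dt \<Longrightarrow> time_inv (duh_ext dt t0 sg G) t \<xi> =
   cis (- t * (sg * jap \<xi>)) * (LBINT t'=ereal t0..ereal t. cis (t' * (sg * jap \<xi>)) * time_inv G t' \<xi>)"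
proof -
 let ?c = "sg * jap \<xi>"
 define f where "f = (\<lambda>m. G (\<xi>, m - ?c))"
 define g where "g = (\<lambda>m. cis (t0 * m) * f m)"
 have f: "integrable lborel f"
  using lborel_integrable_real_affine[OF G, of 1 "- ?c"] by (simp add: f_def)
 have g: "integrable lborel g" unfolding g_def by (rule integrable_cis_mult[OF f])
 note [measurable] = borel_measurable_integrable[OF f] borel_measurable_integrable[OF g]
 define H where "H = (\<lambda>u l m. cis (u * l) * kern dt l m * g m)"
 have [measurable]: "case_prod (H u) \<in> borel_measurable (lborel \<Otimes>\<^sub>M lborel)" for u unfolding H_def by measurable
 obtain K where K: "0 \<le> K" "\<And>m. (\<L> l. ennreal (cmod (kern dt l m))) \<le> ennreal K"
  using kern_mass[OF dt] by blast
 have int: "integrable (lborel \<Otimes>\<^sub>M lborel) (case_prod (H u))" for u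
 proof (rule integrableI_bounded)
  have "(\<integral>\<^sup>+ x. ennreal (norm (case_prod (H u) x)) \<partial>(lborel \<Otimes>\<^sub>M lborel)) = (\<L> m. (\<L> l. ennreal (cmod (H u l m))))"
   by (subst lborel_pair.nn_integral_snd[symmetric]) auto
  also have "... \<le> (\<L> m. ennreal K * ennreal (cmod (g m)))"
  proof (rule nn_integral_mono)
   fix m
   have "(\<L> l. ennreal (cmod (H u l m))) = (\<L> l. ennreal (cmod (kern dt l m)) * ennreal (cmod (g m)))"
    by (intro nn_integral_cong) (simp add: H_def norm_mult ennreal_mult)
   also have "... = (\<L> l. ennreal (cmod (kern dt l m))) * ennreal (cmod (g m))"
    by (rule nn_integral_multc) measurable
   also have "... \<le> ennreal K * ennreal (cmod (g m))" by (intro mult_right_mono K) simp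
   finally show "(\<L> l. ennreal (cmod (H u l m))) \<le> ennreal K * ennreal (cmod (g m))" .
  qed
  also have "... = ennreal K * (\<L> m. ennreal (cmod (g m)))" by (rule nn_integral_cmult) measurable
  also have "... < \<infinity>" using g by (simp add: ennreal_mult_less_top integrable_iff_bounded)
  finally show "(\<integral>\<^sup>+ x. ennreal (norm (case_prod (H u) x)) \<partial>(lborel \<Otimes>\<^sub>M lborel)) < \<infinity>" .
 qed measurable
 have duh: "duh_ext dt t0 sg G (\<xi>, l - ?c) = cis (- t0 * l) * (\<integral>m. H 0 l m \<partial>lborel)" for l
  by (simp add: duh_ext_def H_def g_def f_def)
 have "integrable lborel (\<lambda>l. \<integral>m. H (- t0) l m \<partial>lborel)"
  using lborel_pair.integrable_fst'[OF int[of "- t0"]] by simp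
 moreover have "(\<integral>m. H (- t0) l m \<partial>lborel) = cis (- t0 * l) * (\<integral>m. H 0 l m \<partial>lborel)" for l
  by (subst integral_mult_right_zero[symmetric]) (simp add: H_def mult.assoc)
 moreover have "- ?c + 1 * l = l - ?c" for l by simp
 ultimately have "integrable lborel (\<lambda>l. duh_ext dt t0 sg G (\<xi>, - ?c + 1 * l))"
  by (simp only: duh)
 then show "integrable lborel (\<lambda>\<tau>. duh_ext dt t0 sg G (\<xi>, \<tau>))"
  using lborel_integrable_real_affine_iff[of 1 "\<lambda>\<tau>. duh_ext dt t0 sg G (\<xi>, \<tau>)" "- ?c"] by simp
 assume t: "\<bar>t - t0\<bar> \<le> dt"
 have "(\<integral>\<tau>. cis (t * \<tau>) * duh_ext dt t0 sg G (\<xi>, \<tau>) \<partial>lborel) = (\<integral>l. cis (t * (l - ?c)) * duh_ext dt t0 sg G (\<xi>, l - ?c) \<partial>lborel)"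
  using lborel_integral_real_affine[of 1 "\<lambda>\<tau>. cis (t * \<tau>) * duh_ext dt t0 sg G (\<xi>, \<tau>)" "- ?c"] by simp
 also have "... = (\<integral>l. cis (- t * ?c) * (\<integral>m. H (t - t0) l m \<partial>lborel) \<partial>lborel)"
 proof (rule Bochner_Integration.integral_cong)
  fix l
  have "(\<integral>m. H (t - t0) l m \<partial>lborel) = cis ((t - t0) * l) * (\<integral>m. H 0 l m \<partial>lborel)"
   by (subst integral_mult_right_zero[symmetric]) (simp add: H_def mult.assoc)
  moreover have "cis (t * (l - ?c)) * cis (- t0 * l) = cis (- t * ?c) * cis ((t - t0) * l)"
   by (simp add: cis_mult algebra_simps)
  ultimately show "cis (t * (l - ?c)) * duh_ext dt t0 sg G (\<xi>, l - ?c) = cis (- t * ?c) * (\<integral>m. H (t - t0) l m \<partial>lborel)"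
   unfolding duh by (simp only: mult.assoc[symmetric])
 qed simp
 also have "... = cis (- t * ?c) * (\<integral>l. (\<integral>m. H (t - t0) l m \<partial>lborel) \<partial>lborel)"
  by (rule integral_mult_right_zero)
 also have "(\<integral>l. (\<integral>m. H (t - t0) l m \<partial>lborel) \<partial>lborel) = (\<integral>m. (\<integral>l. H (t - t0) l m \<partial>lborel) \<partial>lborel)"
  by (rule lborel_pair.Fubini_integral[OF int, symmetric])
 also have "... = (\<integral>m. (LBINT t'=ereal t0..ereal t. cis (t' * m)) * f m \<partial>lborel)"
 proof (rule integral_cong_AE)
  \<comment> \<open>The primitive of the exponential divides by \<open>m\<close>; the exceptional
    frequency is a null set.\<close>
  have "AE m in lborel. m \<noteq> (0 :: real)" by (rule AE_lborel_singleton)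
  then show "AE m in lborel. (\<integral>l. H (t - t0) l m \<partial>lborel) = (LBINT t'=ereal t0..ereal t. cis (t' * m)) * f m"
  proof eventually_elim
   case (elim m)
   have "(\<integral>l. H (t - t0) l m \<partial>lborel) = (\<integral>l. cis ((t - t0) * l) * kern dt l m \<partial>lborel) * g m"
    unfolding H_def by (rule integral_mult_left_zero)
   also have "... = (cis ((t - t0) * m) - 1) / (\<i> * complex_of_real m) * (cis (t0 * m) * f m)"
    by (simp only: kern_transform[OF dt t] g_def)
   also have "... = (cis ((t - t0) * m) * cis (t0 * m) - cis (t0 * m)) / (\<i> * complex_of_real m) * f m"
    by (simp add: field_simps)
   also have "cis ((t - t0) * m) * cis (t0 * m) = cis (t * m)"
    by (simp add: cis_mult algebra_simps)
   finally show ?case by (simp only: interval_integral_cis[OF elim])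
  qed
  show "(\<lambda>m. (LBINT t'=ereal t0..ereal t. cis (t' * m)) * f m) \<in> borel_measurable lborel"
   unfolding interval_lebesgue_integral_def set_lebesgue_integral_def by measurable
 qed measurable
 also have "... = (LBINT t'=ereal t0..ereal t. (\<integral>m. cis (t' * m) * f m \<partial>lborel))"
  by (rule interval_integral_transform[OF f, symmetric])
 also have "(\<lambda>t'. \<integral>m. cis (t' * m) * f m \<partial>lborel) = (\<lambda>t'. cis (t' * ?c) * (\<integral>\<tau>. cis (t' * \<tau>) * G (\<xi>, \<tau>) \<partial>lborel))"
 proof
  fix t'
  have "(\<integral>m. cis (t' * m) * f m \<partial>lborel) = (\<integral>\<tau>. cis (t' * (?c + 1 * \<tau>)) * f (?c + 1 * \<tau>) \<partial>lborel)"
   using lborel_integral_real_affine[of 1 "\<lambda>m. cis (t' * m) * f m" ?c] by simp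
  also have "... = (\<integral>\<tau>. cis (t' * ?c) * (cis (t' * \<tau>) * G (\<xi>, \<tau>)) \<partial>lborel)"
   by (intro Bochner_Integration.integral_cong) (simp_all add: f_def ring_distribs mult.assoc flip: cis_mult)
  also have "... = cis (t' * ?c) * (\<integral>\<tau>. cis (t' * \<tau>) * G (\<xi>, \<tau>) \<partial>lborel)"
   by (rule integral_mult_right_zero)
  finally show "(\<integral>m. cis (t' * m) * f m \<partial>lborel) = cis (t' * ?c) * (\<integral>\<tau>. cis (t' * \<tau>) * G (\<xi>, \<tau>) \<partial>lborel)" .
 qed
 finally have E: "(\<integral>\<tau>. cis (t * \<tau>) * duh_ext dt t0 sg G (\<xi>, \<tau>) \<partial>lborel) =
   cis (- t * ?c) * (LBINT t'=ereal t0..ereal t. cis (t' * ?c) * (\<integral>\<tau>. cis (t' * \<tau>) * G (\<xi>, \<tau>) \<partial>lborel))" .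
 have I: "(LBINT t'=ereal t0..ereal t. cis (t' * ?c) * (of_real (1 / (2 * pi)) * (\<integral>\<tau>. cis (t' * \<tau>) * G (\<xi>, \<tau>) \<partial>lborel)))
  = of_real (1 / (2 * pi)) * (LBINT t'=ereal t0..ereal t. cis (t' * ?c) * (\<integral>\<tau>. cis (t' * \<tau>) * G (\<xi>, \<tau>) \<partial>lborel))"
  by (subst interval_lebesgue_integral_mult_right[symmetric]) (simp only: mult.left_commute)
 show "time_inv (duh_ext dt t0 sg G) t \<xi> =
   cis (- t * ?c) * (LBINT t'=ereal t0..ereal t. cis (t' * ?c) * time_inv G t' \<xi>)"
  unfolding time_inv_def E I by (simp only: mult.left_commute)
qed

lemma free_ext_section:
 shows "integrable lborel (\<lambda>\<tau>. free_ext sg F (\<xi>, \<tau>))"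
  and "\<bar>t\<bar> \<le> 1 \<Longrightarrow> time_inv (free_ext sg F) t \<xi> = cis (- t * (sg * jap \<xi>)) * F \<xi>"
proof -
 let ?c = "sg * jap \<xi>"
 have b: "integrable lborel bump" using integrable_bump_scaled[of 1] by (simp add: bump_scaled_def[abs_def])
 have "integrable lborel (\<lambda>\<tau>. bump (?c + 1 * \<tau>))"
  using lborel_integrable_real_affine[OF b, of 1 ?c] by simp
 then have "integrable lborel (\<lambda>\<tau>. of_real (2 * pi * bump (?c + 1 * \<tau>)) * F \<xi>)"
  by (intro integrable_mult_left integrable_of_real integrable_mult_right)
 then show "integrable lborel (\<lambda>\<tau>. free_ext sg F (\<xi>, \<tau>))"
  by (simp add: free_ext_def add.commute)
 assume t: "\<bar>t\<bar> \<le> 1"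
 have "(\<integral>\<tau>. cis (t * \<tau>) * free_ext sg F (\<xi>, \<tau>) \<partial>lborel) = (\<integral>\<tau>. (of_real (2 * pi) * F \<xi>) * (cis (t * \<tau>) * complex_of_real (bump_scaled 1 (\<tau> - (- ?c)))) \<partial>lborel)"
  by (intro Bochner_Integration.integral_cong) (simp_all add: free_ext_def bump_scaled_def mult_ac)
 also have "... = (of_real (2 * pi) * F \<xi>) * cis (t * (- ?c))"
  using t by (subst integral_mult_right_zero, subst bump_scaled_transform) auto
 finally show "time_inv (free_ext sg F) t \<xi> = cis (- t * ?c) * F \<xi>"
  by (simp add: time_inv_def mult_ac)
qed

lemma time_inv_cmult: "time_inv (\<lambda>q. c (fst q) * U q) t \<xi> = c \<xi> * time_inv U t \<xi>"
proof -
 have "(\<integral>\<tau>. cis (t * \<tau>) * (c \<xi> * U (\<xi>, \<tau>)) \<partial>lborel) = (\<integral>\<tau>. c \<xi> * (cis (t * \<tau>) * U (\<xi>, \<tau>)) \<partial>lborel)"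
  by (simp only: mult.left_commute)
 also have "... = c \<xi> * (\<integral>\<tau>. cis (t * \<tau>) * U (\<xi>, \<tau>) \<partial>lborel)"
  by (rule integral_mult_right_zero)
 finally show ?thesis by (simp add: time_inv_def)
qed

lemma time_inv_add:
 assumes "integrable lborel (\<lambda>\<tau>. U (\<xi>, \<tau>))" "integrable lborel (\<lambda>\<tau>. V (\<xi>, \<tau>))"
 shows "time_inv (\<lambda>q. U q + V q) t \<xi> = time_inv U t \<xi> + time_inv V t \<xi>"
 using Bochner_Integration.integral_add[OF integrable_cis_mult[OF assms(1), of t] integrable_cis_mult[OF assms(2), of t]]
 by (simp add: time_inv_def ring_distribs)

lemma time_inv_diff:
 assumes "integrable lborel (\<lambda>\<tau>. U (\<xi>, \<tau>))" "integrable lborel (\<lambda>\<tau>. V (\<xi>, \<tau>))"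
 shows "time_inv (\<lambda>q. U q - V q) t \<xi> = time_inv U t \<xi> - time_inv V t \<xi>"
 using Bochner_Integration.integral_diff[OF integrable_cis_mult[OF assms(1), of t] integrable_cis_mult[OF assms(2), of t]]
 by (simp add: time_inv_def ring_distribs right_diff_distrib)

lemma continuous_time_inv:
 assumes "integrable lborel (\<lambda>\<tau>. U (\<xi>, \<tau>))"
 shows "continuous_on S (\<lambda>t. time_inv U t \<xi>)"
proof -
 have "continuous_on UNIV (\<lambda>t. time_inv U t \<xi>)"
  unfolding time_inv_def by (intro continuous_on_mult continuous_on_const continuous_transform[OF assms])
 then show ?thesis by (rule continuous_on_subset) simp
qed

lemma time_inv_cong_AE:
 assumes "AE \<tau> in lborel. U (\<xi>, \<tau>) = V (\<xi>, \<tau>)"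
  and [measurable]: "U \<in> BM" "V \<in> BM"
 shows "time_inv U t \<xi> = time_inv V t \<xi>"
 unfolding time_inv_def
 by (intro arg_cong[where f="(*) _"] integral_cong_AE) (use assms(1) in \<open>auto elim: eventually_mono\<close>)

lemma AE_lborel_section:
 fixes P :: "'a::euclidean_space \<times> 'b::euclidean_space \<Rightarrow> bool"
 assumes "AE q in lborel. P q"
 shows "AE x in lborel. AE y in lborel. P (x, y)"
proof -
 have "AE q in lborel \<Otimes>\<^sub>M lborel. P q" using assms by (simp only: lborel_prod)
 then show ?thesis by (rule lborel_pair.AE_pair)
qed

text \<open>The exceptional set for each time separately may depend on the time. The union over
  rational times is still null, and continuity in time extends the equality to the whole
  interval.\<close>

lemma AE_all_interval:
 fixes f g :: "real \<Rightarrow> 'a \<Rightarrow> complex"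
 assumes "a < b" and eq: "\<And>t. t \<in> {a..b} \<Longrightarrow> AE x in M. f t x = g t x"
  and c: "AE x in M. continuous_on {a..b} (\<lambda>t. f t x) \<and> continuous_on {a..b} (\<lambda>t. g t x)"
 shows "AE x in M. \<forall>t\<in>{a..b}. f t x = g t x"
proof -
 let ?D = "\<rat> \<inter> {a..b}"
 have "AE x in M. \<forall>t\<in>?D. f t x = g t x"
  using eq by (subst AE_ball_countable) (auto intro: countable_subset[OF _ countable_rat])
 with c show ?thesis
 proof eventually_elim
  case (elim x)
  have cl: "closure ?D = {a..b}"
  proof
   show "closure ?D \<subseteq> {a..b}" by (rule closure_minimal) auto
   show "{a..b} \<subseteq> closure ?D"
   proof
    fix t assume t: "t \<in> {a..b}"
    have "\<exists>y\<in>?D. dist y t < e" if "0 < e" for e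
    proof -
     have "max a (t - e) < min b (t + e)" using t that \<open>a < b\<close> by auto
     then obtain y where "y \<in> \<rat>" "max a (t - e) < y" "y < min b (t + e)" using Rats_dense_in_real by blast
     then show ?thesis by (intro bexI[of _ y]) (auto simp: dist_real_def)
    qed
    then show "t \<in> closure ?D" by (simp add: closure_approachable)
   qed
  qed
  have "f t x - g t x = 0" if "t \<in> {a..b}" for t
  proof (rule continuous_constant_on_closure[where S="?D" and f="\<lambda>t. f t x - g t x"])
   show "continuous_on (closure ?D) (\<lambda>t. f t x - g t x)" unfolding cl using elim by (intro continuous_on_diff) auto
  qed (use elim that cl in auto)
  then show ?case by simp
 qed
qed

lemma time_inv_dt_hat:
 assumes "integrable lborel (\<lambda>\<tau>. U (\<xi>, \<tau>))" "integrable lborel (\<lambda>\<tau>. dt_hat U (\<xi>, \<tau>))"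
 shows "(LBINT t=ereal a..ereal c. time_inv (dt_hat U) t \<xi>) = time_inv U c \<xi> - time_inv U a \<xi>"
proof -
 have "(LBINT t=ereal a..ereal c. (\<integral>\<tau>. cis (t * \<tau>) * dt_hat U (\<xi>, \<tau>) \<partial>lborel)) = (\<integral>\<tau>. (LBINT t=ereal a..ereal c. cis (t * \<tau>)) * dt_hat U (\<xi>, \<tau>) \<partial>lborel)"
  by (rule interval_integral_transform[OF assms(2)])
 also have "... = (\<integral>\<tau>. cis (c * \<tau>) * U (\<xi>, \<tau>) - cis (a * \<tau>) * U (\<xi>, \<tau>) \<partial>lborel)"
 proof (rule integral_cong_AE)
  have "AE m in lborel. m \<noteq> (0 :: real)" by (rule AE_lborel_singleton)
  then show "AE m in lborel. (LBINT t=ereal a..ereal c. cis (t * m)) * dt_hat U (\<xi>, m) = cis (c * m) * U (\<xi>, m) - cis (a * m) * U (\<xi>, m)"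
  proof eventually_elim
   case (elim m)
   then show ?case unfolding interval_integral_cis[OF elim] by (simp add: dt_hat_def field_simps)
  qed
  note [measurable] = borel_measurable_integrable[OF assms(1)] borel_measurable_integrable[OF assms(2)]
  show "(\<lambda>\<tau>. (LBINT t=ereal a..ereal c. cis (t * \<tau>)) * dt_hat U (\<xi>, \<tau>)) \<in> borel_measurable lborel"
   unfolding interval_lebesgue_integral_def set_lebesgue_integral_def by measurable
  show "(\<lambda>\<tau>. cis (c * \<tau>) * U (\<xi>, \<tau>) - cis (a * \<tau>) * U (\<xi>, \<tau>)) \<in> borel_measurable lborel" by measurable
 qed
 also have "... = (\<integral>\<tau>. cis (c * \<tau>) * U (\<xi>, \<tau>) \<partial>lborel) - (\<integral>\<tau>. cis (a * \<tau>) * U (\<xi>, \<tau>) \<partial>lborel)"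
  by (rule Bochner_Integration.integral_diff[OF integrable_cis_mult integrable_cis_mult, OF assms(1) assms(1)])
 finally show ?thesis
  unfolding time_inv_def by (simp add: diff_divide_distrib)
qed

text \<open>The second half of the Z-norm makes \<tau> U integrable in \<tau> for almost every
  \<xi>, so the time section is an integral of a continuous function and hence
  differentiable.\<close>

lemma time_inv_has_derivative:
 assumes "integrable lborel (\<lambda>\<tau>. U (\<xi>, \<tau>))" "integrable lborel (\<lambda>\<tau>. dt_hat U (\<xi>, \<tau>))" "a \<le> t" "t \<le> c"
 shows "((\<lambda>t. time_inv U t \<xi>) has_vector_derivative time_inv (dt_hat U) t \<xi>) (at t within {a..c})"
proof -
 have "((\<lambda>u. LBINT y=ereal a..ereal u. time_inv (dt_hat U) y \<xi>) has_vector_derivative time_inv (dt_hat U) t \<xi>) (at t within {a..c})"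
  using assms by (intro interval_integral_FTC2) (auto intro: continuous_time_inv)
 then have "((\<lambda>u. time_inv U u \<xi> - time_inv U a \<xi> + time_inv U a \<xi>) has_vector_derivative (time_inv (dt_hat U) t \<xi> + 0)) (at t within {a..c})"
  unfolding time_inv_dt_hat[OF assms(1,2)] by (intro has_vector_derivative_add has_vector_derivative_const)
 then show ?thesis by simp
qed

lemma cis_has_vector_derivative:
 "((\<lambda>t. cis (t * m)) has_vector_derivative (\<i> * complex_of_real m * cis (t * m))) (at t within S)"
proof -
 have "((\<lambda>x. cis (x * m)) has_vector_derivative (m *\<^sub>R (\<i> * cis (t * m)))) (at t within S)"
  unfolding has_vector_derivative_def
  by (rule has_derivative_eq_rhs[OF has_derivative_cis[OF has_derivative_mult_left[OF has_derivative_ident]]])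
   (auto simp: fun_eq_iff scaleR_conv_of_real mult_ac)
 then show ?thesis by (simp add: scaleR_conv_of_real mult_ac)
qed

text \<open>The two forcing terms \<open>\<mp> g / \<langle>\<xi>\<rangle>\<close> cancel in the sum of the two Duhamel formulas.\<close>
lemma duhamel_time_derivative:
 fixes g :: "real \<Rightarrow> complex"
 assumes int: "integrable lborel (\<lambda>\<tau>. Up (\<xi>, \<tau>))" "integrable lborel (\<lambda>\<tau>. dt_hat Up (\<xi>, \<tau>))"
   "integrable lborel (\<lambda>\<tau>. Um (\<xi>, \<tau>))" "integrable lborel (\<lambda>\<tau>. dt_hat Um (\<xi>, \<tau>))"
  and dt: "0 < dt" and g: "continuous_on {-dt..dt} g"
  and up: "\<And>t. t \<in> {-dt..dt} \<Longrightarrow> time_inv Up t \<xi> = cis (- 1 * t * jap \<xi>) * fp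
   - \<i> * (LBINT t'=0..t. cis (- 1 * (t - t') * jap \<xi>) * (- of_real (1 / jap \<xi>) * g t'))"
  and um: "\<And>t. t \<in> {-dt..dt} \<Longrightarrow> time_inv Um t \<xi> = cis (- (- 1) * t * jap \<xi>) * fm
   - \<i> * (LBINT t'=0..t. cis (- (- 1) * (t - t') * jap \<xi>) * (- of_real ((- 1) / jap \<xi>) * g t'))"
  and t: "t \<in> {-dt..dt}"
 shows "time_inv (dt_hat (\<lambda>q. Up q + Um q)) t \<xi> = - \<i> * of_real (jap \<xi>) * (time_inv Up t \<xi> - time_inv Um t \<xi>)"
proof -
 let ?z = "jap \<xi>"
 have D: "time_inv (dt_hat U) t \<xi> = - \<i> * of_real (sg * ?z) * time_inv U t \<xi> + \<i> * of_real (sg / ?z) * g t"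
  if U: "integrable lborel (\<lambda>\<tau>. U (\<xi>, \<tau>))" "integrable lborel (\<lambda>\<tau>. dt_hat U (\<xi>, \<tau>))"
   and d: "\<And>t. t \<in> {-dt..dt} \<Longrightarrow> time_inv U t \<xi> = cis (- sg * t * ?z) * f
   - \<i> * (LBINT t'=0..t. cis (- sg * (t - t') * ?z) * (- of_real (sg / ?z) * g t'))" for U sg f
 proof -
  define h where "h = (\<lambda>t'. cis (t' * (sg * ?z)) * (- of_real (sg / ?z) * g t'))"
  define A where "A = (\<lambda>t. cis (t * (- sg * ?z)))"
  define B where "B = (\<lambda>t. f - \<i> * (LBINT t'=ereal 0..ereal t. h t'))"
  have eq: "time_inv U t \<xi> = A t * B t" if "t \<in> {-dt..dt}" for t
  proof -
   have "cis (- sg * (t - t') * ?z) = A t * cis (t' * (sg * ?z))" for t'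
    by (simp add: A_def cis_mult algebra_simps)
   then have "(LBINT t'=0..t. cis (- sg * (t - t') * ?z) * (- of_real (sg / ?z) * g t')) = A t * (LBINT t'=ereal 0..ereal t. h t')"
    by (simp only: h_def mult.assoc zero_ereal_def interval_lebesgue_integral_mult_right)
   moreover have "cis (- sg * t * ?z) = A t" by (simp add: A_def mult_ac)
   ultimately show ?thesis
    unfolding d[OF that] B_def by (simp add: right_diff_distrib mult_ac)
  qed
  have "((\<lambda>u. LBINT y=ereal 0..ereal u. h y) has_vector_derivative h t) (at t within {-dt..dt})"
   using dt t g unfolding h_def by (intro interval_integral_FTC2 continuous_intros) auto
  then have dB: "(B has_vector_derivative (0 - \<i> * h t)) (at t within {-dt..dt})"
   unfolding B_def by (intro has_vector_derivative_diff has_vector_derivative_const has_vector_derivative_mult_right)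
  have dA: "(A has_vector_derivative (\<i> * of_real (- sg * ?z) * A t)) (at t within {-dt..dt})"
   unfolding A_def by (rule cis_has_vector_derivative)
  have "((\<lambda>t. A t * B t) has_vector_derivative (A t * (0 - \<i> * h t) + \<i> * of_real (- sg * ?z) * A t * B t)) (at t within {-dt..dt})"
   by (rule has_vector_derivative_mult[OF dA dB])
  then have "((\<lambda>t. time_inv U t \<xi>) has_vector_derivative (A t * (0 - \<i> * h t) + \<i> * of_real (- sg * ?z) * A t * B t)) (at t within {-dt..dt})"
   by (rule has_vector_derivative_transform[OF t, rotated]) (simp add: eq)
  moreover have "((\<lambda>t. time_inv U t \<xi>) has_vector_derivative time_inv (dt_hat U) t \<xi>) (at t within {-dt..dt})"
   using t by (intro time_inv_has_derivative U) auto
  \<comment> \<open>Both derivatives are taken within the interval, one-sided at its ends; they are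
    unique because every point of it is a limit point.\<close>
  ultimately have "time_inv (dt_hat U) t \<xi> = A t * (0 - \<i> * h t) + \<i> * of_real (- sg * ?z) * A t * B t"
   using vector_derivative_unique_within[of t "{-dt..dt}"] dt t
   by (metis (no_types, lifting) trivial_limit_within islimpt_Icc minus_less_iff neg_less_pos less_trans neg_less_0_iff_less atLeastAtMost_iff)
  also have "A t * (0 - \<i> * h t) = \<i> * of_real (sg / ?z) * g t"
  proof -
   have "A t * cis (t * (sg * ?z)) = 1" by (simp add: A_def cis_mult)
   then have "A t * h t = - of_real (sg / ?z) * g t" by (simp add: h_def mult.assoc[symmetric])
   then show ?thesis by (simp add: mult.left_commute[of "A t"])
  qed
  finally show ?thesis using eq[OF t] by (simp add: mult.assoc)
 qed
 have dt: "dt_hat (\<lambda>q. Up q + Um q) = (\<lambda>q. dt_hat Up q + dt_hat Um q)"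
  by (simp add: fun_eq_iff dt_hat_def ring_distribs)
 have "time_inv (dt_hat (\<lambda>q. Up q + Um q)) t \<xi> = time_inv (dt_hat Up) t \<xi> + time_inv (dt_hat Um) t \<xi>"
  unfolding dt by (rule time_inv_add[OF int(2,4)])
 also have "... = - \<i> * complex_of_real ?z * (time_inv Up t \<xi> - time_inv Um t \<xi>)"
 proof -
  have "time_inv (dt_hat Up) t \<xi> = - \<i> * of_real (1 * ?z) * time_inv Up t \<xi> + \<i> * of_real (1 / ?z) * g t"
   by (rule D[OF int(1,2) up])
  moreover have "time_inv (dt_hat Um) t \<xi> = - \<i> * of_real ((- 1) * ?z) * time_inv Um t \<xi> + \<i> * of_real ((- 1) / ?z) * g t"
   by (rule D[OF int(3,4) um])
  ultimately show ?thesis by (simp add: algebra_simps)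
 qed
 finally show ?thesis .
qed

section \<open>The Duhamel map\<close>

definition psub :: "pair \<Rightarrow> pair \<Rightarrow> pair" where
 "psub U V = (\<lambda>q. fst U q - fst V q, \<lambda>q. snd U q - snd V q)"

definition pzero :: "pair" where
 "pzero = (\<lambda>_. 0, \<lambda>_. 0)"

lemma psub_pzero [simp]: "psub U pzero = U"
 by (simp add: psub_def pzero_def)

lemma sgnpart_psub: "sgnpart sg (psub U V) q = sgnpart sg U q - sgnpart sg V q"
 by (simp add: sgnpart_def psub_def)

lemma symb_psub: "symb d (psub U V) q = symb d U q - symb d V q"
 by (cases d) (simp_all add: symb_def psub_def algebra_simps)

lemma borel_pair_psub [measurable]: "borel_pair U \<Longrightarrow> borel_pair V \<Longrightarrow> borel_pair (psub U V)"
 unfolding borel_pair_def psub_def fst_conv snd_conv by (intro conjI borel_measurable_diff) auto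

lemma borel_pair_pzero [simp, measurable]: "borel_pair pzero"
 by (simp add: borel_pair_def pzero_def)

text \<open>A non-integrable function has integral 0, so additivity of \<open>duh_ext\<close> is not
  automatic. Integrable sections in \<tau> and the boundedness of \<open>kern\<close> in
  \<open>m\<close> secure it.\<close>

lemma duh_ext_diff:
 assumes dt: "0 < dt" and [measurable]: "G1 \<in> BM" "G2 \<in> BM" "G3 \<in> BM"
  and int: "integrable lborel (\<lambda>\<tau>. G1 (\<xi>, \<tau>))" "integrable lborel (\<lambda>\<tau>. G2 (\<xi>, \<tau>))"
  and eq: "AE \<tau> in lborel. G1 (\<xi>, \<tau>) - G2 (\<xi>, \<tau>) = G3 (\<xi>, \<tau>)"
 shows "duh_ext dt t0 sg G1 (\<xi>, \<tau>) - duh_ext dt t0 sg G2 (\<xi>, \<tau>) = duh_ext dt t0 sg G3 (\<xi>, \<tau>)"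
proof -
 let ?c = "sg * jap \<xi>" and ?l = "\<tau> + sg * jap \<xi>"
 let ?k = "\<lambda>G m. kern dt ?l m * (cis (t0 * m) * G (\<xi>, m - ?c))"
 obtain K where K: "\<And>m. cmod (kern dt ?l m) \<le> K"
 proof -
  obtain C where C: "0 \<le> C" "\<And>l m. cmod (kern dt l m) \<le> C * dt\<^sup>2 * (japr (dt * m) powr (- 1) * (japr (dt * (l - m)) powr (- 4) + japr (dt * l) powr (- 4)))"
   using kern_le dt by meson
  have le1: "japr x powr (- a) \<le> 1" if "0 \<le> a" for x a
   using powr_mono[of "- a" 0 "japr x"] that by simp
  have "cmod (kern dt ?l m) \<le> C * dt\<^sup>2 * (1 * (1 + 1))" for m
   using C by (intro order_trans[OF C(2)] mult_left_mono mult_mono add_mono le1) auto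
  then show ?thesis using that by blast
 qed
 have i: "integrable lborel (?k G)" if [measurable]: "G \<in> BM" and G: "integrable lborel (\<lambda>\<tau>. G (\<xi>, \<tau>))" for G
 proof (rule Bochner_Integration.integrable_bound)
  have "integrable lborel (\<lambda>m. G (\<xi>, m - ?c))"
   using lborel_integrable_real_affine[OF G, of 1 "- ?c"] by simp
  then show "integrable lborel (\<lambda>m. complex_of_real K * G (\<xi>, m - ?c))" by simp
  show "AE m in lborel. norm (?k G m) \<le> norm (complex_of_real K * G (\<xi>, m - ?c))"
  proof (rule AE_I2)
   fix m
   have "cmod (kern dt ?l m) \<le> \<bar>K\<bar>" using K[of m] by linarith
   then show "norm (?k G m) \<le> norm (complex_of_real K * G (\<xi>, m - ?c))"
    by (simp add: norm_mult mult_right_mono)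
  qed
 qed measurable
 have "AE m in lborel. ?k G1 m - ?k G2 m = ?k G3 m"
 proof -
  have "AE m in distr lborel borel ((+) (- ?c)). G1 (\<xi>, m) - G2 (\<xi>, m) = G3 (\<xi>, m)" using eq by (simp only: lborel_distr_plus)
  then have "AE m in lborel. G1 (\<xi>, - ?c + m) - G2 (\<xi>, - ?c + m) = G3 (\<xi>, - ?c + m)" by (rule AE_distrD[rotated]) simp
  then show ?thesis
  proof eventually_elim
   case (elim m)
   then have e: "G3 (\<xi>, m - ?c) = G1 (\<xi>, m - ?c) - G2 (\<xi>, m - ?c)" by simp
   show ?case unfolding e by (simp only: right_diff_distrib)
  qed
 qed
 then have "(\<integral>m. ?k G1 m - ?k G2 m \<partial>lborel) = (\<integral>m. ?k G3 m \<partial>lborel)"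
  by (intro integral_cong_AE) simp_all
 then have "(\<integral>m. ?k G1 m \<partial>lborel) - (\<integral>m. ?k G2 m \<partial>lborel) = (\<integral>m. ?k G3 m \<partial>lborel)"
  using i[OF _ int(1)] i[OF _ int(2)] by (simp add: Bochner_Integration.integral_diff)
 then show ?thesis
  by (simp only: duh_ext_def fst_conv snd_conv right_diff_distrib[symmetric])
qed

locale wave_system = wave_params +
 fixes d1 d2 :: der
begin

definition fin :: "pair \<Rightarrow> bool" where
 "fin U \<longleftrightarrow> borel_pair U \<and> pn U < \<infinity>"

lemma finD [measurable_dest]: "fin U \<Longrightarrow> borel_pair U"
 by (simp add: fin_def)

lemma fin_parts:
 assumes "fin U"
 shows "fst U \<in> BM" "snd U \<in> BM"
  "X_int r 1 s b (fst U) < \<infinity>" "X_int r (- 1) s b (snd U) < \<infinity>"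
 using assms by (auto simp: fin_def borel_pair_def pnorm_def)

lemma X_int_0 [simp]: "X_int r sg s' b' (\<lambda>_. 0) = 0"
 using p by (simp add: X_int_def)

lemma pnorm_pzero [simp]: "pn pzero = 0"
 by (simp add: pnorm_def pzero_def)

lemma fin_pzero [simp]: "fin pzero"
 by (simp add: fin_def)

lemma X_int_diff_le:
 assumes [measurable]: "U \<in> BM" "V \<in> BM"
 shows "X_int r sg s' b' (\<lambda>q. U q - V q) \<le> ennreal (2 powr p) * (X_int r sg s' b' U + X_int r sg s' b' V)"
 by (rule X_int_add_le[OF r1]) (auto intro!: AE_I2 norm_triangle_ineq4)

lemma fin_psub:
 assumes "fin U" "fin V"
 shows "fin (psub U V)"
proof -
 have "X_int r 1 s b (\<lambda>q. fst U q - fst V q) < \<infinity>" "X_int r (- 1) s b (\<lambda>q. snd U q - snd V q) < \<infinity>"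
  using fin_parts[OF assms(1)] fin_parts[OF assms(2)]
  by (auto intro!: le_less_trans[OF X_int_diff_le] simp: ennreal_mult_less_top)
 then have "pn (psub U V) < \<infinity>"
  unfolding pnorm_def psub_def fst_conv snd_conv by (simp add: less_top)
 with borel_pair_psub[OF finD[OF assms(1)] finD[OF assms(2)]] show ?thesis
  by (simp add: fin_def)
qed

lemma fin_tame:
 assumes "fin U"
 shows "tame (fst U)" "tame (snd U)" "tame (symb d U)"
proof -
 note [measurable] = finD[OF assms] fin_parts(1,2)[OF assms]
 show "tame (fst U)" "tame (snd U)"
  using tame_of_X_int_s[OF _ fin_parts(1,3)[OF assms]] tame_of_X_int_s[OF _ fin_parts(2,4)[OF assms]] by simp_all
 have "tame (\<lambda>q. of_real (jap (fst q)) * fst U q)" "tame (\<lambda>q. of_real (jap (fst q)) * snd U q)"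
  using tame_jap_mult[OF _ fin_parts(1,3)[OF assms]] tame_jap_mult[OF _ fin_parts(2,4)[OF assms]] by simp_all
 then show "tame (symb d U)"
 proof (rule tame_add_mono)
  show "cmod (symb d U q) \<le> cmod (of_real (jap (fst q)) * fst U q) + cmod (of_real (jap (fst q)) * snd U q)" for q
   using cmod_symb_le[of d U q] by (simp add: mag_def norm_mult ring_distribs)
 qed measurable
qed

lemma tame_section: "tame P \<Longrightarrow> AE \<xi> in lborel. integrable lborel (\<lambda>\<tau>. P (\<xi>, \<tau>))"
proof -
 assume P: "tame P"
 show ?thesis using tame_AE[OF P] by eventually_elim (rule integrable_section[OF tame_measurable[OF P]])
qed

abbreviation force :: "real \<Rightarrow> pair \<Rightarrow> pair \<Rightarrow> pair \<Rightarrow> spacetime" where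
 "force \<equiv> forcing d1 d2"

text \<open>The exceptional set of frequencies serves all times and both signs. Outside it the
  space-time formula for the forcing term becomes the spatial one at every fixed time.\<close>

lemma force_section:
 assumes "fin U" "fin V" "fin L"
 shows "AE \<xi> in lborel. \<forall>sg. integrable lborel (\<lambda>\<tau>. force sg U V L (\<xi>, \<tau>)) \<and>
  (\<forall>t. time_inv (force sg U V L) t \<xi> = - of_real (sg / jap \<xi>) *
    (conv3 (time_inv (symb d1 U) t) (time_inv (symb d2 V) t) \<xi> / 4 + (time_inv (fst L) t \<xi> + time_inv (snd L) t \<xi>) / 2))"
proof -
 note tU = fin_tame(3)[OF assms(1), of d1] and tV = fin_tame(3)[OF assms(2), of d2]
 note L = fin_tame(1,2)[OF assms(3)]
 show ?thesis
  using tame_conv_finite[OF tU tV] tame_section[OF L(1)] tame_section[OF L(2)]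
 proof eventually_elim
  case (elim \<xi>)
  let ?A = "\<lambda>q. of_real (1 / (2 * pi) ^ 4) * conv4 (symb d1 U) (symb d2 V) q"
  let ?A4 = "\<lambda>q. (1/4) * ?A q" and ?L = "\<lambda>q. fst L q + snd L q"
  let ?L2 = "\<lambda>q. (1/2) * ?L q"
  have A: "integrable lborel (\<lambda>\<tau>. ?A4 (\<xi>, \<tau>))"
   by (intro integrable_mult_right conv4_section(1)[OF tame_measurable[OF tU] tame_measurable[OF tV] elim(1)])
  have iL: "integrable lborel (\<lambda>\<tau>. ?L2 (\<xi>, \<tau>))"
   using elim(2,3) by (intro integrable_mult_right Bochner_Integration.integrable_add)
  have f: "force sg U V L = (\<lambda>q. - of_real (sg / jap (fst q)) * (?A4 q + ?L2 q))" for sg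
   by (simp add: fun_eq_iff forcing_def)
  show ?case
  proof (intro allI conjI)
   fix sg t
   show "integrable lborel (\<lambda>\<tau>. force sg U V L (\<xi>, \<tau>))"
    unfolding f fst_conv by (intro integrable_mult_right Bochner_Integration.integrable_add A iL)
   have "time_inv (force sg U V L) t \<xi> = - of_real (sg / jap \<xi>) * (time_inv ?A4 t \<xi> + time_inv ?L2 t \<xi>)"
    unfolding f time_inv_cmult[where c="\<lambda>\<xi>. - complex_of_real (sg / jap \<xi>)"] time_inv_add[OF A iL] ..
   also have "time_inv ?A4 t \<xi> = (1/4) * conv3 (time_inv (symb d1 U) t) (time_inv (symb d2 V) t) \<xi>"
    unfolding time_inv_cmult[where c="\<lambda>_. 1/4"]
    by (simp only: time_inv_conv4[OF tame_measurable[OF tU] tame_measurable[OF tV] elim(1)])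
   also have "time_inv ?L2 t \<xi> = (1/2) * (time_inv (fst L) t \<xi> + time_inv (snd L) t \<xi>)"
    unfolding time_inv_cmult[where c="\<lambda>_. 1/2"] by (simp only: time_inv_add[OF elim(2,3)])
   finally show "time_inv (force sg U V L) t \<xi> = - of_real (sg / jap \<xi>) *
    (conv3 (time_inv (symb d1 U) t) (time_inv (symb d2 V) t) \<xi> / 4 + (time_inv (fst L) t \<xi> + time_inv (snd L) t \<xi>) / 2)"
    by simp
  qed
 qed
qed

text \<open>Absolute convergence is read off from finiteness of the majorant; it is what makes
  \<open>conv4\<close> additive in each factor.\<close>

lemma conv_integrable_AE:
 assumes "fin U" "fin V"
 shows "AE x in lborel. integrable lborel (\<lambda>y. symb d U y * symb d' V (x - y))"
proof -
 note [measurable] = finD[OF assms(1)] finD[OF assms(2)]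
 obtain C where "(\<L> x. ennreal (Xw 1 (s - 1) 0 x powr p) * epow (\<L> y. ennreal (mag U y * mag V (x - y))) p) \<le> ennreal C * (pn U * pn V)"
  using majorant_conv_le[of 1] finD[OF assms(1)] finD[OF assms(2)] by blast
 also have "... < \<infinity>" using assms by (simp add: fin_def ennreal_mult_less_top)
 finally have "AE x in lborel. ennreal (Xw 1 (s - 1) 0 x powr p) * epow (\<L> y. ennreal (mag U y * mag V (x - y))) p \<noteq> \<infinity>"
  by (intro nn_integral_PInf_AE) auto
 then show ?thesis
 proof eventually_elim
  case (elim x)
  have "Xw 1 (s - 1) 0 x \<noteq> 0" using Xw_pos[of 1 "s - 1" 0 x] by linarith
  then have "ennreal (Xw 1 (s - 1) 0 x powr p) \<noteq> 0" by (simp add: ennreal_eq_0_iff not_le)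
  with elim have "(\<L> y. ennreal (mag U y * mag V (x - y))) < \<infinity>"
   by (auto simp: ennreal_mult_eq_top_iff less_top)
  moreover have "(\<L> y. ennreal (norm (symb d U y * symb d' V (x - y)))) \<le> (\<L> y. ennreal (mag U y * mag V (x - y)))"
   by (intro nn_integral_mono ennreal_leI) (simp add: norm_mult mult_mono cmod_symb_le)
  ultimately show ?case by (intro integrableI_bounded) (auto intro: le_less_trans)
 qed
qed

text \<open>The difference of the forcing terms of U and V, written as linear in D = U - V.\<close>
definition linf :: "real \<Rightarrow> pair \<Rightarrow> pair \<Rightarrow> pair \<Rightarrow> spacetime" where
 "linf sg D U V q = force sg D U D q + force sg V D pzero q"

lemma measurable_linf [measurable]:
 assumes [measurable]: "borel_pair D" "borel_pair U" "borel_pair V"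
 shows "linf sg D U V \<in> BM"
 unfolding linf_def[abs_def] by measurable

text \<open>With D = U - V, the product U U - V V is D U + V D. The identity needs the convolutions
  of U with U, V with V and V with U to converge, so it holds almost everywhere.\<close>

lemma force_diff_AE:
 assumes "fin U" "fin V"
 shows "AE q in lborel. force sg U U U q - force sg V V V q = linf sg (psub U V) U V q"
 using conv_integrable_AE[OF assms(1) assms(1), of d1 d2] conv_integrable_AE[OF assms(2) assms(2), of d1 d2] conv_integrable_AE[OF assms(2) assms(1), of d1 d2]
proof eventually_elim
 case (elim x)
 let ?s = "\<lambda>d U V y. symb d U y"
 have "conv4 (symb d1 (psub U V)) (symb d2 U) x = conv4 (symb d1 U) (symb d2 U) x - conv4 (symb d1 V) (symb d2 U) x"
  unfolding conv4_def symb_psub left_diff_distrib by (rule Bochner_Integration.integral_diff[OF elim(1,3)])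
 moreover have "conv4 (symb d1 V) (symb d2 (psub U V)) x = conv4 (symb d1 V) (symb d2 U) x - conv4 (symb d1 V) (symb d2 V) x"
  unfolding conv4_def symb_psub right_diff_distrib by (rule Bochner_Integration.integral_diff[OF elim(3,2)])
 ultimately have "conv4 (symb d1 U) (symb d2 U) x - conv4 (symb d1 V) (symb d2 V) x
  = conv4 (symb d1 (psub U V)) (symb d2 U) x + conv4 (symb d1 V) (symb d2 (psub U V)) x" by simp
 then have e: "conv4 (symb d1 U) (symb d2 U) x = conv4 (symb d1 V) (symb d2 V) x + conv4 (symb d1 (psub U V)) (symb d2 U) x + conv4 (symb d1 V) (symb d2 (psub U V)) x"
  by (simp add: algebra_simps)
 define k where "k = - complex_of_real (sg / jap (fst x))"
 define c where "c = complex_of_real (1 / (2 * pi) ^ 4)"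
 show ?case
  unfolding linf_def forcing_def k_def[symmetric] c_def[symmetric] e
  by (simp add: psub_def pzero_def field_simps)
qed

lemma linf_bound:
 assumes sg: "sg \<in> {1, -1}"
 shows "\<exists>C\<ge>0. \<forall>D U V. borel_pair D \<longrightarrow> borel_pair U \<longrightarrow> borel_pair V \<longrightarrow>
  X_int r sg s 0 (linf sg D U V) \<le> ennreal C * (pn D * (pn U + pn V + 1))
 \<and> X_int r sg (s - 1) b (linf sg D U V) \<le> ennreal C * (pn D * (pn U + pn V + 1))"
proof -
 obtain C where C: "0 \<le> C" and C1: "\<And>U V L. borel_pair U \<Longrightarrow> borel_pair V \<Longrightarrow> borel_pair L \<Longrightarrow>
  X_int r sg s 0 (force sg U V L) \<le> ennreal C * (pn U * pn V + pn L)"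
  and C2: "\<And>U V L. borel_pair U \<Longrightarrow> borel_pair V \<Longrightarrow> borel_pair L \<Longrightarrow>
  X_int r sg (s - 1) b (force sg U V L) \<le> ennreal C * (pn U * pn V + pn L)"
  using forcing_bound[OF sg, of d1 d2] by blast
 have main: "X_int r sg s0 b0 (linf sg D U V) \<le> ennreal (2 powr p * C) * (pn D * (pn U + pn V + 1))"
  if [measurable]: "borel_pair D" "borel_pair U" "borel_pair V"
   and f: "\<And>U V L. borel_pair U \<Longrightarrow> borel_pair V \<Longrightarrow> borel_pair L \<Longrightarrow> X_int r sg s0 b0 (force sg U V L) \<le> ennreal C * (pn U * pn V + pn L)"
  for D U V s0 b0
 proof -
  have "X_int r sg s0 b0 (linf sg D U V) \<le> ennreal (2 powr p) * (X_int r sg s0 b0 (force sg D U D) + X_int r sg s0 b0 (force sg V D pzero))"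
   by (rule X_int_add_le[OF r1]) (auto simp: linf_def intro!: AE_I2 norm_triangle_ineq)
  also have "... \<le> ennreal (2 powr p) * (ennreal C * (pn D * pn U + pn D) + ennreal C * (pn V * pn D + pn pzero))"
   using that by (intro mult_left_mono add_mono f) simp_all
  also have "... = ennreal (2 powr p * C) * (pn D * (pn U + pn V + 1))"
   using C by (simp add: ennreal_mult distrib_left mult_ac add_ac)
  finally show ?thesis .
 qed
 show ?thesis
  using main[OF _ _ _ C1] main[OF _ _ _ C2] C by (intro exI[of _ "2 powr p * C"]) auto
qed

lemma duh_linf_bound:
 "\<exists>C\<ge>0. \<forall>dt t0 sg D U V. 0 < dt \<longrightarrow> dt \<le> 1 \<longrightarrow> sg \<in> {1, -1} \<longrightarrow> borel_pair D \<longrightarrow> borel_pair U \<longrightarrow> borel_pair V \<longrightarrow>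
  X_int r sg s b (duh_ext dt t0 sg (linf sg D U V)) \<le> ennreal (C * dt powr ((1 - b) * p)) * (pn D * (pn U + pn V + 1))"
proof -
 obtain C where C: "0 \<le> C" and Cd: "\<And>dt t0 sg G. 0 < dt \<Longrightarrow> dt \<le> 1 \<Longrightarrow> \<bar>sg\<bar> = 1 \<Longrightarrow> G \<in> BM \<Longrightarrow>
    X_int r sg s b (duh_ext dt t0 sg G) \<le> ennreal (C * dt powr ((1 - b) * p)) * X_int r sg s 0 G"
  using duh_ext_bound[OF r1] sr b1 by (meson less_imp_le)
 have "\<exists>K\<ge>0. \<forall>sg\<in>{1, -1}. \<forall>D U V. borel_pair D \<longrightarrow> borel_pair U \<longrightarrow> borel_pair V \<longrightarrow>
  X_int r sg s 0 (linf sg D U V) \<le> ennreal K * (pn D * (pn U + pn V + 1))"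
 proof -
  obtain K1 where K1: "0 \<le> K1" "\<And>D U V. borel_pair D \<Longrightarrow> borel_pair U \<Longrightarrow> borel_pair V \<Longrightarrow>
   X_int r 1 s 0 (linf 1 D U V) \<le> ennreal K1 * (pn D * (pn U + pn V + 1))"
   using linf_bound[of 1] by blast
  obtain K2 where K2: "0 \<le> K2" "\<And>D U V. borel_pair D \<Longrightarrow> borel_pair U \<Longrightarrow> borel_pair V \<Longrightarrow>
   X_int r (-1) s 0 (linf (-1) D U V) \<le> ennreal K2 * (pn D * (pn U + pn V + 1))"
   using linf_bound[of "-1"] by blast
  have m: "ennreal K1 * x \<le> ennreal (max K1 K2) * x" "ennreal K2 * x \<le> ennreal (max K1 K2) * x" for x
   by (auto intro!: mult_right_mono ennreal_leI)
  show ?thesis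
  proof (intro exI[of _ "max K1 K2"] conjI ballI allI impI)
   show "0 \<le> max K1 K2" using K1(1) by simp
   fix sg :: real and D U V
   assume "sg \<in> {1, -1}" and DUV: "borel_pair D" "borel_pair U" "borel_pair V"
   then consider "sg = 1" | "sg = - 1" by blast
   then show "X_int r sg s 0 (linf sg D U V) \<le> ennreal (max K1 K2) * (pn D * (pn U + pn V + 1))"
   proof cases
    case 1
    then show ?thesis using order_trans[OF K1(2)[OF DUV] m(1)] by simp
   next
    case 2
    then show ?thesis using order_trans[OF K2(2)[OF DUV] m(2)] by simp
   qed
  qed
 qed
 then obtain K where K: "0 \<le> K" "\<And>sg D U V. sg \<in> {1, -1} \<Longrightarrow> borel_pair D \<Longrightarrow> borel_pair U \<Longrightarrow> borel_pair V \<Longrightarrow>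
  X_int r sg s 0 (linf sg D U V) \<le> ennreal K * (pn D * (pn U + pn V + 1))"
  by blast
 have "X_int r sg s b (duh_ext dt t0 sg (linf sg D U V)) \<le> ennreal (C * K * dt powr ((1 - b) * p)) * (pn D * (pn U + pn V + 1))"
  if "0 < dt" "dt \<le> 1" and sg: "sg \<in> {1, -1}" and [measurable]: "borel_pair D" "borel_pair U" "borel_pair V" for dt t0 sg D U V
 proof -
  have "X_int r sg s b (duh_ext dt t0 sg (linf sg D U V)) \<le> ennreal (C * dt powr ((1 - b) * p)) * X_int r sg s 0 (linf sg D U V)"
   using that by (intro Cd) auto
  also have "... \<le> ennreal (C * dt powr ((1 - b) * p)) * (ennreal K * (pn D * (pn U + pn V + 1)))"
   using that by (intro mult_left_mono K) auto
  also have "... = ennreal (C * K * dt powr ((1 - b) * p)) * (pn D * (pn U + pn V + 1))"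
   using C K(1) by (simp add: ennreal_mult mult_ac)
  finally show ?thesis .
 qed
 then show ?thesis using C K(1) by (intro exI[of _ "C * K"]) auto
qed

abbreviation dsub :: "data \<Rightarrow> data \<Rightarrow> data"
 where "dsub F G \<equiv> (\<lambda>\<xi>. fst F \<xi> - fst G \<xi>, \<lambda>\<xi>. snd F \<xi> - snd G \<xi>)"

definition hnorm :: "data \<Rightarrow> ennreal" where
 "hnorm F = Hhat_int r s (fst F) + Hhat_int r s (snd F)"

text \<open>Only the integral term is cut off at length \<open>dt\<close>; the free evolution keeps
  the unit cutoff, which covers |t| \<le> dt as long as dt \<le> 1. With \<open>dt = 1\<close> the
  map yields an extension whose regularity is controlled independently of the lifespan.\<close>

definition duhmap :: "real \<Rightarrow> data \<Rightarrow> pair \<Rightarrow> pair" where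
 "duhmap dt F U = (\<lambda>q. free_ext 1 (fst F) q - \<i> * duh_ext dt 0 1 (force 1 U U U) q,
         \<lambda>q. free_ext (- 1) (snd F) q - \<i> * duh_ext dt 0 (- 1) (force (- 1) U U U) q)"

lemma sgnpart_duhmap:
 assumes "sg \<in> {1, -1}"
 shows "sgnpart sg (duhmap dt F U) = (\<lambda>q. free_ext sg (if sg = 1 then fst F else snd F) q - \<i> * duh_ext dt 0 sg (force sg U U U) q)"
 using assms by (auto simp: duhmap_def)

lemma borel_pair_duhmap [measurable]:
 assumes [measurable]: "fst F \<in> BM" "snd F \<in> BM" "borel_pair U"
 shows "borel_pair (duhmap dt F U)"
 unfolding borel_pair_def duhmap_def by simp

lemma force_pzero: "force sg pzero pzero pzero = (\<lambda>_. 0)"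
proof -
 have z: "symb d pzero = (\<lambda>_. 0)" for d by (cases d) (simp_all add: fun_eq_iff symb_def pzero_def)
 show ?thesis unfolding forcing_def[abs_def] z conv4_def by (simp add: pzero_def)
qed

lemma duh_force_diff_AE:
 assumes "0 < dt" "fin U" "fin V"
 shows "AE q in lborel. duh_ext dt t0 sg (force sg U U U) q - duh_ext dt t0 sg (force sg V V V) q = duh_ext dt t0 sg (linf sg (psub U V) U V) q"
proof -
 note fU = finD[OF assms(2)] and fV = finD[OF assms(3)]
 note [measurable] = fU fV
 have "AE \<xi> in lborel. AE \<tau> in lborel. duh_ext dt t0 sg (force sg U U U) (\<xi>, \<tau>) - duh_ext dt t0 sg (force sg V V V) (\<xi>, \<tau>) = duh_ext dt t0 sg (linf sg (psub U V) U V) (\<xi>, \<tau>)"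
  using AE_lborel_section[OF force_diff_AE[OF assms(2,3), of sg]] force_section[OF assms(2) assms(2) assms(2)] force_section[OF assms(3) assms(3) assms(3)]
 proof eventually_elim
  case (elim \<xi>)
  have "integrable lborel (\<lambda>\<tau>. force sg U U U (\<xi>, \<tau>))" "integrable lborel (\<lambda>\<tau>. force sg V V V (\<xi>, \<tau>))"
   using elim(2,3) by blast+
  from duh_ext_diff[OF assms(1) _ _ _ this elim(1)] show ?case
   using measurable_forcing[OF fU fU fU] measurable_forcing[OF fV fV fV] measurable_linf[OF borel_pair_psub[OF fU fV] fU fV] by blast
 qed
 then have "AE q in lborel \<Otimes>\<^sub>M lborel. duh_ext dt t0 sg (force sg U U U) q - duh_ext dt t0 sg (force sg V V V) q = duh_ext dt t0 sg (linf sg (psub U V) U V) q"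
 proof (rule lborel_pair.AE_pair_measure[rotated])
  show "{q \<in> space (lborel \<Otimes>\<^sub>M lborel). duh_ext dt t0 sg (force sg U U U) q - duh_ext dt t0 sg (force sg V V V) q = duh_ext dt t0 sg (linf sg (psub U V) U V) q} \<in> sets (lborel \<Otimes>\<^sub>M lborel)"
   unfolding lborel_prod by measurable
 qed
 then show ?thesis by (simp only: lborel_prod)
qed

text \<open>With zero data and state in the second place this also bounds the map itself, so one
  estimate serves the invariance of a ball, the contraction and the dependence on the data.\<close>

lemma duhmap_diff_bound:
 "\<exists>C\<ge>1. \<forall>dt F G U V. 0 < dt \<longrightarrow> dt \<le> 1 \<longrightarrow> fst F \<in> BM \<longrightarrow> snd F \<in> BM \<longrightarrow>
  fst G \<in> BM \<longrightarrow> snd G \<in> BM \<longrightarrow> fin U \<longrightarrow> fin V \<longrightarrow>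
  pn (psub (duhmap dt F U) (duhmap dt G V)) \<le> ennreal C * (hnorm (dsub F G)
   + ennreal (dt powr ((1 - b) * p)) * (pn (psub U V) * (pn U + pn V + 1)))"
proof -
 obtain C1 where C1: "0 \<le> C1" and C1b: "\<And>sg F. \<bar>sg\<bar> = 1 \<Longrightarrow> F \<in> BM \<Longrightarrow> X_int r sg s b (free_ext sg F) \<le> ennreal C1 * Hhat_int r s F"
  using free_ext_bound[OF r1] sr b1 by (meson less_imp_le less_trans one_less_numeral_iff semiring_norm(76))
 obtain C2 where C2: "0 \<le> C2" and C2b: "\<And>dt t0 sg D U V. 0 < dt \<Longrightarrow> dt \<le> 1 \<Longrightarrow> sg \<in> {1, -1} \<Longrightarrow> borel_pair D \<Longrightarrow> borel_pair U \<Longrightarrow> borel_pair V \<Longrightarrow>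
  X_int r sg s b (duh_ext dt t0 sg (linf sg D U V)) \<le> ennreal (C2 * dt powr ((1 - b) * p)) * (pn D * (pn U + pn V + 1))"
  using duh_linf_bound by meson
 define C where "C = 2 powr p * (C1 + C2 + C2) + 1"
 have main: "pn (psub (duhmap dt F U) (duhmap dt G V)) \<le> ennreal C * (hnorm (dsub F G)
   + ennreal (dt powr ((1 - b) * p)) * (pn (psub U V) * (pn U + pn V + 1)))"
  if dt: "0 < dt" "dt \<le> 1" and [measurable]: "fst F \<in> BM" "snd F \<in> BM"
  "fst G \<in> BM" "snd G \<in> BM" and UV: "fin U" "fin V" for dt F G U V
 proof -
  note [measurable] = finD[OF UV(1)] finD[OF UV(2)]
  define X where "X = ennreal (dt powr ((1 - b) * p)) * (pn (psub U V) * (pn U + pn V + 1))"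
  have part: "X_int r sg s b (\<lambda>q. (free_ext sg f q - \<i> * duh_ext dt 0 sg (force sg U U U) q) - (free_ext sg g q - \<i> * duh_ext dt 0 sg (force sg V V V) q))
   \<le> ennreal (2 powr p) * (ennreal C1 * Hhat_int r s (\<lambda>\<xi>. f \<xi> - g \<xi>) + ennreal C2 * X)"
   if sg: "sg \<in> {1, -1}" and [measurable]: "f \<in> BM" "g \<in> BM" for sg f g
  proof -
   have a: "\<bar>sg\<bar> = 1" using sg by auto
   have "X_int r sg s b (\<lambda>q. (free_ext sg f q - \<i> * duh_ext dt 0 sg (force sg U U U) q) - (free_ext sg g q - \<i> * duh_ext dt 0 sg (force sg V V V) q))
    \<le> ennreal (2 powr p) * (X_int r sg s b (free_ext sg (\<lambda>\<xi>. f \<xi> - g \<xi>)) + X_int r sg s b (duh_ext dt 0 sg (linf sg (psub U V) U V)))"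
   proof (rule X_int_add_le[OF r1])
    show "AE q in lborel. cmod ((free_ext sg f q - \<i> * duh_ext dt 0 sg (force sg U U U) q) - (free_ext sg g q - \<i> * duh_ext dt 0 sg (force sg V V V) q))
      \<le> cmod (free_ext sg (\<lambda>\<xi>. f \<xi> - g \<xi>) q) + cmod (duh_ext dt 0 sg (linf sg (psub U V) U V) q)"
     using duh_force_diff_AE[OF dt(1) UV, of 0 sg]
    proof eventually_elim
     case (elim q)
     have "(free_ext sg f q - \<i> * duh_ext dt 0 sg (force sg U U U) q) - (free_ext sg g q - \<i> * duh_ext dt 0 sg (force sg V V V) q)
      = free_ext sg (\<lambda>\<xi>. f \<xi> - g \<xi>) q - \<i> * duh_ext dt 0 sg (linf sg (psub U V) U V) q"
      unfolding elim[symmetric] by (simp add: free_ext_def algebra_simps)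
     then show ?case
      using norm_triangle_ineq4[of "free_ext sg (\<lambda>\<xi>. f \<xi> - g \<xi>) q" "\<i> * duh_ext dt 0 sg (linf sg (psub U V) U V) q"] by (simp add: norm_mult)
    qed
   qed measurable
   also have "... \<le> ennreal (2 powr p) * (ennreal C1 * Hhat_int r s (\<lambda>\<xi>. f \<xi> - g \<xi>) + ennreal (C2 * dt powr ((1 - b) * p)) * (pn (psub U V) * (pn U + pn V + 1)))"
    using dt sg a finD[OF UV(1)] finD[OF UV(2)] borel_pair_psub[OF finD[OF UV(1)] finD[OF UV(2)]]
    by (intro mult_left_mono add_mono C1b C2b) simp_all
   also have "... = ennreal (2 powr p) * (ennreal C1 * Hhat_int r s (\<lambda>\<xi>. f \<xi> - g \<xi>) + ennreal C2 * X)"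
    using C2 by (simp add: X_def ennreal_mult mult_ac)
   finally show ?thesis .
  qed
  let ?H = "hnorm (dsub F G)"
  have "pn (psub (duhmap dt F U) (duhmap dt G V))
   \<le> ennreal (2 powr p) * (ennreal C1 * Hhat_int r s (\<lambda>\<xi>. fst F \<xi> - fst G \<xi>) + ennreal C2 * X)
    + ennreal (2 powr p) * (ennreal C1 * Hhat_int r s (\<lambda>\<xi>. snd F \<xi> - snd G \<xi>) + ennreal C2 * X)"
   unfolding pnorm_def psub_def duhmap_def fst_conv snd_conv by (intro add_mono part) auto
  also have "... = ennreal (2 powr p) * (ennreal C1 * ?H + ennreal (C2 + C2) * X)"
  proof -
   have "ennreal (C2 + C2) * X = ennreal C2 * X + ennreal C2 * X"
    using C2 by (simp only: ennreal_plus distrib_right)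
   then show ?thesis by (simp only: hnorm_def fst_conv snd_conv distrib_left add_ac)
  qed
  also have "... \<le> ennreal (2 powr p) * (ennreal (C1 + C2 + C2) * ?H + ennreal (C1 + C2 + C2) * X)"
   using C1 C2 by (intro mult_left_mono add_mono mult_right_mono ennreal_leI) auto
  also have "... = ennreal (2 powr p * (C1 + C2 + C2)) * (?H + X)"
  proof -
   have "ennreal (2 powr p * (C1 + C2 + C2)) = ennreal (2 powr p) * ennreal (C1 + C2 + C2)"
    using C1 C2 by (intro ennreal_mult) auto
   then show ?thesis by (simp only: distrib_left mult.assoc)
  qed
  also have "... \<le> ennreal C * (?H + X)"
   by (intro mult_right_mono ennreal_leI) (auto simp: C_def)
  finally show ?thesis unfolding X_def .
 qed
 have "1 \<le> C" using C1 C2 by (simp add: C_def)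
 then show ?thesis using main by blast
qed

end

section \<open>Fixed points and uniqueness\<close>

text \<open>Completeness of the weighted L^p in the form of p-th powers. Geometric decay of the
  increments gives a limit almost everywhere, and Fatou's lemma carries the Cauchy bound over to
  it.\<close>

lemma geometric_limit:
 fixes f :: "nat \<Rightarrow> 'a \<Rightarrow> complex" and w :: "'a \<Rightarrow> real"
 assumes [measurable]: "\<And>n. f n \<in> borel_measurable M" "w \<in> borel_measurable M" and w: "\<And>x. 0 < w x"
  and p: "0 < p" and A: "0 \<le> A" and \<kappa>: "0 \<le> \<kappa>" "2 * 2 powr p * \<kappa> \<le> 1"
  and bound: "\<And>n. (\<integral>\<^sup>+ x. ennreal ((w x * cmod (f (Suc n) x - f n x)) powr p) \<partial>M) \<le> ennreal (A * \<kappa> ^ n)"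
 shows "\<exists>g\<in>borel_measurable M. \<forall>N. (\<integral>\<^sup>+ x. ennreal ((w x * cmod (f N x - g x)) powr p) \<partial>M) \<le> ennreal (2 * 2 powr p * A * \<kappa> ^ N)"
proof -
 define I where "I = (\<lambda>m n. \<integral>\<^sup>+ x. ennreal ((w x * cmod (f m x - f n x)) powr p) \<partial>M)"
 have tri: "I m n \<le> ennreal (2 powr p) * (I m k + I k n)" for m k n
 proof -
  have "(w x * cmod (f m x - f n x)) powr p \<le> 2 powr p * ((w x * cmod (f m x - f k x)) powr p + (w x * cmod (f k x - f n x)) powr p)" for x
  proof -
   have "cmod (f m x - f n x) \<le> cmod (f m x - f k x) + cmod (f k x - f n x)"
    using norm_triangle_ineq[of "f m x - f k x" "f k x - f n x"] by simp
   then have "w x * cmod (f m x - f n x) \<le> w x * (cmod (f m x - f k x) + cmod (f k x - f n x))"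
    using w[of x] by (intro mult_left_mono) auto
   then have "(w x * cmod (f m x - f n x)) powr p \<le> (w x * cmod (f m x - f k x) + w x * cmod (f k x - f n x)) powr p"
    using p w[of x] by (intro powr_mono2) (auto simp: distrib_left)
   also have "... \<le> 2 powr p * ((w x * cmod (f m x - f k x)) powr p + (w x * cmod (f k x - f n x)) powr p)"
    using p w[of x] by (intro powr_add_le) auto
   finally show ?thesis .
  qed
  then have "I m n \<le> (\<integral>\<^sup>+ x. ennreal (2 powr p) * (ennreal ((w x * cmod (f m x - f k x)) powr p) + ennreal ((w x * cmod (f k x - f n x)) powr p)) \<partial>M)"
   unfolding I_def by (intro nn_integral_mono) (simp add: ennreal_leI flip: ennreal_mult ennreal_plus)
  also have "... = ennreal (2 powr p) * (I m k + I k n)"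
   by (simp add: I_def nn_integral_cmult nn_integral_add)
  finally show ?thesis .
 qed
 \<comment> \<open>The first increment is split off and the induction hypothesis used from
   \<open>Suc N\<close> on. The loss of 2^p in the triangle inequality is recovered because
   \<open>2 * 2 powr p * \<kappa> \<le> 1\<close>, so the same constant reappears.\<close>
 have cauchy: "I (N + n) N \<le> ennreal (2 * 2 powr p * A * \<kappa> ^ N)" for n N
 proof (induction n arbitrary: N)
  case 0
  have "I N N = 0" using p by (simp add: I_def)
  then show ?case by simp
 next
  case (Suc n)
  have "I (N + Suc n) N \<le> ennreal (2 powr p) * (I (Suc N + n) (Suc N) + I (Suc N) N)"
   using tri[of "N + Suc n" N "Suc N"] by simp
  also have "... \<le> ennreal (2 powr p) * (ennreal (2 * 2 powr p * A * \<kappa> ^ Suc N) + ennreal (A * \<kappa> ^ N))"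
   using bound[of N] by (intro mult_left_mono add_mono Suc) (auto simp: I_def)
  also have "... = ennreal (2 powr p * (2 * 2 powr p * A * \<kappa> ^ Suc N + A * \<kappa> ^ N))"
   using A \<kappa> by (simp flip: ennreal_mult ennreal_plus)
  also have "... \<le> ennreal (2 * 2 powr p * A * \<kappa> ^ N)"
  proof (rule ennreal_leI)
   have "2 powr p * (A * \<kappa> ^ N) * (2 * 2 powr p * \<kappa>) \<le> 2 powr p * (A * \<kappa> ^ N) * 1"
    using A \<kappa> by (intro mult_left_mono) auto
   then show "2 powr p * (2 * 2 powr p * A * \<kappa> ^ Suc N + A * \<kappa> ^ N) \<le> 2 * 2 powr p * A * \<kappa> ^ N"
    by (simp add: algebra_simps)
  qed
  finally show ?case .
 qed
 \<comment> \<open>The increments are weighted by 2^n; their p-th powers are still summable, since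
   2^p \<kappa> \<le> 1/2. Almost everywhere the increments are thus eventually at most (1/2)^n up
   to a constant, and the telescoping series converges.\<close>
 have conv: "AE x in M. convergent (\<lambda>n. f n x)"
 proof -
  let ?e = "\<lambda>n x. (2 ^ n * w x * cmod (f (Suc n) x - f n x)) powr p"
  have "(\<integral>\<^sup>+ x. (\<Sum>n. ennreal (?e n x)) \<partial>M) = (\<Sum>n. \<integral>\<^sup>+ x. ennreal (?e n x) \<partial>M)"
   by (intro nn_integral_suminf) measurable
  also have "... \<le> (\<Sum>n. ennreal (A * (1 / 2) ^ n))"
  proof (intro suminf_le allI)
   fix n
   have "?e n x = (2 powr p) ^ n * (w x * cmod (f (Suc n) x - f n x)) powr p" for x
    using w[of x] by (simp add: powr_mult mult.assoc powr_power powr_realpow[symmetric] powr_powr mult.commute)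
   then have "(\<integral>\<^sup>+ x. ennreal (?e n x) \<partial>M) = ennreal ((2 powr p) ^ n) * (\<integral>\<^sup>+ x. ennreal ((w x * cmod (f (Suc n) x - f n x)) powr p) \<partial>M)"
    by (simp add: ennreal_mult nn_integral_cmult)
   also have "... \<le> ennreal ((2 powr p) ^ n) * ennreal (A * \<kappa> ^ n)"
    by (intro mult_left_mono bound) auto
   also have "... = ennreal (A * (2 powr p * \<kappa>) ^ n)"
    using A \<kappa> by (simp add: power_mult_distrib mult_ac flip: ennreal_mult)
   also have "... \<le> ennreal (A * (1 / 2) ^ n)"
    using A \<kappa> by (intro ennreal_leI mult_left_mono power_mono) auto
   finally show "(\<integral>\<^sup>+ x. ennreal (?e n x) \<partial>M) \<le> ennreal (A * (1 / 2) ^ n)" .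
  qed auto
  also have "... < \<infinity>"
  proof -
   have "summable (\<lambda>n. A * (1 / 2) ^ n)" by (intro summable_mult summable_geometric) simp
   then show ?thesis using A by (subst suminf_ennreal2) auto
  qed
  finally have "AE x in M. (\<Sum>n. ennreal (?e n x)) \<noteq> \<infinity>"
   by (intro nn_integral_PInf_AE) auto
  then show ?thesis
  proof eventually_elim
   case (elim x)
   have "summable (\<lambda>n. ?e n x)" using elim by (intro summable_suminf_not_top) auto
   then have "(\<lambda>n. ?e n x) \<longlonglongrightarrow> 0" by (rule summable_LIMSEQ_zero)
   then have "eventually (\<lambda>n. ?e n x < 1) sequentially" by (rule order_tendstoD) simp
   then have "eventually (\<lambda>n. norm (f (Suc n) x - f n x) \<le> (1 / w x) * (1 / 2) ^ n) sequentially"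
   proof eventually_elim
    case (elim n)
    have "2 ^ n * w x * cmod (f (Suc n) x - f n x) \<le> 1"
    proof (rule ccontr)
     assume "\<not> ?thesis"
     then have "1 powr p \<le> ?e n x" using p by (intro powr_mono2) auto
     with elim show False by simp
    qed
    then show ?case using w[of x] by (simp add: field_simps)
   qed
   moreover have "summable (\<lambda>n. (1 / w x) * (1 / 2) ^ n)" by (intro summable_mult summable_geometric) simp
   ultimately have "summable (\<lambda>n. f (Suc n) x - f n x)" by (rule summable_comparison_test_ev)
   then have "convergent (\<lambda>n. \<Sum>i<n. f (Suc i) x - f i x)" by (simp only: summable_iff_convergent)
   moreover have "(\<Sum>i<n. f (Suc i) x - f i x) = f n x - f 0 x" for n
    using sum_lessThan_telescope[of "\<lambda>n. f n x" n] .
   ultimately show ?case by (simp add: convergent_diff_const_right_iff)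
  qed
 qed
 define g where "g = (\<lambda>x. lim (\<lambda>n. f n x))"
 have [measurable]: "g \<in> borel_measurable M" unfolding g_def by (rule borel_measurable_lim_metric) simp
 have "(\<integral>\<^sup>+ x. ennreal ((w x * cmod (f N x - g x)) powr p) \<partial>M) \<le> ennreal (2 * 2 powr p * A * \<kappa> ^ N)" for N
 proof -
  have "(\<integral>\<^sup>+ x. ennreal ((w x * cmod (f N x - g x)) powr p) \<partial>M) = (\<integral>\<^sup>+ x. liminf (\<lambda>n. ennreal ((w x * cmod (f (N + n) x - f N x)) powr p)) \<partial>M)"
  proof (rule nn_integral_cong_AE)
   show "AE x in M. ennreal ((w x * cmod (f N x - g x)) powr p) = liminf (\<lambda>n. ennreal ((w x * cmod (f (N + n) x - f N x)) powr p))"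
    using conv
   proof eventually_elim
    case (elim x)
    then have "(\<lambda>n. f n x) \<longlonglongrightarrow> g x" by (simp add: g_def convergent_LIMSEQ_iff)
    then have "(\<lambda>n. f (N + n) x) \<longlonglongrightarrow> g x" by (subst add.commute) (rule LIMSEQ_ignore_initial_segment)
    then have "(\<lambda>n. ennreal ((w x * cmod (f (N + n) x - f N x)) powr p)) \<longlonglongrightarrow> ennreal ((w x * cmod (g x - f N x)) powr p)"
     using p w[of x] by (intro tendsto_ennrealI tendsto_powr' tendsto_intros) auto
    from lim_imp_Liminf[OF trivial_limit_sequentially this] show ?case
     unfolding norm_minus_commute[of "f N x" "g x"] by simp
   qed
  qed
  also have "... \<le> liminf (\<lambda>n. I (N + n) N)"
   unfolding I_def by (intro nn_integral_liminf) measurable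
  also have "... \<le> ennreal (2 * 2 powr p * A * \<kappa> ^ N)"
   by (rule Liminf_le) (auto simp: cauchy)
  finally show ?thesis .
 qed
 then show ?thesis by (intro bexI[of _ g] allI) simp_all
qed

context wave_system
begin

lemma pnorm_psub_le:
 assumes "borel_pair U" "borel_pair V" "borel_pair W"
 shows "pn (psub U W) \<le> ennreal (2 powr p) * (pn (psub U V) + pn (psub V W))"
proof -
 note [measurable] = assms
 have *: "X_int r sg s b (\<lambda>q. f q - h q) \<le> ennreal (2 powr p) * (X_int r sg s b (\<lambda>q. f q - g q) + X_int r sg s b (\<lambda>q. g q - h q))"
  if [measurable]: "f \<in> BM" "g \<in> BM" "h \<in> BM" for sg f g h
 proof (rule X_int_add_le[OF r1])
  show "AE q in lborel. cmod (f q - h q) \<le> cmod (f q - g q) + cmod (g q - h q)"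
   using norm_triangle_ineq[of "f q - g q" "g q - h q" for q] by simp
 qed measurable
 have "pn (psub U W) \<le> ennreal (2 powr p) * (X_int r 1 s b (\<lambda>q. fst U q - fst V q) + X_int r 1 s b (\<lambda>q. fst V q - fst W q))
  + ennreal (2 powr p) * (X_int r (- 1) s b (\<lambda>q. snd U q - snd V q) + X_int r (- 1) s b (\<lambda>q. snd V q - snd W q))"
  unfolding pnorm_def psub_def fst_conv snd_conv by (intro add_mono *) measurable
 also have "... = ennreal (2 powr p) * (pn (psub U V) + pn (psub V W))"
  by (simp add: pnorm_def psub_def distrib_left add_ac)
 finally show ?thesis .
qed

definition pequiv :: "pair \<Rightarrow> pair \<Rightarrow> bool" where
 "pequiv U V \<longleftrightarrow> (AE q in lborel. fst U q = fst V q \<and> snd U q = snd V q)"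

lemma X_int_eq_0D:
 assumes [measurable]: "f \<in> BM" and "X_int r sg s' b' f = 0"
 shows "AE q in lborel. f q = 0"
proof -
 have "AE q in lborel. ennreal ((Xw sg s' b' q * cmod (f q)) powr p) = 0"
  using assms(2) unfolding X_int_eq by (subst (asm) nn_integral_0_iff_AE) auto
 then show ?thesis
 proof eventually_elim
  case (elim q)
  have "0 \<le> (Xw sg s' b' q * cmod (f q)) powr p" by simp
  with elim have "Xw sg s' b' q * cmod (f q) = 0" using p by (simp add: ennreal_eq_0_iff)
  then show ?case using Xw_pos[of sg s' b' q] by simp
 qed
qed

lemma pequivI:
 assumes "borel_pair U" "borel_pair V" "pn (psub U V) = 0"
 shows "pequiv U V"
proof -
 note [measurable] = assms(1,2)
 have z: "X_int r 1 s b (\<lambda>q. fst U q - fst V q) = 0" "X_int r (- 1) s b (\<lambda>q. snd U q - snd V q) = 0"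
  using assms(3) by (simp_all add: pnorm_def psub_def)
 have "AE q in lborel. fst U q - fst V q = 0" "AE q in lborel. snd U q - snd V q = 0"
  by (rule X_int_eq_0D[OF _ z(1)], measurable) (rule X_int_eq_0D[OF _ z(2)], measurable)
 then show ?thesis unfolding pequiv_def by eventually_elim simp
qed

text \<open>Absorption of half the left-hand side. The value \<infinity> satisfies the first
  premise, so finiteness has to be known beforehand.\<close>

lemma ennreal_le_half: "(x :: ennreal) \<le> y + ennreal (1 / 2) * x \<Longrightarrow> x < \<infinity> \<Longrightarrow> x \<le> ennreal 2 * y"
proof (cases x; cases y)
 fix a c :: real
 assume *: "x \<le> y + ennreal (1 / 2) * x" "x = ennreal a" "0 \<le> a" "y = ennreal c" "0 \<le> c"
 then have "ennreal a \<le> ennreal (c + 1 / 2 * a)" by (simp add: ennreal_mult ennreal_plus del: times_divide_eq_left)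
 then have "a \<le> c + 1 / 2 * a" using * by (subst (asm) ennreal_le_iff) auto
 then have "a \<le> 2 * c" by simp
 then show ?thesis using * by (metis ennreal_leI ennreal_mult zero_le_numeral)
qed (auto simp: ennreal_mult_top)

section \<open>Contraction and fixed points\<close>

definition borel_data :: "data \<Rightarrow> bool" where
 "borel_data F \<longleftrightarrow> fst F \<in> BM \<and> snd F \<in> BM"

lemma Hhat_int_0 [simp]: "Hhat_int r s (\<lambda>_. 0) = 0"
 using p by (simp add: Hhat_int_def)

lemma hnorm_0 [simp]: "hnorm (\<lambda>_. 0, \<lambda>_. 0) = 0"
 by (simp add: hnorm_def)

lemma duh_ext_0: "duh_ext dt t0 sg (\<lambda>_. 0) = (\<lambda>_. 0)"
 by (simp add: fun_eq_iff duh_ext_def)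

lemma duhmap_0: "duhmap dt (\<lambda>_. 0, \<lambda>_. 0) pzero = pzero"
 by (simp add: duhmap_def force_pzero duh_ext_0) (simp add: free_ext_def pzero_def)

lemma X_int_cong_AE: "AE q in lborel. f q = g q \<Longrightarrow> X_int r sg s' b' f = X_int r sg s' b' g"
 unfolding X_int_def by (rule nn_integral_cong_AE) (auto elim: eventually_mono)

lemma pnorm_cong:
 assumes "pequiv U U'" "pequiv V V'"
 shows "pn (psub U V) = pn (psub U' V')"
proof -
 have "AE q in lborel. fst U q - fst V q = fst U' q - fst V' q \<and> snd U q - snd V q = snd U' q - snd V' q"
  using assms unfolding pequiv_def by eventually_elim simp
 then have e: "AE q in lborel. fst U q - fst V q = fst U' q - fst V' q" "AE q in lborel. snd U q - snd V q = snd U' q - snd V' q"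
  by (auto elim: eventually_mono)
 show ?thesis unfolding pnorm_def psub_def fst_conv snd_conv using X_int_cong_AE[OF e(1)] X_int_cong_AE[OF e(2)] by simp
qed

lemma pnorm_psub_commute: "pn (psub U V) = pn (psub V U)"
 by (simp add: pnorm_def psub_def X_int_def norm_minus_commute)

lemma pnorm_psub_pzero: "pn (psub pzero U) = pn U"
 by (simp add: pnorm_psub_commute[of pzero])

lemma borel_data_0 [simp]: "borel_data (\<lambda>_. 0, \<lambda>_. 0)"
 by (simp add: borel_data_def)

lemma borel_pair_duhmap': "borel_data F \<Longrightarrow> borel_pair U \<Longrightarrow> borel_pair (duhmap dt F U)"
 unfolding borel_data_def by (intro borel_pair_duhmap) auto

definition contracts :: "real \<Rightarrow> real \<Rightarrow> real \<Rightarrow> real \<Rightarrow> bool" where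
 "contracts K \<kappa> B dt \<longleftrightarrow> (\<forall>F G U V. borel_data F \<longrightarrow> borel_data G \<longrightarrow> borel_pair U \<longrightarrow> borel_pair V \<longrightarrow>
  pn U \<le> ennreal B \<longrightarrow> pn V \<le> ennreal B \<longrightarrow>
  pn (psub (duhmap dt F U) (duhmap dt G V))
   \<le> ennreal K * hnorm (dsub F G) + ennreal \<kappa> * pn (psub U V))"

lemma contractsD:
 "contracts K \<kappa> B dt \<Longrightarrow> borel_data F \<Longrightarrow> borel_data G \<Longrightarrow> borel_pair U \<Longrightarrow> borel_pair V \<Longrightarrow>
  pn U \<le> ennreal B \<Longrightarrow> pn V \<le> ennreal B \<Longrightarrow>
  pn (psub (duhmap dt F U) (duhmap dt G V))
   \<le> ennreal K * hnorm (dsub F G) + ennreal \<kappa> * pn (psub U V)"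
 unfolding contracts_def by blast

text \<open>The order of quantifiers matters: \<open>K\<close> comes first, because the radius
  \<open>B\<close> of the ball is later chosen as a multiple of \<open>K\<close>, and only then
  \<open>dt\<close> is made small.\<close>

lemma contracts_exists: "\<exists>K\<ge>1. \<forall>\<kappa> B. 0 < \<kappa> \<longrightarrow> \<kappa> \<le> 1 \<longrightarrow> 0 \<le> B \<longrightarrow> (\<exists>dt>0. dt \<le> 1 \<and> contracts K \<kappa> B dt)"
proof -
 obtain K where K: "1 \<le> K" and Kb: "\<And>dt F G U V. 0 < dt \<Longrightarrow> dt \<le> 1 \<Longrightarrow> fst F \<in> BM \<Longrightarrow> snd F \<in> BM \<Longrightarrow>
  fst G \<in> BM \<Longrightarrow> snd G \<in> BM \<Longrightarrow> fin U \<Longrightarrow> fin V \<Longrightarrow>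
  pn (psub (duhmap dt F U) (duhmap dt G V)) \<le> ennreal K * (hnorm (dsub F G)
   + ennreal (dt powr ((1 - b) * p)) * (pn (psub U V) * (pn U + pn V + 1)))"
  using duhmap_diff_bound by blast
 have "\<exists>dt>0. dt \<le> 1 \<and> contracts K \<kappa> B dt" if \<kappa>: "0 < \<kappa>" "\<kappa> \<le> 1" and B: "0 \<le> B" for \<kappa> B
 proof -
  let ?\<theta> = "(1 - b) * p"
  \<comment> \<open>On the ball the factor \<open>pn U + pn V + 1\<close> is at most
    \<open>2 * B + 1\<close>; \<open>d\<close> is the value of the time factor that makes the
    product of all constants equal to \<open>\<kappa>\<close>.\<close>
  define d where "d = \<kappa> / (K * (2 * B + 1))"
  define dt where "dt = d powr (1 / ?\<theta>)"
  have \<theta>: "0 < ?\<theta>" using b1 p by simp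
  have KB: "1 \<le> K * (2 * B + 1)" using mult_mono[of 1 K 1 "2 * B + 1"] K B by simp
  then have d: "0 < d" "d \<le> 1" using \<kappa> by (auto simp: d_def divide_le_eq)
  have dt: "0 < dt" "dt \<le> 1" using d \<theta> powr_le1[of "1 / ?\<theta>" d] by (auto simp: dt_def)
  have dtd: "dt powr ?\<theta> = d" using d b1 p(3) by (simp add: dt_def powr_powr)
  have Kd: "K * d * (2 * B + 1) = \<kappa>" using K B KB by (simp add: d_def add_nonneg_eq_0_iff)
  have "contracts K \<kappa> B dt"
   unfolding contracts_def
  proof (intro allI impI)
   fix F G U V
   assume F: "borel_data F" "borel_data G" and U: "borel_pair U" "borel_pair V" and n: "pn U \<le> ennreal B" "pn V \<le> ennreal B"
   let ?h = "hnorm (dsub F G)" and ?x = "pn (psub U V)"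
   have f: "fin U" "fin V" using U n by (auto simp: fin_def intro: le_less_trans)
   have s1: "pn U + pn V + 1 \<le> ennreal (2 * B + 1)"
   proof -
    have "pn U + pn V + 1 \<le> ennreal B + ennreal B + 1" using n by (intro add_mono) auto
    also have "... = ennreal (2 * B + 1)" using B by (simp flip: ennreal_plus ennreal_1)
    finally show ?thesis .
   qed
   have "pn (psub (duhmap dt F U) (duhmap dt G V)) \<le> ennreal K * (?h + ennreal (dt powr ?\<theta>) * (?x * (pn U + pn V + 1)))"
    using F unfolding borel_data_def by (intro Kb dt f) auto
   also have "... \<le> ennreal K * (?h + ennreal d * (?x * ennreal (2 * B + 1)))"
    unfolding dtd by (intro mult_left_mono add_mono s1) auto
   also have "... = ennreal K * ?h + (ennreal K * ennreal d * ennreal (2 * B + 1)) * ?x"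
    by (simp only: distrib_left mult_ac)
   also have "ennreal K * ennreal d * ennreal (2 * B + 1) = ennreal \<kappa>"
    unfolding Kd[symmetric] using K d B by (simp only: ennreal_mult[symmetric] mult_nonneg_nonneg)
   finally show "pn (psub (duhmap dt F U) (duhmap dt G V)) \<le> ennreal K * ?h + ennreal \<kappa> * ?x" .
  qed
  then show ?thesis using dt by blast
 qed
 then show ?thesis using K by blast
qed

text \<open>The iterates stay below A = 2 K (R + 1), since K R and \<kappa> A are each at most A /
  2. The limit is only known to be within 2 * 2^p * A of the starting point 0 in each component, so
  the ball on which the map must contract has radius B = 4 * 2^p * A.\<close>

lemma fixed_point:
 assumes K: "1 \<le> K" and R: "0 \<le> R" and B: "B = 4 * 2 powr p * (2 * K * (R + 1))"
  and c: "contracts K (1 / (2 * 2 powr p)) B dt" and F: "borel_data F" "hnorm F \<le> ennreal R"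
 shows "\<exists>U. borel_pair U \<and> pn U \<le> ennreal B \<and> pequiv U (duhmap dt F U)"
proof -
 define \<kappa> where "\<kappa> = 1 / (2 * 2 powr p)"
 define A where "A = 2 * K * (R + 1)"
 have p2: "1 \<le> 2 powr p" using p ge_one_powr_ge_zero[of 2 p] by simp
 have \<kappa>: "0 \<le> \<kappa>" "2 * 2 powr p * \<kappa> \<le> 1" "\<kappa> \<le> 1 / 2" "\<kappa> < 1" using p2 by (auto simp: \<kappa>_def divide_le_eq divide_less_eq)
 have A: "0 \<le> A" using K R by (simp add: A_def)
 have B': "B = 4 * 2 powr p * A" by (simp add: B A_def)
 have AB: "A \<le> B" using mult_right_mono[of 1 "4 * 2 powr p" A] A p2 by (simp add: B')
 have B0: "0 \<le> B" using A AB by linarith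
 note c' = contractsD[OF c[folded \<kappa>_def]]
 define u where "u = (\<lambda>n. (duhmap dt F ^^ n) pzero)"
 have u0: "u 0 = pzero" and uS: "u (Suc n) = duhmap dt F (u n)" for n by (simp_all add: u_def)
 have bu: "borel_pair (u n)" for n by (induction n) (simp_all add: u0 uS borel_pair_duhmap' F)
 have nu: "pn (u n) \<le> ennreal A" for n
 proof (induction n)
  case 0
  then show ?case by (simp add: u0)
 next
  case (Suc n)
  let ?Z = "(\<lambda>_. 0, \<lambda>_. 0) :: data"
  have "pn (u (Suc n)) = pn (psub (duhmap dt F (u n)) (duhmap dt ?Z pzero))"
   by (simp add: uS duhmap_0)
  also have "... \<le> ennreal K * hnorm (dsub F ?Z) + ennreal \<kappa> * pn (psub (u n) pzero)"
   using order_trans[OF Suc ennreal_leI[OF AB]] by (intro c' F bu borel_data_0 borel_pair_pzero) auto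
  also have "... \<le> ennreal K * ennreal R + ennreal \<kappa> * ennreal A"
   using F Suc by (intro add_mono mult_left_mono) auto
  also have "... = ennreal (K * R + \<kappa> * A)" using K R \<kappa> A by (simp add: ennreal_mult)
  also have "... \<le> ennreal A"
  proof (rule ennreal_leI)
   have "\<kappa> * A \<le> (1 / 2) * A" using \<kappa> A by (intro mult_right_mono) auto
   moreover have "K * R \<le> (1 / 2) * A" using K by (simp add: A_def)
   ultimately show "K * R + \<kappa> * A \<le> A" by simp
  qed
  finally show ?case .
 qed
 have nuB: "pn (u n) \<le> ennreal B" for n by (rule order_trans[OF nu ennreal_leI[OF AB]])
 have du: "pn (psub (u (Suc n)) (u n)) \<le> ennreal (A * \<kappa> ^ n)" for n
 proof (induction n)
  case 0
  then show ?case using nu[of 1] by (simp add: u0)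
 next
  case (Suc n)
  have "pn (psub (u (Suc (Suc n))) (u (Suc n))) \<le> ennreal K * hnorm (dsub F F) + ennreal \<kappa> * pn (psub (u (Suc n)) (u n))"
   unfolding uS[of "Suc n"] by (subst (2) uS) (intro c' F bu nuB)
  also have "... \<le> 0 + ennreal \<kappa> * ennreal (A * \<kappa> ^ n)"
   using Suc by (intro add_mono mult_left_mono) auto
  also have "... = ennreal (A * \<kappa> ^ Suc n)" using A \<kappa> by (simp add: mult_ac flip: ennreal_mult)
  finally show ?case .
 qed
 have lim: "\<exists>g\<in>borel_measurable lborel. \<forall>N. X_int r sg s b (\<lambda>q. f N q - g q) \<le> ennreal (2 * 2 powr p * A * \<kappa> ^ N)"
  if m[measurable]: "\<And>n. f n \<in> borel_measurable lborel" and le: "\<And>n. X_int r sg s b (\<lambda>q. f (Suc n) q - f n q) \<le> pn (psub (u (Suc n)) (u n))" for f sg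
  unfolding X_int_eq
 proof (rule geometric_limit[OF m _ Xw_pos p(3) A \<kappa>(1,2)])
  show "(\<L> x. ennreal ((Xw sg s b x * cmod (f (Suc n) x - f n x)) powr p)) \<le> ennreal (A * \<kappa> ^ n)" for n
   using order_trans[OF le du] by (simp only: X_int_eq)
 qed measurable
 obtain g1 where g1: "g1 \<in> borel_measurable lborel" "\<And>N. X_int r 1 s b (\<lambda>q. fst (u N) q - g1 q) \<le> ennreal (2 * 2 powr p * A * \<kappa> ^ N)"
  using lim[of "\<lambda>n. fst (u n)" 1] bu by (auto simp: pnorm_def psub_def borel_pair_def)
 obtain g2 where g2: "g2 \<in> borel_measurable lborel" "\<And>N. X_int r (- 1) s b (\<lambda>q. snd (u N) q - g2 q) \<le> ennreal (2 * 2 powr p * A * \<kappa> ^ N)"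
  using lim[of "\<lambda>n. snd (u n)" "- 1"] bu by (auto simp: pnorm_def psub_def borel_pair_def)
 define U where "U = (g1, g2)"
 have U: "borel_pair U" using g1(1) g2(1) by (simp add: U_def borel_pair_def)
 have lU: "pn (psub (u N) U) \<le> ennreal (B * \<kappa> ^ N)" for N
 proof -
  have "pn (psub (u N) U) \<le> ennreal (2 * 2 powr p * A * \<kappa> ^ N) + ennreal (2 * 2 powr p * A * \<kappa> ^ N)"
   unfolding pnorm_def psub_def U_def fst_conv snd_conv by (intro add_mono g1 g2)
  also have "... = ennreal (B * \<kappa> ^ N)" using A \<kappa> by (simp add: B' flip: ennreal_plus)
  finally show ?thesis .
 qed
 have nU: "pn U \<le> ennreal B"
  using lU[of 0] by (simp add: u0 pnorm_psub_pzero)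
 let ?x = "pn (psub U (duhmap dt F U))"
 \<comment> \<open>The limit is compared with its image through the iterate
   \<open>u (Suc N)\<close>, which is close to both.\<close>
 have bd: "?x \<le> ennreal (2 powr p * (2 * B) * \<kappa> ^ N)" for N
 proof -
  have "?x \<le> ennreal (2 powr p) * (pn (psub U (u (Suc N))) + pn (psub (u (Suc N)) (duhmap dt F U)))"
   by (intro pnorm_psub_le U bu borel_pair_duhmap' F)
  also have "pn (psub U (u (Suc N))) \<le> ennreal (B * \<kappa> ^ N)"
   unfolding pnorm_psub_commute[of U] using \<kappa> B0 power_decreasing[of N "Suc N" \<kappa>] by (intro order_trans[OF lU] ennreal_leI mult_left_mono) auto
  also have "pn (psub (u (Suc N)) (duhmap dt F U)) \<le> ennreal K * hnorm (dsub F F) + ennreal \<kappa> * pn (psub (u N) U)"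
   unfolding uS by (intro c' F bu U nU nuB)
  also have "... \<le> 0 + 1 * ennreal (B * \<kappa> ^ N)"
   using \<kappa> by (intro add_mono mult_mono lU) (auto simp: ennreal_le_1)
  finally have "?x \<le> ennreal (2 powr p) * (ennreal (B * \<kappa> ^ N) + ennreal (B * \<kappa> ^ N))"
   by (simp add: mult_left_mono add_mono)
  also have "... = ennreal (2 powr p * (2 * B) * \<kappa> ^ N)"
   using B0 \<kappa> by (simp flip: ennreal_plus ennreal_mult)
  finally show ?thesis .
 qed
 have "(\<lambda>N. ennreal (2 powr p * (2 * B) * \<kappa> ^ N)) \<longlonglongrightarrow> ennreal (2 powr p * (2 * B) * 0)"
  using \<kappa> by (intro tendsto_ennrealI tendsto_mult tendsto_const LIMSEQ_power_zero) auto
 then have "?x \<le> ennreal (2 powr p * (2 * B) * 0)"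
  using bd by (intro LIMSEQ_le_const) auto
 then have "pequiv U (duhmap dt F U)"
  by (intro pequivI U borel_pair_duhmap' F) simp
 then show ?thesis using U nU by blast
qed

text \<open>The contraction estimate bounds the difference by the data plus at most half of itself,
  as \<kappa> \<le> 1/2; the latter is absorbed.\<close>

lemma fixed_point_diff:
 assumes c: "contracts K (1 / (2 * 2 powr p)) B dt" and K: "0 \<le> K" and F: "borel_data F" "borel_data G"
  and U: "borel_pair U" "pn U \<le> ennreal B" "pequiv U (duhmap dt F U)"
  and V: "borel_pair V" "pn V \<le> ennreal B" "pequiv V (duhmap dt G V)"
 shows "pn (psub U V) \<le> ennreal (2 * K) * hnorm (dsub F G)"
proof -
 let ?x = "pn (psub U V)" and ?h = "hnorm (dsub F G)"
 have p2: "1 \<le> 2 powr p" using p ge_one_powr_ge_zero[of 2 p] by simp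
 have "?x = pn (psub (duhmap dt F U) (duhmap dt G V))" by (rule pnorm_cong[OF U(3) V(3)])
 also have "... \<le> ennreal K * ?h + ennreal (1 / (2 * 2 powr p)) * ?x"
  by (rule contractsD[OF c F U(1) V(1) U(2) V(2)])
 also have "... \<le> ennreal K * ?h + ennreal (1 / 2) * ?x"
  using p2 by (intro add_mono mult_right_mono ennreal_leI) (auto simp: divide_le_eq)
 finally have "?x \<le> ennreal K * ?h + ennreal (1 / 2) * ?x" .
 moreover have "fin U" "fin V" using U V by (auto simp: fin_def intro: le_less_trans)
 then have "?x < \<infinity>" using fin_psub unfolding fin_def by blast
 ultimately have "?x \<le> ennreal 2 * (ennreal K * ?h)" by (rule ennreal_le_half)
 then show ?thesis using K by (simp add: ennreal_mult mult.assoc)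
qed

section \<open>Equality of the represented functions on a time interval\<close>

definition agree :: "real set \<Rightarrow> pair \<Rightarrow> pair \<Rightarrow> bool" where
 "agree J U V \<longleftrightarrow> (AE \<xi> in lborel. \<forall>t\<in>J. \<forall>sg\<in>{1, -1}. time_inv (sgnpart sg U) t \<xi> = time_inv (sgnpart sg V) t \<xi>)"

lemma agree_refl [simp]: "agree J U U"
 by (simp add: agree_def)

lemma agree_trans:
 assumes "agree J U V" "agree J V W"
 shows "agree J U W"
 using assms unfolding agree_def by eventually_elim simp

lemma agree_mono: "agree J U V \<Longrightarrow> I \<subseteq> J \<Longrightarrow> agree I U V"
 unfolding agree_def by (elim eventually_mono) blast

lemma agree_pequiv:
 assumes "pequiv U V" and b: "borel_pair U" "borel_pair V"
 shows "agree J U V"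
proof -
 have "AE \<xi> in lborel. AE \<tau> in lborel. fst U (\<xi>, \<tau>) = fst V (\<xi>, \<tau>) \<and> snd U (\<xi>, \<tau>) = snd V (\<xi>, \<tau>)"
  using assms(1) unfolding pequiv_def by (rule AE_lborel_section)
 then show ?thesis
  unfolding agree_def
 proof eventually_elim
  case (elim \<xi>)
  then have "AE \<tau> in lborel. fst U (\<xi>, \<tau>) = fst V (\<xi>, \<tau>)" "AE \<tau> in lborel. snd U (\<xi>, \<tau>) = snd V (\<xi>, \<tau>)"
   by (auto elim: eventually_mono)
  then have "time_inv (fst U) t \<xi> = time_inv (fst V) t \<xi>" "time_inv (snd U) t \<xi> = time_inv (snd V) t \<xi>" for t
   using b by (auto intro!: time_inv_cong_AE simp: borel_pair_def)
  then show ?case by simp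
 qed
qed

lemma measurable_time_inv [measurable]:
 assumes [measurable]: "U \<in> BM"
 shows "time_inv U t \<in> BM"
 unfolding time_inv_def[abs_def] by measurable

lemma fin_section:
 assumes "fin U"
 shows "AE \<xi> in lborel. integrable lborel (\<lambda>\<tau>. fst U (\<xi>, \<tau>)) \<and> integrable lborel (\<lambda>\<tau>. snd U (\<xi>, \<tau>))"
 using tame_section[OF fin_tame(1)[OF assms]] tame_section[OF fin_tame(2)[OF assms]] by eventually_elim simp

definition symbv :: "der \<Rightarrow> real^3 \<Rightarrow> complex \<Rightarrow> complex \<Rightarrow> complex" where
 "symbv d \<xi> x y = (case d of
   Dt \<Rightarrow> - \<i> * of_real (jap \<xi>) * (x - y)
  | Dx j \<Rightarrow> \<i> * of_real (\<xi> $ j) * (x + y))"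

lemma time_inv_symb:
 assumes "integrable lborel (\<lambda>\<tau>. fst U (\<xi>, \<tau>))" "integrable lborel (\<lambda>\<tau>. snd U (\<xi>, \<tau>))"
 shows "time_inv (symb d U) t \<xi> = symbv d \<xi> (time_inv (fst U) t \<xi>) (time_inv (snd U) t \<xi>)"
proof (cases d)
 case Dt
 have "symb d U = (\<lambda>q. (\<lambda>\<xi>. - \<i> * complex_of_real (jap \<xi>)) (fst q) * (\<lambda>q. fst U q - snd U q) q)"
  by (simp add: fun_eq_iff symb_def Dt)
 then have "time_inv (symb d U) t \<xi> = - \<i> * of_real (jap \<xi>) * time_inv (\<lambda>q. fst U q - snd U q) t \<xi>"
  using time_inv_cmult[of "\<lambda>\<xi>. - \<i> * complex_of_real (jap \<xi>)" "\<lambda>q. fst U q - snd U q" t \<xi>] by (simp only:)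
 then show ?thesis
  by (simp only: time_inv_diff[OF assms]) (simp add: symbv_def Dt)
next
 case (Dx j)
 have "symb d U = (\<lambda>q. (\<lambda>\<xi>. \<i> * complex_of_real (\<xi> $ j)) (fst q) * (\<lambda>q. fst U q + snd U q) q)"
  by (simp add: fun_eq_iff symb_def Dx)
 then have "time_inv (symb d U) t \<xi> = \<i> * of_real (\<xi> $ j) * time_inv (\<lambda>q. fst U q + snd U q) t \<xi>"
  using time_inv_cmult[of "\<lambda>\<xi>. \<i> * complex_of_real (\<xi> $ j)" "\<lambda>q. fst U q + snd U q" t \<xi>] by (simp only:)
 then show ?thesis
  by (simp only: time_inv_add[OF assms]) (simp add: symbv_def Dx)
qed

lemma agree_symb:
 assumes "fin U" "fin V" "agree J U V"
 shows "AE \<xi> in lborel. \<forall>t\<in>J. time_inv (symb d U) t \<xi> = time_inv (symb d V) t \<xi>"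
 using fin_section[OF assms(1)] fin_section[OF assms(2)] assms(3)[unfolded agree_def]
 by eventually_elim (simp add: time_inv_symb)

lemma conv3_cong:
 assumes [measurable]: "P \<in> BM" "P' \<in> BM" "Q \<in> BM" "Q' \<in> BM"
  and "AE \<xi> in lborel. P \<xi> = P' \<xi>" "AE \<xi> in lborel. Q \<xi> = Q' \<xi>"
 shows "conv3 P Q \<xi> = conv3 P' Q' \<xi>"
proof -
 have "AE \<eta> in lborel. Q (\<xi> - \<eta>) = Q' (\<xi> - \<eta>)" by (rule AE_lborel_reflect[OF assms(6)])
 with assms(5) have "AE \<eta> in lborel. P \<eta> * Q (\<xi> - \<eta>) = P' \<eta> * Q' (\<xi> - \<eta>)" by eventually_elim simp
 then have "(\<integral>\<eta>. P \<eta> * Q (\<xi> - \<eta>) \<partial>lborel) = (\<integral>\<eta>. P' \<eta> * Q' (\<xi> - \<eta>) \<partial>lborel)"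
  by (intro integral_cong_AE) simp_all
 then show ?thesis by (simp add: conv3_def)
qed

text \<open>The forcing term is local in time: its value at \<open>t\<close> depends only on the
  values of its arguments at \<open>t\<close>. For the time derivative this is due to
  \<open>symb\<close>, which expresses it through the functions themselves; the convolution sees
  these functions only up to null sets of frequencies.\<close>

lemma force_cong:
 assumes U: "fin U" "fin U'" "agree J U U'" and V: "fin V" "fin V'" "agree J V V'" and L: "fin L" "fin L'" "agree J L L'"
 shows "AE \<xi> in lborel. \<forall>t\<in>J. \<forall>sg. time_inv (force sg U V L) t \<xi> = time_inv (force sg U' V' L') t \<xi>"
proof -
 have c: "conv3 (time_inv (symb d1 U) t) (time_inv (symb d2 V) t) \<xi> = conv3 (time_inv (symb d1 U') t) (time_inv (symb d2 V') t) \<xi>" if "t \<in> J" for t \<xi>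
 proof (rule conv3_cong)
  show "AE \<xi> in lborel. time_inv (symb d1 U) t \<xi> = time_inv (symb d1 U') t \<xi>"
   using agree_symb[OF U, of d1] by eventually_elim (use that in blast)
  show "AE \<xi> in lborel. time_inv (symb d2 V) t \<xi> = time_inv (symb d2 V') t \<xi>"
   using agree_symb[OF V, of d2] by eventually_elim (use that in blast)
 qed (intro measurable_time_inv measurable_symb finD U V)+
 show ?thesis
  using force_section[OF U(1) V(1) L(1)] force_section[OF U(2) V(2) L(2)] L(3)[unfolded agree_def]
 proof eventually_elim
  case (elim \<xi>)
  show ?case
  proof (intro ballI allI)
   fix t sg assume t: "t \<in> J"
   have "time_inv (fst L) t \<xi> = time_inv (fst L') t \<xi>" "time_inv (snd L) t \<xi> = time_inv (snd L') t \<xi>"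
    using elim(3) t by (simp_all add: sgnpart_def)
   then show "time_inv (force sg U V L) t \<xi> = time_inv (force sg U' V' L') t \<xi>"
    using elim(1,2) c[OF t] by (simp only:)
  qed
 qed
qed

definition hdat :: "real \<Rightarrow> data \<Rightarrow> real^3 \<Rightarrow> complex" where
 "hdat sg F = (if sg = 1 then fst F else snd F)"

lemma duhmap_section:
 assumes U: "fin U" and dt: "0 < dt" "dt \<le> 1"
 shows "AE \<xi> in lborel. \<forall>sg\<in>{1, -1}. integrable lborel (\<lambda>\<tau>. sgnpart sg (duhmap dt F U) (\<xi>, \<tau>)) \<and>
  (\<forall>t. \<bar>t\<bar> \<le> dt \<longrightarrow> time_inv (sgnpart sg (duhmap dt F U)) t \<xi> = cis (- t * (sg * jap \<xi>)) *
   (hdat sg F \<xi> - \<i> * (LBINT t'=ereal 0..ereal t. cis (t' * (sg * jap \<xi>)) * time_inv (force sg U U U) t' \<xi>)))"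
 using force_section[OF U U U]
proof eventually_elim
 case (elim \<xi>)
 note [measurable] = finD[OF U]
 show ?case
 proof (intro ballI conjI allI impI)
  fix sg :: real and t :: real
  assume sg: "sg \<in> {1, -1}"
  have i: "integrable lborel (\<lambda>\<tau>. force sg U U U (\<xi>, \<tau>))" using elim by blast
  have m: "force sg U U U \<in> BM" by measurable
  note d = duh_ext_section[OF m i dt(1)] and f = free_ext_section
  have eq: "sgnpart sg (duhmap dt F U) = (\<lambda>q. free_ext sg (hdat sg F) q - (\<lambda>q. (\<lambda>_. \<i>) (fst q) * duh_ext dt 0 sg (force sg U U U) q) q)"
   unfolding sgnpart_duhmap[OF sg] hdat_def by simp
  have di: "integrable lborel (\<lambda>\<tau>. (\<lambda>_. \<i>) (fst (\<xi>, \<tau>)) * duh_ext dt 0 sg (force sg U U U) (\<xi>, \<tau>))"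
   by (intro integrable_mult_right d(1))
  show "integrable lborel (\<lambda>\<tau>. sgnpart sg (duhmap dt F U) (\<xi>, \<tau>))"
   unfolding eq by (intro Bochner_Integration.integrable_diff f(1) di)
  assume t: "\<bar>t\<bar> \<le> dt"
  have "time_inv (sgnpart sg (duhmap dt F U)) t \<xi> = time_inv (free_ext sg (hdat sg F)) t \<xi> - \<i> * time_inv (duh_ext dt 0 sg (force sg U U U)) t \<xi>"
   unfolding eq time_inv_diff[OF f(1) di] time_inv_cmult[where c="\<lambda>_. \<i>"] ..
  also have "time_inv (free_ext sg (hdat sg F)) t \<xi> = cis (- t * (sg * jap \<xi>)) * hdat sg F \<xi>"
   using t dt by (intro f(2)) auto
  also have "time_inv (duh_ext dt 0 sg (force sg U U U)) t \<xi> = cis (- t * (sg * jap \<xi>)) * (LBINT t'=ereal 0..ereal t. cis (t' * (sg * jap \<xi>)) * time_inv (force sg U U U) t' \<xi>)"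
   using t by (intro d(2)) auto
  finally show "time_inv (sgnpart sg (duhmap dt F U)) t \<xi> = cis (- t * (sg * jap \<xi>)) *
   (hdat sg F \<xi> - \<i> * (LBINT t'=ereal 0..ereal t. cis (t' * (sg * jap \<xi>)) * time_inv (force sg U U U) t' \<xi>))"
   by (simp add: algebra_simps)
 qed
qed

lemma interval_integrable_cont:
 fixes f :: "real \<Rightarrow> complex"
 assumes "continuous_on UNIV f"
 shows "interval_lebesgue_integrable lborel (ereal a) (ereal c) f"
proof (cases "a \<le> c")
 case True
 then show ?thesis by (rule interval_integrable_continuous_on) (rule continuous_on_subset[OF assms], simp)
next
 case False
 then have "interval_lebesgue_integrable lborel (ereal c) (ereal a) f"
  by (intro interval_integrable_continuous_on) (auto intro: continuous_on_subset[OF assms])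
 then show ?thesis by (subst interval_integrable_endpoints_reverse)
qed

lemma interval_cong_between:
 fixes f g :: "real \<Rightarrow> complex"
 assumes "\<And>x. min a c \<le> x \<Longrightarrow> x \<le> max a c \<Longrightarrow> f x = g x"
 shows "(LBINT x=ereal a..ereal c. f x) = (LBINT x=ereal a..ereal c. g x)"
 by (rule interval_integral_cong) (use assms in \<open>auto simp: einterval_def min_def max_def split: if_splits\<close>)

text \<open>The length of the cutoff is invisible inside the interval, where both maps reduce to the
  same Duhamel formula. This permits the passage from the short cutoff of the contraction to the
  unit one.\<close>

lemma duhmap_agree:
 assumes U: "fin U" "fin V" "agree {-dt..dt} U V" and dt: "0 < dt" "dt \<le> dt1" "dt \<le> dt2" "dt1 \<le> 1" "dt2 \<le> 1"
 shows "agree {-dt..dt} (duhmap dt1 F U) (duhmap dt2 F V)"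
proof -
 have "0 < dt1" "0 < dt2" using dt by auto
 with duhmap_section[OF U(1), of dt1 F] duhmap_section[OF U(2), of dt2 F]
 have "AE \<xi> in lborel. \<forall>sg\<in>{1, -1}. \<forall>t. \<bar>t\<bar> \<le> dt1 \<longrightarrow> time_inv (sgnpart sg (duhmap dt1 F U)) t \<xi> = cis (- t * (sg * jap \<xi>)) *
   (hdat sg F \<xi> - \<i> * (LBINT t'=ereal 0..ereal t. cis (t' * (sg * jap \<xi>)) * time_inv (force sg U U U) t' \<xi>))"
  "AE \<xi> in lborel. \<forall>sg\<in>{1, -1}. \<forall>t. \<bar>t\<bar> \<le> dt2 \<longrightarrow> time_inv (sgnpart sg (duhmap dt2 F V)) t \<xi> = cis (- t * (sg * jap \<xi>)) *
   (hdat sg F \<xi> - \<i> * (LBINT t'=ereal 0..ereal t. cis (t' * (sg * jap \<xi>)) * time_inv (force sg V V V) t' \<xi>))"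
  using dt by (auto elim!: eventually_mono)
 then show ?thesis
  using force_cong[OF U U U] unfolding agree_def
 proof eventually_elim
  case (elim \<xi>)
  show ?case
  proof (intro ballI)
   fix t sg :: real
   assume t: "t \<in> {-dt..dt}" and sg: "sg \<in> {1, -1}"
   have e: "(LBINT t'=ereal 0..ereal t. cis (t' * (sg * jap \<xi>)) * time_inv (force sg U U U) t' \<xi>) = (LBINT t'=ereal 0..ereal t. cis (t' * (sg * jap \<xi>)) * time_inv (force sg V V V) t' \<xi>)"
   proof (rule interval_cong_between)
    fix x assume "min 0 t \<le> x" "x \<le> max 0 t"
    then have "x \<in> {-dt..dt}" using t dt by (auto simp: min_def max_def split: if_splits)
    then show "cis (x * (sg * jap \<xi>)) * time_inv (force sg U U U) x \<xi> = cis (x * (sg * jap \<xi>)) * time_inv (force sg V V V) x \<xi>"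
     using elim(3) by simp
   qed
   have t': "\<bar>t\<bar> \<le> dt1" "\<bar>t\<bar> \<le> dt2" using t dt by auto
   have "time_inv (sgnpart sg (duhmap dt1 F U)) t \<xi> = cis (- t * (sg * jap \<xi>)) *
   (hdat sg F \<xi> - \<i> * (LBINT t'=ereal 0..ereal t. cis (t' * (sg * jap \<xi>)) * time_inv (force sg U U U) t' \<xi>))"
    using elim(1) sg t'(1) by blast
   moreover have "time_inv (sgnpart sg (duhmap dt2 F V)) t \<xi> = cis (- t * (sg * jap \<xi>)) *
   (hdat sg F \<xi> - \<i> * (LBINT t'=ereal 0..ereal t. cis (t' * (sg * jap \<xi>)) * time_inv (force sg V V V) t' \<xi>))"
    using elim(2) sg t'(2) by blast
   ultimately show "time_inv (sgnpart sg (duhmap dt1 F U)) t \<xi> = time_inv (sgnpart sg (duhmap dt2 F V)) t \<xi>"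
    unfolding e by simp
  qed
 qed
qed

text \<open>The Duhamel map of the linearized equation with zero value at \<open>t0\<close>. The
  solutions \<open>U\<close> and \<open>V\<close> occur only as coefficients; the argument
  \<open>D\<close> may be any extension of their difference.\<close>

definition lstep :: "pair \<Rightarrow> pair \<Rightarrow> real \<Rightarrow> real \<Rightarrow> pair \<Rightarrow> pair" where
 "lstep U V \<eta> t0 D = (\<lambda>q. - \<i> * duh_ext \<eta> t0 1 (linf 1 D U V) q, \<lambda>q. - \<i> * duh_ext \<eta> t0 (- 1) (linf (- 1) D U V) q)"

lemma sgnpart_lstep: "sg \<in> {1, -1} \<Longrightarrow> sgnpart sg (lstep U V \<eta> t0 D) = (\<lambda>q. (\<lambda>_. - \<i>) (fst q) * duh_ext \<eta> t0 sg (linf sg D U V) q)"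
 by (auto simp: lstep_def)

lemma borel_pair_lstep:
 assumes "borel_pair U" "borel_pair V" "borel_pair D"
 shows "borel_pair (lstep U V \<eta> t0 D)"
 unfolding borel_pair_def lstep_def fst_conv snd_conv
 by (intro conjI borel_measurable_times borel_measurable_const measurable_duh_ext measurable_linf assms)

text \<open>Linearity in \<open>D\<close> makes the factor depend on \<open>U\<close> and
  \<open>V\<close> through their norms alone, so one \<open>\<eta>\<close> serves all base points
  \<open>t0\<close>, and no smallness of the solutions is required.\<close>

lemma lstep_bound:
 assumes "fin U" "fin V" "0 < e" 
 shows "\<exists>\<eta>>0. \<eta> \<le> 1 \<and> (\<forall>t0 D. borel_pair D \<longrightarrow> pn (lstep U V \<eta> t0 D) \<le> ennreal e * pn D)"
proof -
 obtain C where C: "0 \<le> C" and Cb: "\<And>dt t0 sg D U V. 0 < dt \<Longrightarrow> dt \<le> 1 \<Longrightarrow> sg \<in> {1, -1} \<Longrightarrow> borel_pair D \<Longrightarrow> borel_pair U \<Longrightarrow> borel_pair V \<Longrightarrow>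
  X_int r sg s b (duh_ext dt t0 sg (linf sg D U V)) \<le> ennreal (C * dt powr ((1 - b) * p)) * (pn D * (pn U + pn V + 1))"
  using duh_linf_bound by blast
 define B where "B = enn2real (pn U + pn V + 1)"
 have B: "pn U + pn V + 1 = ennreal B" "0 \<le> B"
  using assms(1,2) by (simp_all add: B_def fin_def less_top)
 \<comment> \<open>The choice gives \<open>2 * (C * d * B) \<le> e\<close>, one summand for each
   sign; the added 1 keeps the denominator positive.\<close>
 define d where "d = min 1 (e / (2 * C * B + 1))"
 define \<eta> where "\<eta> = d powr (1 / ((1 - b) * p))"
 have CB: "0 \<le> 2 * C * B" using C B by simp
 then have "0 < 2 * C * B + 1" by linarith
 then have d: "0 < d" "d \<le> 1" using assms(3) by (simp_all add: d_def)
 have \<eta>: "0 < \<eta>" "\<eta> \<le> 1" using d b1 p(3) powr_le1[of "1 / ((1 - b) * p)" d] by (auto simp: \<eta>_def)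
 have \<eta>d: "\<eta> powr ((1 - b) * p) = d" using d b1 p(3) by (simp add: \<eta>_def powr_powr)
 have "d \<le> e / (2 * C * B + 1)" by (simp add: d_def)
 then have "d * (2 * C * B + 1) \<le> e" using \<open>0 < 2 * C * B + 1\<close> by (simp only: pos_le_divide_eq)
 then have de: "2 * (C * d * B) \<le> e" using d by (simp add: algebra_simps)
 have "pn (lstep U V \<eta> t0 D) \<le> ennreal e * pn D" if D: "borel_pair D" for t0 D
 proof -
  have X: "X_int r sg s b (\<lambda>q. - \<i> * duh_ext \<eta> t0 sg (linf sg D U V) q) \<le> ennreal (C * d * B) * pn D" if sg: "sg \<in> {1, -1}" for sg
  proof -
   have "X_int r sg s b (\<lambda>q. - \<i> * duh_ext \<eta> t0 sg (linf sg D U V) q) = X_int r sg s b (duh_ext \<eta> t0 sg (linf sg D U V))"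
    by (simp add: X_int_def norm_mult)
   also have "... \<le> ennreal (C * \<eta> powr ((1 - b) * p)) * (pn D * (pn U + pn V + 1))"
    by (intro Cb \<eta> sg D finD assms)
   also have "... = ennreal (C * d * B) * pn D"
    unfolding \<eta>d B(1) using C d B(2) by (simp add: ennreal_mult mult_ac)
   finally show ?thesis .
  qed
  have "pn (lstep U V \<eta> t0 D) \<le> ennreal (C * d * B) * pn D + ennreal (C * d * B) * pn D"
   unfolding lstep_def pnorm_def[of r s b "(f, g)" for f g] fst_conv snd_conv by (intro add_mono X) auto
  also have "... = ennreal (2 * (C * d * B)) * pn D"
  proof -
   have "ennreal (2 * (C * d * B)) = ennreal (C * d * B) + ennreal (C * d * B)"
    using C d B(2) by (subst ennreal_plus[symmetric]) auto
   then show ?thesis by (simp only: distrib_right)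
  qed
  also have "... \<le> ennreal e * pn D"
   using de by (intro mult_right_mono ennreal_leI) auto
  finally show ?thesis .
 qed
 then show ?thesis using \<eta> by blast
qed

lemma linf_section:
 assumes "fin D" "fin U" "fin V"
 shows "AE \<xi> in lborel. \<forall>sg. integrable lborel (\<lambda>\<tau>. linf sg D U V (\<xi>, \<tau>)) \<and>
  (\<forall>t. time_inv (linf sg D U V) t \<xi> = time_inv (force sg D U D) t \<xi> + time_inv (force sg V D pzero) t \<xi>)"
 using force_section[OF assms(1,2,1)] force_section[OF assms(3,1) fin_pzero]
proof eventually_elim
 case (elim \<xi>)
 show ?case
 proof (intro allI conjI)
  fix sg t
  have i: "integrable lborel (\<lambda>\<tau>. force sg D U D (\<xi>, \<tau>))" "integrable lborel (\<lambda>\<tau>. force sg V D pzero (\<xi>, \<tau>))"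
   using elim by blast+
  have e: "linf sg D U V = (\<lambda>q. force sg D U D q + force sg V D pzero q)" by (simp add: fun_eq_iff linf_def)
  show "integrable lborel (\<lambda>\<tau>. linf sg D U V (\<xi>, \<tau>))" unfolding e by (intro Bochner_Integration.integrable_add i)
  show "time_inv (linf sg D U V) t \<xi> = time_inv (force sg D U D) t \<xi> + time_inv (force sg V D pzero) t \<xi>"
   unfolding e by (rule time_inv_add[OF i])
 qed
qed

lemma linf_psub_section:
 assumes "fin U" "fin V"
 shows "AE \<xi> in lborel. \<forall>sg\<in>{1, -1}. \<forall>t. time_inv (linf sg (psub U V) U V) t \<xi> = time_inv (force sg U U U) t \<xi> - time_inv (force sg V V V) t \<xi>"
 using AE_lborel_section[OF force_diff_AE[OF assms, of 1]] AE_lborel_section[OF force_diff_AE[OF assms, of "- 1"]]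
  force_section[OF assms(1,1,1)] force_section[OF assms(2,2,2)]
proof eventually_elim
 case (elim \<xi>)
 show ?case
 proof (intro ballI allI)
  fix sg t :: real assume "sg \<in> {1, -1}"
  then have e: "AE \<tau> in lborel. force sg U U U (\<xi>, \<tau>) - force sg V V V (\<xi>, \<tau>) = linf sg (psub U V) U V (\<xi>, \<tau>)"
   using elim(1,2) by blast
  have i: "integrable lborel (\<lambda>\<tau>. force sg U U U (\<xi>, \<tau>))" "integrable lborel (\<lambda>\<tau>. force sg V V V (\<xi>, \<tau>))"
   using elim(3,4) by blast+
  have "time_inv (linf sg (psub U V) U V) t \<xi> = time_inv (\<lambda>q. force sg U U U q - force sg V V V q) t \<xi>"
  proof (rule time_inv_cong_AE)
   show "AE \<tau> in lborel. linf sg (psub U V) U V (\<xi>, \<tau>) = force sg U U U (\<xi>, \<tau>) - force sg V V V (\<xi>, \<tau>)"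
    using e by eventually_elim simp
  qed (intro measurable_linf measurable_forcing borel_pair_psub borel_measurable_diff finD assms)+
  also have "... = time_inv (force sg U U U) t \<xi> - time_inv (force sg V V V) t \<xi>" by (rule time_inv_diff[OF i])
  finally show "time_inv (linf sg (psub U V) U V) t \<xi> = time_inv (force sg U U U) t \<xi> - time_inv (force sg V V V) t \<xi>" .
 qed
qed

lemma psub_section:
 assumes "fin U" "fin V"
 shows "AE \<xi> in lborel. \<forall>sg\<in>{1, -1}. \<forall>t. time_inv (sgnpart sg (psub U V)) t \<xi> = time_inv (sgnpart sg U) t \<xi> - time_inv (sgnpart sg V) t \<xi>"
 using fin_section[OF assms(1)] fin_section[OF assms(2)]
 by eventually_elim (simp add: psub_def time_inv_diff)

text \<open>On \<open>J\<close> the linearized forcing depends only on the values of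
  \<open>D\<close>, which are those of U - V, and there it equals the difference of the two forcing
  terms. The Duhamel integral of this difference from \<open>t0\<close> is the difference of the
  solutions.\<close>

lemma lstep_agree:
 assumes U: "fin U" "agree {-dt..dt} U (duhmap 1 F U)" and V: "fin V" "agree {-dt..dt} V (duhmap 1 F V)"
  and D: "fin D" and J: "J = {max (t0 - \<eta>) (- dt)..min (t0 + \<eta>) dt}" and DJ: "agree J D (psub U V)"
  and t0: "t0 \<in> {-dt..dt}" "agree {t0} U V" and dt: "0 < dt" "dt \<le> 1" and \<eta>: "0 < \<eta>"
 shows "agree J (lstep U V \<eta> t0 D) (psub U V)"
proof -
 let ?D = "psub U V"
 have fD: "fin ?D" by (rule fin_psub[OF U(1) V(1)])
 have m: "linf sg D U V \<in> BM" for sg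
  by (intro measurable_linf finD D U V)
 have one: "0 < (1::real)" "(1::real) \<le> 1" by auto
 show ?thesis
  using force_cong[OF D fD DJ U(1) U(1) agree_refl D fD DJ] force_cong[OF V(1) V(1) agree_refl D fD DJ fin_pzero fin_pzero agree_refl]
   linf_section[OF D U(1) V(1)] linf_section[OF fD U(1) V(1)] linf_psub_section[OF U(1) V(1)]
   duhmap_section[OF U(1) one, of F] duhmap_section[OF V(1) one, of F] U(2)[unfolded agree_def] V(2)[unfolded agree_def] t0(2)[unfolded agree_def]
   psub_section[OF U(1) V(1)] force_section[OF U(1) U(1) U(1)] force_section[OF V(1) V(1) V(1)]
  unfolding agree_def
 proof eventually_elim
  case (elim \<xi>)
  show ?case
  proof (intro ballI)
   fix t sg :: real
   assume t: "t \<in> J" and sg: "sg \<in> {1, -1}"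
   let ?a = "sg * jap \<xi>"
   let ?f = "\<lambda>U x. cis (x * ?a) * time_inv (force sg U U U) x \<xi>"
   define I where "I = (\<lambda>U a t. LBINT x=ereal a..ereal t. ?f U x)"
   have iUV: "integrable lborel (\<lambda>\<tau>. force sg U U U (\<xi>, \<tau>))" "integrable lborel (\<lambda>\<tau>. force sg V V V (\<xi>, \<tau>))"
    using elim(12,13) by blast+
   have c: "continuous_on UNIV (?f U)" "continuous_on UNIV (?f V)"
    by (intro continuous_intros continuous_time_inv iUV)+
   have Jdt: "J \<subseteq> {-dt..dt}" "t0 \<in> J" using J t0 dt \<eta> by auto
   have e: "time_inv (sgnpart sg U) t \<xi> - time_inv (sgnpart sg V) t \<xi> = - \<i> * cis (- t * ?a) * (I U 0 t - I V 0 t)" if "t \<in> {-dt..dt}" for t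
   proof -
    have t1: "\<bar>t\<bar> \<le> 1" using that dt by auto
    have "time_inv (sgnpart sg U) t \<xi> = cis (- t * ?a) * (hdat sg F \<xi> - \<i> * I U 0 t)"
     unfolding I_def by (rule trans[OF bspec[OF bspec[OF elim(8) that] sg] mp[OF spec[OF conjunct2[OF bspec[OF elim(6) sg]]] t1]])
    moreover have "time_inv (sgnpart sg V) t \<xi> = cis (- t * ?a) * (hdat sg F \<xi> - \<i> * I V 0 t)"
     unfolding I_def by (rule trans[OF bspec[OF bspec[OF elim(9) that] sg] mp[OF spec[OF conjunct2[OF bspec[OF elim(7) sg]]] t1]])
    ultimately show ?thesis by (simp only: right_diff_distrib mult_minus_left) (simp add: mult_ac)
   qed
   have split: "I W 0 t = I W 0 t0 + I W t0 t" if "W = U \<or> W = V" for W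
   proof -
    have "interval_lebesgue_integrable lborel (min 0 (min (ereal t0) (ereal t))) (max 0 (max (ereal t0) (ereal t))) (?f W)"
    proof -
     have "min 0 (min (ereal t0) (ereal t)) = ereal (min 0 (min t0 t))" "max 0 (max (ereal t0) (ereal t)) = ereal (max 0 (max t0 t))"
      by (simp_all add: zero_ereal_def)
     moreover have "continuous_on UNIV (?f W)" using c that by blast
     ultimately show ?thesis by (simp only: interval_integrable_cont)
    qed
    then show ?thesis
     unfolding I_def using interval_integral_sum[of 0 "ereal t0" "ereal t" "?f W"] by (simp add: zero_ereal_def)
   qed
   \<comment> \<open>The Duhamel formulas start at time 0. Agreement at \<open>t0\<close> says that
     the parts of the integrals from 0 to \<open>t0\<close> are equal, which moves the starting
     point to \<open>t0\<close>.\<close>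
   have "I U 0 t0 - I V 0 t0 = 0"
   proof -
    have "time_inv (sgnpart sg U) t0 \<xi> = time_inv (sgnpart sg V) t0 \<xi>" using elim(10) sg by blast
    then have "- \<i> * cis (- t0 * ?a) * (I U 0 t0 - I V 0 t0) = 0" using e[OF t0(1)] by simp
    then show ?thesis by (simp add: mult_eq_0_iff)
   qed
   then have I: "I U 0 t - I V 0 t = I U t0 t - I V t0 t" using split[of U] split[of V] by (simp add: algebra_simps)
   have tJ: "t \<in> {-dt..dt}" using t Jdt by blast
   have u: "time_inv (sgnpart sg ?D) t \<xi> = - \<i> * cis (- t * ?a) * (I U t0 t - I V t0 t)"
    unfolding spec[OF bspec[OF elim(11) sg]] e[OF tJ] I ..
   have i: "integrable lborel (\<lambda>\<tau>. linf sg D U V (\<xi>, \<tau>))" using elim(3) by blast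
   have tt: "\<bar>t - t0\<bar> \<le> \<eta>" using t J by auto
   have "time_inv (sgnpart sg (lstep U V \<eta> t0 D)) t \<xi> = - \<i> * time_inv (duh_ext \<eta> t0 sg (linf sg D U V)) t \<xi>"
    unfolding sgnpart_lstep[OF sg] by (rule time_inv_cmult[where c="\<lambda>_. - \<i>"])
   also have "time_inv (duh_ext \<eta> t0 sg (linf sg D U V)) t \<xi> = cis (- t * ?a) * (LBINT x=ereal t0..ereal t. cis (x * ?a) * time_inv (linf sg D U V) x \<xi>)"
    by (rule duh_ext_section(2)[OF m i \<eta> tt])
   also have "(LBINT x=ereal t0..ereal t. cis (x * ?a) * time_inv (linf sg D U V) x \<xi>) = (LBINT x=ereal t0..ereal t. ?f U x - ?f V x)"
   proof (rule interval_cong_between)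
    fix x assume "min t0 t \<le> x" "x \<le> max t0 t"
    then have x: "x \<in> J" using t Jdt(2) unfolding J by (auto simp: min_def max_def split: if_splits)
    have "time_inv (linf sg D U V) x \<xi> = time_inv (force sg D U D) x \<xi> + time_inv (force sg V D pzero) x \<xi>"
     using elim(3) by blast
    also have "... = time_inv (force sg ?D U ?D) x \<xi> + time_inv (force sg V ?D pzero) x \<xi>"
     using elim(1,2) x by simp
    also have "... = time_inv (linf sg ?D U V) x \<xi>" using elim(4) by simp
    also have "... = time_inv (force sg U U U) x \<xi> - time_inv (force sg V V V) x \<xi>" using elim(5) sg by blast
    finally show "cis (x * ?a) * time_inv (linf sg D U V) x \<xi> = ?f U x - ?f V x" by (simp add: right_diff_distrib)
   qed
   also have "... = I U t0 t - I V t0 t"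
    unfolding I_def by (intro interval_lebesgue_integral_diff interval_integrable_cont c)
   finally show "time_inv (sgnpart sg (lstep U V \<eta> t0 D)) t \<xi> = time_inv (sgnpart sg ?D) t \<xi>"
    unfolding u by (simp add: mult.assoc)
  qed
 qed
qed

lemma time_inv_le: "ennreal (cmod (time_inv U t \<xi>)) \<le> (\<L> \<tau>. ennreal (cmod (U (\<xi>, \<tau>))))"
proof -
 have "cmod (time_inv U t \<xi>) \<le> 1 * cmod (\<integral>\<tau>. cis (t * \<tau>) * U (\<xi>, \<tau>) \<partial>lborel)"
  unfolding time_inv_def norm_mult using pi_gt3 by (intro mult_right_mono) (auto simp: norm_divide)
 then have "ennreal (cmod (time_inv U t \<xi>)) \<le> ennreal (cmod (\<integral>\<tau>. cis (t * \<tau>) * U (\<xi>, \<tau>) \<partial>lborel))"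
  by (intro ennreal_leI) simp
 also have "... \<le> (\<L> \<tau>. ennreal (cmod (cis (t * \<tau>) * U (\<xi>, \<tau>))))" by (rule cmod_integral_le)
 finally show ?thesis by (simp add: norm_mult)
qed

lemma X_int_sgnpart_le: "sg \<in> {1, -1} \<Longrightarrow> X_int r sg s b (sgnpart sg U) \<le> pn U"
 by (auto simp: pnorm_def intro: add_increasing add_increasing2)

text \<open>At a time in \<open>J\<close> the value of \<open>E\<close> is that of every
  \<open>D n\<close>, and the embedding bounds this value by the norm of \<open>D n\<close>, which
  tends to 0.\<close>

lemma section_zero:
 assumes D: "\<And>n. borel_pair (D n)" "\<And>n. agree J (D n) E" "\<And>n. pn (D n) \<le> ennreal (A * (1 / 2) ^ n)" and A: "0 \<le> A"
  and E: "borel_pair E" and t: "t \<in> J" and sg: "sg \<in> {1, -1}"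
 shows "AE \<xi> in lborel. time_inv (sgnpart sg E) t \<xi> = 0"
proof -
 note [measurable] = E D(1)
 define c where "c = enn2real (Jint (b * r)) powr (p / r)"
 define w where "w = (\<lambda>\<xi>. ennreal (jap \<xi> powr (s * p)))"
 let ?I = "\<L> \<xi>. w \<xi> * epow (ennreal (cmod (time_inv (sgnpart sg E) t \<xi>))) p"
 have bd: "?I \<le> ennreal (c * A * (1 / 2) ^ n)" for n
 proof -
  have "?I \<le> (\<L> \<xi>. w \<xi> * epow (\<L> \<tau>. ennreal (cmod (sgnpart sg (D n) (\<xi>, \<tau>)))) p)"
  proof (rule nn_integral_mono_AE)
   show "AE \<xi> in lborel. w \<xi> * epow (ennreal (cmod (time_inv (sgnpart sg E) t \<xi>))) p \<le> w \<xi> * epow (\<L> \<tau>. ennreal (cmod (sgnpart sg (D n) (\<xi>, \<tau>)))) p"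
    using D(2)[of n] unfolding agree_def
   proof eventually_elim
    case (elim \<xi>)
    have "time_inv (sgnpart sg E) t \<xi> = time_inv (sgnpart sg (D n)) t \<xi>" by (rule sym[OF bspec[OF bspec[OF elim t] sg]])
    then show ?case using time_inv_le[of "sgnpart sg (D n)" t \<xi>] p(3) by (intro mult_left_mono epow_mono) auto
   qed
  qed
  also have "... \<le> ennreal c * X_int r sg s b (sgnpart sg (D n))"
   unfolding w_def c_def using sg by (intro time_mass_bound) auto
  also have "... \<le> ennreal c * ennreal (A * (1 / 2) ^ n)"
   using order_trans[OF X_int_sgnpart_le[OF sg] D(3)] by (intro mult_left_mono) auto
  also have "... = ennreal (c * A * (1 / 2) ^ n)"
   using A by (simp add: c_def mult.assoc flip: ennreal_mult)
  finally show ?thesis .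
 qed
 have "(\<lambda>n. ennreal (c * A * (1 / 2) ^ n)) \<longlonglongrightarrow> ennreal (c * A * 0)"
  by (intro tendsto_ennrealI tendsto_mult tendsto_const LIMSEQ_power_zero) auto
 then have "?I \<le> ennreal (c * A * 0)" using bd by (intro LIMSEQ_le_const) auto
 then have "?I = 0" by simp
 then have "AE \<xi> in lborel. w \<xi> * epow (ennreal (cmod (time_inv (sgnpart sg E) t \<xi>))) p = 0"
  by (subst (asm) nn_integral_0_iff_AE) (simp_all add: w_def)
 then show ?thesis
 proof eventually_elim
  case (elim \<xi>)
  then have "cmod (time_inv (sgnpart sg E) t \<xi>) powr p = 0"
   using jap_pos[of \<xi>] by (simp add: w_def ennreal_eq_0_iff not_le)
  then show ?case by simp
 qed
qed

lemma agree_all_times: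
 assumes "fin U" "fin V" "a < c" "\<And>t. t \<in> {a..c} \<Longrightarrow> agree {t} U V"
 shows "agree {a..c} U V"
proof -
 have e: "AE \<xi> in lborel. \<forall>t\<in>{a..c}. time_inv (sgnpart sg U) t \<xi> = time_inv (sgnpart sg V) t \<xi>" if sg: "sg \<in> {1, -1}" for sg
 proof (rule AE_all_interval[OF assms(3)])
  show "AE \<xi> in lborel. time_inv (sgnpart sg U) t \<xi> = time_inv (sgnpart sg V) t \<xi>" if "t \<in> {a..c}" for t
   using assms(4)[OF that] unfolding agree_def by (elim eventually_mono) (use sg in blast)
  show "AE \<xi> in lborel. continuous_on {a..c} (\<lambda>t. time_inv (sgnpart sg U) t \<xi>) \<and> continuous_on {a..c} (\<lambda>t. time_inv (sgnpart sg V) t \<xi>)"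
   using fin_section[OF assms(1)] fin_section[OF assms(2)]
   by eventually_elim (simp add: sgnpart_def continuous_time_inv)
 qed
 from e[OF insertI1] e[OF insertI2[OF insertI1]] show ?thesis
  unfolding agree_def by eventually_elim simp
qed

lemma local_uniqueness:
 assumes U: "fin U" "agree {-dt..dt} U (duhmap 1 F U)" and V: "fin V" "agree {-dt..dt} V (duhmap 1 F V)" and dt: "0 < dt" "dt \<le> 1"
 shows "\<exists>\<eta>>0. \<forall>t0\<in>{-dt..dt}. agree {t0} U V \<longrightarrow> agree {max (t0 - \<eta>) (- dt)..min (t0 + \<eta>) dt} U V"
proof -
 obtain \<eta> where \<eta>: "0 < \<eta>" and \<eta>b: "\<And>t0 D. borel_pair D \<Longrightarrow> pn (lstep U V \<eta> t0 D) \<le> ennreal (1 / 2) * pn D"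
  using lstep_bound[OF U(1) V(1), of "1 / 2"] by auto
 have "agree {max (t0 - \<eta>) (- dt)..min (t0 + \<eta>) dt} U V" if t0: "t0 \<in> {-dt..dt}" "agree {t0} U V" for t0
 proof -
  let ?J = "{max (t0 - \<eta>) (- dt)..min (t0 + \<eta>) dt}"
  define D where "D = (\<lambda>n. (lstep U V \<eta> t0 ^^ n) (psub U V))"
  have D0: "D 0 = psub U V" and DS: "D (Suc n) = lstep U V \<eta> t0 (D n)" for n by (simp_all add: D_def)
  have f0: "fin (psub U V)" by (rule fin_psub[OF U(1) V(1)])
  define A where "A = enn2real (pn (psub U V))"
  have A: "0 \<le> A" "pn (psub U V) = ennreal A" using f0 by (simp_all add: A_def fin_def)
  have "borel_pair (D n) \<and> pn (D n) \<le> ennreal (A * (1 / 2) ^ n) \<and> agree ?J (D n) (psub U V)" for n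
  proof (induction n)
   case 0
   then show ?case using finD[OF f0] A by (simp add: D0)
  next
   case (Suc n)
   then have IH: "borel_pair (D n)" "pn (D n) \<le> ennreal (A * (1 / 2) ^ n)" "agree ?J (D n) (psub U V)" by auto
   have fD: "fin (D n)" unfolding fin_def using IH(1) le_less_trans[OF IH(2)] by simp
   have "pn (D (Suc n)) \<le> ennreal (1 / 2) * pn (D n)" unfolding DS by (rule \<eta>b[OF IH(1)])
   also have "... \<le> ennreal (1 / 2) * ennreal (A * (1 / 2) ^ n)" by (intro mult_left_mono IH) simp
   also have "... = ennreal (1 / 2 * (A * (1 / 2) ^ n))" using A by (intro ennreal_mult[symmetric]) auto
   also have "1 / 2 * (A * (1 / 2) ^ n) = A * (1 / 2) ^ Suc n" by simp
   finally have "pn (D (Suc n)) \<le> ennreal (A * (1 / 2) ^ Suc n)" .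
   moreover have "agree ?J (D (Suc n)) (psub U V)"
    unfolding DS by (rule lstep_agree[OF U V fD refl IH(3) t0 dt \<eta>])
   moreover have "borel_pair (D (Suc n))" unfolding DS by (rule borel_pair_lstep[OF finD[OF U(1)] finD[OF V(1)] IH(1)])
   ultimately show ?case by blast
  qed
  then have "\<And>n. borel_pair (D n)" "\<And>n. agree ?J (D n) (psub U V)" "\<And>n. pn (D n) \<le> ennreal (A * (1 / 2) ^ n)" by blast+
  note z = section_zero[OF this A(1) finD[OF f0]]
  have "agree {t} U V" if t: "t \<in> ?J" for t
   using z[OF t insertI1] z[OF t insertI2[OF insertI1]] psub_section[OF U(1) V(1)] unfolding agree_def
   by eventually_elim simp
  moreover have "max (t0 - \<eta>) (- dt) < min (t0 + \<eta>) dt" using t0 dt \<eta> by auto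
  ultimately show ?thesis by (intro agree_all_times U V) auto
 qed
 then show ?thesis using \<eta> by blast
qed

lemma uniqueness:
 assumes U: "fin U" "agree {-dt..dt} U (duhmap 1 F U)" and V: "fin V" "agree {-dt..dt} V (duhmap 1 F V)" and dt: "0 < dt" "dt \<le> 1"
 shows "agree {-dt..dt} U V"
proof -
 obtain \<eta> where \<eta>: "0 < \<eta>" and step: "\<And>t0. t0 \<in> {-dt..dt} \<Longrightarrow> agree {t0} U V \<Longrightarrow> agree {max (t0 - \<eta>) (- dt)..min (t0 + \<eta>) dt} U V"
  using local_uniqueness[OF assms] by blast
 have one: "0 < (1::real)" "(1::real) \<le> 1" by auto
 have zero: "agree {0} U V"
  using duhmap_section[OF U(1) one, of F] duhmap_section[OF V(1) one, of F] U(2) V(2) unfolding agree_def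
  by eventually_elim (use dt in simp)
 have ind: "\<forall>t\<in>{-dt..dt}. \<bar>t\<bar> \<le> real n * \<eta> \<longrightarrow> agree {t} U V" for n
 proof (induction n)
  case 0
  then show ?case using zero by auto
 next
  case (Suc n)
  show ?case
  proof (intro ballI impI)
   fix t assume t: "t \<in> {-dt..dt}" "\<bar>t\<bar> \<le> real (Suc n) * \<eta>"
   \<comment> \<open>The point \<open>t\<close> moved towards 0 by one step of length
     \<open>\<eta>\<close>, without passing 0; it belongs to the range already treated.\<close>
   define t0 where "t0 = (if \<bar>t\<bar> \<le> \<eta> then 0 else if 0 < t then t - \<eta> else t + \<eta>)"
   have n\<eta>: "0 \<le> real n * \<eta>" using \<eta> by simp
   have "\<bar>t\<bar> \<le> real n * \<eta> + \<eta>" using t(2) by (simp add: algebra_simps)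
   then have "t0 \<in> {-dt..dt}" "\<bar>t0\<bar> \<le> real n * \<eta>" "\<bar>t - t0\<bar> \<le> \<eta>"
    using t(1) \<eta> n\<eta> dt by (auto simp: t0_def)
   moreover from this Suc have "agree {t0} U V" by blast
   ultimately have "agree {max (t0 - \<eta>) (- dt)..min (t0 + \<eta>) dt} U V" "t \<in> {max (t0 - \<eta>) (- dt)..min (t0 + \<eta>) dt}"
    using step[of t0] t(1) by auto
   then show "agree {t} U V" by (auto intro: agree_mono)
  qed
 qed
 have "agree {t} U V" if t: "t \<in> {-dt..dt}" for t
 proof -
  obtain n where "\<bar>t\<bar> / \<eta> < real n" using reals_Archimedean2 by blast
  then have "\<bar>t\<bar> \<le> real n * \<eta>" using \<eta> by (simp add: field_simps)
  then show ?thesis using ind[of n] t by blast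
 qed
 then show ?thesis using dt by (intro agree_all_times U V) auto
qed

end

section \<open>Solutions of the system\<close>

context wave_system
begin

lemma Hhat_int_mono_s:
 assumes "s' \<le> s''"
 shows "Hhat_int r s' F \<le> Hhat_int r s'' F"
 unfolding Hhat_int_borel
 using p(3) assms by (intro nn_integral_mono ennreal_leI powr_mono2 mult_right_mono powr_mono) auto

text \<open>The time derivative splits into a part in X_{s,b}, covered by the estimate of the map
  itself, and a part in X_{s-1,1+b}. For the latter the Duhamel operator with unit cutoff gains one
  full power of the modulation over the forcing term, which lies in X_{s-1,b}.\<close>

lemma duhmap_dt_bound:
 assumes sg: "sg \<in> {1, -1}"
 shows "\<exists>C\<ge>0. \<forall>F G U V. borel_data F \<longrightarrow> borel_data G \<longrightarrow> fin U \<longrightarrow> fin V \<longrightarrow>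
  X_int r sg (s - 1) b (dt_hat (sgnpart sg (psub (duhmap 1 F U) (duhmap 1 G V))))
   \<le> ennreal C * (hnorm (dsub F G) + pn (psub U V) * (pn U + pn V + 1))"
proof -
 obtain C1 where C1: "1 \<le> C1" and C1b: "\<And>dt F G U V. 0 < dt \<Longrightarrow> dt \<le> 1 \<Longrightarrow> fst F \<in> BM \<Longrightarrow> snd F \<in> BM \<Longrightarrow>
  fst G \<in> BM \<Longrightarrow> snd G \<in> BM \<Longrightarrow> fin U \<Longrightarrow> fin V \<Longrightarrow>
  pn (psub (duhmap dt F U) (duhmap dt G V)) \<le> ennreal C1 * (hnorm (dsub F G)
   + ennreal (dt powr ((1 - b) * p)) * (pn (psub U V) * (pn U + pn V + 1)))"
  using duhmap_diff_bound by blast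
 obtain C2 where C2: "0 \<le> C2" and C2b: "\<And>sg s b F. 0 \<le> b \<Longrightarrow> b \<le> 2 \<Longrightarrow> \<bar>sg\<bar> = 1 \<Longrightarrow> F \<in> BM \<Longrightarrow>
  X_int r sg s b (free_ext sg F) \<le> ennreal C2 * Hhat_int r s F"
  using free_ext_bound[OF r1] by blast
 obtain C3 where C3: "0 \<le> C3" and C3q: "\<forall>t0 sg s b G. 0 \<le> b \<and> b \<le> 1 \<and> \<bar>sg\<bar> = 1 \<and> G \<in> BM \<longrightarrow>
    X_int r sg s (1 + b) (duh_ext 1 t0 sg G) \<le> ennreal C3 * X_int r sg s b G"
  using duh_ext_bound[OF r1] by (elim exE conjE) (rule that)
 have C3b: "X_int r sg s (1 + b) (duh_ext 1 t0 sg G) \<le> ennreal C3 * X_int r sg s b G"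
  if "0 \<le> b" "b \<le> 1" "\<bar>sg\<bar> = 1" "G \<in> BM" for t0 sg s b G
  using C3q that by blast
 have asg: "\<bar>sg\<bar> = 1" using sg by auto
 obtain C4 where C4: "0 \<le> C4" and C4b: "\<And>D U V. borel_pair D \<Longrightarrow> borel_pair U \<Longrightarrow> borel_pair V \<Longrightarrow>
  X_int r sg (s - 1) b (linf sg D U V) \<le> ennreal C4 * (pn D * (pn U + pn V + 1))"
  using linf_bound[OF sg] by blast
 define C where "C = 2 powr p * (C1 + 2 powr p * (C2 + C3 * C4))"
 have C0: "0 \<le> C" using C1 C2 C3 C4 by (simp add: C_def)
 have "X_int r sg (s - 1) b (dt_hat (sgnpart sg (psub (duhmap 1 F U) (duhmap 1 G V))))
  \<le> ennreal C * (hnorm (dsub F G) + pn (psub U V) * (pn U + pn V + 1))"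
  if F: "borel_data F" "borel_data G" and U: "fin U" "fin V" for F G U V
 proof -
  let ?E = "sgnpart sg (psub (duhmap 1 F U) (duhmap 1 G V))" and ?f = "\<lambda>\<xi>. hdat sg F \<xi> - hdat sg G \<xi>"
  let ?h = "hnorm (dsub F G)"
  define X where "X = pn (psub U V) * (pn U + pn V + 1)"
  note fU = finD[OF U(1)] and fV = finD[OF U(2)]
  have bE: "borel_pair (psub (duhmap 1 F U) (duhmap 1 G V))"
   by (intro borel_pair_psub borel_pair_duhmap' F fU fV)
  have [measurable]: "?f \<in> BM" using F by (auto simp: borel_data_def hdat_def)
  have [measurable]: "linf sg (psub U V) U V \<in> BM" by (intro measurable_linf borel_pair_psub fU fV)
  have h: "Hhat_int r s ?f \<le> ?h" using sg by (auto simp: hdat_def hnorm_def intro: add_increasing add_increasing2)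
  have e1: "X_int r sg s b ?E \<le> ennreal C1 * (?h + X)"
  proof -
   have "X_int r sg s b ?E \<le> pn (psub (duhmap 1 F U) (duhmap 1 G V))" by (rule X_int_sgnpart_le[OF sg])
   also have "... \<le> ennreal C1 * (?h + ennreal (1 powr ((1 - b) * p)) * X)"
    unfolding X_def using F U by (intro C1b) (auto simp: borel_data_def)
   finally show ?thesis by simp
  qed
  have e2: "X_int r sg (s - 1) (1 + b) ?E \<le> ennreal (2 powr p) * (X_int r sg (s - 1) (1 + b) (free_ext sg ?f) + X_int r sg (s - 1) (1 + b) (duh_ext 1 0 sg (linf sg (psub U V) U V)))"
  proof (rule X_int_add_le[OF r1])
   show "AE q in lborel. cmod (?E q) \<le> cmod (free_ext sg ?f q) + cmod (duh_ext 1 0 sg (linf sg (psub U V) U V) q)"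
    using duh_force_diff_AE[OF zero_less_one U, of 0 sg]
   proof eventually_elim
    case (elim q)
    have "?E q = (free_ext sg (hdat sg F) q - \<i> * duh_ext 1 0 sg (force sg U U U) q) - (free_ext sg (hdat sg G) q - \<i> * duh_ext 1 0 sg (force sg V V V) q)"
     unfolding sgnpart_psub sgnpart_duhmap[OF sg] hdat_def ..
    also have "... = free_ext sg ?f q - \<i> * duh_ext 1 0 sg (linf sg (psub U V) U V) q"
     unfolding elim[symmetric] by (simp add: free_ext_def algebra_simps)
    finally show ?case
     using norm_triangle_ineq4[of "free_ext sg ?f q" "\<i> * duh_ext 1 0 sg (linf sg (psub U V) U V) q"] by (simp add: norm_mult)
   qed
  qed measurable
  have e3: "X_int r sg (s - 1) (1 + b) (free_ext sg ?f) \<le> ennreal C2 * ?h"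
  proof -
   have "X_int r sg (s - 1) (1 + b) (free_ext sg ?f) \<le> ennreal C2 * Hhat_int r (s - 1) ?f"
    using sr(5) b1 by (intro C2b asg) auto
   also have "... \<le> ennreal C2 * ?h" by (intro mult_left_mono order_trans[OF Hhat_int_mono_s h]) auto
   finally show ?thesis .
  qed
  have e4: "X_int r sg (s - 1) (1 + b) (duh_ext 1 0 sg (linf sg (psub U V) U V)) \<le> ennreal (C3 * C4) * X"
  proof -
   have "X_int r sg (s - 1) (1 + b) (duh_ext 1 0 sg (linf sg (psub U V) U V)) \<le> ennreal C3 * X_int r sg (s - 1) b (linf sg (psub U V) U V)"
    using sr(5) b1 by (intro C3b asg) auto
   also have "... \<le> ennreal C3 * (ennreal C4 * X)"
    unfolding X_def by (intro mult_left_mono C4b borel_pair_psub fU fV) auto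
   finally show ?thesis using C3 C4 by (simp add: ennreal_mult mult.assoc)
  qed
  have "X_int r sg (s - 1) b (dt_hat ?E) \<le> ennreal (2 powr p) * (X_int r sg s b ?E + X_int r sg (s - 1) (1 + b) ?E)"
   by (rule X_int_dt_hat_le[OF r1 asg measurable_sgnpart[OF bE]])
  also have "... \<le> ennreal (2 powr p) * (ennreal C1 * (?h + X) + ennreal (2 powr p) * (ennreal C2 * ?h + ennreal (C3 * C4) * X))"
   by (intro mult_left_mono add_mono e1 order_trans[OF e2] e3 e4) auto
  also have "... \<le> ennreal (2 powr p) * (ennreal C1 * (?h + X) + ennreal (2 powr p) * (ennreal (C2 + C3 * C4) * ?h + ennreal (C2 + C3 * C4) * X))"
   using C2 C3 C4 by (intro mult_left_mono add_mono mult_right_mono ennreal_leI) auto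
  also have "... = ennreal (2 powr p) * ((ennreal C1 + ennreal (2 powr p) * ennreal (C2 + C3 * C4)) * (?h + X))"
   by (simp only: distrib_left distrib_right mult_ac add_ac)
  also have "... = ennreal C * (?h + X)"
  proof -
   have "ennreal C1 + ennreal (2 powr p) * ennreal (C2 + C3 * C4) = ennreal (C1 + 2 powr p * (C2 + C3 * C4))"
    using C1 C2 C3 C4 by (simp only: ennreal_plus ennreal_mult powr_ge_zero add_nonneg_nonneg mult_nonneg_nonneg zero_le_one order_trans[OF zero_le_one C1])
   moreover have "ennreal C = ennreal (2 powr p) * ennreal (C1 + 2 powr p * (C2 + C3 * C4))"
    unfolding C_def using C1 C2 C3 C4 by (intro ennreal_mult) auto
   ultimately show ?thesis by (simp only: mult.assoc)
  qed
  finally show ?thesis unfolding X_def .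
 qed
 then show ?thesis using C0 by blast
qed

text \<open>A solution expressed through extensions and Borel data. The cutoff in the map is fixed
  to length 1, so the notion does not refer to the contraction and applies to every solution on the
  interval.\<close>

definition zsol :: "real \<Rightarrow> data \<Rightarrow> pair \<Rightarrow> bool" where
 "zsol dt F U \<longleftrightarrow> Z_in r 1 s b (fst U) \<and> Z_in r (- 1) s b (snd U) \<and> agree {-dt..dt} U (duhmap 1 F U)"

lemma fin_of_Z: "Z_in r 1 s b (fst U) \<Longrightarrow> Z_in r (- 1) s b (snd U) \<Longrightarrow> fin U"
 by (simp add: Z_in_def fin_def borel_pair_def pnorm_def)

text \<open>A solution map \<open>S\<close> on a whole ball of data, with Lipschitz bounds for both
  parts of the Z-norm of the chosen extensions. The same \<open>dt\<close> serves all data of the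
  ball, as local Lipschitz continuity requires.\<close>

definition good :: "real \<Rightarrow> real \<Rightarrow> bool" where
 "good R dt \<longleftrightarrow> (\<exists>L S. 0 \<le> L \<and> (\<forall>F. borel_data F \<longrightarrow> hnorm F \<le> ennreal R \<longrightarrow> zsol dt F (S F)) \<and>
  (\<forall>sg\<in>{1, -1}. \<forall>F G. borel_data F \<longrightarrow> hnorm F \<le> ennreal R \<longrightarrow> borel_data G \<longrightarrow> hnorm G \<le> ennreal R \<longrightarrow>
    X_int r sg s b (sgnpart sg (psub (S F) (S G))) \<le> ennreal L * hnorm (dsub F G) \<and>
    X_int r sg (s - 1) b (dt_hat (sgnpart sg (psub (S F) (S G)))) \<le> ennreal L * hnorm (dsub F G)))"

text \<open>The fixed point \<open>T F\<close> is controlled in X_{s,b} only. One further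
  application of the map, now with unit cutoff, gives \<open>S F\<close> in Z without changing the
  function on the interval; the Lipschitz bounds of \<open>S\<close> follow from those of
  \<open>T\<close>.\<close>

lemma good_exists:
 assumes R: "0 \<le> R"
 shows "\<exists>dt>0. dt \<le> 1 \<and> good R dt"
proof -
 obtain K where K: "1 \<le> K" and Kc: "\<And>\<kappa> B. 0 < \<kappa> \<Longrightarrow> \<kappa> \<le> 1 \<Longrightarrow> 0 \<le> B \<Longrightarrow> \<exists>dt>0. dt \<le> 1 \<and> contracts K \<kappa> B dt"
  using contracts_exists by blast
 define B where "B = 4 * 2 powr p * (2 * K * (R + 1))"
 have p2: "1 \<le> 2 powr p" using p ge_one_powr_ge_zero[of 2 p] by simp
 have B: "0 \<le> B" using K R by (simp add: B_def)
 have "0 < 1 / (2 * 2 powr p)" "1 / (2 * 2 powr p) \<le> 1" using p2 by (simp_all add: divide_le_eq)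
 then obtain dt where dt: "0 < dt" "dt \<le> 1" and c: "contracts K (1 / (2 * 2 powr p)) B dt" using Kc[OF _ _ B] by blast
 define T where "T = (\<lambda>F. SOME U. borel_pair U \<and> pn U \<le> ennreal B \<and> pequiv U (duhmap dt F U))"
 have T: "borel_pair (T F)" "pn (T F) \<le> ennreal B" "pequiv (T F) (duhmap dt F (T F))"
  if "borel_data F" "hnorm F \<le> ennreal R" for F
  using someI_ex[OF fixed_point[OF K R B_def c that]] by (simp_all add: T_def)
 have fT: "fin (T F)" if "borel_data F" "hnorm F \<le> ennreal R" for F
  unfolding fin_def using T(1,2)[OF that] by (auto intro: le_less_trans)
 define S where "S = (\<lambda>F. duhmap 1 F (T F))"
 obtain C1 where C1: "1 \<le> C1" and C1b: "\<And>dt F G U V. 0 < dt \<Longrightarrow> dt \<le> 1 \<Longrightarrow> fst F \<in> BM \<Longrightarrow> snd F \<in> BM \<Longrightarrow>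
  fst G \<in> BM \<Longrightarrow> snd G \<in> BM \<Longrightarrow> fin U \<Longrightarrow> fin V \<Longrightarrow>
  pn (psub (duhmap dt F U) (duhmap dt G V)) \<le> ennreal C1 * (hnorm (dsub F G)
   + ennreal (dt powr ((1 - b) * p)) * (pn (psub U V) * (pn U + pn V + 1)))"
  using duhmap_diff_bound by blast
 have C1c: "X_int r sg s b (sgnpart sg (psub (duhmap 1 F U) (duhmap 1 G V))) \<le> ennreal C1 * (hnorm (dsub F G)
   + pn (psub U V) * (pn U + pn V + 1))"
  if "sg \<in> {1, -1}" "borel_data F" "borel_data G" "fin U" "fin V" for F G U V sg
 proof -
  have "X_int r sg s b (sgnpart sg (psub (duhmap 1 F U) (duhmap 1 G V))) \<le> pn (psub (duhmap 1 F U) (duhmap 1 G V))"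
   by (rule X_int_sgnpart_le[OF that(1)])
  also have "... \<le> ennreal C1 * (hnorm (dsub F G)
   + ennreal (1 powr ((1 - b) * p)) * (pn (psub U V) * (pn U + pn V + 1)))"
   using that unfolding borel_data_def by (intro C1b) auto
  finally show ?thesis by simp
 qed
 define ok where "ok = (\<lambda>sg C. \<forall>F G U V. borel_data F \<longrightarrow> borel_data G \<longrightarrow> fin U \<longrightarrow> fin V \<longrightarrow>
  X_int r sg (s - 1) b (dt_hat (sgnpart sg (psub (duhmap 1 F U) (duhmap 1 G V))))
   \<le> ennreal C * (hnorm (dsub F G) + pn (psub U V) * (pn U + pn V + 1)))"
 obtain Ca Cb where Cab: "0 \<le> Ca" "ok 1 Ca" "0 \<le> Cb" "ok (- 1) Cb"
  using duhmap_dt_bound[OF insertI1] duhmap_dt_bound[OF insertI2[OF insertI1]] unfolding ok_def by blast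
 define C2 where "C2 = max Ca Cb"
 have C2: "0 \<le> C2" using Cab by (simp add: C2_def)
 have mono: "ok sg C2" if "ok sg C" "C \<le> C2" for sg C
  unfolding ok_def
  by (intro allI impI, rule order_trans[OF that(1)[unfolded ok_def, rule_format]]) (auto intro!: mult_right_mono ennreal_leI that(2))
 have "ok sg C2" if "sg \<in> {1, -1}" for sg
  using that mono[OF Cab(2)] mono[OF Cab(4)] by (auto simp: C2_def)
 note C2b = this[unfolded ok_def, rule_format]
 define M where "M = 1 + 2 * K * (2 * B + 1)"
 have M: "0 \<le> M" using K B by (simp add: M_def)
 have hM: "hnorm (dsub F G) + pn (psub (T F) (T G)) * (pn (T F) + pn (T G) + 1)
   \<le> ennreal M * hnorm (dsub F G)" (is "?h + _ \<le> _")
  if F: "borel_data F" "hnorm F \<le> ennreal R" and G: "borel_data G" "hnorm G \<le> ennreal R" for F G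
 proof -
  have K0: "0 \<le> K" using K by simp
  have "pn (psub (T F) (T G)) * (pn (T F) + pn (T G) + 1) \<le> (ennreal (2 * K) * ?h) * (ennreal B + ennreal B + 1)"
   by (intro mult_mono add_mono fixed_point_diff[OF c K0 F(1) G(1) T[OF F] T[OF G]] T(2) F G) auto
  also have "ennreal B + ennreal B + 1 = ennreal (2 * B + 1)" using B by (simp flip: ennreal_plus ennreal_1)
  finally have "?h + pn (psub (T F) (T G)) * (pn (T F) + pn (T G) + 1) \<le> ennreal 1 * ?h + ennreal (2 * K) * ?h * ennreal (2 * B + 1)"
   by (simp add: add_left_mono)
  also have "... = (ennreal 1 + ennreal (2 * K) * ennreal (2 * B + 1)) * ?h" by (simp only: distrib_right mult_ac)
  also have "ennreal 1 + ennreal (2 * K) * ennreal (2 * B + 1) = ennreal M"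
  proof -
   have "ennreal (2 * K) * ennreal (2 * B + 1) = ennreal (2 * K * (2 * B + 1))" using K B by (intro ennreal_mult[symmetric]) auto
   then show ?thesis using K B unfolding M_def by (subst ennreal_plus) auto
  qed
  finally show ?thesis .
 qed
 define L where "L = max C1 C2 * M"
 have L: "0 \<le> L" using C1 M by (simp add: L_def)
 have le: "ennreal C * x \<le> ennreal L * y" if "x \<le> ennreal M * y" "0 \<le> C" "C \<le> max C1 C2" for C x y
 proof -
  have "ennreal C * x \<le> ennreal (max C1 C2) * (ennreal M * y)" using that by (intro mult_mono ennreal_leI) auto
  also have "... = ennreal L * y" using C1 M by (simp add: L_def ennreal_mult mult.assoc)
  finally show ?thesis .
 qed
 have lip: "X_int r sg s b (sgnpart sg (psub (S F) (S G))) \<le> ennreal L * hnorm (dsub F G)"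
  "X_int r sg (s - 1) b (dt_hat (sgnpart sg (psub (S F) (S G)))) \<le> ennreal L * hnorm (dsub F G)"
  if sg: "sg \<in> {1, -1}" and F: "borel_data F" "hnorm F \<le> ennreal R" and G: "borel_data G" "hnorm G \<le> ennreal R" for sg F G
  unfolding S_def using C1 C2
  by (auto intro!: order_trans[OF C1c[OF sg F(1) G(1) fT[OF F] fT[OF G]] le[OF hM[OF F G]]] order_trans[OF C2b[OF sg F(1) G(1) fT[OF F] fT[OF G]] le[OF hM[OF F G]]])
 have sol: "zsol dt F (S F)" if F: "borel_data F" "hnorm F \<le> ennreal R" for F
 proof -
  let ?Z = "(\<lambda>_. 0, \<lambda>_. 0) :: data"
  have fS: "psub (duhmap 1 F (T F)) (duhmap 1 ?Z pzero) = duhmap 1 F (T F)" by (simp add: duhmap_0)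
  have h: "hnorm (dsub F ?Z) + pn (psub (T F) pzero) * (pn (T F) + pn pzero + 1) < \<infinity>"
   using F(2) fT[OF F] by (auto simp: fin_def ennreal_mult_less_top intro: le_less_trans)
  have i: "ennreal C * (hnorm (dsub F ?Z) + pn (psub (T F) pzero) * (pn (T F) + pn pzero + 1)) < \<infinity>" for C
  proof -
   have "ennreal C * y < \<infinity>" if "y < \<infinity>" for y :: ennreal using that by (simp add: ennreal_mult_less_top)
   from this[OF h] show ?thesis .
  qed
  have x: "X_int r sg s b (sgnpart sg (S F)) < \<infinity>" "X_int r sg (s - 1) b (dt_hat (sgnpart sg (S F))) < \<infinity>" if sg: "sg \<in> {1, -1}" for sg
   unfolding S_def
   by (rule le_less_trans[OF C1c[OF sg F(1) borel_data_0 fT[OF F] fin_pzero, unfolded fS] i],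
     rule le_less_trans[OF C2b[OF sg F(1) borel_data_0 fT[OF F] fin_pzero, unfolded fS] i])
  have bS: "borel_pair (S F)" unfolding S_def by (intro borel_pair_duhmap' F T)
  have Z: "Z_in r 1 s b (fst (S F))" "Z_in r (- 1) s b (snd (S F))"
   using x[OF insertI1] x[OF insertI2[OF insertI1]] bS by (simp_all add: Z_in_def borel_pair_def)
  have a1: "agree {-dt..dt} (T F) (duhmap dt F (T F))"
   by (intro agree_pequiv T F borel_pair_duhmap')
  have a2: "agree {-dt..dt} (duhmap dt F (T F)) (S F)"
   unfolding S_def using dt by (intro duhmap_agree fT F agree_refl) auto
  \<comment> \<open>Since \<open>S F\<close> and \<open>T F\<close> agree on the interval, their
    images under the map with unit cutoff agree there, and the image of \<open>T F\<close> is
    \<open>S F\<close>.\<close>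
  have a3: "agree {-dt..dt} (S F) (duhmap 1 F (S F))"
   using duhmap_agree[OF fT[OF F] fin_of_Z[OF Z] agree_trans[OF a1 a2] dt(1) dt(2) dt(2) order_refl order_refl, of F]
   by (simp only: S_def)
  show ?thesis unfolding zsol_def using Z a3 by blast
 qed
 have "good R dt" unfolding good_def using L sol lip by blast
 then show ?thesis using dt by blast
qed

section \<open>Replacing the time derivative by its spatial expression\<close>

lemma conv_continuous:
 assumes "tame P" "tame Q"
 shows "AE \<xi> in lborel. continuous_on UNIV (\<lambda>t. conv3 (time_inv P t) (time_inv Q t) \<xi>)"
 using tame_conv_finite[OF assms]
proof eventually_elim
 case (elim \<xi>)
 note m = tame_measurable[OF assms(1)] tame_measurable[OF assms(2)]
 have "continuous_on UNIV (\<lambda>t. time_inv (\<lambda>q. of_real (1 / (2 * pi) ^ 4) * conv4 P Q q) t \<xi>)"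
  by (intro continuous_time_inv integrable_mult_right conv4_section(1)[OF m elim])
 then show ?case by (simp only: time_inv_conv4[OF m elim])
qed

text \<open>The true derivative, as opposed to \<open>symb\<close>. The two coincide for space
  derivatives; for the time derivative they coincide in time sections of solutions.\<close>

definition dsymb :: "der \<Rightarrow> pair \<Rightarrow> spacetime" where
 "dsymb d U = (case d of
   Dt \<Rightarrow> dt_hat (\<lambda>q. fst U q + snd U q)
  | Dx j \<Rightarrow> (\<lambda>q. \<i> * of_real (fst q $ j) * (fst U q + snd U q)))"

lemma der_hat_eq: "der_hat d (\<lambda>q. fst U q + snd U q) t \<xi> = time_inv (dsymb d U) t \<xi>"
 by (cases d) (simp_all add: der_hat_def dsymb_def
  time_inv_cmult[of "\<lambda>\<xi>. \<i> * complex_of_real (\<xi> $ _)" "\<lambda>q. fst U q + snd U q", symmetric])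

lemma dsymb_Dx: "dsymb (Dx j) U = symb (Dx j) U"
 by (simp add: fun_eq_iff dsymb_def symb_def)

lemma tame_dt:
 assumes "Z_in r sg s b f" "\<bar>sg\<bar> = 1"
 shows "tame (dt_hat f)"
proof (rule tame_of_X_int[OF assms(2)])
 show "X_int r sg (s - 1) b (dt_hat f) < \<infinity>" using assms(1) by (simp add: Z_in_def)
 have [measurable]: "f \<in> BM" using assms(1) by (simp add: Z_in_def)
 show "dt_hat f \<in> BM" unfolding dt_hat_def[abs_def] by measurable
qed

lemma tame_dsymb:
 assumes "Z_in r 1 s b (fst U)" "Z_in r (- 1) s b (snd U)"
 shows "tame (dsymb d U)"
proof (cases d)
 case Dt
 have t: "tame (dt_hat (fst U))" "tame (dt_hat (snd U))" using assms by (auto intro: tame_dt)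
 have [measurable]: "fst U \<in> BM" "snd U \<in> BM" using assms by (simp_all add: Z_in_def)
 show ?thesis
 proof (rule tame_add_mono[OF t])
  show "dsymb d U \<in> BM" by (simp add: dsymb_def Dt dt_hat_def[abs_def])
  show "cmod (dsymb d U q) \<le> cmod (dt_hat (fst U) q) + cmod (dt_hat (snd U) q)" for q
   using norm_triangle_ineq[of "dt_hat (fst U) q" "dt_hat (snd U) q"] by (simp add: dsymb_def Dt dt_hat_def distrib_left)
 qed
next
 case (Dx j)
 show ?thesis unfolding Dx dsymb_Dx by (rule fin_tame(3)[OF fin_of_Z[OF assms]])
qed

definition duhamel_form :: "real \<Rightarrow> real^3 \<Rightarrow> complex \<Rightarrow> (real \<Rightarrow> complex) \<Rightarrow> real \<Rightarrow> complex" where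
 "duhamel_form sg \<xi> f g t = cis (- t * (sg * jap \<xi>)) *
  (f - \<i> * (LBINT t'=ereal 0..ereal t. cis (t' * (sg * jap \<xi>)) * (- of_real (sg / jap \<xi>) * g t')))"

lemma duhamel_form_eq:
 "cis (- sg * t * jap \<xi>) * f - \<i> * (LBINT t'=0..t. cis (- sg * (t - t') * jap \<xi>) * (- of_real (sg / jap \<xi>) * g t')) = duhamel_form sg \<xi> f g t"
proof -
 have "cis (- sg * (t - t') * jap \<xi>) = cis (- t * (sg * jap \<xi>)) * cis (t' * (sg * jap \<xi>))" for t'
  by (simp add: cis_mult algebra_simps)
 then have "(LBINT t'=0..t. cis (- sg * (t - t') * jap \<xi>) * (- of_real (sg / jap \<xi>) * g t'))
  = cis (- t * (sg * jap \<xi>)) * (LBINT t'=ereal 0..ereal t. cis (t' * (sg * jap \<xi>)) * (- of_real (sg / jap \<xi>) * g t'))"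
  by (simp only: mult.assoc zero_ereal_def interval_lebesgue_integral_mult_right)
 moreover have "cis (- sg * t * jap \<xi>) = cis (- t * (sg * jap \<xi>))" by (simp add: mult_ac)
 ultimately show ?thesis unfolding duhamel_form_def by (simp only: right_diff_distrib mult_ac)
qed

lemma duhamel_form_cong:
 assumes "\<And>x. min 0 t \<le> x \<Longrightarrow> x \<le> max 0 t \<Longrightarrow> g x = h x"
 shows "duhamel_form sg \<xi> f g t = duhamel_form sg \<xi> f h t"
proof -
 have "(LBINT t'=ereal 0..ereal t. cis (t' * (sg * jap \<xi>)) * (- of_real (sg / jap \<xi>) * g t'))
  = (LBINT t'=ereal 0..ereal t. cis (t' * (sg * jap \<xi>)) * (- of_real (sg / jap \<xi>) * h t'))"
  by (rule interval_cong_between) (simp add: assms)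
 then show ?thesis by (simp only: duhamel_form_def)
qed

lemma continuous_duhamel_form:
 assumes "0 < dt" "continuous_on UNIV g"
 shows "continuous_on {-dt..dt} (duhamel_form sg \<xi> f g)"
proof -
 let ?h = "\<lambda>t'. cis (t' * (sg * jap \<xi>)) * (- of_real (sg / jap \<xi>) * g t')"
 have c: "continuous_on {-dt..dt} ?h" by (intro continuous_intros continuous_on_subset[OF assms(2)]) auto
 have "((\<lambda>u. LBINT y=ereal 0..ereal u. ?h y) has_vector_derivative ?h t) (at t within {-dt..dt})" if "t \<in> {-dt..dt}" for t
  using assms(1) that c by (intro interval_integral_FTC2) auto
 then have "continuous_on {-dt..dt} (\<lambda>u. LBINT y=ereal 0..ereal u. ?h y)"
  unfolding continuous_on_eq_continuous_within by (blast intro: has_vector_derivative_continuous)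
 then show ?thesis unfolding duhamel_form_def[abs_def] by (intro continuous_intros)
qed

definition gsymb :: "pair \<Rightarrow> real^3 \<Rightarrow> real \<Rightarrow> complex" where
 "gsymb U \<xi> t = conv3 (time_inv (symb d1 U) t) (time_inv (symb d2 U) t) \<xi> / 4 + (time_inv (fst U) t \<xi> + time_inv (snd U) t \<xi>) / 2"

definition gder :: "pair \<Rightarrow> real^3 \<Rightarrow> real \<Rightarrow> complex" where
 "gder U \<xi> t = conv3 (time_inv (dsymb d1 U) t) (time_inv (dsymb d2 U) t) \<xi> / 4 + time_inv (\<lambda>q. fst U q + snd U q) t \<xi> / 2"

lemma duhamel_rhs_eq: "duhamel_rhs d1 d2 sg f (fst U) (snd U) t \<xi> = duhamel_form sg \<xi> (f \<xi>) (gder U \<xi>) t"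
proof -
 have "der_hat d (\<lambda>p. fst U p + snd U p) t' = time_inv (dsymb d U) t'" for d t'
  by (rule ext) (rule der_hat_eq)
 then show ?thesis
  unfolding duhamel_rhs_def Let_def duhamel_form_eq[symmetric] gder_def by (simp only:)
qed

lemma gsymb_continuous:
 assumes "fin U"
 shows "AE \<xi> in lborel. continuous_on UNIV (gsymb U \<xi>)"
 using conv_continuous[OF fin_tame(3)[OF assms, of d1] fin_tame(3)[OF assms, of d2]] fin_section[OF assms]
 by eventually_elim (auto simp: gsymb_def[abs_def] intro!: continuous_intros continuous_time_inv)

lemma gder_continuous:
 assumes "Z_in r 1 s b (fst U)" "Z_in r (- 1) s b (snd U)"
 shows "AE \<xi> in lborel. continuous_on UNIV (gder U \<xi>)"
 using conv_continuous[OF tame_dsymb[OF assms, of d1] tame_dsymb[OF assms, of d2]] fin_section[OF fin_of_Z[OF assms]]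
 by eventually_elim (auto simp: gder_def[abs_def] intro!: continuous_intros continuous_time_inv)

lemma duhmap_form:
 assumes U: "fin U"
 shows "AE \<xi> in lborel. \<forall>sg\<in>{1, -1}. \<forall>t. \<bar>t\<bar> \<le> 1 \<longrightarrow> time_inv (sgnpart sg (duhmap 1 F U)) t \<xi> = duhamel_form sg \<xi> (hdat sg F \<xi>) (gsymb U \<xi>) t"
 using duhmap_section[OF U zero_less_one order_refl, of F] force_section[OF U U U]
proof eventually_elim
 case (elim \<xi>)
 show ?case
 proof (intro ballI allI impI)
  fix sg t :: real assume sg: "sg \<in> {1, -1}" and t: "\<bar>t\<bar> \<le> 1"
  have f: "time_inv (force sg U U U) x \<xi> = - of_real (sg / jap \<xi>) * gsymb U \<xi> x" for x
   unfolding gsymb_def using elim(2) by blast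
  show "time_inv (sgnpart sg (duhmap 1 F U)) t \<xi> = duhamel_form sg \<xi> (hdat sg F \<xi>) (gsymb U \<xi>) t"
   unfolding duhamel_form_def f[symmetric] by (rule mp[OF spec[OF conjunct2[OF bspec[OF elim(1) sg]]] t])
 qed
qed

text \<open>The forcing \<open>g\<close> is left arbitrary because the cancellation between the two
  equations takes place whatever it is. It is applied with \<open>gsymb\<close>, to show that a
  fixed point solves the original system, and with \<open>gder\<close>, to show that a solution of
  the original system is a fixed point.\<close>

lemma gder_eq_gsymb:
 assumes Z: "Z_in r 1 s b (fst U)" "Z_in r (- 1) s b (snd U)" and dt: "0 < dt"
  and g: "AE \<xi> in lborel. continuous_on UNIV (g \<xi>)"
  and form: "AE \<xi> in lborel. \<forall>sg\<in>{1, -1}. \<forall>t\<in>{-dt..dt}. time_inv (sgnpart sg U) t \<xi> = duhamel_form sg \<xi> (hdat sg F \<xi>) (g \<xi>) t"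
 shows "AE \<xi> in lborel. \<forall>t\<in>{-dt..dt}. gder U \<xi> t = gsymb U \<xi> t"
proof -
 have fU: "fin U" by (rule fin_of_Z[OF Z])
 have t: "tame (dt_hat (fst U))" "tame (dt_hat (snd U))" using Z by (auto intro: tame_dt)
 have sec: "AE \<xi> in lborel. \<forall>t\<in>{-dt..dt}. time_inv (dsymb Dt U) t \<xi> = time_inv (symb Dt U) t \<xi>"
  using g form fin_section[OF fU] tame_section[OF t(1)] tame_section[OF t(2)]
 proof eventually_elim
  case (elim \<xi>)
  note i = conjunct1[OF elim(3)] elim(4) conjunct2[OF elim(3)] elim(5)
  show ?case
  proof
   fix t assume t: "t \<in> {-dt..dt}"
   have "time_inv (dt_hat (\<lambda>q. fst U q + snd U q)) t \<xi> = - \<i> * of_real (jap \<xi>) * (time_inv (fst U) t \<xi> - time_inv (snd U) t \<xi>)"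
   proof (rule duhamel_time_derivative[OF i dt continuous_on_subset[OF elim(1) subset_UNIV] _ _ t, where fp="hdat 1 F \<xi>" and fm="hdat (- 1) F \<xi>"])
    fix t assume t: "t \<in> {-dt..dt}"
    show "time_inv (fst U) t \<xi> = cis (- 1 * t * jap \<xi>) * hdat 1 F \<xi> - \<i> * (LBINT t'=0..t. cis (- 1 * (t - t') * jap \<xi>) * (- of_real (1 / jap \<xi>) * g \<xi> t'))"
     unfolding duhamel_form_eq using bspec[OF bspec[OF elim(2) insertI1] t] by simp
    show "time_inv (snd U) t \<xi> = cis (- (- 1) * t * jap \<xi>) * hdat (- 1) F \<xi> - \<i> * (LBINT t'=0..t. cis (- (- 1) * (t - t') * jap \<xi>) * (- of_real (- 1 / jap \<xi>) * g \<xi> t'))"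
     unfolding duhamel_form_eq using bspec[OF bspec[OF elim(2) insertI2[OF insertI1]] t] by simp
   qed
   then show "time_inv (dsymb Dt U) t \<xi> = time_inv (symb Dt U) t \<xi>"
    unfolding time_inv_symb[OF i(1,3)] by (simp add: dsymb_def symbv_def)
  qed
 qed
 have sec': "AE \<xi> in lborel. time_inv (dsymb d U) t \<xi> = time_inv (symb d U) t \<xi>" if "t \<in> {-dt..dt}" for d t
 proof (cases d)
  case Dt
  show ?thesis unfolding Dt using sec by eventually_elim (use that in blast)
 qed (simp add: dsymb_Dx)
 have c: "conv3 (time_inv (dsymb d1 U) t) (time_inv (dsymb d2 U) t) \<xi> = conv3 (time_inv (symb d1 U) t) (time_inv (symb d2 U) t) \<xi>"
  if "t \<in> {-dt..dt}" for t \<xi>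
  by (intro conv3_cong measurable_time_inv tame_measurable[OF tame_dsymb[OF Z]] tame_measurable[OF fin_tame(3)[OF fU]] sec'[OF that])
 show ?thesis
  using fin_section[OF fU] by eventually_elim (simp add: gder_def gsymb_def c time_inv_add)
qed

lemma form_of_zsol:
 assumes Z: "zsol dt F U" and dt: "0 < dt" "dt \<le> 1"
 shows "AE \<xi> in lborel. \<forall>sg\<in>{1, -1}. \<forall>t\<in>{-dt..dt}. time_inv (sgnpart sg U) t \<xi> = duhamel_form sg \<xi> (hdat sg F \<xi>) (gder U \<xi>) t"
proof -
 have Zs: "Z_in r 1 s b (fst U)" "Z_in r (- 1) s b (snd U)" and a: "agree {-dt..dt} U (duhmap 1 F U)" using Z by (simp_all add: zsol_def)
 have fU: "fin U" by (rule fin_of_Z[OF Zs])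
 have form: "AE \<xi> in lborel. \<forall>sg\<in>{1, -1}. \<forall>t\<in>{-dt..dt}. time_inv (sgnpart sg U) t \<xi> = duhamel_form sg \<xi> (hdat sg F \<xi>) (gsymb U \<xi>) t"
  using a[unfolded agree_def] duhmap_form[OF fU, of F]
 proof eventually_elim
  case (elim \<xi>)
  show ?case
  proof (intro ballI)
   fix sg t :: real assume sg: "sg \<in> {1, -1}" and t: "t \<in> {-dt..dt}"
   have "\<bar>t\<bar> \<le> 1" using t dt by auto
   from trans[OF bspec[OF bspec[OF elim(1) t] sg] mp[OF spec[OF bspec[OF elim(2) sg]] this]]
   show "time_inv (sgnpart sg U) t \<xi> = duhamel_form sg \<xi> (hdat sg F \<xi>) (gsymb U \<xi>) t" .
  qed
 qed
 show ?thesis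
  using form gder_eq_gsymb[OF Zs dt(1) gsymb_continuous[OF fU] form]
 proof eventually_elim
  case (elim \<xi>)
  show ?case
  proof (intro ballI)
   fix sg t :: real assume sg: "sg \<in> {1, -1}" and t: "t \<in> {-dt..dt}"
   have "duhamel_form sg \<xi> (hdat sg F \<xi>) (gsymb U \<xi>) t = duhamel_form sg \<xi> (hdat sg F \<xi>) (gder U \<xi>) t"
   proof (rule duhamel_form_cong)
    fix x assume "min 0 t \<le> x" "x \<le> max 0 t"
    then have "x \<in> {-dt..dt}" using t dt by (auto simp: min_def max_def split: if_splits)
    then show "gsymb U \<xi> x = gder U \<xi> x" using elim(2) by simp
   qed
   then show "time_inv (sgnpart sg U) t \<xi> = duhamel_form sg \<xi> (hdat sg F \<xi>) (gder U \<xi>) t"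
    using bspec[OF bspec[OF elim(1) sg] t] by simp
  qed
 qed
qed

lemma zsol_of_form:
 assumes Z: "Z_in r 1 s b (fst U)" "Z_in r (- 1) s b (snd U)" and dt: "0 < dt" "dt \<le> 1"
  and form: "AE \<xi> in lborel. \<forall>sg\<in>{1, -1}. \<forall>t\<in>{-dt..dt}. time_inv (sgnpart sg U) t \<xi> = duhamel_form sg \<xi> (hdat sg F \<xi>) (gder U \<xi>) t"
 shows "zsol dt F U"
proof -
 have fU: "fin U" by (rule fin_of_Z[OF Z])
 have "agree {-dt..dt} U (duhmap 1 F U)"
  unfolding agree_def
  using form gder_eq_gsymb[OF Z dt(1) gder_continuous[OF Z] form] duhmap_form[OF fU, of F]
 proof eventually_elim
  case (elim \<xi>)
  show ?case
  proof (intro ballI)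
   fix sg t :: real assume sg: "sg \<in> {1, -1}" and t: "t \<in> {-dt..dt}"
   have t1: "\<bar>t\<bar> \<le> 1" using t dt by auto
   have "duhamel_form sg \<xi> (hdat sg F \<xi>) (gder U \<xi>) t = duhamel_form sg \<xi> (hdat sg F \<xi>) (gsymb U \<xi>) t"
   proof (rule duhamel_form_cong)
    fix x assume "min 0 t \<le> x" "x \<le> max 0 t"
    then have "x \<in> {-dt..dt}" using t dt by (auto simp: min_def max_def split: if_splits)
    then show "gder U \<xi> x = gsymb U \<xi> x" using elim(2) by simp
   qed
   then show "time_inv (sgnpart sg U) t \<xi> = time_inv (sgnpart sg (duhmap 1 F U)) t \<xi>"
    using bspec[OF bspec[OF elim(1) sg] t] mp[OF spec[OF bspec[OF elim(3) sg]] t1] by simp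
  qed
 qed
 then show ?thesis using Z by (simp add: zsol_def)
qed

text \<open>In \<open>is_solution\<close> the exceptional set may depend on the time. Both sides of
  the Duhamel formula are continuous in time for almost every frequency, so one null set suffices.
  The data may be replaced by Borel functions equal to them almost everywhere.\<close>

lemma zsol_cong_data:
 assumes "0 < dt" "dt \<le> 1" and sol: "is_solution r s b dt d1 d2 Fp Fm up um"
  and F: "AE \<xi> in lborel. Fp \<xi> = fst F \<xi>" "AE \<xi> in lborel. Fm \<xi> = snd F \<xi>"
 shows "\<exists>U. zsol dt F U \<and> (\<forall>t\<in>{-dt..dt}. AE \<xi> in lebesgue. up t \<xi> = time_inv (fst U) t \<xi> \<and> um t \<xi> = time_inv (snd U) t \<xi>)"
proof -
 obtain Up Um where e: "is_ext r 1 s b dt Up up" "is_ext r (- 1) s b dt Um um"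
  and d: "\<And>t. t \<in> {-dt..dt} \<Longrightarrow> AE \<xi> in lebesgue. up t \<xi> = duhamel_rhs d1 d2 1 Fp Up Um t \<xi> \<and> um t \<xi> = duhamel_rhs d1 d2 (- 1) Fm Up Um t \<xi>"
  using sol unfolding is_solution_def by blast
 define U where "U = (Up, Um)"
 have Z: "Z_in r 1 s b (fst U)" "Z_in r (- 1) s b (snd U)" using e by (simp_all add: is_ext_def U_def)
 have u: "AE \<xi> in lebesgue. up t \<xi> = time_inv (fst U) t \<xi> \<and> um t \<xi> = time_inv (snd U) t \<xi>" if "t \<in> {-dt..dt}" for t
 proof -
  have "AE \<xi> in lebesgue. up t \<xi> = time_inv Up t \<xi>" "AE \<xi> in lebesgue. um t \<xi> = time_inv Um t \<xi>"
   using e that by (auto simp: is_ext_def)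
  then show ?thesis unfolding U_def by eventually_elim simp
 qed
 have eq: "AE \<xi> in lborel. time_inv (fst U) t \<xi> = duhamel_form 1 \<xi> (fst F \<xi>) (gder U \<xi>) t \<and> time_inv (snd U) t \<xi> = duhamel_form (- 1) \<xi> (snd F \<xi>) (gder U \<xi>) t"
  if "t \<in> {-dt..dt}" for t
 proof -
  have d': "AE \<xi> in lborel. up t \<xi> = duhamel_rhs d1 d2 1 Fp Up Um t \<xi> \<and> um t \<xi> = duhamel_rhs d1 d2 (- 1) Fm Up Um t \<xi>"
   and u': "AE \<xi> in lborel. up t \<xi> = time_inv (fst U) t \<xi> \<and> um t \<xi> = time_inv (snd U) t \<xi>"
   using d[OF that] u[OF that] by (simp_all only: AE_completion_iff)
  show ?thesis
   using d' u' F
  proof eventually_elim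
   case (elim \<xi>)
   then show ?case
    using duhamel_rhs_eq[of 1 Fp U t \<xi>] duhamel_rhs_eq[of "- 1" Fm U t \<xi>] by (simp add: U_def)
  qed
 qed
 have cont: "AE \<xi> in lborel. continuous_on {-dt..dt} (\<lambda>t. time_inv f t \<xi>) \<and> continuous_on {-dt..dt} (duhamel_form sg \<xi> (h \<xi>) (gder U \<xi>))"
  if "f = fst U \<or> f = snd U" for f sg h
  using fin_section[OF fin_of_Z[OF Z]] gder_continuous[OF Z]
  by eventually_elim (use that assms(1) in \<open>auto intro: continuous_time_inv continuous_duhamel_form\<close>)
 have lt: "- dt < dt" using assms(1) by simp
 have "AE \<xi> in lborel. \<forall>t\<in>{-dt..dt}. time_inv (fst U) t \<xi> = duhamel_form 1 \<xi> (fst F \<xi>) (gder U \<xi>) t"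
  by (rule AE_all_interval[OF lt _ cont]) (use eq in \<open>auto elim: eventually_mono\<close>)
 moreover have "AE \<xi> in lborel. \<forall>t\<in>{-dt..dt}. time_inv (snd U) t \<xi> = duhamel_form (- 1) \<xi> (snd F \<xi>) (gder U \<xi>) t"
  by (rule AE_all_interval[OF lt _ cont]) (use eq in \<open>auto elim: eventually_mono\<close>)
 ultimately have "AE \<xi> in lborel. \<forall>sg\<in>{1, -1}. \<forall>t\<in>{-dt..dt}. time_inv (sgnpart sg U) t \<xi> = duhamel_form sg \<xi> (hdat sg F \<xi>) (gder U \<xi>) t"
  by eventually_elim (simp add: hdat_def)
 then have "zsol dt F U" by (intro zsol_of_form Z assms)
 then show ?thesis using u by blast
qed

lemma is_solution_of_zsol:
 assumes dt: "0 < dt" "dt \<le> 1" and Z: "zsol dt F U"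
  and F: "AE \<xi> in lborel. Fp \<xi> = fst F \<xi>" "AE \<xi> in lborel. Fm \<xi> = snd F \<xi>"
 shows "is_solution r s b dt d1 d2 Fp Fm (time_inv (fst U)) (time_inv (snd U))"
 unfolding is_solution_def
proof (intro exI conjI ballI)
 show "is_ext r 1 s b dt (fst U) (time_inv (fst U))" "is_ext r (- 1) s b dt (snd U) (time_inv (snd U))"
  using Z by (simp_all add: is_ext_def zsol_def)
 fix t assume t: "t \<in> {-dt..dt}"
 have "AE \<xi> in lborel. time_inv (fst U) t \<xi> = duhamel_rhs d1 d2 1 Fp (fst U) (snd U) t \<xi> \<and> time_inv (snd U) t \<xi> = duhamel_rhs d1 d2 (- 1) Fm (fst U) (snd U) t \<xi>"
  using form_of_zsol[OF Z dt] F
 proof eventually_elim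
  case (elim \<xi>)
  show ?case
   unfolding duhamel_rhs_eq
   using bspec[OF bspec[OF elim(1) insertI1] t] bspec[OF bspec[OF elim(1) insertI2[OF insertI1]] t] elim(2,3) by (simp add: hdat_def)
 qed
 then show "AE \<xi> in lebesgue. time_inv (fst U) t \<xi> = duhamel_rhs d1 d2 1 Fp (fst U) (snd U) t \<xi> \<and> time_inv (snd U) t \<xi> = duhamel_rhs d1 d2 (- 1) Fm (fst U) (snd U) t \<xi>"
  by (rule AE_completion)
qed

lemma zsol_unique:
 assumes "0 < dt" "dt \<le> 1" "zsol dt F U" "zsol dt F V" "t \<in> {-dt..dt}"
 shows "AE \<xi> in lborel. time_inv (fst U) t \<xi> = time_inv (fst V) t \<xi> \<and> time_inv (snd U) t \<xi> = time_inv (snd V) t \<xi>"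
proof -
 have "agree {-dt..dt} U V"
  using assms by (intro uniqueness[of U dt F V]) (auto simp: zsol_def intro: fin_of_Z)
 then show ?thesis unfolding agree_def by eventually_elim (use assms(5) in simp)
qed

section \<open>Lebesgue measurable data and real-valued norms\<close>

lemma Hhat_norm_powr: "Hhat_in r s F \<Longrightarrow> Hhat_int r s F = ennreal (Hhat_norm r s F powr p)"
 using p by (simp add: Hhat_in_def Hhat_norm_def powr_powr)

lemma Hhat_in_diff:
 assumes "Hhat_in r s F" "Hhat_in r s G"
 shows "Hhat_in r s (\<lambda>\<xi>. F \<xi> - G \<xi>)" and "Hhat_int r s F \<le> ennreal (2 powr p) * (Hhat_int r s (\<lambda>\<xi>. F \<xi> - G \<xi>) + Hhat_int r s G)"
proof -
 have [measurable]: "F \<in> borel_measurable lebesgue" "G \<in> borel_measurable lebesgue" using assms by (simp_all add: Hhat_in_def)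
 have "jap \<in> BM" using measurable_jap[of "\<lambda>\<xi> :: real^3. \<xi>" borel] by simp
 then have [measurable]: "jap \<in> borel_measurable lebesgue" by (intro measurable_completion) simp
 have add: "Hhat_int r s h \<le> ennreal (2 powr p) * (Hhat_int r s f + Hhat_int r s g)"
  if [measurable]: "f \<in> borel_measurable lebesgue" "g \<in> borel_measurable lebesgue" and le: "\<And>\<xi>. cmod (h \<xi>) \<le> cmod (f \<xi>) + cmod (g \<xi>)" for f g h
 proof -
  have "jap \<xi> powr (s * p) * cmod (h \<xi>) powr p \<le> 2 powr p * (jap \<xi> powr (s * p) * cmod (f \<xi>) powr p + jap \<xi> powr (s * p) * cmod (g \<xi>) powr p)" for \<xi>
  proof -
   have "cmod (h \<xi>) powr p \<le> (cmod (f \<xi>) + cmod (g \<xi>)) powr p" using p le by (intro powr_mono2) auto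
   also have "... \<le> 2 powr p * (cmod (f \<xi>) powr p + cmod (g \<xi>) powr p)" using p by (intro powr_add_le) auto
   finally have "jap \<xi> powr (s * p) * cmod (h \<xi>) powr p \<le> jap \<xi> powr (s * p) * (2 powr p * (cmod (f \<xi>) powr p + cmod (g \<xi>) powr p))"
    by (intro mult_left_mono) auto
   then show ?thesis by (simp add: algebra_simps)
  qed
  then have "Hhat_int r s h \<le> (\<integral>\<^sup>+ \<xi>. ennreal (2 powr p) * (ennreal (jap \<xi> powr (s * p) * cmod (f \<xi>) powr p) + ennreal (jap \<xi> powr (s * p) * cmod (g \<xi>) powr p)) \<partial>lebesgue)"
   unfolding Hhat_int_def by (intro nn_integral_mono) (simp add: ennreal_leI flip: ennreal_mult ennreal_plus)
  also have "... = ennreal (2 powr p) * (Hhat_int r s f + Hhat_int r s g)"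
   by (simp add: Hhat_int_def nn_integral_cmult nn_integral_add)
  finally show ?thesis .
 qed
 have "Hhat_int r s (\<lambda>\<xi>. F \<xi> - G \<xi>) \<le> ennreal (2 powr p) * (Hhat_int r s F + Hhat_int r s G)"
  by (rule add) (auto intro: norm_triangle_ineq4)
 also have "... < \<infinity>" using assms by (simp add: Hhat_in_def ennreal_mult_less_top)
 finally show "Hhat_in r s (\<lambda>\<xi>. F \<xi> - G \<xi>)" by (simp add: Hhat_in_def)
 show "Hhat_int r s F \<le> ennreal (2 powr p) * (Hhat_int r s (\<lambda>\<xi>. F \<xi> - G \<xi>) + Hhat_int r s G)"
  by (rule add) (use norm_triangle_ineq[of "F \<xi> - G \<xi>" "G \<xi>" for \<xi>] in auto)
qed

lemma borel_representative:
 fixes F :: "real^3 \<Rightarrow> complex"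
 assumes "F \<in> borel_measurable lebesgue"
 shows "\<exists>F'\<in>BM. AE \<xi> in lborel. F \<xi> = F' \<xi>"
proof -
 have "(\<lambda>\<xi>. Re (F \<xi>)) \<in> borel_measurable lebesgue" "(\<lambda>\<xi>. Im (F \<xi>)) \<in> borel_measurable lebesgue" using assms by measurable
 from this[THEN completion_ex_borel_measurable_real]
 obtain f g where f: "f \<in> borel_measurable lborel" "AE \<xi> in lborel. Re (F \<xi>) = f \<xi>" and g: "g \<in> borel_measurable lborel" "AE \<xi> in lborel. Im (F \<xi>) = g \<xi>"
  by blast
 note [measurable] = f(1) g(1)
 define F' where "F' = (\<lambda>\<xi>. complex_of_real (f \<xi>) + \<i> * complex_of_real (g \<xi>))"
 have "F' \<in> borel_measurable lborel" unfolding F'_def by measurable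
 moreover have "AE \<xi> in lborel. F \<xi> = F' \<xi>"
  using f(2) g(2) by eventually_elim (simp add: complex_eq_iff F'_def)
 ultimately show ?thesis by (intro bexI[of _ F']) simp_all
qed

text \<open>Data are merely Lebesgue measurable, while the estimates are made for Borel functions;
  the representative bridges the two.\<close>

definition brep :: "(real^3 \<Rightarrow> complex) \<Rightarrow> real^3 \<Rightarrow> complex" where
 "brep F = (SOME F'. F' \<in> BM \<and> (AE \<xi> in lborel. F \<xi> = F' \<xi>))"

lemma brep:
 assumes "Hhat_in r s F"
 shows "brep F \<in> BM" "AE \<xi> in lborel. F \<xi> = brep F \<xi>"
proof -
 have "\<exists>F'. F' \<in> BM \<and> (AE \<xi> in lborel. F \<xi> = F' \<xi>)"
  using borel_representative[of F] assms by (auto simp: Hhat_in_def)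
 from someI_ex[OF this] show "brep F \<in> BM" "AE \<xi> in lborel. F \<xi> = brep F \<xi>"
  by (simp_all add: brep_def)
qed

lemma Hhat_int_cong: "AE \<xi> in lborel. F \<xi> = G \<xi> \<Longrightarrow> Hhat_int r s F = Hhat_int r s G"
 unfolding Hhat_int_borel by (rule nn_integral_cong_AE) (auto elim: eventually_mono)

lemma hnorm_brep_diff:
 assumes F: "Hhat_in r s Fp" "Hhat_in r s Fm" and G: "Hhat_in r s Gp" "Hhat_in r s Gm"
 shows "hnorm (\<lambda>\<xi>. brep Fp \<xi> - brep Gp \<xi>, \<lambda>\<xi>. brep Fm \<xi> - brep Gm \<xi>)
  = ennreal (Hhat_norm r s (\<lambda>\<xi>. Fp \<xi> - Gp \<xi>) powr p + Hhat_norm r s (\<lambda>\<xi>. Fm \<xi> - Gm \<xi>) powr p)"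
proof -
 have "AE \<xi> in lborel. brep Fp \<xi> - brep Gp \<xi> = Fp \<xi> - Gp \<xi>"
  using brep(2)[OF F(1)] brep(2)[OF G(1)] by eventually_elim simp
 moreover have "AE \<xi> in lborel. brep Fm \<xi> - brep Gm \<xi> = Fm \<xi> - Gm \<xi>"
  using brep(2)[OF F(2)] brep(2)[OF G(2)] by eventually_elim simp
 ultimately show ?thesis
  using Hhat_norm_powr[OF Hhat_in_diff(1)[OF F(1) G(1)]] Hhat_norm_powr[OF Hhat_in_diff(1)[OF F(2) G(2)]]
  by (simp add: hnorm_def Hhat_int_cong ennreal_plus)
qed

text \<open>Only the extension is used, not the equation. By the embedding the sections in \<tau>
  are integrable, hence continuous in time after transformation, and twice their mass is a majorant
  of all differences; dominated convergence gives continuity in the data norm.\<close>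

lemma persistent_of_ext:
 assumes sg: "\<bar>sg\<bar> = 1" and e: "is_ext r sg s b dt U u"
 shows "persistent r s dt u"
proof -
 have [measurable]: "U \<in> BM" and X: "X_int r sg s b U < \<infinity>" using e by (simp_all add: is_ext_def Z_in_def)
 define m where "m = (\<lambda>\<xi>. \<integral>\<^sup>+ \<tau>. ennreal (cmod (U (\<xi>, \<tau>))) \<partial>lborel)"
 have [measurable]: "m \<in> BM" unfolding m_def by measurable
 let ?w = "\<lambda>\<xi>. ennreal (jap \<xi> powr (s * p))"
 have mass: "(\<L> \<xi>. ?w \<xi> * epow (m \<xi>) p) < \<infinity>"
 proof (rule le_less_trans)
  show "(\<L> \<xi>. ?w \<xi> * epow (m \<xi>) p) \<le> ennreal (enn2real (Jint (b * r)) powr (p / r)) * X_int r sg s b U"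
   unfolding m_def by (rule time_mass_bound[OF sg]) simp
  show "ennreal (enn2real (Jint (b * r)) powr (p / r)) * X_int r sg s b U < \<infinity>" using X by (simp add: ennreal_mult_less_top)
 qed
 have mfin: "AE \<xi> in lborel. m \<xi> < \<infinity>"
  using tame_AE[OF tame_of_X_int_s[OF sg _ X]] by (simp add: m_def)
 have tm: "ennreal (cmod (time_inv U t \<xi>)) \<le> m \<xi>" for t \<xi> unfolding m_def by (rule time_inv_le)
 have eq: "AE \<xi> in lborel. u t \<xi> = time_inv U t \<xi>" if "t \<in> {-dt..dt}" for t
  using e that by (simp add: is_ext_def AE_completion_iff)
 have H: "Hhat_in r s (u t)" if t: "t \<in> {-dt..dt}" for t
  unfolding Hhat_in_def
 proof
  show "u t \<in> borel_measurable lebesgue"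
  proof (rule measurableI)
   fix A :: "complex set" assume A: "A \<in> sets borel"
   have m: "time_inv U t \<in> borel_measurable lebesgue" by (rule measurable_completion) simp
   show "u t -` A \<inter> space lebesgue \<in> sets lebesgue"
   \<comment> \<open>The function \<open>u t\<close> is only known up to a null set; completeness of
     Lebesgue measure still makes it measurable.\<close>
   proof (rule completion.in_sets_AE)
    show "AE \<xi> in lebesgue. \<xi> \<in> time_inv U t -` A \<inter> space lebesgue \<longleftrightarrow> \<xi> \<in> u t -` A \<inter> space lebesgue"
     using AE_completion[OF eq[OF t]] by eventually_elim simp
    show "time_inv U t -` A \<inter> space lebesgue \<in> sets lebesgue" by (rule measurable_sets[OF m A])
   qed simp
  qed simp
  have "Hhat_int r s (u t) = Hhat_int r s (time_inv U t)" by (rule Hhat_int_cong[OF eq[OF t]])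
  also have "... \<le> (\<L> \<xi>. ?w \<xi> * epow (m \<xi>) p)"
   unfolding Hhat_int_def nn_integral_completion
  proof (rule nn_integral_mono)
   fix \<xi>
   show "ennreal (jap \<xi> powr (s * p) * cmod (time_inv U t \<xi>) powr p) \<le> ?w \<xi> * epow (m \<xi>) p"
    using ennreal_powr_le_epow[OF p(3) _ tm, of t \<xi>] by (simp add: ennreal_mult mult_left_mono)
  qed
  also have "... < \<infinity>" by (rule mass)
  finally show "Hhat_int r s (u t) < \<infinity>" .
 qed
 have lim: "((\<lambda>t. Hhat_norm r s (\<lambda>\<xi>. u t \<xi> - u t0 \<xi>)) \<longlongrightarrow> 0) (at t0 within {-dt..dt})" if t0: "t0 \<in> {-dt..dt}" for t0
  unfolding tendsto_at_iff_sequentially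
 proof (intro allI impI)
  fix x assume x: "\<forall>i. x i \<in> {-dt..dt} - {t0}" "x \<longlonglongrightarrow> t0"
  let ?g = "\<lambda>i \<xi>. ennreal (jap \<xi> powr (s * p) * cmod (time_inv U (x i) \<xi> - time_inv U t0 \<xi>) powr p)"
  have "(\<lambda>i. \<integral>\<^sup>+ \<xi>. ?g i \<xi> \<partial>lborel) \<longlonglongrightarrow> (\<L> (\<xi> :: real^3). 0)"
  proof (rule nn_integral_dominated_convergence[where w="\<lambda>\<xi>. ennreal (2 powr p) * (?w \<xi> * epow (m \<xi>) p)"])
   show "AE \<xi> in lborel. ?g j \<xi> \<le> ennreal (2 powr p) * (?w \<xi> * epow (m \<xi>) p)" for j
    using mfin
   proof eventually_elim
    case (elim \<xi>)
    then obtain y where y: "m \<xi> = ennreal y" "0 \<le> y" by (cases "m \<xi>") auto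
    have "cmod (time_inv U t \<xi>) \<le> y" for t using tm[of t \<xi>] y by simp
    from this[of "x j"] this[of t0] have "cmod (time_inv U (x j) \<xi> - time_inv U t0 \<xi>) \<le> 2 * y"
     using norm_triangle_ineq4[of "time_inv U (x j) \<xi>" "time_inv U t0 \<xi>"] by linarith
    then have "cmod (time_inv U (x j) \<xi> - time_inv U t0 \<xi>) powr p \<le> (2 * y) powr p" using p by (intro powr_mono2) auto
    also have "... = 2 powr p * y powr p" using y by (simp add: powr_mult)
    finally have "jap \<xi> powr (s * p) * cmod (time_inv U (x j) \<xi> - time_inv U t0 \<xi>) powr p \<le> jap \<xi> powr (s * p) * (2 powr p * y powr p)"
     by (intro mult_left_mono) auto
    then have "?g j \<xi> \<le> ennreal (2 powr p * (jap \<xi> powr (s * p) * y powr p))" by (intro ennreal_leI) (simp add: mult_ac)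
    also have "... = ennreal (2 powr p) * (?w \<xi> * epow (m \<xi>) p)" using y by (simp add: ennreal_mult)
    finally show ?case .
   qed
   show "(\<L> \<xi>. ennreal (2 powr p) * (?w \<xi> * epow (m \<xi>) p)) < \<infinity>"
    using mass by (simp add: nn_integral_cmult ennreal_mult_less_top)
   show "AE \<xi> in lborel. (\<lambda>i. ?g i \<xi>) \<longlonglongrightarrow> 0"
    using mfin
   proof eventually_elim
    case (elim \<xi>)
    have "integrable lborel (\<lambda>\<tau>. U (\<xi>, \<tau>))" by (rule integrable_section) (use elim in \<open>auto simp: m_def\<close>)
    from continuous_time_inv[OF this, of UNIV] have "isCont (\<lambda>t. time_inv U t \<xi>) t0" by (simp add: continuous_on_eq_continuous_at)
    then have "(\<lambda>i. time_inv U (x i) \<xi>) \<longlonglongrightarrow> time_inv U t0 \<xi>" using x(2) by (rule isCont_tendsto_compose)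
    then have "(\<lambda>i. cmod (time_inv U (x i) \<xi> - time_inv U t0 \<xi>)) \<longlonglongrightarrow> 0"
     by (simp only: tendsto_norm_zero_iff LIM_zero_iff)
    then have "(\<lambda>i. cmod (time_inv U (x i) \<xi> - time_inv U t0 \<xi>) powr p) \<longlonglongrightarrow> 0 powr p"
     using p by (intro tendsto_powr' tendsto_const) auto
    then have "(\<lambda>i. jap \<xi> powr (s * p) * cmod (time_inv U (x i) \<xi> - time_inv U t0 \<xi>) powr p) \<longlonglongrightarrow> jap \<xi> powr (s * p) * 0"
     using p by (intro tendsto_mult tendsto_const) simp
    from tendsto_ennrealI[OF this] show ?case by simp
   qed
  qed measurable
  then have l: "(\<lambda>i. \<integral>\<^sup>+ \<xi>. ?g i \<xi> \<partial>lborel) \<longlonglongrightarrow> 0" by simp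
  have i: "Hhat_int r s (\<lambda>\<xi>. u (x i) \<xi> - u t0 \<xi>) = (\<L> \<xi>. ?g i \<xi>)" for i
  proof -
   have "x i \<in> {-dt..dt}" using x(1) by blast
   from eq[OF this] eq[OF t0] have "AE \<xi> in lborel. u (x i) \<xi> - u t0 \<xi> = time_inv U (x i) \<xi> - time_inv U t0 \<xi>"
    by eventually_elim simp
   from Hhat_int_cong[OF this] show ?thesis by (simp only: Hhat_int_def nn_integral_completion)
  qed
  have "(\<lambda>i. enn2real (Hhat_int r s (\<lambda>\<xi>. u (x i) \<xi> - u t0 \<xi>))) \<longlonglongrightarrow> enn2real 0"
   unfolding i using l by (intro tendsto_enn2real) auto
  then have "(\<lambda>i. enn2real (Hhat_int r s (\<lambda>\<xi>. u (x i) \<xi> - u t0 \<xi>)) powr (1 / p)) \<longlonglongrightarrow> 0 powr (1 / p)"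
   using p by (intro tendsto_powr' tendsto_const) auto
  then show "((\<lambda>t. Hhat_norm r s (\<lambda>\<xi>. u t \<xi> - u t0 \<xi>)) \<circ> x) \<longlonglongrightarrow> 0" by (simp add: Hhat_norm_def o_def)
 qed
 show ?thesis unfolding persistent_def using H lim by blast
qed

section \<open>Lipschitz dependence on the data\<close>

lemma powr_superadd:
 fixes x y q :: real
 assumes "0 \<le> x" "0 \<le> y" "1 \<le> q"
 shows "x powr q + y powr q \<le> (x + y) powr q"
proof -
 have "z powr q \<le> z * (x + y) powr (q - 1)" if "0 \<le> z" "z \<le> x + y" for z
 proof -
  have "z powr q = z * z powr (q - 1)" using powr_mult_base[OF that(1), of "q - 1"] by simp
  also have "... \<le> z * (x + y) powr (q - 1)" using that assms by (intro mult_left_mono powr_mono2) auto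
  finally show ?thesis .
 qed
 from this[of x] this[of y] have "x powr q + y powr q \<le> (x + y) * (x + y) powr (q - 1)"
  using assms by (simp add: distrib_right)
 also have "... = (x + y) powr q" using powr_mult_base[of "x + y" "q - 1"] assms by simp
 finally show ?thesis .
qed

text \<open>Returns from p-th powers to norms: the sum of the p-th powers of the two data norms is
  at most the p-th power of their sum, so the root gives a bound linear in the data.\<close>

lemma X_norm_le:
 assumes "X_int r sg s' b' f \<le> ennreal L * ennreal (x powr p + y powr p)" "0 \<le> L" "0 \<le> x" "0 \<le> y"
 shows "X_norm r sg s' b' f \<le> L powr (1 / p) * (x + y)"
proof -
 have "x powr p + y powr p \<le> (x + y) powr p" using assms p by (intro powr_superadd) auto
 then have "ennreal L * ennreal (x powr p + y powr p) \<le> ennreal (L * (x + y) powr p)"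
  using assms by (subst ennreal_mult[symmetric]) (auto intro!: ennreal_leI mult_left_mono)
 with assms(1) have "X_int r sg s' b' f \<le> ennreal (L * (x + y) powr p)" by (rule order_trans)
 then have "enn2real (X_int r sg s' b' f) \<le> L * (x + y) powr p" using assms by (intro enn2real_leI) auto
 then have "X_norm r sg s' b' f \<le> (L * (x + y) powr p) powr (1 / p)"
  unfolding X_norm_def using p by (intro powr_mono2) auto
 also have "... = L powr (1 / p) * (x + y)" using assms p by (simp add: powr_mult powr_powr)
 finally show ?thesis .
qed

lemma Z_in_diff:
 assumes "Z_in r sg s b f" "Z_in r sg s b g"
 shows "Z_in r sg s b (\<lambda>q. f q - g q)"
proof -
 have [measurable]: "f \<in> BM" "g \<in> BM" using assms by (simp_all add: Z_in_def)
 have m: "dt_hat f \<in> BM" "dt_hat g \<in> BM" unfolding dt_hat_def[abs_def] by measurable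
 have e: "dt_hat (\<lambda>q. f q - g q) = (\<lambda>q. dt_hat f q - dt_hat g q)" by (simp add: fun_eq_iff dt_hat_def right_diff_distrib)
 have "X_int r sg s b (\<lambda>q. f q - g q) < \<infinity>"
  by (rule le_less_trans[OF X_int_diff_le]) (use assms in \<open>auto simp: Z_in_def ennreal_mult_less_top\<close>)
 moreover have "X_int r sg (s - 1) b (\<lambda>q. dt_hat f q - dt_hat g q) < \<infinity>"
  by (rule le_less_trans[OF X_int_diff_le[OF m]]) (use assms in \<open>auto simp: Z_in_def ennreal_mult_less_top\<close>)
 ultimately show ?thesis unfolding Z_in_def e by simp
qed

lemma Zd_norm_le:
 assumes "is_ext r sg s b dt U u"
 shows "Zd_norm r sg s b dt u \<le> Z_norm r sg s b U"
 unfolding Zd_norm_def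
proof (rule cInf_lower)
 show "bdd_below {Z_norm r sg s b U |U. is_ext r sg s b dt U u}"
  by (rule bdd_belowI[of _ 0]) (auto simp: Z_norm_def X_norm_def)
qed (use assms in blast)

text \<open>Bounds the p-th powers of all data at distance less than 1 from data with norms
  \<open>x\<close> and \<open>y\<close>. The lifespan is computed from this bound and so is valid
  for the whole neighbourhood.\<close>

definition radius :: "real \<Rightarrow> real \<Rightarrow> real" where
 "radius x y = 2 powr p * (x powr p + y powr p + 2)"

lemma hnorm_le_radius:
 assumes F: "Hhat_in r s Fp" "Hhat_in r s Fm" and G: "Hhat_in r s Gp" "Hhat_in r s Gm"
  and lt: "Hhat_norm r s (\<lambda>\<xi>. Gp \<xi> - Fp \<xi>) < 1" "Hhat_norm r s (\<lambda>\<xi>. Gm \<xi> - Fm \<xi>) < 1"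
 shows "hnorm (brep Gp, brep Gm) \<le> ennreal (radius (Hhat_norm r s Fp) (Hhat_norm r s Fm))"
proof -
 have le: "Hhat_int r s g \<le> ennreal (2 powr p * (1 + Hhat_norm r s f powr p))"
  if "Hhat_in r s f" "Hhat_in r s g" "Hhat_norm r s (\<lambda>\<xi>. g \<xi> - f \<xi>) < 1" for f g
 proof -
  have n: "0 \<le> Hhat_norm r s (\<lambda>\<xi>. g \<xi> - f \<xi>)" by (simp add: Hhat_norm_def)
  have "Hhat_int r s g \<le> ennreal (2 powr p) * (Hhat_int r s (\<lambda>\<xi>. g \<xi> - f \<xi>) + Hhat_int r s f)" by (rule Hhat_in_diff(2)[OF that(2,1)])
  also have "... \<le> ennreal (2 powr p) * (ennreal 1 + ennreal (Hhat_norm r s f powr p))"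
   unfolding Hhat_norm_powr[OF Hhat_in_diff(1)[OF that(2,1)]] Hhat_norm_powr[OF that(1)]
   using n that(3) p by (intro mult_left_mono add_mono ennreal_leI powr_le1) auto
  also have "... = ennreal (2 powr p * (1 + Hhat_norm r s f powr p))"
   by (subst ennreal_mult) (auto simp: ennreal_plus simp del: ennreal_1)
  finally show ?thesis .
 qed
 have "hnorm (brep Gp, brep Gm) = Hhat_int r s Gp + Hhat_int r s Gm"
  using Hhat_int_cong[OF brep(2)[OF G(1)]] Hhat_int_cong[OF brep(2)[OF G(2)]] by (simp add: hnorm_def)
 also have "... \<le> ennreal (2 powr p * (1 + Hhat_norm r s Fp powr p)) + ennreal (2 powr p * (1 + Hhat_norm r s Fm powr p))"
  by (intro add_mono le F G lt)
 also have "... = ennreal (radius (Hhat_norm r s Fp) (Hhat_norm r s Fm))"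
  by (simp add: radius_def algebra_simps flip: ennreal_plus)
 finally show ?thesis .
qed

lemma zsol_exists:
 assumes "0 < dt" "dt \<le> 1" "is_solution r s b dt d1 d2 Fp Fm up um" "Hhat_in r s Fp" "Hhat_in r s Fm"
 shows "\<exists>U. zsol dt (brep Fp, brep Fm) U \<and> (\<forall>t\<in>{-dt..dt}. AE \<xi> in lebesgue. up t \<xi> = time_inv (fst U) t \<xi> \<and> um t \<xi> = time_inv (snd U) t \<xi>)"
 by (rule zsol_cong_data[OF assms(1-3)]) (simp_all add: brep(2) assms(4,5))

lemma borel_data_brep: "Hhat_in r s Fp \<Longrightarrow> Hhat_in r s Fm \<Longrightarrow> borel_data (brep Fp, brep Fm)"
 by (simp add: borel_data_def brep(1))

lemma solution_unique:
 assumes dt: "0 < dt" "dt \<le> 1" and F: "Hhat_in r s Fp" "Hhat_in r s Fm" and sol: "is_solution r s b dt d1 d2 Fp Fm up um"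
  and Z: "zsol dt (brep Fp, brep Fm) V" and t: "t \<in> {-dt..dt}"
 shows "AE \<xi> in lebesgue. up t \<xi> = time_inv (fst V) t \<xi> \<and> um t \<xi> = time_inv (snd V) t \<xi>"
proof -
 obtain U where U: "zsol dt (brep Fp, brep Fm) U" "\<And>t. t \<in> {-dt..dt} \<Longrightarrow> AE \<xi> in lebesgue. up t \<xi> = time_inv (fst U) t \<xi> \<and> um t \<xi> = time_inv (snd U) t \<xi>"
  using zsol_exists[OF dt sol F] by blast
 show ?thesis
  using U(2)[OF t] AE_completion[OF zsol_unique[OF dt U(1) Z t]] by eventually_elim simp
qed

text \<open>By uniqueness the given solutions coincide on the interval with those produced by the
  solution map \<open>S\<close>. The difference of its extensions is then one admissible extension
  of the difference of the solutions and bounds the infimum in \<open>Zd_norm\<close>. The factor 4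
  in the constant counts two signs and two terms of the Z-norm.\<close>

lemma lipschitz:
 assumes dt: "0 < dt" "dt \<le> 1" and R: "good R dt"
 shows "\<exists>L. \<forall>Gp Gm Hp Hm up um vp vm. Hhat_in r s Gp \<longrightarrow> Hhat_in r s Gm \<longrightarrow> Hhat_in r s Hp \<longrightarrow> Hhat_in r s Hm \<longrightarrow>
  hnorm (brep Gp, brep Gm) \<le> ennreal R \<longrightarrow> hnorm (brep Hp, brep Hm) \<le> ennreal R \<longrightarrow>
  is_solution r s b dt d1 d2 Gp Gm up um \<longrightarrow> is_solution r s b dt d1 d2 Hp Hm vp vm \<longrightarrow>
  Zd_norm r 1 s b dt (\<lambda>t \<xi>. up t \<xi> - vp t \<xi>) + Zd_norm r (-1) s b dt (\<lambda>t \<xi>. um t \<xi> - vm t \<xi>)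
   \<le> L * (Hhat_norm r s (\<lambda>\<xi>. Gp \<xi> - Hp \<xi>) + Hhat_norm r s (\<lambda>\<xi>. Gm \<xi> - Hm \<xi>))"
proof -
 obtain L S where L: "0 \<le> L" and S: "\<And>F. borel_data F \<Longrightarrow> hnorm F \<le> ennreal R \<Longrightarrow> zsol dt F (S F)"
  and X: "\<And>sg F G. sg \<in> {1, -1} \<Longrightarrow> borel_data F \<Longrightarrow> hnorm F \<le> ennreal R \<Longrightarrow> borel_data G \<Longrightarrow> hnorm G \<le> ennreal R \<Longrightarrow>
    X_int r sg s b (sgnpart sg (psub (S F) (S G))) \<le> ennreal L * hnorm (dsub F G) \<and>
    X_int r sg (s - 1) b (dt_hat (sgnpart sg (psub (S F) (S G)))) \<le> ennreal L * hnorm (dsub F G)"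
  using R unfolding good_def by (elim exE conjE) (rule that, blast+)
 have "Zd_norm r 1 s b dt (\<lambda>t \<xi>. up t \<xi> - vp t \<xi>) + Zd_norm r (-1) s b dt (\<lambda>t \<xi>. um t \<xi> - vm t \<xi>)
   \<le> (4 * L powr (1 / p)) * (Hhat_norm r s (\<lambda>\<xi>. Gp \<xi> - Hp \<xi>) + Hhat_norm r s (\<lambda>\<xi>. Gm \<xi> - Hm \<xi>))"
  if G: "Hhat_in r s Gp" "Hhat_in r s Gm" and H: "Hhat_in r s Hp" "Hhat_in r s Hm"
   and gR: "hnorm (brep Gp, brep Gm) \<le> ennreal R" and hR: "hnorm (brep Hp, brep Hm) \<le> ennreal R"
   and sg: "is_solution r s b dt d1 d2 Gp Gm up um" and sh: "is_solution r s b dt d1 d2 Hp Hm vp vm" for Gp Gm Hp Hm up um vp vm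
 proof -
  define U where "U = S (brep Gp, brep Gm)"
  define V where "V = S (brep Hp, brep Hm)"
  note bG = borel_data_brep[OF G] and bH = borel_data_brep[OF H]
  have U: "zsol dt (brep Gp, brep Gm) U" unfolding U_def by (rule S[OF bG gR])
  have V: "zsol dt (brep Hp, brep Hm) V" unfolding V_def by (rule S[OF bH hR])
  have fUV: "fin U" "fin V" using U V by (auto simp: zsol_def intro: fin_of_Z)
  have ext: "is_ext r 1 s b dt (fst (psub U V)) (\<lambda>t \<xi>. up t \<xi> - vp t \<xi>)" "is_ext r (- 1) s b dt (snd (psub U V)) (\<lambda>t \<xi>. um t \<xi> - vm t \<xi>)"
  proof -
   have e: "AE \<xi> in lebesgue. up t \<xi> - vp t \<xi> = time_inv (fst (psub U V)) t \<xi> \<and> um t \<xi> - vm t \<xi> = time_inv (snd (psub U V)) t \<xi>"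
    if "t \<in> {-dt..dt}" for t
    using solution_unique[OF dt G sg U that] solution_unique[OF dt H sh V that] AE_completion[OF psub_section[OF fUV]]
    by eventually_elim simp
   have Z: "Z_in r 1 s b (fst (psub U V))" "Z_in r (- 1) s b (snd (psub U V))"
    using U V unfolding psub_def fst_conv snd_conv zsol_def by (blast intro: Z_in_diff)+
   show "is_ext r 1 s b dt (fst (psub U V)) (\<lambda>t \<xi>. up t \<xi> - vp t \<xi>)"
    unfolding is_ext_def using Z(1) e by (auto elim: eventually_mono)
   show "is_ext r (- 1) s b dt (snd (psub U V)) (\<lambda>t \<xi>. um t \<xi> - vm t \<xi>)"
    unfolding is_ext_def using Z(2) e by (auto elim: eventually_mono)
  qed
  let ?x = "Hhat_norm r s (\<lambda>\<xi>. Gp \<xi> - Hp \<xi>)" and ?y = "Hhat_norm r s (\<lambda>\<xi>. Gm \<xi> - Hm \<xi>)"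
  have xy: "0 \<le> ?x" "0 \<le> ?y" by (simp_all add: Hhat_norm_def)
  have h: "hnorm (dsub (brep Gp, brep Gm) (brep Hp, brep Hm)) = ennreal (?x powr p + ?y powr p)"
   using hnorm_brep_diff[OF G H] by simp
  have Zn: "Z_norm r sg s b (sgnpart sg (psub U V)) \<le> 2 * (L powr (1 / p) * (?x + ?y))" if "sg \<in> {1, -1}" for sg
   using X_norm_le[OF conjunct1[OF X[OF that bG gR bH hR, unfolded h]] L xy] X_norm_le[OF conjunct2[OF X[OF that bG gR bH hR, unfolded h]] L xy]
   unfolding Z_norm_def U_def V_def by simp
  show ?thesis
   using Zd_norm_le[OF ext(1)] Zd_norm_le[OF ext(2)] Zn[OF insertI1] Zn[OF insertI2[OF insertI1]] by simp
 qed
 then show ?thesis by blast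
qed

lemma solution_exists:
 assumes dt: "0 < dt" "dt \<le> 1" "good R dt" and G: "Hhat_in r s Gp" "Hhat_in r s Gm" and h: "hnorm (brep Gp, brep Gm) \<le> ennreal R"
 shows "\<exists>up um. is_solution r s b dt d1 d2 Gp Gm up um"
proof -
 obtain U where "zsol dt (brep Gp, brep Gm) U" using dt(3) borel_data_brep[OF G] h unfolding good_def by blast
 from is_solution_of_zsol[OF dt(1,2) this, of Gp Gm] brep(2)[OF G(1)] brep(2)[OF G(2)] show ?thesis by auto
qed

end

theorem theorem2:
  fixes r s b :: real and d1 d2 :: der
  assumes "1 < r" and "r \<le> 2" and "s > 2 / r + 1" and "1 / r < b" and "b < 1"
  shows "\<exists>\<Delta> :: real \<Rightarrow> real \<Rightarrow> real. (\<forall>x y. \<Delta> x y > 0) \<and>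
    (\<forall>Fp Fm. Hhat_in r s Fp \<and> Hhat_in r s Fm \<longrightarrow>
      (let \<delta> = \<Delta> (Hhat_norm r s Fp) (Hhat_norm r s Fm) in
        (\<exists>up um. is_solution r s b \<delta> d1 d2 Fp Fm up um) \<and>
        (\<forall>up um vp vm. is_solution r s b \<delta> d1 d2 Fp Fm up um \<and> is_solution r s b \<delta> d1 d2 Fp Fm vp vm
            \<longrightarrow> (\<forall>t\<in>{-\<delta>..\<delta>}. AE \<xi> in lebesgue. up t \<xi> = vp t \<xi> \<and> um t \<xi> = vm t \<xi>)) \<and>
        (\<forall>up um. is_solution r s b \<delta> d1 d2 Fp Fm up um \<longrightarrow> persistent r s \<delta> up \<and> persistent r s \<delta> um) \<and>
        (\<exists>\<epsilon> > 0. \<exists>L.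
          (\<forall>Gp Gm. Hhat_in r s Gp \<and> Hhat_in r s Gm \<and>
              Hhat_norm r s (\<lambda>\<xi>. Gp \<xi> - Fp \<xi>) < \<epsilon> \<and> Hhat_norm r s (\<lambda>\<xi>. Gm \<xi> - Fm \<xi>) < \<epsilon>
              \<longrightarrow> (\<exists>up um. is_solution r s b \<delta> d1 d2 Gp Gm up um)) \<and>
          (\<forall>Gp Gm Hp Hm up um vp vm.
              Hhat_in r s Gp \<and> Hhat_in r s Gm \<and> Hhat_in r s Hp \<and> Hhat_in r s Hm \<and>
              Hhat_norm r s (\<lambda>\<xi>. Gp \<xi> - Fp \<xi>) < \<epsilon> \<and> Hhat_norm r s (\<lambda>\<xi>. Gm \<xi> - Fm \<xi>) < \<epsilon> \<and>
              Hhat_norm r s (\<lambda>\<xi>. Hp \<xi> - Fp \<xi>) < \<epsilon> \<and> Hhat_norm r s (\<lambda>\<xi>. Hm \<xi> - Fm \<xi>) < \<epsilon> \<and>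
              is_solution r s b \<delta> d1 d2 Gp Gm up um \<and> is_solution r s b \<delta> d1 d2 Hp Hm vp vm
              \<longrightarrow> Zd_norm r 1 s b \<delta> (\<lambda>t \<xi>. up t \<xi> - vp t \<xi>) + Zd_norm r (-1) s b \<delta> (\<lambda>t \<xi>. um t \<xi> - vm t \<xi>)
                  \<le> L * (Hhat_norm r s (\<lambda>\<xi>. Gp \<xi> - Hp \<xi>) + Hhat_norm r s (\<lambda>\<xi>. Gm \<xi> - Hm \<xi>))))))"
proof -
 interpret wave_system r s b d1 d2 by unfold_locales (use assms in auto)
 \<comment> \<open>The lifespan is chosen from the two norms alone, before the data are
   given.\<close>
 define \<Delta> where "\<Delta> = (\<lambda>x y. SOME dt. 0 < dt \<and> dt \<le> 1 \<and> good (radius x y) dt)"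
 have \<Delta>: "0 < \<Delta> x y \<and> \<Delta> x y \<le> 1 \<and> good (radius x y) (\<Delta> x y)" for x y
 proof -
  have "0 \<le> radius x y" by (simp add: radius_def)
  from good_exists[OF this] show ?thesis unfolding \<Delta>_def by (intro someI_ex[of "\<lambda>dt. 0 < dt \<and> dt \<le> 1 \<and> good (radius x y) dt"]) blast
 qed
 show ?thesis
  unfolding Let_def
 proof (rule exI[of _ \<Delta>], rule conjI, use \<Delta> in blast, intro allI impI, elim conjE, goal_cases)
  case (1 Fp Fm)
  note F = 1
  let ?R = "radius (Hhat_norm r s Fp) (Hhat_norm r s Fm)"
  define dt where "dt = \<Delta> (Hhat_norm r s Fp) (Hhat_norm r s Fm)"
  have dt: "0 < dt" "dt \<le> 1" "good ?R dt" using \<Delta> unfolding dt_def by blast+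
  have z: "Hhat_norm r s (\<lambda>\<xi>. f \<xi> - f \<xi>) < 1" for f using p by (simp add: Hhat_norm_def)
  show ?case
   unfolding dt_def[symmetric]
  proof (intro conjI, goal_cases)
   case 1
   show ?case by (rule solution_exists[OF dt F hnorm_le_radius[OF F F z z]])
  next
   case 2
   show ?case
   proof (intro allI impI ballI, elim conjE)
    fix up um vp vm t
    assume sol: "is_solution r s b dt d1 d2 Fp Fm up um" "is_solution r s b dt d1 d2 Fp Fm vp vm" and t: "t \<in> {-dt..dt}"
    obtain V where V: "zsol dt (brep Fp, brep Fm) V" using zsol_exists[OF dt(1,2) sol(1) F] by blast
    show "AE \<xi> in lebesgue. up t \<xi> = vp t \<xi> \<and> um t \<xi> = vm t \<xi>"
     using solution_unique[OF dt(1,2) F sol(1) V t] solution_unique[OF dt(1,2) F sol(2) V t] by eventually_elim simp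
   qed
  next
   case 3
   show ?case
   proof (intro allI impI)
    fix up um assume "is_solution r s b dt d1 d2 Fp Fm up um"
    then obtain Up Um where "is_ext r 1 s b dt Up up" "is_ext r (- 1) s b dt Um um" unfolding is_solution_def by blast
    then show "persistent r s dt up \<and> persistent r s dt um"
     using persistent_of_ext[of 1 dt Up up] persistent_of_ext[of "- 1" dt Um um] by simp
   qed
  next
   case 4
   from lipschitz[OF dt] obtain L where L: "\<forall>Gp Gm Hp Hm up um vp vm. Hhat_in r s Gp \<longrightarrow> Hhat_in r s Gm \<longrightarrow> Hhat_in r s Hp \<longrightarrow> Hhat_in r s Hm \<longrightarrow>
    hnorm (brep Gp, brep Gm) \<le> ennreal ?R \<longrightarrow> hnorm (brep Hp, brep Hm) \<le> ennreal ?R \<longrightarrow>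
    is_solution r s b dt d1 d2 Gp Gm up um \<longrightarrow> is_solution r s b dt d1 d2 Hp Hm vp vm \<longrightarrow>
    Zd_norm r 1 s b dt (\<lambda>t \<xi>. up t \<xi> - vp t \<xi>) + Zd_norm r (-1) s b dt (\<lambda>t \<xi>. um t \<xi> - vm t \<xi>)
     \<le> L * (Hhat_norm r s (\<lambda>\<xi>. Gp \<xi> - Hp \<xi>) + Hhat_norm r s (\<lambda>\<xi>. Gm \<xi> - Hm \<xi>))"
    by (elim exE)
   show ?case
   \<comment> \<open>The neighbourhood has radius 1 because \<open>radius\<close> was made to cover
     data at distance less than 1.\<close>
   proof (rule exI[of _ 1], rule conjI[OF zero_less_one], rule exI[of _ L], intro conjI allI impI; elim conjE)
    fix Gp Gm
    assume G: "Hhat_in r s Gp" "Hhat_in r s Gm" "Hhat_norm r s (\<lambda>\<xi>. Gp \<xi> - Fp \<xi>) < 1" "Hhat_norm r s (\<lambda>\<xi>. Gm \<xi> - Fm \<xi>) < 1"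
    show "\<exists>up um. is_solution r s b dt d1 d2 Gp Gm up um" by (rule solution_exists[OF dt G(1,2) hnorm_le_radius[OF F G]])
   next
    fix Gp Gm Hp Hm up um vp vm
    assume G: "Hhat_in r s Gp" "Hhat_in r s Gm" and H: "Hhat_in r s Hp" "Hhat_in r s Hm"
     and G1: "Hhat_norm r s (\<lambda>\<xi>. Gp \<xi> - Fp \<xi>) < 1" "Hhat_norm r s (\<lambda>\<xi>. Gm \<xi> - Fm \<xi>) < 1"
     and H1: "Hhat_norm r s (\<lambda>\<xi>. Hp \<xi> - Fp \<xi>) < 1" "Hhat_norm r s (\<lambda>\<xi>. Hm \<xi> - Fm \<xi>) < 1"
     and sol: "is_solution r s b dt d1 d2 Gp Gm up um" "is_solution r s b dt d1 d2 Hp Hm vp vm"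
    show "Zd_norm r 1 s b dt (\<lambda>t \<xi>. up t \<xi> - vp t \<xi>) + Zd_norm r (-1) s b dt (\<lambda>t \<xi>. um t \<xi> - vm t \<xi>)
     \<le> L * (Hhat_norm r s (\<lambda>\<xi>. Gp \<xi> - Hp \<xi>) + Hhat_norm r s (\<lambda>\<xi>. Gm \<xi> - Hm \<xi>))"
     by (rule L[rule_format, OF G H hnorm_le_radius[OF F G G1] hnorm_le_radius[OF F H H1] sol])
   qed
  qed
 qed
qed

end
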